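(* The moduli space $\mathcal{F}_{L_2(7)}$ of smooth cubic fourfolds $X$ with $L_2(7)<\mathrm{Aut}^s(X)$ has (GIT) compactification $\overline{\mathcal{F}}_{L_2(7)}\cong\mathbb{P}^1$. The boundary $\overline{\mathcal{F}}_{L_2(7)}\setminus\mathcal{F}_{L_2(7)}$ consists of exactly one determinantal cubic fourfold, one cubic fourfold with $7$ nodes and one cubic fourfold with $14$ nodes.
   Context: Everything is over $\mathbb{C}$. $L_2(7)=\mathrm{PSL}(2,\mathbb{F}_7)$. For a smooth cubic fourfold $X\subset\mathbb{P}^5$, $\mathrm{Aut}^s(X)$ is the group of automorphisms acting trivially on $H^{3,1}(X)$. Let $L_2(7)=\langle(12)(36),(1234567)\rangle\subset S_7$ act on $\mathbb{C}^7$ by permuting coordinates; the resulting irreducible $6$-dimensional representation on $\{x_1+\dots+x_7=0\}$, in the coordinates $x_1,\dots,x_6$, embeds $L_2(7)$ in $\mathrm{GL}(6,\mathbb{C})$ and in $\mathrm{PGL}(6,\mathbb{C})$. $\mathcal{V}_{L_2(7)}$ is the space of $L_2(7)$-invariant cubic forms in $x_1,\dots,x_6$; it is spanned by $f_1=\sum_{i=1}^6x_i^3-(\sum_{i=1}^6x_i)^3$ and $f_2=x_1x_2x_4+x_2x_3x_5+x_3x_4x_6+x_1x_5x_6-(x_1x_3+x_4x_5+x_2x_6)(\sum_{i=1}^6x_i)$. With $\mathbb{P}\mathcal{V}_{L_2(7)}^{sm}$ the locus of smooth cubic fourfolds, $\mathcal{F}_{L_2(7)}=N_{\mathrm{PGL}(6,\mathbb{C})}(L_2(7))\backslash\mathbb{P}\mathcal{V}_{L_2(7)}^{sm}$,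 and $\overline{\mathcal{F}}_{L_2(7)}$ is the corresponding GIT quotient of $\mathbb{P}\mathcal{V}_{L_2(7)}$. A node is an isolated $A_1$ singularity. A determinantal cubic fourfold is one projectively equivalent to the zero locus of the determinant of the generic symmetric $3\times3$ matrix; its singular locus is a Veronese surface. *)

theory Defs
  imports
    "HOL-Analysis.Analysis"
    "HOL-Algebra.Group_Action"
    "HOL-Algebra.Sym_Groups"
    "HOL-Library.Function_Algebras"
    "HOL-Library.Numeral_Type"
begin

section \<open>Projective varieties as spaces with functions\<close>

text \<open>Complex vector spaces are given by a scalar multiplication \<open>s\<close> and a carrier \<open>V\<close>. This covers
  both \<open>\<complex>\<^sup>n\<close> (with \<open>(*s)\<close>) and spaces of forms on \<open>\<complex>\<^sup>n\<close>.\<close>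

definition linear_functional_on :: "(complex \<Rightarrow> 'v \<Rightarrow> 'v) \<Rightarrow> 'v set \<Rightarrow> ('v::ab_group_add \<Rightarrow> complex) \<Rightarrow> bool"
  where "linear_functional_on s V l \<longleftrightarrow>
    (\<forall>v\<in>V. \<forall>w\<in>V. l (v + w) = l v + l w) \<and> (\<forall>c. \<forall>v\<in>V. l (s c v) = c * l v)"

text \<open>Homogeneous polynomial functions of degree \<open>d\<close> on \<open>V\<close>; since \<open>\<complex>\<close> is infinite, forms and their
  polynomial functions are interchangeable. The zero function is homogeneous of every degree.\<close>

inductive homogeneous_on :: "(complex \<Rightarrow> 'v \<Rightarrow> 'v) \<Rightarrow> 'v set \<Rightarrow> nat \<Rightarrow> ('v::ab_group_add \<Rightarrow> complex) \<Rightarrow> bool"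
  for s :: "complex \<Rightarrow> 'v \<Rightarrow> 'v" and V :: "'v set" where
  const: "homogeneous_on s V 0 (\<lambda>_. c)"
| linear: "linear_functional_on s V l \<Longrightarrow> homogeneous_on s V 1 l"
| add: "homogeneous_on s V d p \<Longrightarrow> homogeneous_on s V d q \<Longrightarrow> homogeneous_on s V d (\<lambda>v. p v + q v)"
| mult: "homogeneous_on s V d p \<Longrightarrow> homogeneous_on s V e q \<Longrightarrow> homogeneous_on s V (d + e) (\<lambda>v. p v * q v)"

text \<open>Points of \<open>\<P>(V)\<close> are the one-dimensional subspaces, as sets of vectors.\<close>

definition ray :: "(complex \<Rightarrow> 'v \<Rightarrow> 'v) \<Rightarrow> 'v \<Rightarrow> 'v set"
  where "ray s v = range (\<lambda>c. s c v)"

text \<open>A classical variety: a topological space with, for each open \<open>U\<close>, its regular functions.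
  Membership of \<open>\<phi>\<close> in \<open>regular X U\<close> only depends on the restriction of \<open>\<phi>\<close> to \<open>U\<close>, and \<open>regular X U\<close>
  is only meaningful for open \<open>U\<close>.\<close>

record 'p fun_space =
  zariski :: "'p topology"
  regular :: "'p set \<Rightarrow> ('p \<Rightarrow> complex) set"

abbreviation points :: "'p fun_space \<Rightarrow> 'p set"
  where "points X \<equiv> topspace (zariski X)"

definition principal_open :: "(complex \<Rightarrow> 'v \<Rightarrow> 'v) \<Rightarrow> 'v set \<Rightarrow> ('v::ab_group_add \<Rightarrow> complex) \<Rightarrow> 'v set set"
  where "principal_open s V p = {ray s v | v. v \<in> V \<and> v \<noteq> 0 \<and> p v \<noteq> 0}"

definition proj_topology :: "(complex \<Rightarrow> 'v \<Rightarrow> 'v) \<Rightarrow> 'v::ab_group_add set \<Rightarrow> 'v set topology"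
  where "proj_topology s V = topology_generated_by {principal_open s V p | p d. homogeneous_on s V d p}"

definition proj_space :: "(complex \<Rightarrow> 'v \<Rightarrow> 'v) \<Rightarrow> 'v::ab_group_add set \<Rightarrow> 'v set fun_space"
  where "proj_space s V =
    \<lparr>zariski = proj_topology s V,
     regular = (\<lambda>U. {\<phi>. \<forall>x\<in>U. \<exists>W d p q. openin (proj_topology s V) W \<and> x \<in> W \<and> W \<subseteq> U \<and>
       homogeneous_on s V d p \<and> homogeneous_on s V d q \<and>
       (\<forall>v\<in>V. v \<noteq> 0 \<and> ray s v \<in> W \<longrightarrow> q v \<noteq> 0 \<and> \<phi> (ray s v) = p v / q v)})\<rparr>"

definition open_subvariety :: "'p fun_space \<Rightarrow> 'p set \<Rightarrow> 'p fun_space"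
  where "open_subvariety X S = \<lparr>zariski = subtopology (zariski X) S, regular = regular X\<rparr>"

definition is_open_subvariety :: "'p fun_space \<Rightarrow> 'p fun_space \<Rightarrow> bool"
  where "is_open_subvariety Y X \<longleftrightarrow>
    openin (zariski X) (points Y) \<and>
    zariski Y = subtopology (zariski X) (points Y) \<and>
    (\<forall>U. openin (zariski Y) U \<longrightarrow> regular Y U = regular X U)"

definition quotient_topology :: "'p topology \<Rightarrow> ('p \<Rightarrow> 'q) \<Rightarrow> 'q topology"
  where "quotient_topology T \<pi> =
    topology (\<lambda>U. U \<subseteq> \<pi> ` topspace T \<and> openin T {x \<in> topspace T. \<pi> x \<in> U})"

lemma openin_quotient_topology:
  "openin (quotient_topology T \<pi>) U \<longleftrightarrow> U \<subseteq> \<pi> ` topspace T \<and> openin T {x \<in> topspace T. \<pi> x \<in> U}"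
proof -
  have "istopology (\<lambda>U. U \<subseteq> \<pi> ` topspace T \<and> openin T {x \<in> topspace T. \<pi> x \<in> U})"
    unfolding istopology_def
  proof (intro conjI allI impI)
    fix S U
    assume "S \<subseteq> \<pi> ` topspace T \<and> openin T {x \<in> topspace T. \<pi> x \<in> S}"
      and "U \<subseteq> \<pi> ` topspace T \<and> openin T {x \<in> topspace T. \<pi> x \<in> U}"
    moreover have "{x \<in> topspace T. \<pi> x \<in> S \<inter> U} =
        {x \<in> topspace T. \<pi> x \<in> S} \<inter> {x \<in> topspace T. \<pi> x \<in> U}"
      by blast
    ultimately show "S \<inter> U \<subseteq> \<pi> ` topspace T" "openin T {x \<in> topspace T. \<pi> x \<in> S \<inter> U}"
      by auto
  next
    fix K
    assume K: "\<forall>S\<in>K. S \<subseteq> \<pi> ` topspace T \<and> openin T {x \<in> topspace T. \<pi> x \<in> S}"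
    then show "\<Union>K \<subseteq> \<pi> ` topspace T"
      by blast
    have "{x \<in> topspace T. \<pi> x \<in> \<Union>K} = (\<Union>S\<in>K. {x \<in> topspace T. \<pi> x \<in> S})"
      by blast
    then show "openin T {x \<in> topspace T. \<pi> x \<in> \<Union>K}"
      using K by auto
  qed
  then show ?thesis
    by (simp add: quotient_topology_def)
qed

definition quotient_space :: "'p fun_space \<Rightarrow> ('p \<Rightarrow> 'q) \<Rightarrow> 'q fun_space"
  where "quotient_space X \<pi> =
    \<lparr>zariski = quotient_topology (zariski X) \<pi>,
     regular = (\<lambda>U. {\<phi>. \<phi> \<circ> \<pi> \<in> regular X {x \<in> points X. \<pi> x \<in> U}})\<rparr>"

definition isomorphic_spaces :: "'p fun_space \<Rightarrow> 'q fun_space \<Rightarrow> bool"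
  where "isomorphic_spaces X Y \<longleftrightarrow>
    (\<exists>h. homeomorphic_map (zariski X) (zariski Y) h \<and>
      (\<forall>U \<phi>. openin (zariski Y) U \<longrightarrow>
        (\<phi> \<in> regular Y U \<longleftrightarrow> \<phi> \<circ> h \<in> regular X {x \<in> points X. h x \<in> U})))"

abbreviation projective_line :: "(complex^2) set fun_space"
  where "projective_line \<equiv> proj_space (*s) UNIV"


section \<open>GIT quotients\<close>

text \<open>\<open>G\<close> is a group of linear operators on \<open>V\<close>, i.e. the action on \<open>\<P>(V)\<close> is linearised by
  \<open>\<O>(1)\<close>. An operator moves the point \<open>x\<close> of \<open>\<P>(V)\<close> to its image \<open>g ` x\<close>.\<close>

definition orbit_of :: "('v \<Rightarrow> 'v) set \<Rightarrow> 'v set \<Rightarrow> 'v set set"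
  where "orbit_of G x = (\<lambda>g. g ` x) ` G"

definition semistable_points :: "(complex \<Rightarrow> 'v \<Rightarrow> 'v) \<Rightarrow> 'v::ab_group_add set \<Rightarrow> ('v \<Rightarrow> 'v) set \<Rightarrow> 'v set set"
  where "semistable_points s V G =
    {ray s v | v. v \<in> V \<and> v \<noteq> 0 \<and>
      (\<exists>d>0. \<exists>p. homogeneous_on s V d p \<and> (\<forall>g\<in>G. \<forall>w\<in>V. p (g w) = p w) \<and> p v \<noteq> 0)}"

text \<open>Semistable points are identified in the GIT quotient iff their orbit closures meet in the
  semistable locus.\<close>

definition git_class :: "(complex \<Rightarrow> 'v \<Rightarrow> 'v) \<Rightarrow> 'v::ab_group_add set \<Rightarrow> ('v \<Rightarrow> 'v) set \<Rightarrow> 'v set \<Rightarrow> 'v set set"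
  where "git_class s V G x =
    (let T = subtopology (proj_topology s V) (semistable_points s V G)
     in {y \<in> semistable_points s V G.
          (T closure_of orbit_of G x) \<inter> (T closure_of orbit_of G y) \<noteq> {}})"

definition git_quotient :: "(complex \<Rightarrow> 'v \<Rightarrow> 'v) \<Rightarrow> 'v::ab_group_add set \<Rightarrow> ('v \<Rightarrow> 'v) set \<Rightarrow> 'v set set fun_space"
  where "git_quotient s V G =
    quotient_space (open_subvariety (proj_space s V) (semistable_points s V G)) (git_class s V G)"


section \<open>Cubic fourfolds\<close>

text \<open>The index type \<open>6\<close> is \<open>{1,2,3,4,5,6}\<close> with \<open>6 = 0\<close>, so \<open>x $ 1, \<dots>, x $ 6\<close> are the coordinates.
  A cubic fourfold is a nonzero cubic form on \<open>\<complex>\<^sup>6\<close> up to scalar.\<close>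

type_synonym form = "complex^6 \<Rightarrow> complex"

definition form_scale :: "complex \<Rightarrow> form \<Rightarrow> form"
  where "form_scale c F = (\<lambda>x. c * F x)"

definition cubic_forms :: "form set"
  where "cubic_forms = {F. homogeneous_on (*s) UNIV 3 F}"

definition singular_points :: "form \<Rightarrow> (complex^6) set set"
  where "singular_points F =
    {ray (*s) v | v. v \<noteq> 0 \<and> F v = 0 \<and> (F has_derivative (\<lambda>_. 0)) (at v)}"

definition smooth_cubic :: "form \<Rightarrow> bool"
  where "smooth_cubic F \<longleftrightarrow> F \<in> cubic_forms \<and> F \<noteq> 0 \<and> singular_points F = {}"

definition holomorphic_fun :: "(complex^5) set \<Rightarrow> (complex^5 \<Rightarrow> complex) \<Rightarrow> bool"
  where "holomorphic_fun S f \<longleftrightarrow>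
    (\<forall>z\<in>S. \<exists>f'. (f has_derivative f') (at z) \<and> (\<forall>c w. f' (c *s w) = c * f' w))"

text \<open>The germ of the hypersurface \<open>F = 0\<close> at the point \<open>x\<close> of \<open>\<P>\<^sup>5\<close> is an \<open>A\<^sub>1\<close> singularity: in
  suitable local holomorphic coordinates \<open>z\<close> of \<open>\<P>\<^sup>5\<close> centred at \<open>x\<close>, its equation is
  \<open>z\<^sub>1\<^sup>2 + \<dots> + z\<^sub>5\<^sup>2\<close> times a unit \<open>u\<close>. The coordinates are given by a lift \<open>\<psi>\<close> to \<open>\<complex>\<^sup>6\<close> of their
  inverse; the condition on the derivative says that \<open>z \<mapsto> [\<psi> z]\<close> is a local biholomorphism at \<open>0\<close>,
  the tangent space of \<open>\<P>\<^sup>5\<close> at \<open>x\<close> being the quotient of \<open>\<complex>\<^sup>6\<close> by \<open>x\<close>, up to scalar.\<close>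

definition is_A1_singularity :: "form \<Rightarrow> (complex^6) set \<Rightarrow> bool"
  where "is_A1_singularity F x \<longleftrightarrow>
    (\<exists>(S :: (complex^5) set) (\<psi> :: complex^5 \<Rightarrow> complex^6) u \<psi>'.
       open S \<and> 0 \<in> S \<and>
       (\<forall>i. holomorphic_fun S (\<lambda>z. \<psi> z $ i)) \<and> holomorphic_fun S u \<and> (\<forall>z\<in>S. u z \<noteq> 0) \<and>
       \<psi> 0 \<noteq> 0 \<and> ray (*s) (\<psi> 0) = x \<and>
       (\<psi> has_derivative \<psi>') (at 0) \<and> (\<forall>w. \<psi>' w \<in> x \<longrightarrow> w = 0) \<and>
       (\<forall>z\<in>S. F (\<psi> z) = u z * (\<Sum>i\<in>UNIV. (z $ i)\<^sup>2)))"

definition nodal_with :: "nat \<Rightarrow> form \<Rightarrow> bool"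
  where "nodal_with k F \<longleftrightarrow>
    finite (singular_points F) \<and> card (singular_points F) = k \<and>
    (\<forall>x\<in>singular_points F. is_A1_singularity F x)"

definition generic_symmetric :: "complex^6 \<Rightarrow> complex^3^3"
  where "generic_symmetric x =
    vector [vector [x $ 1, x $ 2, x $ 3],
            vector [x $ 2, x $ 4, x $ 5],
            vector [x $ 3, x $ 5, x $ 6]]"

definition determinantal_cubic :: "form \<Rightarrow> bool"
  where "determinantal_cubic F \<longleftrightarrow>
    (\<exists>A c. invertible A \<and> c \<noteq> 0 \<and> F = (\<lambda>x. c * det (generic_symmetric (A *v x))))"


section \<open>The group and its normalizer\<close>

definition L27_perms :: "(nat \<Rightarrow> nat) set"
  where "L27_perms = generate (sym_group 7)
    {cycle_of_list [1,2] \<circ> cycle_of_list [3,6], cycle_of_list [1,2,3,4,5,6,7]}"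

text \<open>The isomorphism \<open>\<complex>\<^sup>6 \<cong> {y \<in> \<complex>\<^sup>7. y\<^sub>1 + \<dots> + y\<^sub>7 = 0}\<close> whose inverse forgets \<open>y\<^sub>7\<close>.\<close>

definition coord7 :: "complex^6 \<Rightarrow> nat \<Rightarrow> complex"
  where "coord7 x i = (if i = 7 then - (\<Sum>j\<in>UNIV. x $ j) else x $ of_nat i)"

definition L27 :: "(complex^6^6) set"
  where "L27 = {A. \<exists>\<sigma>\<in>L27_perms. \<forall>x. \<forall>i\<in>{1..7}. coord7 (A *v x) (\<sigma> i) = coord7 x i}"

definition GL6 :: "(complex^6^6) monoid"
  where "GL6 = \<lparr>carrier = {A. invertible A}, mult = (**), one = mat 1\<rparr>"

definition scalars6 :: "(complex^6^6) set"
  where "scalars6 = {mat c | c. c \<noteq> 0}"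

definition PGL6 :: "(complex^6^6) set monoid"
  where "PGL6 = GL6 Mod scalars6"

definition normalizer_L27 :: "(complex^6^6) set set"
  where "normalizer_L27 = normalizer PGL6 ((\<lambda>A. scalars6 #>\<^bsub>GL6\<^esub> A) ` L27)"

definition act :: "complex^6^6 \<Rightarrow> form \<Rightarrow> form"
  where "act A F = (\<lambda>x. F (matrix_inv A *v x))"


section \<open>The moduli space and its compactification\<close>

definition V_L27 :: "form set"
  where "V_L27 = {F \<in> cubic_forms. \<forall>A\<in>L27. \<forall>x. F (A *v x) = F x}"

definition smooth_locus :: "form set set"
  where "smooth_locus = {ray form_scale F | F. F \<in> V_L27 \<and> smooth_cubic F}"

text \<open>Elements of \<open>normalizer_L27\<close> are classes of matrices modulo scalars, so the union is the
  preimage of the normalizer in \<open>GL(6)\<close>; it acts on \<open>\<P>(V_L27)\<close> through \<open>PGL(6)\<close>.\<close>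

definition moduli_L27 :: "form set set fun_space"
  where "moduli_L27 =
    quotient_space (open_subvariety (proj_space form_scale V_L27) smooth_locus)
      (orbit_of (act ` \<Union>normalizer_L27))"

text \<open>The action of the normalizer on \<open>\<P>(V_L27)\<close> is linearised by its preimage in \<open>SL(6)\<close>.\<close>

definition git_moduli_L27 :: "form set set fun_space"
  where "git_moduli_L27 =
    git_quotient form_scale V_L27 (act ` {A \<in> \<Union>normalizer_L27. det A = 1})"

text \<open>All cubic fourfolds parametrized by the point \<open>b\<close> of the quotient have property \<open>P\<close>.\<close>

definition parametrizes :: "form set set \<Rightarrow> (form \<Rightarrow> bool) \<Rightarrow> bool"
  where "parametrizes b P \<longleftrightarrow> (\<forall>F. F \<noteq> 0 \<and> ray form_scale F \<in> b \<longrightarrow> P F)"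

end

theory Submission
  imports Defs
begin

text \<open>The seven coordinates of \<open>\<complex>\<^sup>7\<close> are diagonalized by the 7-cycle, and in Fourier coordinates the
  pencil of invariant cubics is \<open>u (a b c + 2 p q r - p\<^sup>2 a - q\<^sup>2 b - r\<^sup>2 c) + v (a b c + 4 p q r - a\<^sup>2 r - b\<^sup>2 p - c\<^sup>2 q)\<close>.
  For \<open>u v = 0\<close> this is the determinant of a symmetric matrix. Otherwise multiplicative relations among
  the critical equations force a singular point into a torus orbit of \<open>(1, 1, 1, A, A, A)\<close>, which leaves two
  values of \<open>u / v\<close> with 7 nodes and two values with 14 nodes, all nodes being nondegenerate critical points.
  The exchange of \<open>(a, b, c)\<close> with \<open>(p, q, r)\<close> normalizes the group and acts on the pencil by
  \<open>u / v \<mapsto> 2 v / u\<close>, and it swaps the two members of each kind. Conversely, an element of the normalizer permutes the 7-nodal members; if it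
  fixes one of them, it permutes its nodes, hence acts monomially on the seven coordinates and trivially on the
  pencil. Thus the normalizer acts through an involution, and the quotient of a projective line by it is a
  projective line.\<close>

section \<open>Cubic forms and their polarization\<close>

text \<open>The exchange is the point-line duality of the Fano plane: on the seven coordinates it
  replaces each one by a sum over a line, which induces the outer automorphism of the group. The
  normalizer itself is never computed, only its action on the pencil. A matrix permuting the seven
  nodes up to scalars respects the only linear relation among them, so all scalars agree and
  \<open>power_sum\<close> is multiplied by a constant; as \<open>power_sum\<close> has nonzero
  components along both 7-nodal members, they get the same eigenvalue. The isomorphism is one of
  spaces with functions, so topology and regular functions must both be transported. The Zariski
  topology of a projective line is cofinite, hence bijections are homeomorphisms; a function
  descends along (a : b) \<mapsto> (a^2 : b^2) by symmetrizing a quotient of forms that is valid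
  near both preimages of a point. The linearization by determinant one leaves only scalars with k^8
  = 1, up to the sign of the involution, so a^8 and b^8 are invariant and every point is semistable.
  Orbits are finite, hence GIT classes are orbits.\<close>

lemma homogeneous_on_monomials:
  fixes F :: "complex^'n \<Rightarrow> complex"
  assumes "homogeneous_on (*s) UNIV d F"
  shows "\<exists>c. \<forall>x. F x = (\<Sum>l | length l = d. c l * (\<Prod>i\<leftarrow>l. x $ i))"
  using assms
proof induction
  case (const c)
  have "{l::'n list. length l = 0} = {[]}" by auto
  then show ?case by (intro exI[of _ "\<lambda>_. c"]) simp
next
  case (linear l)
  have eq: "{l::'n list. length l = 1} = (\<lambda>i. [i]) ` UNIV"
    by (auto simp: length_Suc_conv)
  have lin: "l (v + w) = l v + l w" "l (c *s v) = c * l v" for v w c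
    using linear by (auto simp: linear_functional_on_def)
  have l0: "l 0 = 0" using lin(2)[of 0 0] by simp
  have ls: "l (\<Sum>i\<in>A. f i) = (\<Sum>i\<in>A. l (f i))" if "finite A" for A and f :: "'n \<Rightarrow> complex^'n"
    using that by induction (simp_all add: l0 lin)
  have expand: "l x = (\<Sum>i\<in>UNIV. l (axis i 1) * x $ i)" for x
  proof -
    have "x = (\<Sum>i\<in>UNIV. x $ i *s axis i 1)" by (simp add: basis_expansion)
    then have "l x = l (\<Sum>i\<in>UNIV. x $ i *s axis i 1)" by simp
    also have "\<dots> = (\<Sum>i\<in>UNIV. l (axis i 1) * x $ i)" by (simp add: ls lin mult.commute)
    finally show ?thesis .
  qed
  have "(\<Sum>l'\<in>{l'. length l' = 1}. l (axis (hd l') 1) * (\<Prod>i\<leftarrow>l'. x $ i))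
      = (\<Sum>i\<in>UNIV. l (axis i 1) * x $ i)" for x
    unfolding eq by (subst sum.reindex) (auto simp: inj_on_def)
  then show ?case
    by (intro exI[of _ "\<lambda>l'. l (axis (hd l') 1)"] allI) (simp only: expand[symmetric])
next
  case (add d p q)
  then obtain c e where "\<forall>x. p x = (\<Sum>l | length l = d. c l * (\<Prod>i\<leftarrow>l. x $ i))"
    "\<forall>x. q x = (\<Sum>l | length l = d. e l * (\<Prod>i\<leftarrow>l. x $ i))" by blast
  then show ?case
    by (intro exI[of _ "\<lambda>l. c l + e l"]) (simp add: sum.distrib distrib_right)
next
  case (mult d p e q)
  then obtain c c' where c: "\<And>x. p x = (\<Sum>l | length l = d. c l * (\<Prod>i\<leftarrow>l. x $ i))"
    "\<And>x. q x = (\<Sum>l | length l = e. c' l * (\<Prod>i\<leftarrow>l. x $ i))" by blast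
  \<comment> \<open>Monomials are indexed by ordered index lists rather than exponents, so that
    pairs of monomials correspond bijectively to concatenations. The coefficients are then not
    unique, but only their existence matters.\<close>
  have "p x * q x = (\<Sum>l | length l = d + e. (c (take d l) * c' (drop d l)) * (\<Prod>i\<leftarrow>l. x $ i))" for x
  proof -
    have "p x * q x = (\<Sum>(l, l') \<in> {l. length l = d} \<times> {l. length l = e}.
        c l * (\<Prod>i\<leftarrow>l. x $ i) * (c' l' * (\<Prod>i\<leftarrow>l'. x $ i)))"
      unfolding c sum_product sum.cartesian_product ..
    also have "\<dots> = (\<Sum>l | length l = d + e. (c (take d l) * c' (drop d l)) * (\<Prod>i\<leftarrow>l. x $ i))"
      by (rule sum.reindex_bij_witness[of _ "\<lambda>l. (take d l, drop d l)" "\<lambda>(l, l'). l @ l'"]) auto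
    finally show ?thesis .
  qed
  then show ?case by (intro exI[of _ "\<lambda>l. c (take d l) * c' (drop d l)"]) simp
qed

text \<open>The third difference, divided by 6 so that \<open>polar F x x x = F x\<close> for a
  cubic form. It makes sense for every function, so symmetry and compatibility with linear
  substitutions are formal; only multilinearity needs \<open>F\<close> to be cubic.\<close>

definition polar :: "form \<Rightarrow> complex^6 \<Rightarrow> complex^6 \<Rightarrow> complex^6 \<Rightarrow> complex"
  where "polar F x y z = (F (x + y + z) - F (x + y) - F (y + z) - F (x + z) + F x + F y + F z) / 6"

lemma polar_commute: "polar F x y z = polar F y x z" "polar F x y z = polar F x z y"
  by (simp_all add: polar_def algebra_simps)

text \<open>The same unsymmetrized coefficients serve \<open>F\<close> and its polarization: one
  ordered monomial polarizes to the six products shown, and the factor 6 in the first formula clears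
  the denominator of \<open>polar\<close>.\<close>

lemma cubic_form_coefficients:
  assumes "F \<in> cubic_forms"
  obtains c where
    "\<And>x. F x = (\<Sum>i\<in>UNIV. \<Sum>j\<in>UNIV. \<Sum>k\<in>UNIV. c i j k * (6 * (x $ i * x $ j * x $ k)))"
    and "\<And>x y z. polar F x y z = (\<Sum>i\<in>UNIV. \<Sum>j\<in>UNIV. \<Sum>k\<in>UNIV. c i j k *
      (x $ i * y $ j * z $ k + x $ i * z $ j * y $ k + y $ i * x $ j * z $ k
        + y $ i * z $ j * x $ k + z $ i * x $ j * y $ k + z $ i * y $ j * x $ k))"
proof -
  obtain c where c: "\<And>x. F x = (\<Sum>l | length l = 3. c l * (\<Prod>i\<leftarrow>l. x $ i))"
    using homogeneous_on_monomials assms unfolding cubic_forms_def by blast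
  define d where "d i j k = c [i, j, k] / 6" for i j k
  have F: "F x = (\<Sum>i\<in>UNIV. \<Sum>j\<in>UNIV. \<Sum>k\<in>UNIV. d i j k * (6 * (x $ i * x $ j * x $ k)))" for x
  proof -
    have "F x = (\<Sum>(i, j, k) \<in> UNIV \<times> UNIV \<times> UNIV. d i j k * (6 * (x $ i * x $ j * x $ k)))"
      unfolding c d_def
      by (rule sum.reindex_bij_witness[of _ "\<lambda>(i, j, k). [i, j, k]" "\<lambda>l. (l ! 0, l ! 1, l ! 2)"])
        (auto simp: length_Suc_conv numeral_eq_Suc mult.assoc)
    then show ?thesis by (simp add: sum.cartesian_product)
  qed
  have monomial: "e * (6 * ((x + y + z) * (x' + y' + z') * (x'' + y'' + z'')))
      - e * (6 * ((x + y) * (x' + y') * (x'' + y''))) - e * (6 * ((y + z) * (y' + z') * (y'' + z'')))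
      - e * (6 * ((x + z) * (x' + z') * (x'' + z'')))
      + e * (6 * (x * x' * x'')) + e * (6 * (y * y' * y'')) + e * (6 * (z * z' * z''))
    = 6 * (e * (x * y' * z'' + x * z' * y'' + y * x' * z'' + y * z' * x'' + z * x' * y'' + z * y' * x''))"
    for e x y z x' y' z' x'' y'' z'' :: complex by algebra
  show thesis
  proof
    fix x y z
    have "6 * polar F x y z = F (x + y + z) - F (x + y) - F (y + z) - F (x + z) + F x + F y + F z"
      by (simp only: polar_def times_divide_eq_right nonzero_mult_div_cancel_left[OF zero_neq_numeral[symmetric]])
    also have "\<dots> = 6 * (\<Sum>i\<in>UNIV. \<Sum>j\<in>UNIV. \<Sum>k\<in>UNIV. d i j k *
      (x $ i * y $ j * z $ k + x $ i * z $ j * y $ k + y $ i * x $ j * z $ k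
        + y $ i * z $ j * x $ k + z $ i * x $ j * y $ k + z $ i * y $ j * x $ k))"
      unfolding F sum.distrib[symmetric] sum_subtractf[symmetric] sum_distrib_left[of 6]
        vector_add_component monomial ..
    finally have "6 * polar F x y z = 6 * (\<Sum>i\<in>UNIV. \<Sum>j\<in>UNIV. \<Sum>k\<in>UNIV. d i j k *
      (x $ i * y $ j * z $ k + x $ i * z $ j * y $ k + y $ i * x $ j * z $ k
        + y $ i * z $ j * x $ k + z $ i * x $ j * y $ k + z $ i * y $ j * x $ k))" .
    then show "polar F x y z = (\<Sum>i\<in>UNIV. \<Sum>j\<in>UNIV. \<Sum>k\<in>UNIV. d i j k *
      (x $ i * y $ j * z $ k + x $ i * z $ j * y $ k + y $ i * x $ j * z $ k
        + y $ i * z $ j * x $ k + z $ i * x $ j * y $ k + z $ i * y $ j * x $ k))"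
      by (simp only: mult_cancel_left zero_neq_numeral[symmetric] simp_thms)
  qed (rule F)
qed

lemma polar_linear:
  assumes "F \<in> cubic_forms"
  shows "polar F (x + x') y z = polar F x y z + polar F x' y z"
    and "polar F (c *s x) y z = c * polar F x y z"
    and "polar F x x x = F x"
proof -
  obtain e where e: "\<And>x. F x = (\<Sum>i\<in>UNIV. \<Sum>j\<in>UNIV. \<Sum>k\<in>UNIV. e i j k * (6 * (x $ i * x $ j * x $ k)))"
    "\<And>x y z. polar F x y z = (\<Sum>i\<in>UNIV. \<Sum>j\<in>UNIV. \<Sum>k\<in>UNIV. e i j k *
      (x $ i * y $ j * z $ k + x $ i * z $ j * y $ k + y $ i * x $ j * z $ k
        + y $ i * z $ j * x $ k + z $ i * x $ j * y $ k + z $ i * y $ j * x $ k))"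
    using cubic_form_coefficients[OF assms] by blast
  show "polar F (x + x') y z = polar F x y z + polar F x' y z"
    unfolding e sum.distrib[symmetric] vector_add_component by (intro sum.cong refl) algebra
  show "polar F (c *s x) y z = c * polar F x y z"
    unfolding e sum_distrib_left vector_smult_component by (intro sum.cong refl) algebra
  show "polar F x x x = F x"
    unfolding e by (intro sum.cong refl) algebra
qed

lemma polar_rotate: "polar F x y z = polar F y z x" "polar F x y z = polar F z x y"
  by (simp_all add: polar_def algebra_simps)

lemma polar_add:
  assumes "F \<in> cubic_forms"
  shows "polar F (x + x') y z = polar F x y z + polar F x' y z"
    and "polar F y (x + x') z = polar F y x z + polar F y x' z"
    and "polar F y z (x + x') = polar F y z x + polar F y z x'"
  using polar_linear(1)[OF assms, of x x'] polar_rotate(1)[of F y] polar_rotate(2)[of F y z] by simp_all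

lemma polar_scale:
  assumes "F \<in> cubic_forms"
  shows "polar F (c *s x) y z = c * polar F x y z"
    and "polar F y (c *s x) z = c * polar F y x z"
    and "polar F y z (c *s x) = c * polar F y z x"
  using polar_linear(2)[OF assms, of c x] polar_rotate(1)[of F y] polar_rotate(2)[of F y z] by simp_all

lemma polar_sum:
  assumes F: "F \<in> cubic_forms"
  shows "polar F (\<Sum>i\<in>A. f i) y z = (\<Sum>i\<in>A. polar F (f i) y z)"
    and "polar F y (\<Sum>i\<in>A. f i) z = (\<Sum>i\<in>A. polar F y (f i) z)"
    and "polar F y z (\<Sum>i\<in>A. f i) = (\<Sum>i\<in>A. polar F y z (f i))"
proof -
  have zero: "polar F 0 y z = 0" for y z
    using polar_scale(1)[OF F, of 0 0] by simp
  have *: "polar F (\<Sum>i\<in>A. f i) y z = (\<Sum>i\<in>A. polar F (f i) y z)" for y z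
    by (induction A rule: infinite_finite_induct) (simp_all add: zero polar_add[OF F])
  show "polar F (\<Sum>i\<in>A. f i) y z = (\<Sum>i\<in>A. polar F (f i) y z)" by (rule *)
  show "polar F y (\<Sum>i\<in>A. f i) z = (\<Sum>i\<in>A. polar F y (f i) z)"
    using *[of z y] polar_rotate(1)[of F y] by simp
  show "polar F y z (\<Sum>i\<in>A. f i) = (\<Sum>i\<in>A. polar F y z (f i))"
    using * polar_rotate(2)[of F y z] by simp
qed

lemma cubic_form_add:
  assumes F: "F \<in> cubic_forms"
  shows "F (x + w) = F x + 3 * polar F x x w + 3 * polar F x w w + F w"
proof -
  have "F (x + w) = polar F (x + w) (x + w) (x + w)" by (simp add: polar_linear(3)[OF F])
  also have "\<dots> = polar F x x x + polar F x x w + polar F x w x + polar F x w w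
      + polar F w x x + polar F w x w + polar F w w x + polar F w w w"
    by (simp add: polar_add[OF F])
  also have "\<dots> = F x + 3 * polar F x x w + 3 * polar F x w w + F w"
    using polar_rotate[of F x x w] polar_rotate[of F x w w] by (simp add: polar_linear(3)[OF F])
  finally show ?thesis .
qed

lemma cubic_form_scale:
  assumes F: "F \<in> cubic_forms"
  shows "F (c *s x) = c ^ 3 * F x"
  using polar_linear(3)[OF F, of "c *s x"] polar_linear(3)[OF F, of x]
  by (simp add: polar_scale[OF F] power3_eq_cube mult.assoc)

lemma cubic_form_has_derivative:
  assumes F: "F \<in> cubic_forms"
  shows "(F has_derivative (\<lambda>h. 3 * polar F x x h)) (at x)"
proof -
  obtain e where e: "\<And>x. F x = (\<Sum>i\<in>UNIV. \<Sum>j\<in>UNIV. \<Sum>k\<in>UNIV. e i j k * (6 * (x $ i * x $ j * x $ k)))"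
    "\<And>x y z. polar F x y z = (\<Sum>i\<in>UNIV. \<Sum>j\<in>UNIV. \<Sum>k\<in>UNIV. e i j k *
      (x $ i * y $ j * z $ k + x $ i * z $ j * y $ k + y $ i * x $ j * z $ k
        + y $ i * z $ j * x $ k + z $ i * x $ j * y $ k + z $ i * y $ j * x $ k))"
    using cubic_form_coefficients[OF F] by blast
  have F': "F = (\<lambda>x. \<Sum>i\<in>UNIV. \<Sum>j\<in>UNIV. \<Sum>k\<in>UNIV. e i j k * (6 * (x $ i * x $ j * x $ k)))"
    using e(1) by blast
  have nth: "((\<lambda>x. x $ i) has_derivative (\<lambda>h. h $ i)) (at x)" for i and x :: "complex^6"
    by (rule bounded_linear_imp_has_derivative) (rule bounded_linear_vec_nth)
  have "((\<lambda>x. \<Sum>i\<in>UNIV. \<Sum>j\<in>UNIV. \<Sum>k\<in>UNIV. e i j k * (6 * (x $ i * x $ j * x $ k))) has_derivative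
      (\<lambda>h. \<Sum>i\<in>UNIV. \<Sum>j\<in>UNIV. \<Sum>k\<in>UNIV. e i j k *
        (6 * (x $ i * x $ j * h $ k + (x $ i * h $ j + h $ i * x $ j) * x $ k)))) (at x)"
    by (intro has_derivative_sum has_derivative_mult_right has_derivative_mult nth)
  also have "(\<lambda>h. \<Sum>i\<in>UNIV. \<Sum>j\<in>UNIV. \<Sum>k\<in>UNIV. e i j k *
        (6 * (x $ i * x $ j * h $ k + (x $ i * h $ j + h $ i * x $ j) * x $ k)))
      = (\<lambda>h. 3 * polar F x x h)"
    unfolding e(2) sum_distrib_left by (intro ext sum.cong refl) algebra
  finally show ?thesis using F' by simp
qed

text \<open>By Euler's relation, \<open>F v\<close> is the value of \<open>polar F v v\<close> at
  \<open>v\<close>, so the vanishing of the gradient already puts \<open>v\<close> on the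
  hypersurface.\<close>

lemma singular_point_iff:
  assumes F: "F \<in> cubic_forms"
  shows "F v = 0 \<and> (F has_derivative (\<lambda>_. 0)) (at v) \<longleftrightarrow> (\<forall>h. polar F v v h = 0)"
proof
  assume "F v = 0 \<and> (F has_derivative (\<lambda>_. 0)) (at v)"
  then have "(\<lambda>h. 3 * polar F v v h) = (\<lambda>_. 0)"
    using cubic_form_has_derivative[OF F] has_derivative_unique by blast
  then show "\<forall>h. polar F v v h = 0" by (metis mult_eq_0_iff zero_neq_numeral)
next
  assume "\<forall>h. polar F v v h = 0"
  then show "F v = 0 \<and> (F has_derivative (\<lambda>_. 0)) (at v)"
    using cubic_form_has_derivative[OF F, of v] polar_linear(3)[OF F, of v] by simp
qed

lemma singular_points_polar:
  assumes F: "F \<in> cubic_forms"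
  shows "singular_points F = {ray (*s) v | v. v \<noteq> 0 \<and> (\<forall>h. polar F v v h = 0)}"
  unfolding singular_points_def singular_point_iff[OF F, symmetric] by blast

section \<open>The holomorphic Morse lemma for cubic forms\<close>

lemma bilinear_orthonormal_extend:
  fixes \<beta> :: "complex^'n \<Rightarrow> complex^'n \<Rightarrow> complex"
  assumes add: "\<And>x x' y. \<beta> (x + x') y = \<beta> x y + \<beta> x' y"
    and scale: "\<And>c x y. \<beta> (c *s x) y = c * \<beta> x y"
    and sym: "\<And>x y. \<beta> x y = \<beta> y x"
    and rad: "\<And>x. (\<And>y. \<beta> x y = 0) \<Longrightarrow> x \<in> ray (*s) p"
    and fin: "finite I" and card: "card I + 1 < CARD('n)"
    and W: "\<forall>i\<in>I. \<forall>j\<in>I. \<beta> (W i) (W j) = (if i = j then 1 else 0)"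
  obtains w where "\<beta> w w = 1" "\<And>i. i \<in> I \<Longrightarrow> \<beta> w (W i) = 0"
proof -
  have scale': "\<beta> y (c *s x) = c * \<beta> y x" for c x y using scale sym by metis
  have add': "\<beta> y (x + x') = \<beta> y x + \<beta> y x'" for y x x' using add sym by metis
  have zero: "\<beta> 0 y = 0" for y using scale[of 0 0] by simp
  have minus: "\<beta> (- x) y = - \<beta> x y" for x y using scale[of "-1" x y] by simp
  have diff: "\<beta> (x - y) z = \<beta> x z - \<beta> y z" for x y z using add[of x "- y"] minus by simp
  have sums: "\<beta> (\<Sum>i\<in>J. f i) y = (\<Sum>i\<in>J. \<beta> (f i) y)" for J :: "'a set" and f y
    by (induction J rule: infinite_finite_induct) (simp_all add: zero add)
  define proj where "proj x = x - (\<Sum>i\<in>I. \<beta> x (W i) *s W i)" for x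
  have proj: "\<beta> (proj x) (W j) = 0" if "j \<in> I" for x j
  proof -
    have "(\<Sum>i\<in>I. \<beta> x (W i) * \<beta> (W i) (W j)) = (\<Sum>i\<in>I. if i = j then \<beta> x (W i) else 0)"
      using W that by (intro sum.cong) auto
    also have "\<dots> = \<beta> x (W j)" using fin that by simp
    finally show ?thesis by (simp add: proj_def diff sums scale)
  qed
  \<comment> \<open>Including \<open>p\<close> in the span ensures that the projection of a vector
    outside it cannot fall onto the line of \<open>p\<close>, which contains the radical.\<close>
  let ?S = "insert p (W ` I)"
  have "card ?S \<le> card I + 1"
    using card_image_le[OF fin, of W] card_insert_le_m1[of "card I + 1" "W ` I" p] fin
    by (simp add: card_insert_if)
  then have "vec.dim ?S < CARD('n)"
    using vec.dim_le_card[of ?S ?S] fin card vec.span_superset[of ?S] by simp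
  then have "vec.span ?S \<noteq> UNIV"
    using vec.dim_span[of ?S] vec_dim_card[where 'a=complex and 'n='n] by (metis less_irrefl)
  then obtain x where x: "x \<notin> vec.span ?S" by blast
  define y0 where "y0 = proj x"
  have y0: "y0 \<notin> ray (*s) p"
  proof
    assume "y0 \<in> ray (*s) p"
    then have "y0 \<in> vec.span ?S" by (auto simp: ray_def intro: vec.span_scale vec.span_base)
    moreover have "(\<Sum>i\<in>I. \<beta> x (W i) *s W i) \<in> vec.span ?S"
      by (intro vec.span_sum vec.span_scale vec.span_base) auto
    ultimately have "y0 + (\<Sum>i\<in>I. \<beta> x (W i) *s W i) \<in> vec.span ?S" by (rule vec.span_add)
    then show False using x by (simp add: y0_def proj_def)
  qed
  define P where "P = {y. \<forall>j\<in>I. \<beta> y (W j) = 0}"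
  have y0P: "y0 \<in> P" using proj by (simp add: P_def y0_def)
  \<comment> \<open>The form is bilinear, not Hermitian, so isotropic vectors exist. If all of
    \<open>P\<close> were isotropic, polarizing would make \<beta> vanish on \<open>P\<close>; as
    \<open>y0\<close> is orthogonal to every \<open>W i\<close> as well, it would lie in the
    radical.\<close>
  have "\<exists>y\<in>P. \<beta> y y \<noteq> 0"
  proof (rule ccontr)
    assume "\<not> ?thesis"
    then have null: "\<beta> y y = 0" if "y \<in> P" for y using that by blast
    have "\<beta> y0 z = 0" if "z \<in> P" for z
    proof -
      have "y0 + z \<in> P" using y0P that by (simp add: P_def add)
      then have "\<beta> (y0 + z) (y0 + z) = 0" by (rule null)
      then show ?thesis using null[OF y0P] null[OF that] sym[of z y0] by (simp add: add add')
    qed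
    note orth = this
    have "\<beta> y0 z = 0" for z
    proof -
      have pz: "proj z \<in> P" using proj by (simp add: P_def)
      have "z = proj z + (\<Sum>i\<in>I. \<beta> z (W i) *s W i)" by (simp add: proj_def)
      then have "\<beta> z y0 = \<beta> (proj z) y0 + (\<Sum>i\<in>I. \<beta> z (W i) * \<beta> (W i) y0)"
        by (metis (mono_tags, lifting) add sums scale sum.cong)
      also have "(\<Sum>i\<in>I. \<beta> z (W i) * \<beta> (W i) y0) = 0"
        using y0P sym[of "W _" y0] by (intro sum.neutral) (auto simp: P_def)
      finally show ?thesis using orth[OF pz] sym by simp
    qed
    then show False using rad y0 by blast
  qed
  then obtain y where y: "y \<in> P" "\<beta> y y \<noteq> 0" by blast
  define w where "w = (1 / csqrt (\<beta> y y)) *s y"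
  have "\<beta> w w = \<beta> y y / (csqrt (\<beta> y y))\<^sup>2"
    by (simp add: w_def scale scale' power2_eq_square)
  then have "\<beta> w w = 1" using y(2) by simp
  moreover have "\<beta> w (W i) = 0" if "i \<in> I" for i
    using y(1) that by (simp add: w_def scale P_def)
  ultimately show thesis by (rule that)
qed

lemma bilinear_orthonormal_family:
  fixes \<beta> :: "complex^'n \<Rightarrow> complex^'n \<Rightarrow> complex"
  assumes add: "\<And>x x' y. \<beta> (x + x') y = \<beta> x y + \<beta> x' y"
    and scale: "\<And>c x y. \<beta> (c *s x) y = c * \<beta> x y"
    and sym: "\<And>x y. \<beta> x y = \<beta> y x"
    and rad: "\<And>x. (\<And>y. \<beta> x y = 0) \<Longrightarrow> x \<in> ray (*s) p"
    and card: "CARD('m) < CARD('n)"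
  obtains W :: "'m::finite \<Rightarrow> complex^'n" where "\<And>i j. \<beta> (W i) (W j) = (if i = j then 1 else 0)"
proof -
  have "\<exists>W :: 'm \<Rightarrow> complex^'n. \<forall>i\<in>I. \<forall>j\<in>I. \<beta> (W i) (W j) = (if i = j then 1 else 0)"
    if "finite I" for I
    using that
  proof induction
    case empty
    then show ?case by simp
  next
    case (insert k I)
    then obtain W :: "'m \<Rightarrow> complex^'n" where W: "\<forall>i\<in>I. \<forall>j\<in>I. \<beta> (W i) (W j) = (if i = j then 1 else 0)"
      by blast
    have "card (insert k I) \<le> CARD('m)" by (rule card_mono) auto
    then have "card I + 1 < CARD('n)" using card insert by simp
    from bilinear_orthonormal_extend[of \<beta>, OF add scale sym rad insert(1) this W]
    obtain w where w: "\<beta> w w = 1" "\<And>i. i \<in> I \<Longrightarrow> \<beta> w (W i) = 0" by metis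
    have "\<beta> (W i) w = 0" if "i \<in> I" for i using w(2)[OF that] sym by metis
    then show ?case
      using W w insert(2) by (intro exI[of _ "W(k := w)"]) auto
  qed
  from this[of UNIV] show thesis using that by auto
qed

lemma has_derivative_vec_lambda:
  fixes f :: "'a::real_normed_vector \<Rightarrow> 'i::finite \<Rightarrow> 'b::euclidean_space"
  assumes "\<And>i. ((\<lambda>x. f x i) has_derivative (\<lambda>h. f' h i)) (at x)"
  shows "((\<lambda>x. \<chi> i. f x i) has_derivative (\<lambda>h. \<chi> i. f' h i)) (at x)"
proof (subst has_derivative_componentwise_within, rule ballI)
  fix b :: "'b^'i" assume "b \<in> Basis"
  then obtain i u where b: "b = axis i u" by (auto simp: Basis_vec_def)
  show "((\<lambda>x. (\<chi> i. f x i) \<bullet> b) has_derivative (\<lambda>h. (\<chi> i. f' h i) \<bullet> b)) (at x)"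
    unfolding b inner_axis by (simp add: assms has_derivative_inner_left)
qed

text \<open>A map of pairs \<open>(w, B)\<close> of a vector and a matrix whose zero set in the second component forces
  \<open>B\<close> to be symmetric with \<open>B\<^sup>2 = S(w)\<close>, where \<open>S(w)\<close> is the symmetric matrix with entries
  \<open>\<delta>\<^sub>i\<^sub>j + \<Sum>\<^sub>k e\<^sub>k\<^sub>i\<^sub>j w\<^sub>k\<close>; then \<open>z = B w\<close> satisfies \<open>z \<bullet> z = w \<bullet> S(w) w\<close>. Adding the skew part
  \<open>B - B\<^sup>T\<close> makes the derivative at \<open>(0, 1)\<close> invertible.\<close>

definition square_root_map ::
  "('n \<Rightarrow> 'n \<Rightarrow> 'n \<Rightarrow> complex) \<Rightarrow> (complex^'n) \<times> (complex^'n^'n) \<Rightarrow> (complex^'n) \<times> (complex^'n^'n)"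
  where "square_root_map e p = (\<chi> i. \<Sum>k\<in>UNIV. snd p $ i $ k * fst p $ k,
    \<chi> i j. (\<Sum>k\<in>UNIV. snd p $ k $ i * snd p $ k $ j) - (if i = j then 1 else 0)
      - (\<Sum>k\<in>UNIV. fst p $ k * e k i j) + snd p $ i $ j - snd p $ j $ i)"

definition square_root_deriv ::
  "('n \<Rightarrow> 'n \<Rightarrow> 'n \<Rightarrow> complex) \<Rightarrow> (complex^'n) \<times> (complex^'n^'n)
    \<Rightarrow> (complex^'n) \<times> (complex^'n^'n) \<Rightarrow> (complex^'n) \<times> (complex^'n^'n)"
  where "square_root_deriv e p h =
    (\<chi> i. \<Sum>k\<in>UNIV. snd p $ i $ k * fst h $ k + snd h $ i $ k * fst p $ k,
     \<chi> i j. (\<Sum>k\<in>UNIV. snd p $ k $ i * snd h $ k $ j + snd h $ k $ i * snd p $ k $ j)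
      - (\<Sum>k\<in>UNIV. fst h $ k * e k i j) + snd h $ i $ j - snd h $ j $ i)"

lemma has_derivative_nth:
  "(f has_derivative f') (at x) \<Longrightarrow> ((\<lambda>x. f x $ i) has_derivative (\<lambda>h. f' h $ i)) (at x)"
  by (rule bounded_linear.has_derivative[OF bounded_linear_vec_nth])

lemma square_root_map_has_derivative:
  "(square_root_map e has_derivative square_root_deriv e p) (at p)"
  unfolding square_root_map_def[abs_def] square_root_deriv_def[abs_def]
proof (intro has_derivative_Pair has_derivative_vec_lambda)
  show "((\<lambda>p. \<Sum>k\<in>UNIV. snd p $ i $ k * fst p $ k) has_derivative
      (\<lambda>h. \<Sum>k\<in>UNIV. snd p $ i $ k * fst h $ k + snd h $ i $ k * fst p $ k)) (at p)" for i
    by (intro has_derivative_sum has_derivative_mult has_derivative_nth has_derivative_snd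
        has_derivative_fst has_derivative_ident)
  fix i j
  have "((\<lambda>p. (\<Sum>k\<in>UNIV. snd p $ k $ i * snd p $ k $ j) - (if i = j then 1 else 0)
      - (\<Sum>k\<in>UNIV. fst p $ k * e k i j) + snd p $ i $ j - snd p $ j $ i) has_derivative
      (\<lambda>h. (\<Sum>k\<in>UNIV. snd p $ k $ i * snd h $ k $ j + snd h $ k $ i * snd p $ k $ j) - 0
      - (\<Sum>k\<in>UNIV. fst p $ k * 0 + fst h $ k * e k i j) + snd h $ i $ j - snd h $ j $ i)) (at p)"
    by (intro has_derivative_add has_derivative_diff has_derivative_sum
        has_derivative_mult has_derivative_nth has_derivative_snd
        has_derivative_fst has_derivative_ident has_derivative_const)
  then show "((\<lambda>p. (\<Sum>k\<in>UNIV. snd p $ k $ i * snd p $ k $ j) - (if i = j then 1 else 0)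
      - (\<Sum>k\<in>UNIV. fst p $ k * e k i j) + snd p $ i $ j - snd p $ j $ i) has_derivative
      (\<lambda>h. (\<Sum>k\<in>UNIV. snd p $ k $ i * snd h $ k $ j + snd h $ k $ i * snd p $ k $ j)
      - (\<Sum>k\<in>UNIV. fst h $ k * e k i j) + snd h $ i $ j - snd h $ j $ i)) (at p)"
    by (simp only: mult_zero_right add_0_left diff_zero)
qed

lemma square_root_deriv_bounded_linear: "bounded_linear (square_root_deriv e p)"
  using square_root_map_has_derivative by (rule has_derivative_bounded_linear)

text \<open>The inverse function theorem is a statement over the reals. Compatibility with complex
  scalars passes to the inverse of the derivative at every point and makes the local inverse
  holomorphic.\<close>

lemma square_root_deriv_scale:
  "square_root_deriv e p (c *s w, \<chi> i j. c * B $ i $ j) =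
    (c *s fst (square_root_deriv e p (w, B)), \<chi> i j. c * snd (square_root_deriv e p (w, B)) $ i $ j)"
  by (simp add: square_root_deriv_def vec_eq_iff sum_distrib_left right_diff_distrib
      distrib_left mult_ac)

lemma sum_delta_mult:
  fixes f :: "'n::finite \<Rightarrow> complex"
  shows "(\<Sum>k\<in>UNIV. (if i = k then 1 else 0) * f k) = f i"
    and "(\<Sum>k\<in>UNIV. (if k = i then 1 else 0) * f k) = f i"
    and "(\<Sum>k\<in>UNIV. f k * (if k = i then 1 else 0)) = f i"
    and "(\<Sum>k\<in>UNIV. f k * (if i = k then 1 else 0)) = f i"
proof -
  have *: "(\<Sum>k\<in>UNIV. if k = i then f k else 0) = f i" by simp
  show "(\<Sum>k\<in>UNIV. (if i = k then 1 else 0) * f k) = f i"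
    and "(\<Sum>k\<in>UNIV. (if k = i then 1 else 0) * f k) = f i"
    and "(\<Sum>k\<in>UNIV. f k * (if k = i then 1 else 0)) = f i"
    and "(\<Sum>k\<in>UNIV. f k * (if i = k then 1 else 0)) = f i"
    by (subst *[symmetric]; intro sum.cong; simp)+
qed

text \<open>At the identity matrix, the derivative of \<open>B\<^sup>T B\<close> in direction
  \<open>H\<close> is \<open>H + H\<^sup>T\<close> and the skew part adds
  \<open>H - H\<^sup>T\<close>. The sum is \<open>2 H\<close>, so the inverse function theorem
  applies.\<close>

lemma square_root_map_local_inverse:
  fixes e :: "'n::finite \<Rightarrow> 'n \<Rightarrow> 'n \<Rightarrow> complex"
  obtains V g g' where "open V" "(0, 0) \<in> V" "g (0, 0) = (0, mat 1)"
    "\<And>y. y \<in> V \<Longrightarrow> square_root_map e (g y) = y"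
    "\<And>y. y \<in> V \<Longrightarrow> (g has_derivative g' y) (at y)"
    "\<And>y c w B. y \<in> V \<Longrightarrow> g' y (c *s w, \<chi> i j. c * B $ i $ j) =
      (c *s fst (g' y (w, B)), \<chi> i j. c * snd (g' y (w, B)) $ i $ j)"
    "\<And>w. fst (g' (0, 0) (w, 0)) = w"
proof -
  let ?f = "square_root_map e" and ?p = "(0, mat 1) :: (complex^'n) \<times> (complex^'n^'n)"
  define f' where "f' p = Blinfun (square_root_deriv e p)" for p
  have f': "blinfun_apply (f' p) = square_root_deriv e p" for p
    unfolding f'_def by (rule bounded_linear_Blinfun_apply) (rule square_root_deriv_bounded_linear)
  \<comment> \<open>The explicit inverse of the derivative at the base point, which is triangular in
    the vector and the matrix component.\<close>
  define inv0 where "inv0 y = (fst y, \<chi> i j. (snd y $ i $ j + (\<Sum>k\<in>UNIV. fst y $ k * e k i j)) / 2)"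
    for y :: "(complex^'n) \<times> (complex^'n^'n)"
  have deriv0: "square_root_deriv e ?p h = (fst h, \<chi> i j. 2 * snd h $ i $ j - (\<Sum>k\<in>UNIV. fst h $ k * e k i j))" for h
    by (simp add: square_root_deriv_def mat_def vec_eq_iff sum.distrib sum_delta_mult)
  have inv0: "inv0 (square_root_deriv e ?p h) = h" for h
    unfolding deriv0 inv0_def by (simp add: vec_eq_iff prod_eq_iff)
  have "linear inv0"
    unfolding linear_iff inv0_def
    by (auto simp: vec_eq_iff sum.distrib distrib_right distrib_left add_divide_distrib sum_distrib_left
        scaleR_conv_of_real[where 'a=complex] sum_divide_distrib mult_ac)
  then have blin: "bounded_linear inv0" by (simp add: linear_conv_bounded_linear)
  have id: "Blinfun inv0 o\<^sub>L f' ?p = id_blinfun"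
    by (rule blinfun_eqI) (simp add: f' bounded_linear_Blinfun_apply[OF blin] inv0)
  have cont: "continuous_on UNIV f'"
  proof (rule continuous_on_blinfun_componentwise)
    fix h :: "(complex^'n) \<times> (complex^'n^'n)" assume "h \<in> Basis"
    show "continuous_on UNIV (\<lambda>p. blinfun_apply (f' p) h)"
      unfolding f' square_root_deriv_def by (intro continuous_intros)
  qed
  have derf: "(?f has_derivative blinfun_apply (f' p)) (at p)" for p
    by (simp add: f' square_root_map_has_derivative)
  obtain U' V g g' where V: "open U'" "U' \<subseteq> UNIV" "?p \<in> U'" "open V" "?f ?p \<in> V" "homeomorphism U' V ?f g"
    and g': "\<And>y. y \<in> V \<Longrightarrow> (g has_derivative (g' y)) (at y)"
      "\<And>y. y \<in> V \<Longrightarrow> g' y = inv_into UNIV (blinfun_apply (f' (g y)))"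
      "\<And>y. y \<in> V \<Longrightarrow> bij (blinfun_apply (f' (g y)))"
    apply (rule inverse_function_theorem[OF open_UNIV derf cont UNIV_I id])
    subgoal premises prems by (rule that[OF prems(2-)])
    done
  have fp: "?f ?p = (0, 0)"
    by (simp add: square_root_map_def mat_def vec_eq_iff sum_delta_mult)
  have g0: "g (0, 0) = ?p" using V(3,6) fp by (metis homeomorphism_apply1)
  show thesis
  proof
    show "open V" "(0, 0) \<in> V" "g (0, 0) = ?p" using V fp g0 by auto
    fix y assume y: "y \<in> V"
    show "?f (g y) = y" using V(6) y by (simp add: homeomorphism_apply2)
    show "(g has_derivative g' y) (at y)" using g' y by blast
    fix c w B
    let ?h = "g' y (w, B)"
    have bij: "bij (square_root_deriv e (g y))" and inv: "g' y = inv_into UNIV (square_root_deriv e (g y))"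
      using g'(2,3)[OF y] by (simp_all add: f')
    have "square_root_deriv e (g y) ?h = (w, B)"
      using bij inv by (simp add: bij_is_surj surj_f_inv_f)
    then have "square_root_deriv e (g y) (c *s fst ?h, \<chi> i j. c * snd ?h $ i $ j) = (c *s w, \<chi> i j. c * B $ i $ j)"
      using square_root_deriv_scale[of e "g y" c "fst ?h" "snd ?h"] by simp
    then show "g' y (c *s w, \<chi> i j. c * B $ i $ j) = (c *s fst ?h, \<chi> i j. c * snd ?h $ i $ j)"
      using bij inv by (metis bij_inv_eq_iff)
  next
    fix w :: "complex^'n"
    have y: "(0, 0) \<in> V" using V fp by simp
    have "square_root_deriv e ?p (g' (0, 0) (w, 0)) = (w, 0)"
      using g'(2,3)[OF y] g0 by (simp add: f' bij_is_surj surj_f_inv_f)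
    then show "fst (g' (0, 0) (w, 0)) = w" unfolding deriv0 by simp
  qed
qed

text \<open>For a cubic the Taylor expansion at \<open>p\<close> stops after two terms. On a
  complement of \<open>p\<close> with a basis \<open>W\<close> orthonormal for the Hessian it reads
  \<open>w \<bullet> S(w) w\<close>, with \<open>S\<close> affine in \<open>w\<close> and
  \<open>S(0) = 1\<close>. A holomorphic square root of \<open>S(w)\<close> supplies coordinates in
  which the equation is a sum of squares, with unit 1.\<close>

theorem nondegenerate_imp_A1:
  assumes F: "F \<in> cubic_forms" and p: "p \<noteq> 0" and crit: "\<And>h. polar F p p h = 0"
    and nondeg: "\<And>w. (\<And>h. polar F p w h = 0) \<Longrightarrow> w \<in> ray (*s) p"
  shows "is_A1_singularity F (ray (*s) p)"
proof -
  let ?\<beta> = "\<lambda>x y. 3 * polar F p x y"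
  obtain W :: "5 \<Rightarrow> complex^6" where W: "\<And>i j. ?\<beta> (W i) (W j) = (if i = j then 1 else 0)"
  proof (rule bilinear_orthonormal_family[of ?\<beta> p, where 'm=5])
    show "x \<in> ray (*s) p" if "\<And>y. ?\<beta> x y = 0" for x
      using nondeg that by simp
    show "?\<beta> x y = ?\<beta> y x" for x y using polar_commute(2) by simp
  qed (auto simp: polar_add[OF F] polar_scale[OF F])
  define L where "L w = (\<Sum>i\<in>UNIV. w $ i *s W i)" for w :: "complex^5"
  define e where "e k i j = polar F (W k) (W j) (W i)" for k i j
  have e_sym: "e k i j = e k j i" for k i j unfolding e_def by (rule polar_commute)
  obtain V g g' where V: "open V" "(0, 0) \<in> V" "g (0, 0) = (0, mat 1)"
    and g: "\<And>y. y \<in> V \<Longrightarrow> square_root_map e (g y) = y"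
    and g': "\<And>y. y \<in> V \<Longrightarrow> (g has_derivative g' y) (at y)"
    and g'_scale: "\<And>y c w B. y \<in> V \<Longrightarrow> g' y (c *s w, \<chi> i j. c * B $ i $ j) =
      (c *s fst (g' y (w, B)), \<chi> i j. c * snd (g' y (w, B)) $ i $ j)"
    and g'_0: "\<And>w. fst (g' (0, 0) (w, 0)) = w"
    using square_root_map_local_inverse[of e] by blast
  define S where "S = {z. (z, 0) \<in> V}"
  define \<psi> where "\<psi> z = p + L (fst (g (z, 0)))" for z
  have L_zero: "L 0 = 0" by (simp add: L_def)
  have L_scale: "L (c *s w) = c *s L w" for c w
    by (simp add: L_def vec.scale_sum_right)
  have "open ((\<lambda>z. (z, 0)) -` V)"
    by (rule open_vimage[OF V(1)]) (intro continuous_intros)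
  then have openS: "open S" by (simp add: S_def vimage_def)
  have lin_L: "linear L"
    unfolding linear_iff L_def
    by (auto simp: vec_eq_iff sum.distrib distrib_right scaleR_sum_right)
  have \<psi>': "(\<psi> has_derivative (\<lambda>h. L (fst (g' (z, 0) (h, 0))))) (at z)" if "z \<in> S" for z
  proof -
    have inner: "((\<lambda>z. (z, 0)) has_derivative (\<lambda>h. (h, 0))) (at z)"
      by (intro derivative_intros)
    have "(g has_derivative g' (z, 0)) (at (z, 0))" using g' that by (simp add: S_def)
    then have "((\<lambda>z. g (z, 0)) has_derivative (\<lambda>h. g' (z, 0) (h, 0))) (at z)"
      using diff_chain_at[OF inner] by (simp add: o_def)
    then have "((\<lambda>z. L (fst (g (z, 0)))) has_derivative (\<lambda>h. L (fst (g' (z, 0) (h, 0))))) (at z)"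
      by (intro bounded_linear.has_derivative[OF lin_L[unfolded linear_conv_bounded_linear]] has_derivative_fst)
    then show ?thesis
      using has_derivative_add[OF has_derivative_const] unfolding \<psi>_def[abs_def] by fastforce
  qed
  have holo: "holomorphic_fun S (\<lambda>z. \<psi> z $ i)" for i
    unfolding holomorphic_fun_def
  proof (intro ballI exI conjI allI)
    fix z assume z: "z \<in> S"
    show "((\<lambda>z. \<psi> z $ i) has_derivative (\<lambda>h. L (fst (g' (z, 0) (h, 0))) $ i)) (at z)"
      by (rule has_derivative_nth[OF \<psi>'[OF z]])
    show "L (fst (g' (z, 0) (c *s w, 0))) $ i = c * L (fst (g' (z, 0) (w, 0))) $ i" for c w
      using g'_scale[of "(z, 0)" c w 0] z by (simp add: S_def L_scale zero_vec_def[symmetric])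
  qed
  have F_p: "F p = 0" using crit[of p] by (simp add: polar_linear(3)[OF F])
  have F_L: "F (p + L w) = (\<Sum>i\<in>UNIV. \<Sum>j\<in>UNIV. w $ i * w $ j *
      ((if i = j then 1 else 0) + (\<Sum>k\<in>UNIV. w $ k * e k i j)))" for w
  proof -
    have "F (p + L w) = ?\<beta> (L w) (L w) + polar F (L w) (L w) (L w)"
      by (simp add: cubic_form_add[OF F] F_p crit polar_linear(3)[OF F])
    also have "?\<beta> (L w) (L w) = (\<Sum>i\<in>UNIV. \<Sum>j\<in>UNIV. w $ i * w $ j * ?\<beta> (W j) (W i))"
      by (simp add: L_def polar_sum[OF F] polar_scale[OF F] sum_distrib_left mult_ac)
    also have "\<dots> = (\<Sum>i\<in>UNIV. \<Sum>j\<in>UNIV. w $ i * w $ j * (if i = j then 1 else 0))"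
      unfolding W by (intro sum.cong refl) auto
    also have "polar F (L w) (L w) (L w) = (\<Sum>i\<in>UNIV. \<Sum>j\<in>UNIV. \<Sum>k\<in>UNIV. w $ i * w $ j * (w $ k * e k i j))"
    proof -
      have "polar F (L w) (L w) (L w) = (\<Sum>k\<in>UNIV. \<Sum>i\<in>UNIV. \<Sum>j\<in>UNIV. w $ i * w $ j * (w $ k * e k i j))"
        unfolding e_def L_def polar_sum(1)[OF F] polar_scale(1)[OF F]
        unfolding polar_sum(2)[OF F] polar_scale(2)[OF F] polar_sum(3)[OF F] polar_scale(3)[OF F]
        by (simp add: sum_distrib_left mult_ac)
      also have "\<dots> = (\<Sum>i\<in>UNIV. \<Sum>k\<in>UNIV. \<Sum>j\<in>UNIV. w $ i * w $ j * (w $ k * e k i j))"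
        by (rule sum.swap)
      also have "\<dots> = (\<Sum>i\<in>UNIV. \<Sum>j\<in>UNIV. \<Sum>k\<in>UNIV. w $ i * w $ j * (w $ k * e k i j))"
        by (rule sum.cong[OF refl]) (rule sum.swap)
      finally show ?thesis .
    qed
    finally show ?thesis by (simp add: distrib_left sum.distrib sum_distrib_left)
  qed
  have F_\<psi>: "F (\<psi> z) = (\<Sum>i\<in>UNIV. (z $ i)\<^sup>2)" if "z \<in> S" for z
  proof -
    define w B where "w = fst (g (z, 0))" and "B = snd (g (z, 0))"
    have "square_root_map e (w, B) = (z, 0)" using g that by (simp add: w_def B_def S_def)
    then have z: "z $ i = (\<Sum>k\<in>UNIV. B $ i $ k * w $ k)"
      and eq: "(\<Sum>k\<in>UNIV. B $ k $ i * B $ k $ j) - (if i = j then 1 else 0)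
      - (\<Sum>k\<in>UNIV. w $ k * e k i j) + B $ i $ j - B $ j $ i = 0" for i j
      by (auto simp: square_root_map_def vec_eq_iff)
    \<comment> \<open>The equations for (i, j) and (j, i) differ only in the sign of the skew part,
      because \<open>e\<close> is symmetric. Adding them isolates the product.\<close>
    have BB: "(\<Sum>k\<in>UNIV. B $ k $ i * B $ k $ j) = (if i = j then 1 else 0) + (\<Sum>k\<in>UNIV. w $ k * e k i j)" for i j
    proof -
      let ?X = "(\<Sum>k\<in>UNIV. B $ k $ i * B $ k $ j)" and ?E = "(\<Sum>k\<in>UNIV. w $ k * e k i j)"
      let ?d = "if i = j then 1 else 0 :: complex"
      have "?X - ?d - ?E + B $ i $ j - B $ j $ i = 0" by (rule eq)
      moreover have "?X - ?d - ?E + B $ j $ i - B $ i $ j = 0"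
        using eq[of j i] e_sym[of _ j i] by (auto simp: mult.commute)
      moreover have "x = d + e'" if "x - d - e' + b - b' = 0" "x - d - e' + b' - b = 0" for x d e' b b' :: complex
        using that by algebra
      ultimately show ?thesis by blast
    qed
    have "(\<Sum>l\<in>UNIV. (z $ l)\<^sup>2) = (\<Sum>l\<in>UNIV. \<Sum>i\<in>UNIV. \<Sum>j\<in>UNIV. w $ i * w $ j * (B $ l $ i * B $ l $ j))"
      by (simp add: z power2_eq_square sum_product mult_ac)
    also have "\<dots> = (\<Sum>i\<in>UNIV. \<Sum>l\<in>UNIV. \<Sum>j\<in>UNIV. w $ i * w $ j * (B $ l $ i * B $ l $ j))"
      by (rule sum.swap)
    also have "\<dots> = (\<Sum>i\<in>UNIV. \<Sum>j\<in>UNIV. \<Sum>l\<in>UNIV. w $ i * w $ j * (B $ l $ i * B $ l $ j))"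
      by (rule sum.cong[OF refl]) (rule sum.swap)
    also have "\<dots> = F (p + L w)"
      unfolding F_L by (simp only: sum_distrib_left[symmetric] BB)
    finally show ?thesis by (simp add: \<psi>_def w_def)
  qed
  have \<beta>_L: "?\<beta> (W i) (L w) = w $ i" for i w
  proof -
    have "?\<beta> (W i) (L w) = (\<Sum>j\<in>UNIV. w $ j * ?\<beta> (W i) (W j))"
      by (simp add: L_def polar_sum[OF F] polar_scale[OF F] sum_distrib_left mult_ac)
    then show ?thesis by (simp only: W sum_delta_mult)
  qed
  show ?thesis
    unfolding is_A1_singularity_def
  proof (intro exI conjI ballI allI impI)
    show "open S" by (rule openS)
    show "0 \<in> S" using V by (simp add: S_def zero_prod_def)
    show "holomorphic_fun S (\<lambda>z. \<psi> z $ i)" for i by (rule holo)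
    show "holomorphic_fun S (\<lambda>_. 1)"
      unfolding holomorphic_fun_def by (intro ballI exI[of _ "\<lambda>_. 0"]) auto
    have "\<psi> 0 = p" using V(3) by (simp add: \<psi>_def L_zero)
    then show "\<psi> 0 \<noteq> 0" "ray (*s) (\<psi> 0) = ray (*s) p" using p by auto
    show "(\<psi> has_derivative L) (at 0)"
      using \<psi>'[of 0] V(2) g'_0 by (simp add: S_def)
    \<comment> \<open>Pairing with \<open>W i\<close> recovers the i-th coordinate of
      \<open>w\<close>, while every multiple of \<open>p\<close> pairs to zero because
      \<open>p\<close> is critical.\<close>
    show "w = 0" if "L w \<in> ray (*s) p" for w
    proof -
      obtain c where "L w = c *s p" using \<open>L w \<in> ray (*s) p\<close> by (auto simp: ray_def)
      then have "?\<beta> (W i) (L w) = c * (3 * polar F p p (W i))" for i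
        using polar_commute(2)[of F p p "W i"] by (simp add: polar_scale[OF F])
      then show "w = 0" using \<beta>_L crit by (simp add: vec_eq_iff)
    qed
    show "F (\<psi> z) = 1 * (\<Sum>i\<in>UNIV. (z $ i)\<^sup>2)" if "z \<in> S" for z
      using F_\<psi>[OF that] by simp
  qed simp
qed

section \<open>The critical points of a cubic with a torus symmetry of order 21\<close>

definition torus_form :: "complex \<Rightarrow> complex \<Rightarrow> complex \<Rightarrow> complex \<Rightarrow> complex \<Rightarrow> complex \<Rightarrow> complex \<Rightarrow> complex \<Rightarrow> complex"
  where "torus_form u v a b c p q r =
    (u + v) * (a * b * c) + (2 * u + 4 * v) * (p * q * r)
      - u * (p\<^sup>2 * a + q\<^sup>2 * b + r\<^sup>2 * c) - v * (a\<^sup>2 * r + b\<^sup>2 * p + c\<^sup>2 * q)"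

text \<open>The vanishing of the gradient of \<open>torus_form\<close>, with the partial derivatives
  taken in the order a, b, c, p, q, r.\<close>

definition torus_critical :: "complex \<Rightarrow> complex \<Rightarrow> complex \<Rightarrow> complex \<Rightarrow> complex \<Rightarrow> complex \<Rightarrow> complex \<Rightarrow> complex \<Rightarrow> bool"
  where "torus_critical u v a b c p q r \<longleftrightarrow>
    (u + v) * (b * c) = u * p\<^sup>2 + 2 * v * (a * r) \<and>
    (u + v) * (c * a) = u * q\<^sup>2 + 2 * v * (b * p) \<and>
    (u + v) * (a * b) = u * r\<^sup>2 + 2 * v * (c * q) \<and>
    (2 * u + 4 * v) * (q * r) = 2 * u * (a * p) + v * b\<^sup>2 \<and>
    (2 * u + 4 * v) * (r * p) = 2 * u * (b * q) + v * c\<^sup>2 \<and>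
    (2 * u + 4 * v) * (p * q) = 2 * u * (c * r) + v * a\<^sup>2"

lemma torus_critical_cyclic:
  "torus_critical u v a b c p q r \<Longrightarrow> torus_critical u v b c a q r p"
  by (simp add: torus_critical_def mult.commute)

lemma torus_critical_scale:
  assumes "torus_critical u v a b c p q r"
  shows "torus_critical u v (k * a) (k * b) (k * c) (k * p) (k * q) (k * r)"
proof -
  have *: "K * ((k * x) * (k * y)) = L * (k * z)\<^sup>2 + M * ((k * m) * (k * n))"
    "K * ((k * x) * (k * y)) = M * ((k * m) * (k * n)) + L * (k * z)\<^sup>2"
    if "K * (x * y) = L * z\<^sup>2 + M * (m * n)" for K L M x y z m n :: complex
    using that by algebra+
  show ?thesis
    using assms unfolding torus_critical_def by (auto intro!: * simp: add.commute)
qed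

text \<open>Multiplying each equation by its own variable expresses the common quantities
  \<open>k\<close> and \<open>h\<close> through the monomials x and y. Eliminating y shows that x2 -
  4 x1, x3 - 4 x2 and x1 - 4 x3 agree, so going around the cycle multiplies the differences of the x
  by 4. Since 4^3 - 1 = 63 is nonzero, all x agree, and then so do all y.\<close>

lemma torus_critical_equal_monomials:
  assumes crit: "torus_critical u v a b c p q r" and u: "u \<noteq> 0" and v: "v \<noteq> 0"
  shows "a\<^sup>2 * r = b\<^sup>2 * p" "b\<^sup>2 * p = c\<^sup>2 * q" "a * p\<^sup>2 = b * q\<^sup>2" "b * q\<^sup>2 = c * r\<^sup>2"
proof -
  define x1 x2 x3 y1 y2 y3 where xy: "x1 = a\<^sup>2 * r" "x2 = b\<^sup>2 * p" "x3 = c\<^sup>2 * q"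
    "y1 = a * p\<^sup>2" "y2 = b * q\<^sup>2" "y3 = c * r\<^sup>2"
  define k h where "k = (u + v) * (a * b * c)" and "h = (2 * u + 4 * v) * (p * q * r)"
  have eqs: "k = u * y1 + 2 * v * x1" "k = u * y2 + 2 * v * x2" "k = u * y3 + 2 * v * x3"
    "h = 2 * u * y1 + v * x2" "h = 2 * u * y2 + v * x3" "h = 2 * u * y3 + v * x1"
    using crit unfolding torus_critical_def xy k_def h_def by algebra+
  have "v * (x2 - 4 * x1) = h - 2 * k" "v * (x3 - 4 * x2) = h - 2 * k" "v * (x1 - 4 * x3) = h - 2 * k"
    using eqs by algebra+
  then have "v * (63 * (x1 - x2)) = 0" "v * (63 * (x2 - x3)) = 0" by algebra+
  then have x: "x1 = x2" "x2 = x3" using v by simp_all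
  then have "u * y1 = u * y2" using eqs(1,2) by auto
  moreover have "u * y2 = u * y3" using eqs(2,3) x by auto
  ultimately have "y1 = y2" "y2 = y3" using u by simp_all
  with x show "a\<^sup>2 * r = b\<^sup>2 * p" "b\<^sup>2 * p = c\<^sup>2 * q" "a * p\<^sup>2 = b * q\<^sup>2" "b * q\<^sup>2 = c * r\<^sup>2"
    by (simp_all only: xy)
qed

text \<open>A vanishing \<open>a\<close> or \<open>p\<close> kills all the equal monomials, and the
  remaining equations then collapse one after another. With the cyclic symmetry, a singular point
  has six nonzero coordinates, which permits dividing by them.\<close>

lemma torus_critical_zero:
  assumes crit: "torus_critical u v a b c p q r" and u: "u \<noteq> 0" and v: "v \<noteq> 0"
    and zero: "a = 0 \<or> p = 0"
  shows "a = 0 \<and> b = 0 \<and> c = 0 \<and> p = 0 \<and> q = 0 \<and> r = 0"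
proof -
  have m: "b * p = 0" "c * q = 0" "b * q = 0" "c * r = 0" "a * r = 0"
    using torus_critical_equal_monomials[OF crit u v] zero by auto
  show ?thesis
  proof (cases "a = 0")
    case True
    have "q = 0" "r = 0" using crit m True u by (auto simp: torus_critical_def)
    then have "c = 0" using crit m True v by (auto simp: torus_critical_def)
    then have "b = 0" "p = 0" using crit m True u v \<open>q = 0\<close> by (auto simp: torus_critical_def)
    then show ?thesis using True \<open>c = 0\<close> \<open>q = 0\<close> \<open>r = 0\<close> by simp
  next
    case False
    then have p: "p = 0" and r: "r = 0" using zero m by auto
    then have "b = 0" "c = 0" using crit m v by (auto simp: torus_critical_def)
    then show ?thesis using crit False p r v by (auto simp: torus_critical_def)
  qed
qed

text \<open>The orbit of \<open>(1, 1, 1, A, A, A)\<close> under the torus of order 21, twisted by cube roots of unity.\<close>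

lemma torus_critical_normal_form:
  assumes crit: "torus_critical u v a b c p q r" and u: "u \<noteq> 0" and v: "v \<noteq> 0"
    and nz: "\<not> (a = 0 \<and> b = 0 \<and> c = 0 \<and> p = 0 \<and> q = 0 \<and> r = 0)"
  obtains \<epsilon> A where "\<epsilon> ^ 21 = 1" "a \<noteq> 0" "b = a * \<epsilon> ^ 5" "c = a * \<epsilon>"
    "p = a * (A * \<epsilon> ^ 17)" "q = a * (A * \<epsilon> ^ 4)" "r = a * (A * \<epsilon> ^ 6)"
    "u * (\<epsilon> ^ 7) * A\<^sup>2 + 2 * v * A = u + v" "2 * u * (\<epsilon> ^ 7) * A + v = (2 * u + 4 * v) * A\<^sup>2"
proof -
  note crit' = torus_critical_cyclic[OF crit]
  note crit'' = torus_critical_cyclic[OF crit']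
  have nz: "a \<noteq> 0" "b \<noteq> 0" "c \<noteq> 0" "p \<noteq> 0" "q \<noteq> 0" "r \<noteq> 0"
    using nz torus_critical_zero[OF crit u v] torus_critical_zero[OF crit' u v]
      torus_critical_zero[OF crit'' u v] by blast+
  define B \<epsilon> P Q R where defs: "B = b / a" "\<epsilon> = c / a" "P = p / a" "Q = q / a" "R = r / a"
  have scaled: "b = a * B" "c = a * \<epsilon>" "p = a * P" "q = a * Q" "r = a * R"
    and nz': "B \<noteq> 0" "\<epsilon> \<noteq> 0" "R \<noteq> 0"
    using nz by (simp_all add: defs)
  have c1: "torus_critical u v 1 B \<epsilon> P Q R"
    using torus_critical_scale[OF crit, of "1 / a"] nz by (simp add: defs)
  have m: "R = B\<^sup>2 * P" "B\<^sup>2 * P = \<epsilon>\<^sup>2 * Q" "P\<^sup>2 = B * Q\<^sup>2" "B * Q\<^sup>2 = \<epsilon> * R\<^sup>2"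
    using torus_critical_equal_monomials[OF c1 u v] by simp_all
  \<comment> \<open>With \<open>a = 1\<close> the four monomial equations determine B, P and Q from
    \<epsilon> and R and leave one torsion condition on \<epsilon>.\<close>
  have "B * R\<^sup>2 = \<epsilon> ^ 5 * R\<^sup>2" using m by algebra
  then have B: "B = \<epsilon> ^ 5" using nz' by simp
  have "R\<^sup>2 = \<epsilon> ^ 21 * R\<^sup>2" using m B by algebra
  then have e21: "\<epsilon> ^ 21 = 1" using nz' by simp
  \<comment> \<open>The exponent 15 is -6 modulo 21: \<open>A\<close> is \<open>R\<close> with its
    weight 6 removed.\<close>
  define A where "A = R * \<epsilon> ^ 15"
  have R: "R = A * \<epsilon> ^ 6" using e21 unfolding A_def by algebra
  have "Q * \<epsilon>\<^sup>2 = (A * \<epsilon> ^ 4) * \<epsilon>\<^sup>2" using m R by algebra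
  then have Q: "Q = A * \<epsilon> ^ 4" using nz' by simp
  have "P * \<epsilon> ^ 10 = (A * \<epsilon> ^ 17) * \<epsilon> ^ 10" using m B R e21 by algebra
  then have P: "P = A * \<epsilon> ^ 17" using nz' by simp
  have "\<epsilon> ^ 6 * (u * (\<epsilon> ^ 7) * A\<^sup>2 + 2 * v * A) = \<epsilon> ^ 6 * (u + v)"
    using c1 e21 unfolding torus_critical_def B P Q R by algebra
  then have eq1: "u * (\<epsilon> ^ 7) * A\<^sup>2 + 2 * v * A = u + v" using nz' by simp
  have "\<epsilon> ^ 10 * (2 * u * (\<epsilon> ^ 7) * A + v) = \<epsilon> ^ 10 * ((2 * u + 4 * v) * A\<^sup>2)"
    using c1 e21 unfolding torus_critical_def B P Q R by algebra
  then have eq2: "2 * u * (\<epsilon> ^ 7) * A + v = (2 * u + 4 * v) * A\<^sup>2" using nz' by simp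
  show thesis
    by (rule that[OF e21 nz(1) _ _ _ _ _ eq1 eq2]) (simp_all only: scaled(1,3-) B P Q R scaled(2))
qed

lemma torus_critical_normal_point:
  fixes u v A \<epsilon> :: complex
  assumes e21: "\<epsilon> ^ 21 = 1"
    and "u * (\<epsilon> ^ 7) * A\<^sup>2 + 2 * v * A = u + v" "2 * u * (\<epsilon> ^ 7) * A + v = (2 * u + 4 * v) * A\<^sup>2"
  shows "torus_critical u v 1 (\<epsilon> ^ 5) \<epsilon> (A * \<epsilon> ^ 17) (A * \<epsilon> ^ 4) (A * \<epsilon> ^ 6)"
  unfolding torus_critical_def mult_1_left mult_1_right power_one
proof (intro conjI)
  show "(u + v) * (\<epsilon> ^ 5 * \<epsilon>) = u * (A * \<epsilon> ^ 17)\<^sup>2 + 2 * v * (A * \<epsilon> ^ 6)"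
    using assms by algebra
  show "(u + v) * \<epsilon> = u * (A * \<epsilon> ^ 4)\<^sup>2 + 2 * v * (\<epsilon> ^ 5 * (A * \<epsilon> ^ 17))"
    using assms by algebra
  show "(u + v) * \<epsilon> ^ 5 = u * (A * \<epsilon> ^ 6)\<^sup>2 + 2 * v * (\<epsilon> * (A * \<epsilon> ^ 4))"
    using assms by algebra
  show "(2 * u + 4 * v) * (A * \<epsilon> ^ 4 * (A * \<epsilon> ^ 6)) = 2 * u * (A * \<epsilon> ^ 17) + v * (\<epsilon> ^ 5)\<^sup>2"
    using assms by algebra
  show "(2 * u + 4 * v) * (A * \<epsilon> ^ 6 * (A * \<epsilon> ^ 17)) = 2 * u * (\<epsilon> ^ 5 * (A * \<epsilon> ^ 4)) + v * \<epsilon>\<^sup>2"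
    using assms by algebra
  show "(2 * u + 4 * v) * (A * \<epsilon> ^ 17 * (A * \<epsilon> ^ 4)) = 2 * u * (\<epsilon> * (A * \<epsilon> ^ 6)) + v"
    using assms by algebra
qed

text \<open>Here \<open>w\<close> stands for \<epsilon>^7. Eliminating u / v leaves a cubic in
  \<open>A\<close>, one of whose roots (\<open>A = 1\<close> for \<open>w = 1\<close>, and
  \<open>A = w\<close> otherwise) violates \<open>w * A\<^sup>2 \<noteq> 1\<close>. A substitution
  linear in \<open>A\<close> brings the remaining quadratic to \<eta>^2 + \<eta> + 2 = 0 in both
  cases, and the first equation then gives u / v.\<close>

lemma torus_critical_parameters:
  fixes u v w A :: complex
  assumes u: "u \<noteq> 0" and v: "v \<noteq> 0" and w: "w ^ 3 = 1"
    and eq1: "u * w * A\<^sup>2 + 2 * v * A = u + v" and eq2: "2 * u * w * A + v = (2 * u + 4 * v) * A\<^sup>2"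
  shows "(w = 1 \<and> (2 * A)\<^sup>2 + 2 * A + 2 = 0 \<and> 8 * u = (7 * (2 * A) - 3) * v) \<or>
    (w \<noteq> 1 \<and> (2 * (A - w\<^sup>2) - 1)\<^sup>2 + (2 * (A - w\<^sup>2) - 1) + 2 = 0
      \<and> 4 * u = - ((2 * (A - w\<^sup>2) - 1) + 6) * v)"
proof -
  have A: "w * A\<^sup>2 \<noteq> 1"
  \<comment> \<open>If w A^2 = 1, the first equation leaves 2 A = 1, which would force w =
    4.\<close>
  proof
    assume 1: "w * A\<^sup>2 = 1"
    then have "v * (2 * A - 1) = 0" using eq1 by algebra
    then have "2 * A = 1" using v by simp
    then have "w = 4" using 1 by algebra
    then show False using w by simp
  qed
  \<comment> \<open>The first equation is u (w A^2 - 1) = v (1 - 2 A), the second is 2 u (w A - A^2)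
    = v (2 A - 1)(2 A + 1). Cross multiplication gives this product, with 2 A - 1 as a factor to be
    discarded.\<close>
  have "u * v * ((2 * A - 1) * ((w * A\<^sup>2 - 1) * (2 * A + 1) + 2 * w * A - 2 * A\<^sup>2)) = 0"
    using eq1 eq2 by algebra
  moreover have "2 * A - 1 \<noteq> 0"
  proof
    assume 1: "2 * A - 1 = 0"
    then have "u * (w - 4) = 0" using eq1 by algebra
    then have "w = 4" using u by simp
    then show False using w by simp
  qed
  ultimately have cubic: "(w * A\<^sup>2 - 1) * (2 * A + 1) + 2 * w * A - 2 * A\<^sup>2 = 0" using u v by simp
  show ?thesis
  proof (cases "w = 1")
    case True
    have "(A - 1) * ((2 * A)\<^sup>2 + 2 * A + 2) = 0" using cubic True by algebra
    moreover have "A \<noteq> 1" using A True by auto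
    ultimately have \<eta>: "(2 * A)\<^sup>2 + 2 * A + 2 = 0" by simp
    have "(w * A\<^sup>2 - 1) * (8 * u - (7 * (2 * A) - 3) * v) = 0" using eq1 \<eta> True by algebra
    then show ?thesis using A True \<eta> by simp
  next
    case False
    have "(w - 1) * (w\<^sup>2 + w + 1) = 0" using w by algebra
    then have w': "w\<^sup>2 + w + 1 = 0" using False by simp
    define \<eta> where "\<eta> = 2 * (A - w\<^sup>2) - 1"
    have "(A - w) * (\<eta>\<^sup>2 + \<eta> + 2) * w = 0" using cubic w' unfolding \<eta>_def by algebra
    moreover have "A \<noteq> w" using A w by (auto simp: power2_eq_square power3_eq_cube mult.assoc)
    moreover have "w \<noteq> 0" using w by auto
    ultimately have \<eta>: "\<eta>\<^sup>2 + \<eta> + 2 = 0" by simp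
    have "2 * A = 2 * w\<^sup>2 + 1 + \<eta>" by (simp add: \<eta>_def)
    then have "(w * A\<^sup>2 - 1) * (4 * u + (\<eta> + 6) * v) = 0" using eq1 \<eta> w' by algebra
    then have "4 * u + (\<eta> + 6) * v = 0" using A by simp
    then have "4 * u = - (\<eta> + 6) * v" by algebra
    then show ?thesis using False \<eta> by (simp add: \<eta>_def)
  qed
qed

lemma torus_parameters_7:
  fixes u v w A \<eta> :: complex
  assumes "\<eta>\<^sup>2 + \<eta> + 2 = 0" "8 * u = (7 * \<eta> - 3) * v" "w = 1" "A = \<eta> / 2"
  shows "u * w * A\<^sup>2 + 2 * v * A = u + v" "2 * u * w * A + v = (2 * u + 4 * v) * A\<^sup>2"
  using assms by (algebra, algebra)

lemma torus_parameters_14: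
  fixes u v w A \<eta> :: complex
  assumes "\<eta>\<^sup>2 + \<eta> + 2 = 0" "4 * u = - (\<eta> + 6) * v" "w\<^sup>2 + w + 1 = 0" "A = w\<^sup>2 + (1 + \<eta>) / 2"
  shows "u * w * A\<^sup>2 + 2 * v * A = u + v" "2 * u * w * A + v = (2 * u + 4 * v) * A\<^sup>2"
  using assms by (algebra, algebra)

text \<open>Five of the six kernel equations of the Hessian, in coordinates scaled by powers of
  \<epsilon>, already cut out the line of the point itself. The parameter \<open>t\<close> takes u
  and v proportional to \<open>7 * \<eta> - 3\<close> and 8, so that no fractions occur.\<close>

lemma hessian_kernel_7:
  fixes u v w A \<eta> t \<alpha> \<beta> \<gamma> \<pi> \<kappa> \<rho> :: complex
  assumes \<eta>: "\<eta>\<^sup>2 + \<eta> + 2 = 0" and w: "w = 1" and t: "t \<noteq> 0"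
    and A: "A = \<eta> / 2" and u: "u = (7 * \<eta> - 3) * t" and v: "v = 8 * t"
    and hess: "(u + v) * (\<gamma> + \<beta>) = 2 * u * w * A * \<pi> + 2 * v * (\<rho> + A * \<alpha>)"
      "(u + v) * (\<alpha> + \<gamma>) = 2 * u * w * A * \<kappa> + 2 * v * (\<pi> + A * \<beta>)"
      "(u + v) * (\<alpha> + \<beta>) = 2 * u * w * A * \<rho> + 2 * v * (\<kappa> + A * \<gamma>)"
      "(2 * u + 4 * v) * A * (\<rho> + \<kappa>) = 2 * u * w * (\<pi> + A * \<alpha>) + 2 * v * \<beta>"
      "(2 * u + 4 * v) * A * (\<rho> + \<pi>) = 2 * u * w * (\<kappa> + A * \<beta>) + 2 * v * \<gamma>"
  shows "\<beta> = \<alpha> \<and> \<gamma> = \<alpha> \<and> \<pi> = A * \<alpha> \<and> \<kappa> = A * \<alpha> \<and> \<rho> = A * \<alpha>"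
proof -
  define E1 where "E1 = (u + v) * (\<gamma> + \<beta>) - (2 * u * w * A * \<pi> + 2 * v * (\<rho> + A * \<alpha>))"
  define E2 where "E2 = (u + v) * (\<alpha> + \<gamma>) - (2 * u * w * A * \<kappa> + 2 * v * (\<pi> + A * \<beta>))"
  define E3 where "E3 = (u + v) * (\<alpha> + \<beta>) - (2 * u * w * A * \<rho> + 2 * v * (\<kappa> + A * \<gamma>))"
  define E4 where "E4 = (2 * u + 4 * v) * A * (\<rho> + \<kappa>) - (2 * u * w * (\<pi> + A * \<alpha>) + 2 * v * \<beta>)"
  define E5 where "E5 = (2 * u + 4 * v) * A * (\<rho> + \<pi>) - (2 * u * w * (\<kappa> + A * \<beta>) + 2 * v * \<gamma>)"
  note E_defs = E1_def E2_def E3_def E4_def E5_def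
  have E: "E1 = 0" "E2 = 0" "E3 = 0" "E4 = 0" "E5 = 0"
    using hess by (simp_all add: E_defs)
  \<comment> \<open>The coefficients come from solving the linear system over the field generated by
    \<eta>; each displayed combination isolates the deviation of one unknown from its value on the
    expected line.\<close>
  have "672 * t * (\<beta> - \<alpha>) = (2-13 * \<eta>) * E1 + (22+17 * \<eta>) * E2 + (12+2 * \<eta>) * E3 + (-12+10 * \<eta>) * E4 + (6+5 * \<eta>) * E5"
    unfolding E_defs A u v using \<eta> w by algebra
  then have "672 * t * (\<beta> - \<alpha>) = 0" using E by simp
  then have s1: "\<beta> - \<alpha> = 0" using t by simp
  have "672 * t * (\<gamma> - \<alpha>) = (10-5 * \<eta>) * E1 + (20+10 * \<eta>) * E2 + (30+25 * \<eta>) * E3 + (-18+5 * \<eta>) * E4 + (-12+10 * \<eta>) * E5"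
    unfolding E_defs A u v using \<eta> w by algebra
  then have "672 * t * (\<gamma> - \<alpha>) = 0" using E by simp
  then have s2: "\<gamma> - \<alpha> = 0" using t by simp
  have "1344 * t * (\<pi> - A * \<alpha>) = (-20 * \<eta>) * E1 + (-50-15 * \<eta>) * E2 + (-46-25 * \<eta>) * E3 + (10-5 * \<eta>) * E4 + (-10-7 * \<eta>) * E5"
    unfolding E_defs A u v using \<eta> w by algebra
  then have "1344 * t * (\<pi> - A * \<alpha>) = 0" using E by simp
  then have s3: "\<pi> - A * \<alpha> = 0" using t by simp
  have "1344 * t * (\<kappa> - A * \<alpha>) = (-16-20 * \<eta>) * E1 + (-30-25 * \<eta>) * E2 + (-50-15 * \<eta>) * E3 + (-10-15 * \<eta>) * E4 + (10+3 * \<eta>) * E5"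
    unfolding E_defs A u v using \<eta> w by algebra
  then have "1344 * t * (\<kappa> - A * \<alpha>) = 0" using E by simp
  then have s4: "\<kappa> - A * \<alpha> = 0" using t by simp
  have "1344 * t * (\<rho> - A * \<alpha>) = (-20+10 * \<eta>) * E1 + (-46-5 * \<eta>) * E2 + (-30-5 * \<eta>) * E3 + (-30-25 * \<eta>) * E4 + (-30-17 * \<eta>) * E5"
    unfolding E_defs A u v using \<eta> w by algebra
  then have "1344 * t * (\<rho> - A * \<alpha>) = 0" using E by simp
  then have s5: "\<rho> - A * \<alpha> = 0" using t by simp
  show ?thesis using s1 s2 s3 s4 s5 by simp
qed

text \<open>The same elimination, now over the field generated by \<eta> and a primitive cube root
  of unity \<open>w\<close>.\<close>

lemma hessian_kernel_14:
  fixes u v w A \<eta> t \<alpha> \<beta> \<gamma> \<pi> \<kappa> \<rho> :: complex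
  assumes \<eta>: "\<eta>\<^sup>2 + \<eta> + 2 = 0" and w: "w\<^sup>2 + w + 1 = 0" and t: "t \<noteq> 0"
    and A: "A = w\<^sup>2 + (1 + \<eta>) / 2" and u: "u = - (\<eta> + 6) * t" and v: "v = 4 * t"
    and hess: "(u + v) * (\<gamma> + \<beta>) = 2 * u * w * A * \<pi> + 2 * v * (\<rho> + A * \<alpha>)"
      "(u + v) * (\<alpha> + \<gamma>) = 2 * u * w * A * \<kappa> + 2 * v * (\<pi> + A * \<beta>)"
      "(u + v) * (\<alpha> + \<beta>) = 2 * u * w * A * \<rho> + 2 * v * (\<kappa> + A * \<gamma>)"
      "(2 * u + 4 * v) * A * (\<rho> + \<kappa>) = 2 * u * w * (\<pi> + A * \<alpha>) + 2 * v * \<beta>"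
      "(2 * u + 4 * v) * A * (\<rho> + \<pi>) = 2 * u * w * (\<kappa> + A * \<beta>) + 2 * v * \<gamma>"
  shows "\<beta> = \<alpha> \<and> \<gamma> = \<alpha> \<and> \<pi> = A * \<alpha> \<and> \<kappa> = A * \<alpha> \<and> \<rho> = A * \<alpha>"
proof -
  define E1 where "E1 = (u + v) * (\<gamma> + \<beta>) - (2 * u * w * A * \<pi> + 2 * v * (\<rho> + A * \<alpha>))"
  define E2 where "E2 = (u + v) * (\<alpha> + \<gamma>) - (2 * u * w * A * \<kappa> + 2 * v * (\<pi> + A * \<beta>))"
  define E3 where "E3 = (u + v) * (\<alpha> + \<beta>) - (2 * u * w * A * \<rho> + 2 * v * (\<kappa> + A * \<gamma>))"
  define E4 where "E4 = (2 * u + 4 * v) * A * (\<rho> + \<kappa>) - (2 * u * w * (\<pi> + A * \<alpha>) + 2 * v * \<beta>)"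
  define E5 where "E5 = (2 * u + 4 * v) * A * (\<rho> + \<pi>) - (2 * u * w * (\<kappa> + A * \<beta>) + 2 * v * \<gamma>)"
  note E_defs = E1_def E2_def E3_def E4_def E5_def
  have E: "E1 = 0" "E2 = 0" "E3 = 0" "E4 = 0" "E5 = 0"
    using hess by (simp_all add: E_defs)
  have "168 * t * (\<beta> - \<alpha>) = (3-7 * \<eta>-5 * w-7 * \<eta> * w) * E1 + (1-13 * \<eta>-23 * w-13 * \<eta> * w) * E2 + (2-10 * \<eta>-14 * w-10 * \<eta> * w) * E3 + (-14+2 * \<eta>+2 * w+6 * \<eta> * w) * E4 + (-1+1 * \<eta>+1 * w+3 * \<eta> * w) * E5"
    unfolding E_defs A u v using \<eta> w by algebra
  then have "168 * t * (\<beta> - \<alpha>) = 0" using E by simp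
  then have s1: "\<beta> - \<alpha> = 0" using t by simp
  have "168 * t * (\<gamma> - \<alpha>) = (3-11 * \<eta>-13 * w-11 * \<eta> * w) * E1 + (2-14 * \<eta>-22 * w-14 * \<eta> * w) * E2 + (1-17 * \<eta>-31 * w-17 * \<eta> * w) * E3 + (-13+1 * \<eta>+1 * w+3 * \<eta> * w) * E4 + (-14+2 * \<eta>+2 * w+6 * \<eta> * w) * E5"
    unfolding E_defs A u v using \<eta> w by algebra
  then have "168 * t * (\<gamma> - \<alpha>) = 0" using E by simp
  then have s2: "\<gamma> - \<alpha> = 0" using t by simp
  have "336 * t * (\<pi> - A * \<alpha>) = (10+10 * \<eta>+8 * w+16 * \<eta> * w) * E1 + (-19+11 * \<eta>+9 * w+19 * \<eta> * w) * E2 + (-9+9 * \<eta>+7 * w+13 * \<eta> * w) * E3 + (1-5 * \<eta>+7 * w+1 * \<eta> * w) * E4 + (5-1 * \<eta>+5 * w-1 * \<eta> * w) * E5"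
    unfolding E_defs A u v using \<eta> w by algebra
  then have "336 * t * (\<pi> - A * \<alpha>) = 0" using E by simp
  then have s3: "\<pi> - A * \<alpha> = 0" using t by simp
  have "336 * t * (\<kappa> - A * \<alpha>) = (2+10 * \<eta>+8 * w+16 * \<eta> * w) * E1 + (-1+9 * \<eta>+7 * w+13 * \<eta> * w) * E2 + (-19+11 * \<eta>+9 * w+19 * \<eta> * w) * E3 + (9-5 * \<eta>+13 * w-1 * \<eta> * w) * E4 + (-3-1 * \<eta>-1 * w+1 * \<eta> * w) * E5"
    unfolding E_defs A u v using \<eta> w by algebra
  then have "336 * t * (\<kappa> - A * \<alpha>) = 0" using E by simp
  then have s4: "\<kappa> - A * \<alpha> = 0" using t by simp
  have "336 * t * (\<rho> - A * \<alpha>) = (-24+16 * \<eta>+14 * w+34 * \<eta> * w) * E1 + (-25+13 * \<eta>+11 * w+25 * \<eta> * w) * E2 + (-17+13 * \<eta>+11 * w+25 * \<eta> * w) * E3 + (17-5 * \<eta>+19 * w-3 * \<eta> * w) * E4 + (13-1 * \<eta>+11 * w-3 * \<eta> * w) * E5"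
    unfolding E_defs A u v using \<eta> w by algebra
  then have "336 * t * (\<rho> - A * \<alpha>) = 0" using E by simp
  then have s5: "\<rho> - A * \<alpha> = 0" using t by simp
  show ?thesis using s1 s2 s3 s4 s5 by simp
qed

section \<open>The pencil in six Fourier coordinates and its nodes\<close>

lemma UNIV_6: "(UNIV :: 6 set) = {1, 2, 3, 4, 5, 6}"
  by (rule card_seteq[symmetric]) simp_all

lemma forall_6: "(\<forall>i::6. P i) \<longleftrightarrow> P 1 \<and> P 2 \<and> P 3 \<and> P 4 \<and> P 5 \<and> P 6"
proof -
  have "(\<forall>i::6. P i) \<longleftrightarrow> (\<forall>i\<in>(UNIV :: 6 set). P i)" by simp
  also have "\<dots> \<longleftrightarrow> P 1 \<and> P 2 \<and> P 3 \<and> P 4 \<and> P 5 \<and> P 6" unfolding UNIV_6 by simp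
  finally show ?thesis .
qed

lemma sum_6: "(\<Sum>i\<in>(UNIV :: 6 set). f i) = f 1 + f 2 + f 3 + f 4 + f 5 + f 6"
  unfolding UNIV_6 by (simp add: add.assoc)

lemma cubic_monomial: "(\<lambda>y. k * (y $ i * y $ j * y $ l)) \<in> cubic_forms"
proof -
  have lin: "homogeneous_on (*s) UNIV 1 (\<lambda>y :: complex^6. y $ m)" for m
    by (rule homogeneous_on.linear) (simp add: linear_functional_on_def)
  have "homogeneous_on (*s) UNIV (0 + ((1 + 1) + 1)) (\<lambda>y :: complex^6. k * (y $ i * y $ j * y $ l))"
    by (intro homogeneous_on.mult homogeneous_on.const lin)
  then show ?thesis by (simp add: cubic_forms_def numeral_3_eq_3)
qed

lemma cubic_forms_add: "F \<in> cubic_forms \<Longrightarrow> G \<in> cubic_forms \<Longrightarrow> (\<lambda>x. F x + G x) \<in> cubic_forms"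
  unfolding cubic_forms_def mem_Collect_eq by (rule homogeneous_on.add)

text \<open>The quadratic residues 1, 2, 4 modulo 7 carry a, b, c and the non-residues 3, 6, 5 carry
  p, q, r, both in the order in which doubling permutes them. Every monomial then has index sum
  divisible by 7.\<close>

definition fourier_form :: "complex \<Rightarrow> complex \<Rightarrow> form"
  where "fourier_form u v y = torus_form u v (y $ 1) (y $ 2) (y $ 4) (y $ 3) (y $ 6) (y $ 5)"

lemma fourier_form_cubic: "fourier_form u v \<in> cubic_forms"
proof -
  have "fourier_form u v = (\<lambda>y. (u + v) * (y $ 1 * y $ 2 * y $ 4) + (2 * u + 4 * v) * (y $ 3 * y $ 6 * y $ 5)
      + (- u) * (y $ 3 * y $ 3 * y $ 1) + (- u) * (y $ 6 * y $ 6 * y $ 2) + (- u) * (y $ 5 * y $ 5 * y $ 4)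
      + (- v) * (y $ 1 * y $ 1 * y $ 5) + (- v) * (y $ 2 * y $ 2 * y $ 3) + (- v) * (y $ 4 * y $ 4 * y $ 6))"
    unfolding fourier_form_def torus_form_def by (rule ext) algebra
  then show ?thesis by (simp only:) (intro cubic_forms_add cubic_monomial)
qed

lemma polar_fourier_form:
  "6 * polar (fourier_form u v) x w h =
    ((u + v) * (x $ 2 * w $ 4 + x $ 4 * w $ 2) - 2 * u * (x $ 3 * w $ 3) - 2 * v * (x $ 1 * w $ 5 + x $ 5 * w $ 1)) * h $ 1
  + ((u + v) * (x $ 4 * w $ 1 + x $ 1 * w $ 4) - 2 * u * (x $ 6 * w $ 6) - 2 * v * (x $ 2 * w $ 3 + x $ 3 * w $ 2)) * h $ 2
  + ((u + v) * (x $ 1 * w $ 2 + x $ 2 * w $ 1) - 2 * u * (x $ 5 * w $ 5) - 2 * v * (x $ 4 * w $ 6 + x $ 6 * w $ 4)) * h $ 4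
  + ((2 * u + 4 * v) * (x $ 6 * w $ 5 + x $ 5 * w $ 6) - 2 * u * (x $ 1 * w $ 3 + x $ 3 * w $ 1) - 2 * v * (x $ 2 * w $ 2)) * h $ 3
  + ((2 * u + 4 * v) * (x $ 5 * w $ 3 + x $ 3 * w $ 5) - 2 * u * (x $ 2 * w $ 6 + x $ 6 * w $ 2) - 2 * v * (x $ 4 * w $ 4)) * h $ 6
  + ((2 * u + 4 * v) * (x $ 3 * w $ 6 + x $ 6 * w $ 3) - 2 * u * (x $ 4 * w $ 5 + x $ 5 * w $ 4) - 2 * v * (x $ 1 * w $ 1)) * h $ 5"
proof -
  have *: "6 * polar F x w h = F (x + w + h) - F (x + w) - F (w + h) - F (x + h) + F x + F w + F h" for F
    by (simp add: polar_def)
  show ?thesis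
    unfolding * fourier_form_def torus_form_def vector_add_component by algebra
qed

text \<open>Stated with two independent vectors \<open>x\<close> and \<open>w\<close>, this covers
  the gradient (\<open>w = x\<close>) as well as the kernel of the Hessian at
  \<open>x\<close>.\<close>

lemma polar_fourier_form_eq_0:
  "(\<forall>h. polar (fourier_form u v) x w h = 0) \<longleftrightarrow>
    (u + v) * (x $ 2 * w $ 4 + x $ 4 * w $ 2) = 2 * u * (x $ 3 * w $ 3) + 2 * v * (x $ 1 * w $ 5 + x $ 5 * w $ 1) \<and>
    (u + v) * (x $ 4 * w $ 1 + x $ 1 * w $ 4) = 2 * u * (x $ 6 * w $ 6) + 2 * v * (x $ 2 * w $ 3 + x $ 3 * w $ 2) \<and>
    (u + v) * (x $ 1 * w $ 2 + x $ 2 * w $ 1) = 2 * u * (x $ 5 * w $ 5) + 2 * v * (x $ 4 * w $ 6 + x $ 6 * w $ 4) \<and>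
    (2 * u + 4 * v) * (x $ 6 * w $ 5 + x $ 5 * w $ 6) = 2 * u * (x $ 1 * w $ 3 + x $ 3 * w $ 1) + 2 * v * (x $ 2 * w $ 2) \<and>
    (2 * u + 4 * v) * (x $ 5 * w $ 3 + x $ 3 * w $ 5) = 2 * u * (x $ 2 * w $ 6 + x $ 6 * w $ 2) + 2 * v * (x $ 4 * w $ 4) \<and>
    (2 * u + 4 * v) * (x $ 3 * w $ 6 + x $ 6 * w $ 3) = 2 * u * (x $ 4 * w $ 5 + x $ 5 * w $ 4) + 2 * v * (x $ 1 * w $ 1)"
  (is "?P \<longleftrightarrow> ?Q")
proof
  assume ?P
  then have "6 * polar (fourier_form u v) x w (axis i 1) = 0" for i by simp
  then have *: "\<forall>i. 6 * polar (fourier_form u v) x w (axis i 1) = 0" by blast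
  show ?Q
    using *[unfolded polar_fourier_form forall_6] by (simp add: axis_def diff_eq_eq add.commute)
next
  assume ?Q
  then have "6 * polar (fourier_form u v) x w h = 0" for h
    unfolding polar_fourier_form by (simp only: diff_diff_eq diff_self mult_zero_left add_0_left)
  then show ?P by simp
qed

lemma fourier_form_critical:
  "(\<forall>h. polar (fourier_form u v) y y h = 0) \<longleftrightarrow> torus_critical u v (y $ 1) (y $ 2) (y $ 4) (y $ 3) (y $ 6) (y $ 5)"
proof -
  have *: "K * (a * b + b * a) = 2 * L * (c * c) + 2 * M * (d * e + e * d) \<longleftrightarrow> K * (a * b) = L * c\<^sup>2 + 2 * M * (d * e)"
    "K * (a * b + b * a) = 2 * L * (d * e + e * d) + 2 * M * (c * c) \<longleftrightarrow> K * (a * b) = 2 * L * (d * e) + M * c\<^sup>2"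
    for K L M a b c d e :: complex
    by (rule iffI; algebra)+
  show ?thesis
    unfolding polar_fourier_form_eq_0 torus_critical_def * by (simp add: mult.commute)
qed

definition torus_point :: "complex \<Rightarrow> complex \<Rightarrow> complex^6"
  where "torus_point A \<epsilon> = (\<chi> i. if i = 1 then 1 else if i = 2 then \<epsilon> ^ 5 else if i = 4 then \<epsilon>
    else if i = 3 then A * \<epsilon> ^ 17 else if i = 6 then A * \<epsilon> ^ 4 else A * \<epsilon> ^ 6)"

lemma torus_point_nth [simp]:
  "torus_point A \<epsilon> $ 1 = 1" "torus_point A \<epsilon> $ 2 = \<epsilon> ^ 5" "torus_point A \<epsilon> $ 4 = \<epsilon>"
  "torus_point A \<epsilon> $ 3 = A * \<epsilon> ^ 17" "torus_point A \<epsilon> $ 6 = A * \<epsilon> ^ 4" "torus_point A \<epsilon> $ 5 = A * \<epsilon> ^ 6"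
  by (simp_all add: torus_point_def)

lemma torus_point_nonzero: "torus_point A \<epsilon> \<noteq> 0"
proof
  assume "torus_point A \<epsilon> = 0"
  then have "torus_point A \<epsilon> $ 1 = 0" by simp
  then show False by simp
qed

lemma ray_self: "v \<in> ray (*s) v" for v :: "complex^'n"
  unfolding ray_def by (rule range_eqI[of _ _ 1]) simp

text \<open>The first coordinate is normalized to 1 and the fourth one reads off \<epsilon>, so
  nodes can be counted by counting roots of unity.\<close>

lemma ray_torus_point_inj: "ray (*s) (torus_point A \<epsilon>) = ray (*s) (torus_point A' \<epsilon>') \<Longrightarrow> \<epsilon> = \<epsilon>'"
proof -
  assume "ray (*s) (torus_point A \<epsilon>) = ray (*s) (torus_point A' \<epsilon>')"
  then obtain k where k: "torus_point A \<epsilon> = k *s torus_point A' \<epsilon>'"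
    using ray_self[of "torus_point A \<epsilon>"] by (auto simp: ray_def)
  have "1 = k" using arg_cong[OF k, of "\<lambda>y. y $ 1"] by simp
  with arg_cong[OF k, of "\<lambda>y. y $ 4"] show "\<epsilon> = \<epsilon>'" by simp
qed

lemma ray_scale: "k \<noteq> 0 \<Longrightarrow> ray (*s) (k *s v) = ray (*s) v" for v :: "complex^'n"
proof (intro equalityI subsetI)
  fix y assume "k \<noteq> 0" "y \<in> ray (*s) v"
  then obtain c where "y = c *s v" by (auto simp: ray_def)
  then have "y = (c / k) *s (k *s v)" using \<open>k \<noteq> 0\<close> by (simp add: vector_smult_assoc)
  then show "y \<in> ray (*s) (k *s v)" unfolding ray_def by (rule range_eqI)
qed (auto simp: ray_def vector_smult_assoc)

lemma fourier_form_singular_points: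
  assumes u: "u \<noteq> 0" and v: "v \<noteq> 0"
  shows "singular_points (fourier_form u v) =
    {ray (*s) (torus_point A \<epsilon>) | A \<epsilon>. \<epsilon> ^ 21 = 1 \<and> u * (\<epsilon> ^ 7) * A\<^sup>2 + 2 * v * A = u + v
      \<and> 2 * u * (\<epsilon> ^ 7) * A + v = (2 * u + 4 * v) * A\<^sup>2}" (is "_ = ?R")
proof (intro equalityI subsetI)
  fix x assume "x \<in> singular_points (fourier_form u v)"
  then obtain y where x: "x = ray (*s) y" and y: "y \<noteq> 0"
    and crit: "torus_critical u v (y $ 1) (y $ 2) (y $ 4) (y $ 3) (y $ 6) (y $ 5)"
    by (auto simp: singular_points_polar[OF fourier_form_cubic] fourier_form_critical)
  have nz: "\<not> (y $ 1 = 0 \<and> y $ 2 = 0 \<and> y $ 4 = 0 \<and> y $ 3 = 0 \<and> y $ 6 = 0 \<and> y $ 5 = 0)"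
    using y by (auto simp: vec_eq_iff forall_6)
  obtain \<epsilon> A where e: "\<epsilon> ^ 21 = 1" "y $ 1 \<noteq> 0" "y $ 2 = y $ 1 * \<epsilon> ^ 5" "y $ 4 = y $ 1 * \<epsilon>"
    "y $ 3 = y $ 1 * (A * \<epsilon> ^ 17)" "y $ 6 = y $ 1 * (A * \<epsilon> ^ 4)" "y $ 5 = y $ 1 * (A * \<epsilon> ^ 6)"
    and eqs: "u * (\<epsilon> ^ 7) * A\<^sup>2 + 2 * v * A = u + v" "2 * u * (\<epsilon> ^ 7) * A + v = (2 * u + 4 * v) * A\<^sup>2"
    using torus_critical_normal_form[OF crit u v nz] by metis
  have "y = (y $ 1) *s torus_point A \<epsilon>" using e by (simp add: vec_eq_iff forall_6)
  then have "x = ray (*s) (torus_point A \<epsilon>)" unfolding x using ray_scale[OF e(2)] by metis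
  then show "x \<in> ?R" using e(1) eqs by blast
next
  fix x assume "x \<in> ?R"
  then obtain A \<epsilon> where x: "x = ray (*s) (torus_point A \<epsilon>)" and e: "\<epsilon> ^ 21 = 1"
    "u * (\<epsilon> ^ 7) * A\<^sup>2 + 2 * v * A = u + v" "2 * u * (\<epsilon> ^ 7) * A + v = (2 * u + 4 * v) * A\<^sup>2" by blast
  show "x \<in> singular_points (fourier_form u v)"
    unfolding singular_points_polar[OF fourier_form_cubic] fourier_form_critical x
    using torus_critical_normal_point[OF e] torus_point_nonzero by fastforce
qed

text \<open>In the scaled coordinates \<open>w $ i / torus_point 1 \<epsilon> $ i\<close> the Hessian at a singular point only
  depends on \<open>\<epsilon>\<^sup>7\<close>.\<close>

lemma fourier_form_A1:
  assumes e: "\<epsilon> ^ 21 = 1" and crit: "\<And>h. polar (fourier_form u v) (torus_point A \<epsilon>) (torus_point A \<epsilon>) h = 0"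
    and kernel: "\<And>\<alpha> \<beta> \<gamma> \<pi> \<kappa> \<rho>. (u + v) * (\<gamma> + \<beta>) = 2 * u * \<epsilon> ^ 7 * A * \<pi> + 2 * v * (\<rho> + A * \<alpha>) \<Longrightarrow>
      (u + v) * (\<alpha> + \<gamma>) = 2 * u * \<epsilon> ^ 7 * A * \<kappa> + 2 * v * (\<pi> + A * \<beta>) \<Longrightarrow>
      (u + v) * (\<alpha> + \<beta>) = 2 * u * \<epsilon> ^ 7 * A * \<rho> + 2 * v * (\<kappa> + A * \<gamma>) \<Longrightarrow>
      (2 * u + 4 * v) * A * (\<rho> + \<kappa>) = 2 * u * \<epsilon> ^ 7 * (\<pi> + A * \<alpha>) + 2 * v * \<beta> \<Longrightarrow>
      (2 * u + 4 * v) * A * (\<rho> + \<pi>) = 2 * u * \<epsilon> ^ 7 * (\<kappa> + A * \<beta>) + 2 * v * \<gamma> \<Longrightarrow>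
      \<beta> = \<alpha> \<and> \<gamma> = \<alpha> \<and> \<pi> = A * \<alpha> \<and> \<kappa> = A * \<alpha> \<and> \<rho> = A * \<alpha>"
  shows "is_A1_singularity (fourier_form u v) (ray (*s) (torus_point A \<epsilon>))"
proof (rule nondegenerate_imp_A1[OF fourier_form_cubic torus_point_nonzero crit])
  fix w assume w: "\<And>h. polar (fourier_form u v) (torus_point A \<epsilon>) w h = 0"
  have e0: "\<epsilon> \<noteq> 0" using e by auto
  define \<alpha> \<beta> \<gamma> \<pi> \<kappa> \<rho> where defs: "\<alpha> = w $ 1" "\<beta> = w $ 2 / \<epsilon> ^ 5" "\<gamma> = w $ 4 / \<epsilon>"
    "\<pi> = w $ 3 / \<epsilon> ^ 17" "\<kappa> = w $ 6 / \<epsilon> ^ 4" "\<rho> = w $ 5 / \<epsilon> ^ 6"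
  have wi: "w $ 1 = \<alpha>" "w $ 2 = \<beta> * \<epsilon> ^ 5" "w $ 4 = \<gamma> * \<epsilon>" "w $ 3 = \<pi> * \<epsilon> ^ 17"
    "w $ 6 = \<kappa> * \<epsilon> ^ 4" "w $ 5 = \<rho> * \<epsilon> ^ 6" using e0 by (simp_all add: defs)
  have "\<forall>h. polar (fourier_form u v) (torus_point A \<epsilon>) w h = 0" using w by blast
  note H = this[unfolded polar_fourier_form_eq_0 torus_point_nth wi mult_1_left]
  \<comment> \<open>Modulo 21 all terms of a Hessian equation have the same weight in \<epsilon> up
    to \<epsilon>^7. Factoring out the common power, here \<epsilon>^6, leaves an equation in
    \<epsilon>^7 alone.\<close>
  have "\<epsilon> ^ 6 * ((u + v) * (\<gamma> + \<beta>)) = \<epsilon> ^ 6 * (2 * u * \<epsilon> ^ 7 * A * \<pi> + 2 * v * (\<rho> + A * \<alpha>))"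
    using H[THEN conjunct1] e by algebra
  then have h1: "(u + v) * (\<gamma> + \<beta>) = 2 * u * \<epsilon> ^ 7 * A * \<pi> + 2 * v * (\<rho> + A * \<alpha>)" using e0 by simp
  have "\<epsilon> * ((u + v) * (\<alpha> + \<gamma>)) = \<epsilon> * (2 * u * \<epsilon> ^ 7 * A * \<kappa> + 2 * v * (\<pi> + A * \<beta>))"
    using H[THEN conjunct2, THEN conjunct1] e by algebra
  then have h2: "(u + v) * (\<alpha> + \<gamma>) = 2 * u * \<epsilon> ^ 7 * A * \<kappa> + 2 * v * (\<pi> + A * \<beta>)" using e0 by simp
  have "\<epsilon> ^ 5 * ((u + v) * (\<alpha> + \<beta>)) = \<epsilon> ^ 5 * (2 * u * \<epsilon> ^ 7 * A * \<rho> + 2 * v * (\<kappa> + A * \<gamma>))"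
    using H[THEN conjunct2, THEN conjunct2, THEN conjunct1] e by algebra
  then have h3: "(u + v) * (\<alpha> + \<beta>) = 2 * u * \<epsilon> ^ 7 * A * \<rho> + 2 * v * (\<kappa> + A * \<gamma>)" using e0 by simp
  have "\<epsilon> ^ 10 * ((2 * u + 4 * v) * A * (\<rho> + \<kappa>)) = \<epsilon> ^ 10 * (2 * u * \<epsilon> ^ 7 * (\<pi> + A * \<alpha>) + 2 * v * \<beta>)"
    using H[THEN conjunct2, THEN conjunct2, THEN conjunct2, THEN conjunct1] e by algebra
  then have h4: "(2 * u + 4 * v) * A * (\<rho> + \<kappa>) = 2 * u * \<epsilon> ^ 7 * (\<pi> + A * \<alpha>) + 2 * v * \<beta>" using e0 by simp
  have "\<epsilon> ^ 2 * ((2 * u + 4 * v) * A * (\<rho> + \<pi>)) = \<epsilon> ^ 2 * (2 * u * \<epsilon> ^ 7 * (\<kappa> + A * \<beta>) + 2 * v * \<gamma>)"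
    using H[THEN conjunct2, THEN conjunct2, THEN conjunct2, THEN conjunct2, THEN conjunct1] e by algebra
  then have h5: "(2 * u + 4 * v) * A * (\<rho> + \<pi>) = 2 * u * \<epsilon> ^ 7 * (\<kappa> + A * \<beta>) + 2 * v * \<gamma>" using e0 by simp
  have "\<beta> = \<alpha> \<and> \<gamma> = \<alpha> \<and> \<pi> = A * \<alpha> \<and> \<kappa> = A * \<alpha> \<and> \<rho> = A * \<alpha>"
    by (rule kernel[OF h1 h2 h3 h4 h5])
  then have "w = \<alpha> *s torus_point A \<epsilon>" using wi by (simp add: vec_eq_iff forall_6)
  then show "w \<in> ray (*s) (torus_point A \<epsilon>)" by (auto simp: ray_def)
qed

lemma roots_equal:
  fixes \<eta> \<eta>' :: complex
  assumes "\<eta>\<^sup>2 + \<eta> + 2 = 0" "\<eta>'\<^sup>2 + \<eta>' + 2 = 0"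
  shows "\<eta>' = \<eta> \<or> \<eta>' = - 1 - \<eta>"
proof -
  have "(\<eta>' - \<eta>) * (\<eta>' - (- 1 - \<eta>)) = 0" using assms by algebra
  then show ?thesis by auto
qed

text \<open>Equating the two values of u / v gives 7 \<eta> + 2 \<eta>' + 9 = 0. Neither \<eta>' =
  \<eta>, where \<eta> = -1, nor the conjugate choice, where \<eta> = -7/5, is compatible with the
  quadratic equation.\<close>

lemma special_ratios_disjoint:
  fixes \<eta> \<eta>' :: complex
  assumes "\<eta>\<^sup>2 + \<eta> + 2 = 0" "\<eta>'\<^sup>2 + \<eta>' + 2 = 0" and v: "v \<noteq> 0"
    and "8 * u = (7 * \<eta> - 3) * v" "4 * u = - (\<eta>' + 6) * v"
  shows False
proof -
  have "v * (7 * \<eta> + 2 * \<eta>' + 9) = 0" using assms(4,5) by algebra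
  then have 1: "7 * \<eta> + 2 * \<eta>' + 9 = 0" using v by simp
  from roots_equal[OF assms(1,2)] show False
  proof
    assume "\<eta>' = \<eta>"
    then have "7 * \<eta> + 2 * \<eta> + 9 = 0" using 1 by simp
    then have "9 * (\<eta> + 1) = 0" by algebra
    then have "\<eta> + 1 = 0" by (metis mult_eq_0_iff zero_neq_numeral)
    then have "\<eta> = - 1" by (simp only: eq_neg_iff_add_eq_0)
    then show ?thesis using assms(1) by simp
  next
    assume "\<eta>' = - 1 - \<eta>"
    then have "7 * \<eta> + 2 * (- 1 - \<eta>) + 9 = 0" using 1 by simp
    then have "\<eta> * 5 = - 7" by algebra
    then have "\<eta> = (- 7) / 5" by (metis nonzero_eq_divide_eq zero_neq_numeral)
    then show ?thesis using assms(1) by (simp only:) (simp add: power2_eq_square)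
  qed
qed

text \<open>This ratio admits only the branch \<epsilon>^7 = 1, on which \<open>A\<close> is forced
  to be \<eta> / 2. The seven nodes are indexed by the seventh roots of unity.\<close>

lemma fourier_form_singular_points_7:
  assumes \<eta>: "\<eta>\<^sup>2 + \<eta> + 2 = 0" and v: "v \<noteq> 0" and uv: "8 * u = (7 * \<eta> - 3) * v"
  shows "singular_points (fourier_form u v) = (\<lambda>\<epsilon>. ray (*s) (torus_point (\<eta> / 2) \<epsilon>)) ` {\<epsilon>. \<epsilon> ^ 7 = 1}"
    and "nodal_with 7 (fourier_form u v)" and "u \<noteq> 0"
proof -
  show u: "u \<noteq> 0"
  proof
    assume "u = 0"
    then have "\<eta> * 7 = 3" using uv v by (simp add: mult.commute)
    then have "\<eta> = 3 / 7" by (simp add: eq_divide_eq)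
    then show False using \<eta> by (simp only:) (simp add: power2_eq_square)
  qed
  have pow: "\<epsilon> ^ 21 = 1" if "\<epsilon> ^ 7 = 1" for \<epsilon> :: complex
    using that power_mult[of \<epsilon> 7 3] by simp
  show sing: "singular_points (fourier_form u v) = (\<lambda>\<epsilon>. ray (*s) (torus_point (\<eta> / 2) \<epsilon>)) ` {\<epsilon>. \<epsilon> ^ 7 = 1}"
    unfolding fourier_form_singular_points[OF u v]
  proof (intro equalityI subsetI)
    fix x assume "x \<in> {ray (*s) (torus_point A \<epsilon>) | A \<epsilon>. \<epsilon> ^ 21 = 1 \<and> u * (\<epsilon> ^ 7) * A\<^sup>2 + 2 * v * A = u + v
      \<and> 2 * u * (\<epsilon> ^ 7) * A + v = (2 * u + 4 * v) * A\<^sup>2}"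
    then obtain A \<epsilon> where x: "x = ray (*s) (torus_point A \<epsilon>)" and e: "\<epsilon> ^ 21 = 1"
      "u * (\<epsilon> ^ 7) * A\<^sup>2 + 2 * v * A = u + v" "2 * u * (\<epsilon> ^ 7) * A + v = (2 * u + 4 * v) * A\<^sup>2" by blast
    have "(\<epsilon> ^ 7) ^ 3 = 1" using e(1) by (simp flip: power_mult)
    from torus_critical_parameters[OF u v this e(2,3)] show "x \<in> (\<lambda>\<epsilon>. ray (*s) (torus_point (\<eta> / 2) \<epsilon>)) ` {\<epsilon>. \<epsilon> ^ 7 = 1}"
    proof (elim disjE conjE)
      assume a: "\<epsilon> ^ 7 = 1" "8 * u = (7 * (2 * A) - 3) * v"
      then have "v * (2 * A - \<eta>) = 0" using uv by algebra
      then have "A = \<eta> / 2" using v by (simp add: mult.commute)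
      then show ?thesis using a x by blast
    next
      assume "(2 * (A - (\<epsilon> ^ 7)\<^sup>2) - 1)\<^sup>2 + (2 * (A - (\<epsilon> ^ 7)\<^sup>2) - 1) + 2 = 0"
        "4 * u = - ((2 * (A - (\<epsilon> ^ 7)\<^sup>2) - 1) + 6) * v"
      from special_ratios_disjoint[OF \<eta> this(1) v uv this(2)] show ?thesis by blast
    qed
  next
    fix x assume "x \<in> (\<lambda>\<epsilon>. ray (*s) (torus_point (\<eta> / 2) \<epsilon>)) ` {\<epsilon>. \<epsilon> ^ 7 = 1}"
    then obtain \<epsilon> where e: "\<epsilon> ^ 7 = 1" and x: "x = ray (*s) (torus_point (\<eta> / 2) \<epsilon>)" by blast
    show "x \<in> {ray (*s) (torus_point A \<epsilon>) | A \<epsilon>. \<epsilon> ^ 21 = 1 \<and> u * (\<epsilon> ^ 7) * A\<^sup>2 + 2 * v * A = u + v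
      \<and> 2 * u * (\<epsilon> ^ 7) * A + v = (2 * u + 4 * v) * A\<^sup>2}"
      using x pow[OF e] torus_parameters_7[OF \<eta> uv e refl] by blast
  qed
  have inj: "inj_on (\<lambda>\<epsilon>. ray (*s) (torus_point (\<eta> / 2) \<epsilon>)) {\<epsilon>. \<epsilon> ^ 7 = 1}"
    by (rule inj_onI) (erule ray_torus_point_inj)
  have fin: "finite {\<epsilon> :: complex. \<epsilon> ^ 7 = 1}" by (rule finite_roots_unity) simp
  have card: "card {\<epsilon> :: complex. \<epsilon> ^ 7 = 1} = 7" by (rule card_roots_unity_eq) simp
  have "is_A1_singularity (fourier_form u v) (ray (*s) (torus_point (\<eta> / 2) \<epsilon>))" if e: "\<epsilon> ^ 7 = 1" for \<epsilon>
  proof (rule fourier_form_A1[OF pow[OF e]])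
    show "polar (fourier_form u v) (torus_point (\<eta> / 2) \<epsilon>) (torus_point (\<eta> / 2) \<epsilon>) h = 0" for h
      using torus_critical_normal_point[OF pow[OF e] torus_parameters_7[OF \<eta> uv e refl]]
        fourier_form_critical[of u v "torus_point (\<eta> / 2) \<epsilon>"] by simp
    show "\<beta> = \<alpha> \<and> \<gamma> = \<alpha> \<and> \<pi> = \<eta> / 2 * \<alpha> \<and> \<kappa> = \<eta> / 2 * \<alpha> \<and> \<rho> = \<eta> / 2 * \<alpha>"
      if "(u + v) * (\<gamma> + \<beta>) = 2 * u * \<epsilon> ^ 7 * (\<eta> / 2) * \<pi> + 2 * v * (\<rho> + \<eta> / 2 * \<alpha>)"
      "(u + v) * (\<alpha> + \<gamma>) = 2 * u * \<epsilon> ^ 7 * (\<eta> / 2) * \<kappa> + 2 * v * (\<pi> + \<eta> / 2 * \<beta>)"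
      "(u + v) * (\<alpha> + \<beta>) = 2 * u * \<epsilon> ^ 7 * (\<eta> / 2) * \<rho> + 2 * v * (\<kappa> + \<eta> / 2 * \<gamma>)"
      "(2 * u + 4 * v) * (\<eta> / 2) * (\<rho> + \<kappa>) = 2 * u * \<epsilon> ^ 7 * (\<pi> + \<eta> / 2 * \<alpha>) + 2 * v * \<beta>"
      "(2 * u + 4 * v) * (\<eta> / 2) * (\<rho> + \<pi>) = 2 * u * \<epsilon> ^ 7 * (\<kappa> + \<eta> / 2 * \<beta>) + 2 * v * \<gamma>"
      for \<alpha> \<beta> \<gamma> \<pi> \<kappa> \<rho>
      using hessian_kernel_7[OF \<eta> e _ refl _ _ that, of "v / 8"] uv v by (simp add: field_simps)
  qed
  then show "nodal_with 7 (fourier_form u v)"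
    unfolding nodal_with_def sing using fin card card_image[OF inj] by auto
qed

text \<open>Only the branch \<epsilon>^7 \<noteq> 1 survives, and each such \<epsilon> determines
  \<open>A\<close>. This leaves 21 - 7 = 14 roots of unity.\<close>

lemma fourier_form_singular_points_14:
  assumes \<eta>: "\<eta>\<^sup>2 + \<eta> + 2 = 0" and v: "v \<noteq> 0" and uv: "4 * u = - (\<eta> + 6) * v"
  shows "nodal_with 14 (fourier_form u v)" and "u \<noteq> 0"
proof -
  show u: "u \<noteq> 0"
  proof
    assume "u = 0"
    then have "(\<eta> + 6) * v = 0" using uv by algebra
    then have "\<eta> + 6 = 0" using v by simp
    then have "\<eta> = - 6" by (simp add: eq_neg_iff_add_eq_0)
    then show False using \<eta> by simp
  qed
  define E where "E = {\<epsilon> :: complex. \<epsilon> ^ 21 = 1} - {\<epsilon>. \<epsilon> ^ 7 = 1}"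
  define pt where "pt \<epsilon> = ray (*s) (torus_point ((\<epsilon> ^ 7)\<^sup>2 + (1 + \<eta>) / 2) \<epsilon>)" for \<epsilon>
  have w: "(\<epsilon> ^ 7)\<^sup>2 + \<epsilon> ^ 7 + 1 = 0" if "\<epsilon> \<in> E" for \<epsilon>
  proof -
    have "(\<epsilon> ^ 7) ^ 3 = 1" "\<epsilon> ^ 7 - 1 \<noteq> 0" using that by (auto simp: E_def simp flip: power_mult)
    moreover have "(\<epsilon> ^ 7 - 1) * ((\<epsilon> ^ 7)\<^sup>2 + \<epsilon> ^ 7 + 1) = (\<epsilon> ^ 7) ^ 3 - 1" by algebra
    ultimately show ?thesis by simp
  qed
  have sing: "singular_points (fourier_form u v) = pt ` E"
    unfolding fourier_form_singular_points[OF u v]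
  proof (intro equalityI subsetI)
    fix x assume "x \<in> {ray (*s) (torus_point A \<epsilon>) | A \<epsilon>. \<epsilon> ^ 21 = 1 \<and> u * (\<epsilon> ^ 7) * A\<^sup>2 + 2 * v * A = u + v
      \<and> 2 * u * (\<epsilon> ^ 7) * A + v = (2 * u + 4 * v) * A\<^sup>2}"
    then obtain A \<epsilon> where x: "x = ray (*s) (torus_point A \<epsilon>)" and e: "\<epsilon> ^ 21 = 1"
      "u * (\<epsilon> ^ 7) * A\<^sup>2 + 2 * v * A = u + v" "2 * u * (\<epsilon> ^ 7) * A + v = (2 * u + 4 * v) * A\<^sup>2" by blast
    have "(\<epsilon> ^ 7) ^ 3 = 1" using e(1) by (simp flip: power_mult)
    from torus_critical_parameters[OF u v this e(2,3)] show "x \<in> pt ` E"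
    proof (elim disjE conjE)
      assume "(2 * A)\<^sup>2 + 2 * A + 2 = 0" "8 * u = (7 * (2 * A) - 3) * v"
      from special_ratios_disjoint[OF this(1) \<eta> v this(2) uv] show ?thesis by blast
    next
      assume a: "\<epsilon> ^ 7 \<noteq> 1" "4 * u = - ((2 * (A - (\<epsilon> ^ 7)\<^sup>2) - 1) + 6) * v"
      have "v * (2 * (A - ((\<epsilon> ^ 7)\<^sup>2 + (1 + \<eta>) / 2))) = 0" using uv a(2) by algebra
      then have "A - ((\<epsilon> ^ 7)\<^sup>2 + (1 + \<eta>) / 2) = 0" using v by (metis mult_eq_0_iff zero_neq_numeral)
      then have "A = (\<epsilon> ^ 7)\<^sup>2 + (1 + \<eta>) / 2" by (simp only: right_minus_eq)
      then show ?thesis using a(1) e(1) x by (auto simp: pt_def E_def)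
    qed
  next
    fix x assume "x \<in> pt ` E"
    then obtain \<epsilon> where e: "\<epsilon> \<in> E" and x: "x = pt \<epsilon>" by blast
    then show "x \<in> {ray (*s) (torus_point A \<epsilon>) | A \<epsilon>. \<epsilon> ^ 21 = 1 \<and> u * (\<epsilon> ^ 7) * A\<^sup>2 + 2 * v * A = u + v
      \<and> 2 * u * (\<epsilon> ^ 7) * A + v = (2 * u + 4 * v) * A\<^sup>2}"
      using torus_parameters_14[OF \<eta> uv w[OF e] refl] unfolding pt_def E_def by blast
  qed
  have inj: "inj_on pt E"
    by (rule inj_onI) (unfold pt_def, erule ray_torus_point_inj)
  have fin: "finite {\<epsilon> :: complex. \<epsilon> ^ n = 1}" if "n \<ge> 1" for n by (rule finite_roots_unity[OF that])
  have "card E = card {\<epsilon> :: complex. \<epsilon> ^ 21 = 1} - card {\<epsilon> :: complex. \<epsilon> ^ 7 = 1}"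
    unfolding E_def
  proof (rule card_Diff_subset)
    have "\<epsilon> ^ 21 = 1" if "\<epsilon> ^ 7 = 1" for \<epsilon> :: complex
      using that power_mult[of \<epsilon> 7 3] by simp
    then show "{\<epsilon> :: complex. \<epsilon> ^ 7 = 1} \<subseteq> {\<epsilon>. \<epsilon> ^ 21 = 1}" by blast
  qed (rule fin, simp)
  also have "\<dots> = 14" using card_roots_unity_eq[of 21] card_roots_unity_eq[of 7] by simp
  finally have card: "card E = 14" .
  have "is_A1_singularity (fourier_form u v) (pt \<epsilon>)" if e: "\<epsilon> \<in> E" for \<epsilon>
    unfolding pt_def
  proof (rule fourier_form_A1)
    show e21: "\<epsilon> ^ 21 = 1" using e by (simp add: E_def)
    let ?A = "(\<epsilon> ^ 7)\<^sup>2 + (1 + \<eta>) / 2"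
    show "polar (fourier_form u v) (torus_point ?A \<epsilon>) (torus_point ?A \<epsilon>) h = 0" for h
      using torus_critical_normal_point[OF e21 torus_parameters_14[OF \<eta> uv w[OF e] refl]]
        fourier_form_critical[of u v "torus_point ?A \<epsilon>"] by simp
    have "u = - (\<eta> + 6) * (v / 4)" "v = 4 * (v / 4)" "v / 4 \<noteq> 0" using uv v by (simp_all add: field_simps)
    note K = hessian_kernel_14[OF \<eta> w[OF e] this(3) refl this(1,2)]
    show "\<beta> = \<alpha> \<and> \<gamma> = \<alpha> \<and> \<pi> = ?A * \<alpha> \<and> \<kappa> = ?A * \<alpha> \<and> \<rho> = ?A * \<alpha>"
      if "(u + v) * (\<gamma> + \<beta>) = 2 * u * \<epsilon> ^ 7 * ?A * \<pi> + 2 * v * (\<rho> + ?A * \<alpha>)"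
      "(u + v) * (\<alpha> + \<gamma>) = 2 * u * \<epsilon> ^ 7 * ?A * \<kappa> + 2 * v * (\<pi> + ?A * \<beta>)"
      "(u + v) * (\<alpha> + \<beta>) = 2 * u * \<epsilon> ^ 7 * ?A * \<rho> + 2 * v * (\<kappa> + ?A * \<gamma>)"
      "(2 * u + 4 * v) * ?A * (\<rho> + \<kappa>) = 2 * u * \<epsilon> ^ 7 * (\<pi> + ?A * \<alpha>) + 2 * v * \<beta>"
      "(2 * u + 4 * v) * ?A * (\<rho> + \<pi>) = 2 * u * \<epsilon> ^ 7 * (\<kappa> + ?A * \<beta>) + 2 * v * \<gamma>"
      for \<alpha> \<beta> \<gamma> \<pi> \<kappa> \<rho>
      by (rule K[OF that])
  qed
  then show "nodal_with 14 (fourier_form u v)"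
    unfolding nodal_with_def sing using fin[of 21] card card_image[OF inj] by (auto simp: E_def)
qed

lemma fourier_form_smooth:
  assumes u: "u \<noteq> 0" and v: "v \<noteq> 0"
    and generic: "\<And>\<eta>. \<eta>\<^sup>2 + \<eta> + 2 = 0 \<Longrightarrow> 8 * u \<noteq> (7 * \<eta> - 3) * v"
      "\<And>\<eta>. \<eta>\<^sup>2 + \<eta> + 2 = 0 \<Longrightarrow> 4 * u \<noteq> - (\<eta> + 6) * v"
  shows "singular_points (fourier_form u v) = {}"
proof -
  have False if "\<epsilon> ^ 21 = 1" "u * (\<epsilon> ^ 7) * A\<^sup>2 + 2 * v * A = u + v"
    "2 * u * (\<epsilon> ^ 7) * A + v = (2 * u + 4 * v) * A\<^sup>2" for A \<epsilon>
  proof -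
    have "(\<epsilon> ^ 7) ^ 3 = 1" using that(1) by (simp flip: power_mult)
    from torus_critical_parameters[OF u v this that(2,3)] show False using generic by blast
  qed
  then show ?thesis unfolding fourier_form_singular_points[OF u v] by blast
qed

section \<open>Projective lines\<close>

definition binary_form :: "nat \<Rightarrow> (nat \<Rightarrow> complex) \<Rightarrow> complex \<Rightarrow> complex \<Rightarrow> complex"
  where "binary_form d c a b = (\<Sum>i\<le>d. c i * a ^ i * b ^ (d - i))"

lemma binary_form_scale: "binary_form d c (k * a) (k * b) = k ^ d * binary_form d c a b"
  unfolding binary_form_def sum_distrib_left
proof (intro sum.cong refl)
  fix i assume "i \<in> {..d}"
  then have "k ^ d = k ^ i * k ^ (d - i)" by (simp flip: power_add)
  then show "c i * (k * a) ^ i * (k * b) ^ (d - i) = k ^ d * (c i * a ^ i * b ^ (d - i))"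
    by (simp add: power_mult_distrib mult_ac)
qed

lemma binary_form_mult: "\<exists>c''. \<forall>a b. binary_form d c a b * binary_form e c' a b = binary_form (d + e) c'' a b"
proof -
  define S where "S = {..d} \<times> {..e}"
  \<comment> \<open>The sum is restricted to \<open>S\<close> because coefficient functions may take
    nonzero values beyond the degree.\<close>
  define c'' where "c'' k = (\<Sum>(i, j)\<in>{x\<in>S. fst x + snd x = k}. c i * c' j)" for k
  have "binary_form d c a b * binary_form e c' a b = binary_form (d + e) c'' a b" for a b
  proof -
    let ?h = "\<lambda>(i, j). c i * c' j * a ^ (i + j) * b ^ (d + e - (i + j))"
    have "binary_form d c a b * binary_form e c' a b = (\<Sum>x\<in>S. ?h x)"
      unfolding binary_form_def sum_product sum.cartesian_product S_def
    proof (intro sum.cong refl)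
      fix x assume "x \<in> {..d} \<times> {..e}"
      then obtain i j where x: "x = (i, j)" "i \<le> d" "j \<le> e" by auto
      then have "d + e - (i + j) = (d - i) + (e - j)" by simp
      then have "b ^ (d + e - (i + j)) = b ^ (d - i) * b ^ (e - j)" by (simp only: power_add)
      then show "(case x of (i, j) \<Rightarrow> c i * a ^ i * b ^ (d - i) * (c' j * a ^ j * b ^ (e - j))) = ?h x"
        by (simp add: x power_add)
    qed
    also have "\<dots> = (\<Sum>k\<le>d + e. \<Sum>x\<in>{x\<in>S. fst x + snd x = k}. ?h x)"
      by (rule sum.group[symmetric]) (auto simp: S_def)
    also have "\<dots> = binary_form (d + e) c'' a b"
      unfolding binary_form_def c''_def sum_distrib_right by (intro sum.cong refl) auto
    finally show ?thesis .
  qed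
  then show ?thesis by blast
qed

lemma binary_form_add: "binary_form d c a b + binary_form d c' a b = binary_form d (\<lambda>i. c i + c' i) a b"
  by (simp add: binary_form_def distrib_right sum.distrib)

lemma binary_form_monomial:
  assumes "k \<le> d"
  shows "binary_form d (\<lambda>i. if i = k then 1 else 0) a b = a ^ k * b ^ (d - k)"
proof -
  have "binary_form d (\<lambda>i. if i = k then 1 else 0) a b = (\<Sum>i\<le>d. if i = k then a ^ i * b ^ (d - i) else 0)"
    unfolding binary_form_def by (intro sum.cong refl) auto
  then show ?thesis using assms by simp
qed

lemma binary_form_flip: "\<exists>c'. \<forall>a b. binary_form d c a (- b) = binary_form d c' a b"
proof -
  have "binary_form d c a (- b) = binary_form d (\<lambda>i. c i * (- 1) ^ (d - i)) a b" for a b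
    unfolding binary_form_def by (intro sum.cong refl) (simp add: power_minus[of b] mult_ac)
  then show ?thesis by blast
qed

text \<open>Averaging over the sign of \<open>b\<close> kills all odd exponents. This is the
  mechanism by which invariant forms descend to the quotient by the involution.\<close>

lemma binary_form_even:
  assumes "\<And>a b. binary_form (2 * d) c a (- b) = binary_form (2 * d) c a b"
  shows "\<exists>c'. \<forall>a b. binary_form (2 * d) c a b = binary_form d c' (a\<^sup>2) (b\<^sup>2)"
proof -
  let ?t = "\<lambda>a b i. c i * a ^ i * b ^ (2 * d - i)"
  have "binary_form (2 * d) c a b = binary_form d (\<lambda>i. c (2 * i)) (a\<^sup>2) (b\<^sup>2)" for a b
  proof -
    have "2 * binary_form (2 * d) c a b = binary_form (2 * d) c a b + binary_form (2 * d) c a (- b)"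
      using assms by simp
    also have "\<dots> = (\<Sum>i\<le>2 * d. if even i then 2 * ?t a b i else 0)"
      unfolding binary_form_def sum.distrib[symmetric]
    proof (intro sum.cong refl)
      fix i assume "i \<in> {..2 * d}"
      then have "even (2 * d - i) \<longleftrightarrow> even i" by auto
      then show "?t a b i + ?t a (- b) i = (if even i then 2 * ?t a b i else 0)"
        by (simp add: uminus_power_if)
    qed
    also have "\<dots> = (\<Sum>i\<in>{i\<in>{..2 * d}. even i}. 2 * ?t a b i)"
      by (rule sum.inter_filter[symmetric]) simp
    also have "\<dots> = (\<Sum>j\<le>d. 2 * ?t a b (2 * j))"
      by (rule sum.reindex_bij_witness[of _ "\<lambda>j. 2 * j" "\<lambda>i. i div 2"]) auto
    also have "\<dots> = 2 * binary_form d (\<lambda>i. c (2 * i)) (a\<^sup>2) (b\<^sup>2)"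
      unfolding binary_form_def sum_distrib_left
    proof (intro sum.cong refl)
      fix j assume "j \<in> {..d}"
      have "2 * d - 2 * j = 2 * (d - j)" by simp
      then show "2 * ?t a b (2 * j) = 2 * (c (2 * j) * (a\<^sup>2) ^ j * (b\<^sup>2) ^ (d - j))"
        by (simp only: power_mult mult.assoc)
    qed
    finally show ?thesis by simp
  qed
  then show ?thesis by blast
qed

text \<open>The map \<open>ph\<close> is a linear isomorphism from pairs of complex numbers onto
  \<open>V\<close>. Keeping it abstract lets one theory serve the target line on
  \<open>complex^2\<close> and the pencil of forms.\<close>

locale binary_space =
  fixes s :: "complex \<Rightarrow> 'v::ab_group_add \<Rightarrow> 'v" and V :: "'v set" and ph :: "complex \<Rightarrow> complex \<Rightarrow> 'v"
  assumes V_eq: "V = {ph a b | a b. True}"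
    and ph_add: "ph a b + ph a' b' = ph (a + a') (b + b')"
    and ph_scale: "s k (ph a b) = ph (k * a) (k * b)"
    and ph_inj: "ph a b = ph a' b' \<longleftrightarrow> a = a' \<and> b = b'"
begin

definition pt :: "complex \<Rightarrow> complex \<Rightarrow> 'v set"
  where "pt a b = ray s (ph a b)"

definition P :: "'v set set"
  where "P = {pt a b | a b. (a, b) \<noteq> (0, 0)}"

lemma ph_V: "ph a b \<in> V" using V_eq by blast

lemma ph_0: "ph 0 0 = 0" using ph_add[of 0 0 0 0] by simp

lemma ph_eq_0: "ph a b = 0 \<longleftrightarrow> a = 0 \<and> b = 0" using ph_inj[of a b 0 0] ph_0 by simp

lemma pt_scale: "k \<noteq> 0 \<Longrightarrow> pt (k * a) (k * b) = pt a b"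
proof -
  have sub: "pt (k * a) (k * b) \<subseteq> pt a b" for k a b
    unfolding pt_def ray_def ph_scale mult.assoc[symmetric] by blast
  assume k: "k \<noteq> 0"
  have "pt a b \<subseteq> pt (k * a) (k * b)" using sub[of "1 / k" "k * a" "k * b"] k by simp
  with sub[of k a b] show ?thesis by blast
qed

lemma pt_eq_iff:
  assumes "(a, b) \<noteq> (0, 0)" "(a', b') \<noteq> (0, 0)"
  shows "pt a b = pt a' b' \<longleftrightarrow> a * b' = a' * b"
proof
  assume eq: "pt a b = pt a' b'"
  have "ph a b \<in> pt a b" unfolding pt_def ray_def ph_scale by (rule range_eqI[of _ _ 1]) simp
  then obtain k where "ph a b = ph (k * a') (k * b')" unfolding eq by (auto simp: pt_def ray_def ph_scale)
  then show "a * b' = a' * b" by (simp add: ph_inj)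
next
  assume eq: "a * b' = a' * b"
  show "pt a b = pt a' b'"
  proof (cases "a = 0")
    case True
    then have "b \<noteq> 0" "a' = 0" "b' \<noteq> 0" using assms eq by auto
    then show ?thesis using pt_scale[of "b / b'" 0 b'] True by simp
  next
    case False
    then have "a' \<noteq> 0" using assms eq by auto
    moreover have "b = a / a' * b'" using eq \<open>a' \<noteq> 0\<close> by (simp add: field_simps)
    ultimately show ?thesis using pt_scale[of "a / a'" a' b'] False by simp
  qed
qed

lemma homogeneous_imp_binary_form:
  assumes "homogeneous_on s V d p"
  shows "\<exists>c. \<forall>a b. p (ph a b) = binary_form d c a b"
  using assms
proof induction
  case (const c)
  then show ?case by (intro exI[of _ "\<lambda>_. c"]) (simp add: binary_form_def)
next
  case (linear l)
  have lin: "l (ph a b) = a * l (ph 1 0) + b * l (ph 0 1)" for a b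
  proof -
    have "ph a b = s a (ph 1 0) + s b (ph 0 1)" by (simp add: ph_scale ph_add)
    moreover have "s k (ph x y) \<in> V" for k x y by (simp add: ph_scale ph_V)
    ultimately show ?thesis using linear ph_V unfolding linear_functional_on_def by metis
  qed
  have "binary_form 1 (\<lambda>i. if i = 0 then y else x) a b = a * x + b * y" for x y a b
    by (simp add: binary_form_def)
  then show ?case using lin by metis
next
  case (add d p q)
  then obtain c c' where "\<forall>a b. p (ph a b) = binary_form d c a b" "\<forall>a b. q (ph a b) = binary_form d c' a b"
    by blast
  then have "\<forall>a b. p (ph a b) + q (ph a b) = binary_form d (\<lambda>i. c i + c' i) a b"
    by (simp add: binary_form_add)
  then show ?case by blast
next
  case (mult d p e q)
  then obtain c c' where "\<forall>a b. p (ph a b) = binary_form d c a b" "\<forall>a b. q (ph a b) = binary_form e c' a b"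
    by blast
  then show ?case using binary_form_mult[of d c e c'] by simp
qed

definition fst_coord :: "'v \<Rightarrow> complex"
  where "fst_coord v = (THE a. \<exists>b. v = ph a b)"

definition snd_coord :: "'v \<Rightarrow> complex"
  where "snd_coord v = (THE b. \<exists>a. v = ph a b)"

lemma coords [simp]: "fst_coord (ph a b) = a" "snd_coord (ph a b) = b"
  by (simp_all add: fst_coord_def snd_coord_def ph_inj)

lemma binary_form_homogeneous:
  "homogeneous_on s V d (\<lambda>v. binary_form d c (fst_coord v) (snd_coord v))"
proof -
  have fst: "homogeneous_on s V 1 fst_coord"
    by (rule homogeneous_on.linear) (auto simp: linear_functional_on_def V_eq ph_add ph_scale)
  have snd: "homogeneous_on s V 1 snd_coord"
    by (rule homogeneous_on.linear) (auto simp: linear_functional_on_def V_eq ph_add ph_scale)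
  have pow: "homogeneous_on s V n (\<lambda>v. f v ^ n)" if "homogeneous_on s V 1 f" for f n
  proof (induction n)
    case 0
    then show ?case using homogeneous_on.const[of s V 1] by simp
  next
    case (Suc n)
    then show ?case using homogeneous_on.mult[OF that Suc] by simp
  qed
  have monomial: "homogeneous_on s V d (\<lambda>v. c i * fst_coord v ^ i * snd_coord v ^ (d - i))" if "i \<le> d" for i
  proof -
    have "homogeneous_on s V (0 + i + (d - i)) (\<lambda>v. c i * fst_coord v ^ i * snd_coord v ^ (d - i))"
      by (intro homogeneous_on.mult homogeneous_on.const pow fst snd)
    then show ?thesis using that by simp
  qed
  have "homogeneous_on s V d (\<lambda>v. \<Sum>i\<in>A. c i * fst_coord v ^ i * snd_coord v ^ (d - i))"
    if "finite A" "A \<subseteq> {..d}" for A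
    using that
  proof induction
    case empty
    have "homogeneous_on s V (0 + d) (\<lambda>v. 0 * fst_coord v ^ d)"
      by (intro homogeneous_on.mult homogeneous_on.const pow fst snd)
    then show ?case by simp
  next
    case (insert i A)
    then have "homogeneous_on s V d (\<lambda>v. c i * fst_coord v ^ i * snd_coord v ^ (d - i)
        + (\<Sum>i\<in>A. c i * fst_coord v ^ i * snd_coord v ^ (d - i)))"
      by (intro homogeneous_on.add monomial) auto
    then show ?case using insert by simp
  qed
  then show ?thesis unfolding binary_form_def by simp
qed

lemma binary_form_pt:
  assumes "pt a b = pt a' b'" "(a, b) \<noteq> (0, 0)" "(a', b') \<noteq> (0, 0)"
  obtains k where "k \<noteq> 0" "a' = k * a" "b' = k * b"
proof (cases "a = 0")
  case True
  then have "a' = 0" "b \<noteq> 0" "b' \<noteq> 0" using assms pt_eq_iff[OF assms(2,3)] by auto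
  then show thesis using that[of "b' / b"] True by simp
next
  case False
  then have "a' \<noteq> 0" using assms pt_eq_iff[OF assms(2,3)] by auto
  then show thesis using that[of "a' / a"] False assms pt_eq_iff[OF assms(2,3)] by (simp add: field_simps)
qed

lemma pt_in_P: "(a, b) \<noteq> (0, 0) \<Longrightarrow> pt a b \<in> P" by (auto simp: P_def)

text \<open>Setting the second coordinate to 1 turns zeros of the form into roots of a nonzero
  polynomial; only the point \<open>pt 1 0\<close> escapes this chart.\<close>

lemma finite_zero_points:
  assumes "binary_form d c a0 b0 \<noteq> 0"
  shows "finite {pt a b | a b. (a, b) \<noteq> (0, 0) \<and> binary_form d c a b = 0}"
proof -
  obtain k where k: "k \<le> d" "c k \<noteq> 0"
    using assms unfolding binary_form_def by (metis (no_types, lifting) atMost_iff mult_zero_left sum.neutral)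
  have fin: "finite {z. (\<Sum>i\<le>d. c i * z ^ i) = 0}" using k by (subst Poly_Roots.polyfun_finite_roots) blast
  have "{pt a b | a b. (a, b) \<noteq> (0, 0) \<and> binary_form d c a b = 0}
    \<subseteq> insert (pt 1 0) ((\<lambda>z. pt z 1) ` {z. (\<Sum>i\<le>d. c i * z ^ i) = 0})"
  proof
    fix x assume "x \<in> {pt a b | a b. (a, b) \<noteq> (0, 0) \<and> binary_form d c a b = 0}"
    then obtain a b where x: "x = pt a b" and ab: "(a, b) \<noteq> (0, 0)" and 0: "binary_form d c a b = 0" by blast
    show "x \<in> insert (pt 1 0) ((\<lambda>z. pt z 1) ` {z. (\<Sum>i\<le>d. c i * z ^ i) = 0})"
    proof (cases "b = 0")
      case True
      then have "pt a b = pt 1 0" using ab by (subst pt_eq_iff) auto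
      then show ?thesis using x by simp
    next
      case False
      have eq: "pt a b = pt (a / b) 1" using False by (subst pt_eq_iff) auto
      have "0 = b ^ d * binary_form d c (a / b) 1"
        using binary_form_scale[of d c b "a / b" 1] 0 False by simp
      then have "binary_form d c (a / b) 1 = 0" using False by simp
      then have "(\<Sum>i\<le>d. c i * (a / b) ^ i) = 0" by (simp add: binary_form_def)
      then show ?thesis using x eq by blast
    qed
  qed
  then show ?thesis using fin finite_subset by blast
qed

lemma principal_open_binary_form:
  assumes "\<forall>a b. p (ph a b) = binary_form d c a b"
  shows "principal_open s V p = {pt a b | a b. (a, b) \<noteq> (0, 0) \<and> binary_form d c a b \<noteq> 0}"
proof (intro equalityI subsetI)
  fix x assume "x \<in> principal_open s V p"
  then obtain v where v: "x = ray s v" "v \<in> V" "v \<noteq> 0" "p v \<noteq> 0" by (auto simp: principal_open_def)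
  then obtain a b where ab: "v = ph a b" using V_eq by blast
  then have "(a, b) \<noteq> (0, 0)" using v(3) ph_0 by auto
  then show "x \<in> {pt a b | a b. (a, b) \<noteq> (0, 0) \<and> binary_form d c a b \<noteq> 0}"
    using v(1,4) assms by (auto simp: ab pt_def)
next
  fix x assume "x \<in> {pt a b | a b. (a, b) \<noteq> (0, 0) \<and> binary_form d c a b \<noteq> 0}"
  then obtain a b where ab: "x = ray s (ph a b)" "(a, b) \<noteq> (0, 0)" "binary_form d c a b \<noteq> 0"
    unfolding pt_def by blast
  have "ph a b \<noteq> 0" using ab(2) by (simp add: ph_eq_0)
  moreover have "p (ph a b) \<noteq> 0" using ab(3) assms by simp
  ultimately show "x \<in> principal_open s V p" unfolding principal_open_def using ab(1) ph_V by blast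
qed

text \<open>The Zariski topology on a projective line is the cofinite one: a nonempty principal open
  set omits only the finitely many zeros of a form, and the complement of a single point is
  principal, by a linear form.\<close>

lemma openin_proj_topology:
  "openin (proj_topology s V) U \<longleftrightarrow> U = {} \<or> U \<subseteq> P \<and> finite (P - U)"
proof
  assume "openin (proj_topology s V) U"
  then have "generate_topology_on {principal_open s V p | p d. homogeneous_on s V d p} U"
    by (simp add: proj_topology_def openin_topology_generated_by_iff)
  then show "U = {} \<or> U \<subseteq> P \<and> finite (P - U)"
  proof induction
    case Empty
    then show ?case by simp
  next
    case (Int a b)
    then show ?case by (auto simp: Diff_Int)
  next
    case (UN K)
    show ?case
    proof (cases "\<exists>k\<in>K. k \<noteq> {}")
      case True
      then obtain k where k: "k \<in> K" "k \<noteq> {}" by blast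
      then have "finite (P - k)" using UN by blast
      then have "finite (P - \<Union>K)" by (rule rev_finite_subset) (use k in blast)
      then show ?thesis using UN by blast
    next
      case False
      then show ?thesis by auto
    qed
  next
    case (Basis U)
    then obtain p d where p: "U = principal_open s V p" "homogeneous_on s V d p" by blast
    obtain c where c: "\<forall>a b. p (ph a b) = binary_form d c a b"
      using homogeneous_imp_binary_form[OF p(2)] by blast
    note U = p(1)[unfolded principal_open_binary_form[OF c]]
    show ?case
    proof (cases "U = {}")
      case False
      then obtain a b where "binary_form d c a b \<noteq> 0" using U by blast
      note fin = finite_zero_points[OF this]
      have "P - U \<subseteq> {pt a b | a b. (a, b) \<noteq> (0, 0) \<and> binary_form d c a b = 0}"
        unfolding P_def U by blast
      then have "finite (P - U)" using fin finite_subset by blast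
      moreover have "U \<subseteq> P" unfolding P_def U by blast
      ultimately show ?thesis by blast
    qed simp
  qed
next
  have basic: "openin (proj_topology s V) {pt a b | a b. (a, b) \<noteq> (0, 0) \<and> binary_form d c a b \<noteq> 0}" for d c
  proof -
    have "principal_open s V (\<lambda>v. binary_form d c (fst_coord v) (snd_coord v))
        = {pt a b | a b. (a, b) \<noteq> (0, 0) \<and> binary_form d c a b \<noteq> 0}"
      by (rule principal_open_binary_form) simp
    moreover have "openin (proj_topology s V) (principal_open s V (\<lambda>v. binary_form d c (fst_coord v) (snd_coord v)))"
      unfolding proj_topology_def openin_topology_generated_by_iff
      using binary_form_homogeneous by (intro generate_topology_on.Basis) blast
    ultimately show ?thesis by simp
  qed
  have "{pt a b | a b. (a, b) \<noteq> (0, 0) \<and> binary_form 0 (\<lambda>_. 1) a b \<noteq> 0} = P"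
    unfolding P_def by (simp add: binary_form_def)
  then have P: "openin (proj_topology s V) P" using basic[of 0 "\<lambda>_. 1"] by simp
  have compl: "openin (proj_topology s V) (P - {x})" if x: "x \<in> P" for x
  proof -
    obtain a0 b0 where ab0: "x = pt a0 b0" "(a0, b0) \<noteq> (0, 0)" using x by (auto simp: P_def)
    \<comment> \<open>Coefficients of a b0 - a0 b, the linear form vanishing exactly at
      \<open>x\<close>.\<close>
    define c where "c i = (if i = 0 then - a0 else b0)" for i :: nat
    have c: "binary_form 1 c a b = a * b0 - a0 * b" for a b
      by (simp add: binary_form_def c_def)
    have "{pt a b | a b. (a, b) \<noteq> (0, 0) \<and> binary_form 1 c a b \<noteq> 0} = P - {x}"
      unfolding c P_def ab0 using pt_eq_iff[OF _ ab0(2)] by fastforce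
    then show ?thesis using basic[of 1 c] by simp
  qed
  assume "U = {} \<or> U \<subseteq> P \<and> finite (P - U)"
  then show "openin (proj_topology s V) U"
  proof
    assume U: "U \<subseteq> P \<and> finite (P - U)"
    have "openin (proj_topology s V) (P - F)" if "finite F" "F \<subseteq> P" for F
      using that
    proof induction
      case empty
      then show ?case using P by simp
    next
      case (insert x F)
      have "P - insert x F = (P - F) \<inter> (P - {x})" by blast
      then show ?case using insert compl by (simp add: openin_Int)
    qed
    from this[of "P - U"] U show ?thesis by (simp add: double_diff)
  qed simp
qed

lemma topspace_proj_topology [simp]: "topspace (proj_topology s V) = P"
proof
  show "topspace (proj_topology s V) \<subseteq> P"
    using openin_topspace[of "proj_topology s V"] unfolding openin_proj_topology by auto
  have "openin (proj_topology s V) P" unfolding openin_proj_topology by simp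
  then show "P \<subseteq> topspace (proj_topology s V)" by (rule openin_subset)
qed

lemma infinite_P: "infinite P"
proof
  assume "finite P"
  moreover have "range (\<lambda>z. pt z 1) \<subseteq> P" using pt_in_P by auto
  ultimately have "finite (range (\<lambda>z. pt z 1))" by (rule rev_finite_subset)
  moreover have "inj (\<lambda>z. pt z 1)"
    by (rule injI) (simp add: pt_eq_iff)
  ultimately have "finite (UNIV :: complex set)" by (rule finite_imageD)
  then show False by (simp add: infinite_UNIV_char_0)
qed

text \<open>Since open sets are cofinite, a neighbourhood of \<open>x\<close> inside
  \<open>U\<close> can be traded for a finite exceptional set \<open>F\<close> avoiding
  \<open>x\<close>.\<close>

lemma regular_proj_space:
  assumes U: "openin (proj_topology s V) U"
  shows "\<phi> \<in> regular (proj_space s V) U \<longleftrightarrow>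
    (\<forall>x\<in>U. \<exists>d c e F. finite F \<and> x \<notin> F \<and> (\<forall>a b. (a, b) \<noteq> (0, 0) \<and> pt a b \<in> U - F \<longrightarrow>
      binary_form d e a b \<noteq> 0 \<and> \<phi> (pt a b) = binary_form d c a b / binary_form d e a b))" (is "_ \<longleftrightarrow> ?R")
proof
  assume "\<phi> \<in> regular (proj_space s V) U"
  then have *: "\<forall>x\<in>U. \<exists>W d p q. openin (proj_topology s V) W \<and> x \<in> W \<and> W \<subseteq> U \<and>
       homogeneous_on s V d p \<and> homogeneous_on s V d q \<and>
       (\<forall>v\<in>V. v \<noteq> 0 \<and> ray s v \<in> W \<longrightarrow> q v \<noteq> 0 \<and> \<phi> (ray s v) = p v / q v)"
    by (simp add: proj_space_def)
  show ?R
  proof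
    fix x assume "x \<in> U"
    with * obtain W d p q where W: "openin (proj_topology s V) W" "x \<in> W" "W \<subseteq> U"
       "homogeneous_on s V d p" "homogeneous_on s V d q"
       and pq: "\<And>v. v\<in>V \<Longrightarrow> v \<noteq> 0 \<and> ray s v \<in> W \<Longrightarrow> q v \<noteq> 0 \<and> \<phi> (ray s v) = p v / q v" by metis
    obtain c where c: "\<forall>a b. p (ph a b) = binary_form d c a b"
      using homogeneous_imp_binary_form[OF W(4)] by blast
    obtain e where e: "\<forall>a b. q (ph a b) = binary_form d e a b"
      using homogeneous_imp_binary_form[OF W(5)] by blast
    have "finite (P - W)" "U \<subseteq> P" using W(1,2) U openin_subset[OF U] unfolding openin_proj_topology by auto
    moreover have "binary_form d e a b \<noteq> 0 \<and> \<phi> (pt a b) = binary_form d c a b / binary_form d e a b"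
      if "(a, b) \<noteq> (0, 0)" "pt a b \<in> U - (P - W)" for a b
      using pq[OF ph_V, of a b] that c e ph_eq_0 \<open>U \<subseteq> P\<close> by (auto simp: pt_def)
    ultimately show "\<exists>d c e F. finite F \<and> x \<notin> F \<and> (\<forall>a b. (a, b) \<noteq> (0, 0) \<and> pt a b \<in> U - F \<longrightarrow>
      binary_form d e a b \<noteq> 0 \<and> \<phi> (pt a b) = binary_form d c a b / binary_form d e a b)"
      using W(2) by (intro exI[of _ d] exI[of _ c] exI[of _ e] exI[of _ "P - W"]) auto
  qed
next
  assume R: ?R
  show "\<phi> \<in> regular (proj_space s V) U"
    unfolding proj_space_def fun_space.simps mem_Collect_eq
  proof
    fix x assume x: "x \<in> U"
    with R obtain d c e F where F: "finite F" "x \<notin> F" and ce: "\<And>a b. (a, b) \<noteq> (0, 0) \<and> pt a b \<in> U - F \<Longrightarrow>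
      binary_form d e a b \<noteq> 0 \<and> \<phi> (pt a b) = binary_form d c a b / binary_form d e a b" by metis
    have "finite (P - U)" "U \<subseteq> P" using U x unfolding openin_proj_topology by auto
    then have "openin (proj_topology s V) (U - F)"
      unfolding openin_proj_topology using F(1) by (auto simp: Diff_Diff_Int finite_subset intro: rev_finite_subset[of "(P - U) \<union> F"])
    moreover have "binary_form d e (fst_coord v) (snd_coord v) \<noteq> 0 \<and> \<phi> (ray s v) =
        binary_form d c (fst_coord v) (snd_coord v) / binary_form d e (fst_coord v) (snd_coord v)"
      if "v \<in> V" "v \<noteq> 0 \<and> ray s v \<in> U - F" for v
    proof -
      obtain a b where v: "v = ph a b" using \<open>v \<in> V\<close> V_eq by blast
      then show ?thesis using ce[of a b] that(2) ph_0 by (auto simp: pt_def)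
    qed
    ultimately show "\<exists>W d p q. openin (proj_topology s V) W \<and> x \<in> W \<and> W \<subseteq> U \<and>
       homogeneous_on s V d p \<and> homogeneous_on s V d q \<and>
       (\<forall>v\<in>V. v \<noteq> 0 \<and> ray s v \<in> W \<longrightarrow> q v \<noteq> 0 \<and> \<phi> (ray s v) = p v / q v)"
      using x F(2) binary_form_homogeneous
      by (intro exI[of _ "U - F"] exI[of _ d] exI[of _ "\<lambda>v. binary_form d c (fst_coord v) (snd_coord v)"]
          exI[of _ "\<lambda>v. binary_form d e (fst_coord v) (snd_coord v)"]) auto
  qed
qed

end

definition is_binary_form :: "nat \<Rightarrow> (complex \<Rightarrow> complex \<Rightarrow> complex) \<Rightarrow> bool"
  where "is_binary_form d p \<longleftrightarrow> (\<exists>c. \<forall>a b. p a b = binary_form d c a b)"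

lemma is_binary_form_binary_form: "is_binary_form d (binary_form d c)"
  unfolding is_binary_form_def by (rule exI[of _ c]) simp

lemma is_binary_formI: "(\<And>a b. p a b = binary_form d c a b) \<Longrightarrow> is_binary_form d p"
  unfolding is_binary_form_def by (rule exI[of _ c]) simp

lemma is_binary_formE:
  assumes "is_binary_form d p"
  obtains c where "p = binary_form d c"
  using assms unfolding is_binary_form_def fun_eq_iff by blast

lemma is_binary_form_add:
  assumes "is_binary_form d p" "is_binary_form d q" shows "is_binary_form d (\<lambda>a b. p a b + q a b)"
proof -
  obtain c c' where "p = binary_form d c" "q = binary_form d c'" using assms by (elim is_binary_formE)
  then show ?thesis using binary_form_add[of d c _ _ c'] is_binary_formI by auto
qed

lemma is_binary_form_mult:
  assumes "is_binary_form d p" "is_binary_form e q" shows "is_binary_form (d + e) (\<lambda>a b. p a b * q a b)"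
proof -
  obtain c c' where "p = binary_form d c" "q = binary_form e c'" using assms by (elim is_binary_formE)
  then show ?thesis using binary_form_mult[of d c e c'] is_binary_formI by auto
qed

lemma is_binary_form_flip:
  assumes "is_binary_form d p" shows "is_binary_form d (\<lambda>a b. p a (- b))"
proof -
  obtain c where "p = binary_form d c" using assms by (elim is_binary_formE)
  then show ?thesis using binary_form_flip[of d c] is_binary_formI by auto
qed

lemma is_binary_form_const: "is_binary_form 0 (\<lambda>a b. k)"
  unfolding is_binary_form_def by (intro exI[of _ "\<lambda>_. k"]) (simp add: binary_form_def)

lemma is_binary_form_scale:
  assumes "is_binary_form d p" shows "is_binary_form d (\<lambda>a b. k * p a b)"
  using is_binary_form_mult[OF is_binary_form_const assms] by simp

lemma is_binary_form_even:
  assumes "is_binary_form (2 * d) p" "\<And>a b. p a (- b) = p a b"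
  obtains q where "is_binary_form d q" "\<And>a b. p a b = q (a\<^sup>2) (b\<^sup>2)"
proof -
  obtain c where c: "\<forall>a b. p a b = binary_form (2 * d) c a b" using assms(1) is_binary_form_def by blast
  obtain c' where "\<forall>a b. binary_form (2 * d) c a b = binary_form d c' (a\<^sup>2) (b\<^sup>2)"
    using binary_form_even[of d c] assms(2) c by metis
  then show thesis using that[of "binary_form d c'"] is_binary_form_binary_form c by metis
qed

lemma is_binary_form_square:
  assumes "is_binary_form d p"
  shows "is_binary_form (2 * d) (\<lambda>a b. p (a\<^sup>2) (b\<^sup>2))"
proof -
  obtain c where c: "\<And>a b. p a b = binary_form d c a b" using assms is_binary_form_def by blast
  have "binary_form d c (a\<^sup>2) (b\<^sup>2) = binary_form (2 * d) (\<lambda>i. if even i then c (i div 2) else 0) a b" for a b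
  proof -
    have "binary_form (2 * d) (\<lambda>i. if even i then c (i div 2) else 0) a b
        = (\<Sum>i\<le>2 * d. if even i then c (i div 2) * a ^ i * b ^ (2 * d - i) else 0)"
      unfolding binary_form_def by (intro sum.cong refl) auto
    also have "\<dots> = (\<Sum>i\<in>{i\<in>{..2 * d}. even i}. c (i div 2) * a ^ i * b ^ (2 * d - i))"
      by (rule sum.inter_filter[symmetric]) simp
    also have "\<dots> = binary_form d c (a\<^sup>2) (b\<^sup>2)"
      unfolding binary_form_def
    proof (rule sum.reindex_bij_witness[of _ "\<lambda>j. 2 * j" "\<lambda>i. i div 2"])
      fix i assume "i \<in> {i \<in> {..2 * d}. even i}"
      then obtain j where j: "i = 2 * j" "j \<le> d" by (auto elim: evenE)
      have "2 * d - 2 * j = 2 * (d - j)" by simp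
      then show "c (i div 2) * (a\<^sup>2) ^ (i div 2) * (b\<^sup>2) ^ (d - i div 2) = c (i div 2) * a ^ i * b ^ (2 * d - i)"
        unfolding j by (simp only: power_mult nonzero_mult_div_cancel_left[OF zero_neq_numeral[symmetric]])
    qed auto
    finally show ?thesis by simp
  qed
  then show ?thesis unfolding is_binary_form_def c by blast
qed

definition cofinite_topology :: "'a topology \<Rightarrow> bool"
  where "cofinite_topology T \<longleftrightarrow>
    (\<forall>U. openin T U \<longleftrightarrow> U = {} \<or> U \<subseteq> topspace T \<and> finite (topspace T - U))"

text \<open>Images and preimages under a bijection preserve finiteness of complements, so nothing
  about the map beyond bijectivity has to be known.\<close>

lemma cofinite_topology_homeomorphic:
  assumes X: "cofinite_topology X" and Y: "cofinite_topology Y"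
    and h: "bij_betw h (topspace X) (topspace Y)"
  shows "homeomorphic_map X Y h"
proof (rule bijective_open_imp_homeomorphic_map)
  have inj: "inj_on h (topspace X)" and img: "h ` topspace X = topspace Y"
    using h by (auto simp: bij_betw_def)
  then show "h ` topspace X = topspace Y" "inj_on h (topspace X)" by auto
  show "continuous_map X Y h"
    unfolding continuous_map_def
  proof (intro conjI allI impI)
    show "h \<in> topspace X \<rightarrow> topspace Y" using img by auto
    fix U assume "openin Y U"
    then have U: "U = {} \<or> finite (topspace Y - U)" using Y unfolding cofinite_topology_def by blast
    show "openin X {x \<in> topspace X. h x \<in> U}"
    proof (cases "U = {}")
      case False
      have "h ` (topspace X - {x \<in> topspace X. h x \<in> U}) \<subseteq> topspace Y - U" using img by auto
      then have "finite (h ` (topspace X - {x \<in> topspace X. h x \<in> U}))"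
        using U False finite_subset by blast
      then have "finite (topspace X - {x \<in> topspace X. h x \<in> U})"
        by (rule finite_imageD) (rule inj_on_subset[OF inj], blast)
      then show ?thesis using X unfolding cofinite_topology_def by blast
    qed simp
  qed
  show "open_map X Y h"
    unfolding open_map_def
  proof (intro allI impI)
    fix U assume "openin X U"
    then have U: "U = {} \<or> U \<subseteq> topspace X \<and> finite (topspace X - U)" using X unfolding cofinite_topology_def by blast
    show "openin Y (h ` U)"
    proof (cases "U = {}")
      case False
      then have "topspace Y - h ` U = h ` (topspace X - U)"
        using inj_on_image_set_diff[OF inj, of "topspace X" U] U img by auto
      then have "finite (topspace Y - h ` U)" using U False by simp
      then show ?thesis using Y U False img unfolding cofinite_topology_def by blast
    qed simp
  qed
qed

lemma topspace_quotient_topology [simp]: "topspace (quotient_topology T \<pi>) = \<pi> ` topspace T"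
proof
  show "topspace (quotient_topology T \<pi>) \<subseteq> \<pi> ` topspace T"
    using openin_topspace[of "quotient_topology T \<pi>"] unfolding openin_quotient_topology by blast
  have "{x \<in> topspace T. \<pi> x \<in> \<pi> ` topspace T} = topspace T" by blast
  then have "openin (quotient_topology T \<pi>) (\<pi> ` topspace T)"
    unfolding openin_quotient_topology by simp
  then show "\<pi> ` topspace T \<subseteq> topspace (quotient_topology T \<pi>)" by (rule openin_subset)
qed

text \<open>With finite fibres, a subset of the quotient has finite complement exactly when its
  preimage does.\<close>

lemma cofinite_quotient_topology:
  assumes T: "cofinite_topology T" and fin: "\<And>y. finite {x \<in> topspace T. \<pi> x = y}"
  shows "cofinite_topology (quotient_topology T \<pi>)"
  unfolding cofinite_topology_def
proof (intro allI)
  fix U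
  let ?Q = "\<pi> ` topspace T" and ?W = "{x \<in> topspace T. \<pi> x \<in> U}"
  have fin_iff: "finite (topspace T - ?W) \<longleftrightarrow> finite (?Q - U)"
  proof
    assume "finite (topspace T - ?W)"
    then have "finite (\<pi> ` (topspace T - ?W))" by simp
    moreover have "?Q - U \<subseteq> \<pi> ` (topspace T - ?W)" by blast
    ultimately show "finite (?Q - U)" using finite_subset by blast
  next
    assume "finite (?Q - U)"
    then have "finite (\<Union>y\<in>?Q - U. {x \<in> topspace T. \<pi> x = y})" using fin by blast
    moreover have "topspace T - ?W \<subseteq> (\<Union>y\<in>?Q - U. {x \<in> topspace T. \<pi> x = y})" by blast
    ultimately show "finite (topspace T - ?W)" using finite_subset by blast
  qed
  have openin_iff: "openin T ?W \<longleftrightarrow> ?W = {} \<or> ?W \<subseteq> topspace T \<and> finite (topspace T - ?W)"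
    using T unfolding cofinite_topology_def by (rule spec)
  show "openin (quotient_topology T \<pi>) U \<longleftrightarrow> U = {} \<or>
      U \<subseteq> topspace (quotient_topology T \<pi>) \<and> finite (topspace (quotient_topology T \<pi>) - U)"
  proof (cases "U \<subseteq> ?Q")
    case True
    then have "?W = {} \<longleftrightarrow> U = {}" by blast
    then show ?thesis using True fin_iff openin_iff
      unfolding openin_quotient_topology topspace_quotient_topology by auto
  next
    case False
    then show ?thesis unfolding openin_quotient_topology topspace_quotient_topology by auto
  qed
qed

section \<open>Regular functions on a projective line as quotients of binary forms\<close>

context binary_space
begin

lemma cofinite_proj_topology: "cofinite_topology (proj_topology s V)"
  unfolding cofinite_topology_def openin_proj_topology by simp

text \<open>An identity principle: otherwise the line would be covered by the complement of
  \<open>U\<close>, the set \<open>F\<close> and the zeros of the form, all of which are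
  finite.\<close>

lemma binary_form_eq_0:
  assumes p: "is_binary_form d p" and U: "openin (proj_topology s V) U" "U \<noteq> {}" and F: "finite F"
    and 0: "\<And>a b. (a, b) \<noteq> (0, 0) \<Longrightarrow> pt a b \<in> U - F \<Longrightarrow> p a b = 0"
  shows "p a b = 0"
proof (rule ccontr)
  obtain c where c: "\<And>a b. p a b = binary_form d c a b" using p is_binary_form_def by blast
  assume "p a b \<noteq> 0"
  then have fin: "finite {pt a b | a b. (a, b) \<noteq> (0, 0) \<and> p a b = 0}"
    unfolding c by (rule finite_zero_points)
  have "finite (P - U)" using U unfolding openin_proj_topology by blast
  moreover have "P \<subseteq> (P - U) \<union> F \<union> {pt a b | a b. (a, b) \<noteq> (0, 0) \<and> p a b = 0}"
    using 0 unfolding P_def by blast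
  ultimately have "finite P" using fin F finite_subset by blast
  then show False using infinite_P by blast
qed

lemma finite_zeros:
  assumes p: "is_binary_form d p" and nz: "p a0 b0 \<noteq> 0"
  shows "finite {pt a b | a b. (a, b) \<noteq> (0, 0) \<and> p a b = 0}"
proof -
  obtain c where c: "\<And>a b. p a b = binary_form d c a b" using p is_binary_form_def by blast
  show ?thesis using nz unfolding c by (rule finite_zero_points)
qed

definition quotient_of_forms :: "('v set \<Rightarrow> complex) \<Rightarrow> 'v set set \<Rightarrow> 'v set \<Rightarrow> nat \<Rightarrow> (complex \<Rightarrow> complex \<Rightarrow> complex)
    \<Rightarrow> (complex \<Rightarrow> complex \<Rightarrow> complex) \<Rightarrow> 'v set set \<Rightarrow> bool"
  where "quotient_of_forms \<phi> U x d p q F \<longleftrightarrow> is_binary_form d p \<and> is_binary_form d q \<and> finite F \<and> x \<notin> F \<and>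
    (\<forall>a b. (a, b) \<noteq> (0, 0) \<and> pt a b \<in> U - F \<longrightarrow> q a b \<noteq> 0 \<and> \<phi> (pt a b) = p a b / q a b)"

lemma regular_iff_quotient_of_forms:
  assumes "openin (proj_topology s V) U"
  shows "\<phi> \<in> regular (proj_space s V) U \<longleftrightarrow> (\<forall>x\<in>U. \<exists>d p q F. quotient_of_forms \<phi> U x d p q F)"
proof -
  have "(\<exists>d p q F. quotient_of_forms \<phi> U x d p q F) \<longleftrightarrow> (\<exists>d c e F. finite F \<and> x \<notin> F \<and> (\<forall>a b. (a, b) \<noteq> (0, 0) \<and> pt a b \<in> U - F \<longrightarrow>
      binary_form d e a b \<noteq> 0 \<and> \<phi> (pt a b) = binary_form d c a b / binary_form d e a b))" (is "?A \<longleftrightarrow> ?B") for x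
  proof
    assume ?A
    then obtain d p q F where *: "quotient_of_forms \<phi> U x d p q F" by blast
    then obtain c e where "\<And>a b. p a b = binary_form d c a b" "\<And>a b. q a b = binary_form d e a b"
      unfolding quotient_of_forms_def is_binary_form_def by blast
    with * show ?B unfolding quotient_of_forms_def by metis
  next
    assume ?B
    then obtain d c e F where "finite F \<and> x \<notin> F \<and> (\<forall>a b. (a, b) \<noteq> (0, 0) \<and> pt a b \<in> U - F \<longrightarrow>
      binary_form d e a b \<noteq> 0 \<and> \<phi> (pt a b) = binary_form d c a b / binary_form d e a b)" by blast
    then have "quotient_of_forms \<phi> U x d (binary_form d c) (binary_form d e) F"
      unfolding quotient_of_forms_def using is_binary_form_binary_form by blast
    then show ?A by blast
  qed
  then show ?thesis unfolding regular_proj_space[OF assms] by simp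
qed

lemma regular_cong:
  assumes "openin (proj_topology s V) U" "\<And>x. x \<in> U \<Longrightarrow> \<phi> x = \<psi> x"
  shows "\<phi> \<in> regular (proj_space s V) U \<longleftrightarrow> \<psi> \<in> regular (proj_space s V) U"
proof -
  have "quotient_of_forms \<psi> U x d p q F"
    if "quotient_of_forms \<phi> U x d p q F" "\<And>x. x \<in> U \<Longrightarrow> \<phi> x = \<psi> x" for \<phi> \<psi> x d p q F
    unfolding quotient_of_forms_def
  proof (intro conjI allI impI)
    fix a b assume ab: "(a, b) \<noteq> (0, 0) \<and> pt a b \<in> U - F"
    then have "q a b \<noteq> 0 \<and> \<phi> (pt a b) = p a b / q a b" using that(1) unfolding quotient_of_forms_def by blast
    moreover have "\<phi> (pt a b) = \<psi> (pt a b)" using ab that(2) by blast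
    ultimately show "q a b \<noteq> 0" "\<psi> (pt a b) = p a b / q a b" by simp_all
  qed (use that(1) in \<open>auto simp: quotient_of_forms_def\<close>)
  from this[of \<phi> _ _ _ _ _ \<psi>] this[of \<psi> _ _ _ _ _ \<phi>] show ?thesis
    unfolding regular_iff_quotient_of_forms[OF assms(1)] using assms(2) by metis
qed

text \<open>Mediants: a regular function is a single quotient of forms near any two points.\<close>

lemma regular_near_two_points:
  assumes U: "openin (proj_topology s V) U" and \<phi>: "\<phi> \<in> regular (proj_space s V) U"
    and x1: "pt a1 b1 \<in> U" "(a1, b1) \<noteq> (0, 0)" and x2: "pt a2 b2 \<in> U" "(a2, b2) \<noteq> (0, 0)"
    and l: "is_binary_form 1 l" "l a1 b1 \<noteq> 0" "l a2 b2 \<noteq> 0"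
  obtains d p q F where "quotient_of_forms \<phi> U (pt a1 b1) d p q F" "pt a2 b2 \<notin> F"
proof -
  obtain d1 p1 q1 F1 where 1: "quotient_of_forms \<phi> U (pt a1 b1) d1 p1 q1 F1"
    using \<phi> x1 unfolding regular_iff_quotient_of_forms[OF U] by blast
  obtain d2 p2 q2 F2 where 2: "quotient_of_forms \<phi> U (pt a2 b2) d2 p2 q2 F2"
    using \<phi> x2 unfolding regular_iff_quotient_of_forms[OF U] by blast
  have f: "is_binary_form d1 p1" "is_binary_form d1 q1" "is_binary_form d2 p2" "is_binary_form d2 q2"
    and fin: "finite F1" "finite F2" and out: "pt a1 b1 \<notin> F1" "pt a2 b2 \<notin> F2"
    using 1 2 unfolding quotient_of_forms_def by blast+
  have c1: "q1 a b \<noteq> 0 \<and> \<phi> (pt a b) = p1 a b / q1 a b"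
    if "(a, b) \<noteq> (0, 0)" "pt a b \<in> U" "pt a b \<notin> F1" for a b
    using 1 that unfolding quotient_of_forms_def by blast
  have c2: "q2 a b \<noteq> 0 \<and> \<phi> (pt a b) = p2 a b / q2 a b"
    if "(a, b) \<noteq> (0, 0)" "pt a b \<in> U" "pt a b \<notin> F2" for a b
    using 2 that unfolding quotient_of_forms_def by blast
  \<comment> \<open>The cross difference of the two local representations. It vanishes wherever both
    are valid, hence identically.\<close>
  define r where "r a b = p1 a b * q2 a b + (- 1) * (p2 a b * q1 a b)" for a b
  have "r a b = 0" for a b
  proof (rule binary_form_eq_0[of "d1 + d2" r U "F1 \<union> F2"])
    have p2q1: "is_binary_form (d1 + d2) (\<lambda>a b. p2 a b * q1 a b)"
      using is_binary_form_mult[OF f(3,2)] by (simp add: add.commute)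
    have p1q2: "is_binary_form (d1 + d2) (\<lambda>a b. p1 a b * q2 a b)"
      by (rule is_binary_form_mult[OF f(1,4)])
    show "is_binary_form (d1 + d2) r"
      unfolding r_def[abs_def] by (rule is_binary_form_add[OF p1q2 is_binary_form_scale[OF p2q1]])
    show "finite (F1 \<union> F2)" using fin by blast
    show "openin (proj_topology s V) U" "U \<noteq> {}" using U x1 by blast+
    fix a b assume "(a, b) \<noteq> (0, 0)" "pt a b \<in> U - (F1 \<union> F2)"
    then have "q1 a b \<noteq> 0" "q2 a b \<noteq> 0" "p1 a b / q1 a b = p2 a b / q2 a b"
      using c1[of a b] c2[of a b] by auto
    then show "r a b = 0" by (simp add: r_def frac_eq_eq)
  qed
  then have cross: "p1 a b * q2 a b = p2 a b * q1 a b" for a b by (simp add: r_def)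
  have v1: "q1 a1 b1 \<noteq> 0" "\<phi> (pt a1 b1) = p1 a1 b1 / q1 a1 b1" using c1[OF x1(2,1) out(1)] by auto
  have v2: "q2 a2 b2 \<noteq> 0" "\<phi> (pt a2 b2) = p2 a2 b2 / q2 a2 b2" using c2[OF x2(2,1) out(2)] by auto
  have h: "z * q' = p'" if "q \<noteq> 0" "z = p / q" "p * q' = p' * q" for z p q p' q' :: complex
  proof -
    have "p = z * q" using that by simp
    then have "q * (z * q' - p') = 0" using that(3) by algebra
    then show ?thesis using that(1) by simp
  qed
  have e1: "\<phi> (pt a1 b1) * q1 a1 b1 = p1 a1 b1" "\<phi> (pt a1 b1) * q2 a1 b1 = p2 a1 b1"
    using v1 h[OF v1 cross] by simp_all
  have e2: "\<phi> (pt a2 b2) * q2 a2 b2 = p2 a2 b2" "\<phi> (pt a2 b2) * q1 a2 b2 = p1 a2 b2"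
    using v2 h[OF v2 cross[symmetric]] by simp_all
  have e: "\<phi> (pt a b) * q1 a b = p1 a b" "\<phi> (pt a b) * q2 a b = p2 a b"
    if "(a, b) \<noteq> (0, 0)" "pt a b \<in> U - (F1 \<union> F2)" for a b
  proof -
    have "q1 a b \<noteq> 0 \<and> \<phi> (pt a b) = p1 a b / q1 a b" using that by (intro c1) auto
    then show "\<phi> (pt a b) * q1 a b = p1 a b" by simp
    have "q2 a b \<noteq> 0 \<and> \<phi> (pt a b) = p2 a b / q2 a b" using that by (intro c2) auto
    then show "\<phi> (pt a b) * q2 a b = p2 a b" by simp
  qed
  \<comment> \<open>Multiplying by powers of \<open>l\<close> equalizes the degrees of the two
    pairs. One pair alone is enough if its denominator is nonzero at both points; otherwise each
    denominator vanishes exactly at the other point, and their sum works.\<close>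
  obtain m1 m2 k1 k2 where m: "is_binary_form m1 k1" "is_binary_form m2 k2" "d1 + m1 = d2 + m2"
    "k1 a1 b1 * q1 a1 b1 + k2 a1 b1 * q2 a1 b1 \<noteq> 0" "k1 a2 b2 * q1 a2 b2 + k2 a2 b2 * q2 a2 b2 \<noteq> 0"
  proof -
    have pow: "is_binary_form n (\<lambda>a b. k * l a b ^ n)" for n k
    proof (induction n)
      case 0
      then show ?case using is_binary_form_const[of k] by simp
    next
      case (Suc n)
      then show ?case using is_binary_form_mult[OF l(1) Suc] by (simp add: mult_ac)
    qed
    note goal = that
    have w: thesis
      if "c1 * l a1 b1 ^ d2 * q1 a1 b1 + c2 * l a1 b1 ^ d1 * q2 a1 b1 \<noteq> 0"
        "c1 * l a2 b2 ^ d2 * q1 a2 b2 + c2 * l a2 b2 ^ d1 * q2 a2 b2 \<noteq> 0" for c1 c2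
      by (rule goal[OF pow[where n=d2 and k=c1] pow[where n=d1 and k=c2] add.commute that])
    consider "q1 a2 b2 \<noteq> 0" | "q2 a1 b1 \<noteq> 0" | "q1 a2 b2 = 0" "q2 a1 b1 = 0" by blast
    then show thesis
    proof cases
      case 1
      show thesis by (rule w[of 1 0]) (use 1 v1 l in auto)
    next
      case 2
      show thesis by (rule w[of 0 1]) (use 2 v2 l in auto)
    next
      case 3
      show thesis by (rule w[of 1 1]) (use 3 v1 v2 l in auto)
    qed
  qed
  define p q where "p a b = k1 a b * p1 a b + k2 a b * p2 a b" and "q a b = k1 a b * q1 a b + k2 a b * q2 a b" for a b
  have eq: "\<phi> x * q a b = p a b" if "\<phi> x * q1 a b = p1 a b" "\<phi> x * q2 a b = p2 a b" for x a b
    unfolding p_def q_def that[symmetric] by (simp add: algebra_simps)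
  \<comment> \<open>Both chosen points are put back: the combined denominator is nonzero there, and
    the value of \<phi> at them satisfies both cross relations.\<close>
  define F where "F = (F1 \<union> F2 \<union> {pt a b | a b. (a, b) \<noteq> (0, 0) \<and> q a b = 0}) - {pt a1 b1, pt a2 b2}"
  have forms: "is_binary_form (d1 + m1) p" "is_binary_form (d1 + m1) q"
  proof -
    have "is_binary_form (d1 + m1) (\<lambda>a b. k1 a b * r1 a b + k2 a b * r2 a b)"
      if "is_binary_form d1 r1" "is_binary_form d2 r2" for r1 r2
      using is_binary_form_mult[OF m(1) that(1)] is_binary_form_mult[OF m(2) that(2)] m(3)
      by (intro is_binary_form_add) (simp_all add: add.commute)
    then show "is_binary_form (d1 + m1) p" "is_binary_form (d1 + m1) q"
      unfolding p_def[abs_def] q_def[abs_def] using f by blast+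
  qed
  have q12: "q a1 b1 \<noteq> 0" "q a2 b2 \<noteq> 0" using m by (simp_all add: q_def)
  have "finite F" unfolding F_def using finite_zeros[OF forms(2) q12(1)] fin by blast
  moreover have "q a b \<noteq> 0 \<and> \<phi> (pt a b) = p a b / q a b" if ab: "(a, b) \<noteq> (0, 0)" "pt a b \<in> U - F" for a b
  proof -
    have scaled: "q (k * a') (k * b') = k ^ (d1 + m1) * q a' b'" "p (k * a') (k * b') = k ^ (d1 + m1) * p a' b'" for k a' b'
      using forms binary_form_scale unfolding is_binary_form_def by metis+
    have at_pt: ?thesis if h: "pt a b = pt a' b'" "(a', b') \<noteq> (0, 0)" "q a' b' \<noteq> 0" "\<phi> (pt a' b') * q a' b' = p a' b'" for a' b'
    proof -
      obtain k where k: "k \<noteq> 0" "a = k * a'" "b = k * b'" using binary_form_pt[OF h(1)[symmetric] h(2) ab(1)] by blast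
      have "\<phi> (pt a b) = p a' b' / q a' b'" using h(1,3,4) by (simp add: field_simps)
      then show ?thesis using k(1) h(3) unfolding k(2,3) scaled by simp
    qed
    show ?thesis
    proof (cases "pt a b = pt a1 b1 \<or> pt a b = pt a2 b2")
      case True
      then show ?thesis using at_pt[of a1 b1] at_pt[of a2 b2] x1 x2 q12 eq e1 e2 by blast
    next
      case False
      then have "pt a b \<in> U - (F1 \<union> F2)" "q a b \<noteq> 0" using ab unfolding F_def by auto
      then show ?thesis using eq[OF e[OF ab(1)]] by (simp add: field_simps)
    qed
  qed
  ultimately have "quotient_of_forms \<phi> U (pt a1 b1) (d1 + m1) p q F"
    unfolding quotient_of_forms_def using forms by (auto simp: F_def)
  then show thesis by (rule that) (simp add: F_def)
qed

end

section \<open>The quotient of a projective line by an involution\<close>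

context binary_space
begin

text \<open>\<open>G\<close> acts on the projective line through the involution \<open>(a : b) \<mapsto> (a : - b)\<close>; the scalars \<open>k\<close>
  by which it acts on the plane are subject to \<open>R\<close>.\<close>

definition flip_action :: "(complex \<Rightarrow> bool) \<Rightarrow> ('v \<Rightarrow> 'v) set \<Rightarrow> bool"
  where "flip_action R G \<longleftrightarrow>
    (\<forall>g\<in>G. \<exists>k. k \<noteq> 0 \<and> R k \<and>
      ((\<forall>a b. g (ph a b) = ph (k * a) (k * b)) \<or> (\<forall>a b. g (ph a b) = ph (k * a) (- (k * b))))) \<and>
    (\<exists>g\<in>G. \<exists>k. k \<noteq> 0 \<and> (\<forall>a b. g (ph a b) = ph (k * a) (k * b))) \<and>
    (\<exists>g\<in>G. \<exists>k. k \<noteq> 0 \<and> (\<forall>a b. g (ph a b) = ph (k * a) (- (k * b))))"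

lemma image_pt:
  assumes "k \<noteq> 0"
  shows "(\<And>a b. g (ph a b) = ph (k * a) (k * b)) \<Longrightarrow> g ` pt a b = pt a b"
    and "(\<And>a b. g (ph a b) = ph (k * a) (- (k * b))) \<Longrightarrow> g ` pt a b = pt a (- b)"
proof -
  assume "\<And>a b. g (ph a b) = ph (k * a) (k * b)"
  then have "g ` pt a b = range (\<lambda>c. ph (c * (k * a)) (c * (k * b)))"
    unfolding pt_def ray_def ph_scale image_image by (simp add: mult.left_commute)
  also have "\<dots> = pt (k * a) (k * b)" unfolding pt_def ray_def ph_scale ..
  finally show "g ` pt a b = pt a b" using pt_scale[OF assms] by simp
next
  assume "\<And>a b. g (ph a b) = ph (k * a) (- (k * b))"
  then have "g ` pt a b = range (\<lambda>c. ph (c * (k * a)) (c * (k * (- b))))"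
    unfolding pt_def ray_def ph_scale image_image by (simp add: mult.left_commute)
  also have "\<dots> = pt (k * a) (k * (- b))" unfolding pt_def ray_def ph_scale ..
  finally show "g ` pt a b = pt a (- b)" using pt_scale[OF assms, of a "- b"] by simp
qed

lemma orbit_of_flip_action:
  assumes "flip_action R G"
  shows "orbit_of G (pt a b) = {pt a b, pt a (- b)}"
proof
  show "orbit_of G (pt a b) \<subseteq> {pt a b, pt a (- b)}"
  proof
    fix x assume "x \<in> orbit_of G (pt a b)"
    then obtain g where g: "g \<in> G" "x = g ` pt a b" by (auto simp: orbit_of_def)
    then obtain k where "k \<noteq> 0"
      "(\<forall>a b. g (ph a b) = ph (k * a) (k * b)) \<or> (\<forall>a b. g (ph a b) = ph (k * a) (- (k * b)))"
      using assms unfolding flip_action_def by blast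
    then show "x \<in> {pt a b, pt a (- b)}" using image_pt[of k g a b] g(2) by auto
  qed
  obtain g k where g: "g \<in> G" "k \<noteq> 0" "\<forall>a b. g (ph a b) = ph (k * a) (k * b)"
    using assms unfolding flip_action_def by blast
  have 1: "pt a b \<in> orbit_of G (pt a b)"
    unfolding orbit_of_def by (rule image_eqI[where x=g]) (simp_all add: image_pt(1)[of k g] g)
  obtain g k where g: "g \<in> G" "k \<noteq> 0" "\<forall>a b. g (ph a b) = ph (k * a) (- (k * b))"
    using assms unfolding flip_action_def by blast
  have 2: "pt a (- b) \<in> orbit_of G (pt a b)"
    unfolding orbit_of_def by (rule image_eqI[where x=g]) (simp_all add: image_pt(2)[of k g] g)
  show "{pt a b, pt a (- b)} \<subseteq> orbit_of G (pt a b)" using 1 2 by blast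
qed

text \<open>The monomials a^8 and b^8 are invariant, as the scalars are eighth roots of unity and
  the sign of \<open>b\<close> disappears in even degree. They have no common zero.\<close>

lemma semistable_points_flip_action:
  assumes "flip_action (\<lambda>k. k ^ 8 = 1) G"
  shows "semistable_points s V G = P"
proof
  show "semistable_points s V G \<subseteq> P"
  proof
    fix x assume "x \<in> semistable_points s V G"
    then obtain v where v: "x = ray s v" "v \<in> V" "v \<noteq> 0" unfolding semistable_points_def by blast
    then obtain a b where "v = ph a b" using V_eq by blast
    then show "x \<in> P" using v ph_0 pt_in_P[of a b] by (auto simp: pt_def)
  qed
next
  have inv: "\<forall>g\<in>G. \<forall>w\<in>V. binary_form 8 c (fst_coord (g w)) (snd_coord (g w)) = binary_form 8 c (fst_coord w) (snd_coord w)"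
    if c: "\<And>a b. binary_form 8 c a (- b) = binary_form 8 c a b" for c
  proof (intro ballI)
    fix g w assume g: "g \<in> G" "w \<in> V"
    then obtain a b where w: "w = ph a b" using V_eq by blast
    obtain k where k: "k ^ 8 = 1"
      "(\<forall>a b. g (ph a b) = ph (k * a) (k * b)) \<or> (\<forall>a b. g (ph a b) = ph (k * a) (- (k * b)))"
      using assms g(1) unfolding flip_action_def by blast
    have "binary_form 8 c (k * a) (k * b) = binary_form 8 c a b"
      "binary_form 8 c (k * a) (- (k * b)) = binary_form 8 c a b"
      using binary_form_scale[of 8 c k a b] k(1) c by simp_all
    then show "binary_form 8 c (fst_coord (g w)) (snd_coord (g w)) = binary_form 8 c (fst_coord w) (snd_coord w)"
      using k(2) w by auto
  qed
  have sem: "pt a b \<in> semistable_points s V G"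
    if c: "\<And>a b. binary_form 8 c a (- b) = binary_form 8 c a b" and nz: "binary_form 8 c a b \<noteq> 0"
      and ab: "(a, b) \<noteq> (0, 0)" for a b c
  proof -
    let ?p = "\<lambda>v. binary_form 8 c (fst_coord v) (snd_coord v)"
    have "homogeneous_on s V 8 ?p" by (rule binary_form_homogeneous)
    moreover have "?p (ph a b) \<noteq> 0" using nz by simp
    moreover have "ph a b \<noteq> 0" using ab ph_eq_0 by auto
    moreover have "(0 :: nat) < 8" by simp
    ultimately show ?thesis
      unfolding semistable_points_def pt_def mem_Collect_eq using inv[OF c] ph_V by blast
  qed
  show "P \<subseteq> semistable_points s V G"
  proof
    fix x assume "x \<in> P"
    then obtain a b where x: "x = pt a b" "(a, b) \<noteq> (0, 0)" by (auto simp: P_def)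
    show "x \<in> semistable_points s V G"
    proof (cases "a = 0")
      case True
      show ?thesis unfolding x(1)
        by (rule sem[OF _ _ x(2), of "\<lambda>i. if i = 0 then 1 else 0"]) (use True x(2) in \<open>auto simp: binary_form_monomial\<close>)
    next
      case False
      show ?thesis unfolding x(1)
        by (rule sem[OF _ _ x(2), of "\<lambda>i. if i = 8 then 1 else 0"]) (use False in \<open>auto simp: binary_form_monomial\<close>)
    qed
  qed
qed

text \<open>Orbits have at most two points and finite sets are closed, so the orbit closures in the
  GIT equivalence are the orbits themselves.\<close>

lemma git_class_flip_action:
  assumes G: "flip_action (\<lambda>k. k ^ 8 = 1) G" and ab: "(a, b) \<noteq> (0, 0)"
  shows "git_class s V G (pt a b) = {pt a b, pt a (- b)}"
proof -
  let ?T = "subtopology (proj_topology s V) P"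
  have T: "?T = proj_topology s V" using subtopology_topspace[of "proj_topology s V"] by simp
  have clos: "?T closure_of F = F" if "finite F" "F \<subseteq> P" for F
  proof (rule closure_of_closedin)
    show "closedin ?T F" unfolding T closedin_def openin_proj_topology
      using that by (auto simp: double_diff)
  qed
  have orb: "?T closure_of orbit_of G (pt x y) = {pt x y, pt x (- y)}" if "(x, y) \<noteq> (0, 0)" for x y
    unfolding orbit_of_flip_action[OF G] by (rule clos) (use that pt_in_P[of x y] pt_in_P[of x "- y"] in auto)
  have "git_class s V G (pt a b) = {y \<in> P. {pt a b, pt a (- b)} \<inter> (?T closure_of orbit_of G y) \<noteq> {}}"
    unfolding git_class_def Let_def semistable_points_flip_action[OF G] orb[OF ab] ..
  also have "\<dots> = {pt a b, pt a (- b)}"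
  proof (intro equalityI subsetI)
    fix y assume y: "y \<in> {y \<in> P. {pt a b, pt a (- b)} \<inter> (?T closure_of orbit_of G y) \<noteq> {}}"
    then obtain x' y' where y': "y = pt x' y'" "(x', y') \<noteq> (0, 0)" by (auto simp: P_def)
    have *: "pt x (- y) = pt x' y''" if "pt x y = pt x' (- y'')" "(x, y) \<noteq> (0, 0)" "(x', y'') \<noteq> (0, 0)" for x y x' y''
    proof -
      have "x * (- y'') = x' * y" using that pt_eq_iff[of x y x' "- y''"] by simp
      then have "x * y'' = x' * (- y)" by algebra
      then show ?thesis using that pt_eq_iff[of x "- y" x' y''] by simp
    qed
    have "{pt a b, pt a (- b)} \<inter> (?T closure_of orbit_of G (pt x' y')) \<noteq> {}" using y y'(1) by blast
    then have "{pt a b, pt a (- b)} \<inter> {pt x' y', pt x' (- y')} \<noteq> {}" unfolding orb[OF y'(2)] .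
    then have "pt a b = pt x' y' \<or> pt a b = pt x' (- y') \<or> pt a (- b) = pt x' y' \<or> pt a (- b) = pt x' (- y')" by blast
    then show "y \<in> {pt a b, pt a (- b)}"
      using *[of a b x' y'] *[of a "- b" x' y'] ab y' by auto
  next
    fix y assume y: "y \<in> {pt a b, pt a (- b)}"
    have "pt a b \<in> P" "pt a (- b) \<in> P" using ab pt_in_P by auto
    moreover have "?T closure_of orbit_of G y = {pt a b, pt a (- b)}"
      using y orb[OF ab] orb[of a "- b"] ab by auto
    ultimately show "y \<in> {y \<in> P. {pt a b, pt a (- b)} \<inter> (?T closure_of orbit_of G y) \<noteq> {}}" using y by auto
  qed
  finally show ?thesis .
qed

lemma pt_square_eq_iff:
  assumes "(a, b) \<noteq> (0, 0)" "(a', b') \<noteq> (0, 0)"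
  shows "pt a' b' \<in> {pt a b, pt a (- b)} \<longleftrightarrow> a\<^sup>2 * b'\<^sup>2 = a'\<^sup>2 * b\<^sup>2"
proof -
  have "(a, - b) \<noteq> (0, 0)" using assms by simp
  then have "pt a' b' \<in> {pt a b, pt a (- b)} \<longleftrightarrow> a' * b = a * b' \<or> a' * (- b) = a * b'"
    using pt_eq_iff[OF assms(2,1)] pt_eq_iff[OF assms(2), of a "- b"] by simp
  also have "\<dots> \<longleftrightarrow> a\<^sup>2 * b'\<^sup>2 = a'\<^sup>2 * b\<^sup>2"
  proof
    assume "a' * b = a * b' \<or> a' * (- b) = a * b'"
    then show "a\<^sup>2 * b'\<^sup>2 = a'\<^sup>2 * b\<^sup>2" by (elim disjE) algebra+
  next
    assume "a\<^sup>2 * b'\<^sup>2 = a'\<^sup>2 * b\<^sup>2"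
    then have "(a' * b - a * b') * (a' * (- b) - a * b') = 0" by algebra
    then show "a' * b = a * b' \<or> a' * (- b) = a * b'" by auto
  qed
  finally show ?thesis .
qed

end

interpretation line: binary_space "(*s)" "UNIV :: (complex^2) set" "\<lambda>a b. vector [a, b]"
proof
  show "UNIV = {vector [a, b] :: complex^2 | a b. True}"
  proof -
    have "x = vector [x $ 1, x $ 2]" for x :: "complex^2" by (simp add: vec_eq_iff forall_2)
    then show ?thesis by blast
  qed
qed (auto simp: vec_eq_iff forall_2)

context binary_space
begin

text \<open>The quotient map (a : b) \<mapsto> (a^2 : b^2) by the sign involution. Points are sets
  of vectors, so the image is described through any representative; independence of the choice is
  shown next.\<close>

definition square_pt :: "'v set \<Rightarrow> (complex^2) set"
  where "square_pt x = (THE y. \<exists>a b. (a, b) \<noteq> (0, 0) \<and> x = pt a b \<and> y = line.pt (a\<^sup>2) (b\<^sup>2))"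

lemma square_pt:
  assumes ab: "(a, b) \<noteq> (0, 0)"
  shows "square_pt (pt a b) = line.pt (a\<^sup>2) (b\<^sup>2)"
  unfolding square_pt_def
proof (rule the_equality)
  show "\<exists>a' b'. (a', b') \<noteq> (0, 0) \<and> pt a b = pt a' b' \<and> line.pt (a\<^sup>2) (b\<^sup>2) = line.pt (a'\<^sup>2) (b'\<^sup>2)"
    using ab by blast
  fix y assume "\<exists>a' b'. (a', b') \<noteq> (0, 0) \<and> pt a b = pt a' b' \<and> y = line.pt (a'\<^sup>2) (b'\<^sup>2)"
  then obtain a' b' where *: "(a', b') \<noteq> (0, 0)" "pt a b = pt a' b'" "y = line.pt (a'\<^sup>2) (b'\<^sup>2)" by blast
  have "a * b' = a' * b" using pt_eq_iff[OF ab *(1)] *(2) by simp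
  then have "a'\<^sup>2 * b\<^sup>2 = a\<^sup>2 * b'\<^sup>2" by algebra
  then show "y = line.pt (a\<^sup>2) (b\<^sup>2)" unfolding *(3) using ab *(1) by (subst line.pt_eq_iff) auto
qed

lemma square_pt_eq_iff:
  assumes "(a, b) \<noteq> (0, 0)" "(a', b') \<noteq> (0, 0)"
  shows "square_pt (pt a b) = square_pt (pt a' b') \<longleftrightarrow> pt a' b' \<in> {pt a b, pt a (- b)}"
  unfolding square_pt[OF assms(1)] square_pt[OF assms(2)] pt_square_eq_iff[OF assms]
  using assms by (subst line.pt_eq_iff) auto

lemma square_pt_surj:
  assumes "y \<in> line.P"
  obtains a b where "(a, b) \<noteq> (0, 0)" "y = square_pt (pt a b)" "y = square_pt (pt a (- b))"
proof -
  obtain A B where AB: "y = line.pt A B" "(A, B) \<noteq> (0, 0)" using assms by (auto simp: line.P_def)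
  have "(csqrt A, csqrt B) \<noteq> (0, 0)" "(csqrt A, - csqrt B) \<noteq> (0, 0)" using AB(2) by auto
  then show thesis using that[of "csqrt A" "csqrt B"] square_pt AB(1) by simp
qed

lemma square_pt_in_P: "x \<in> P \<Longrightarrow> square_pt x \<in> line.P"
  by (auto simp: P_def square_pt intro!: line.pt_in_P)

lemma finite_square_pt_fibre: "finite {x \<in> P. square_pt x = y}"
proof (cases "\<exists>x\<in>P. square_pt x = y")
  case True
  then obtain a b where ab: "(a, b) \<noteq> (0, 0)" "square_pt (pt a b) = y" by (auto simp: P_def)
  have "{x \<in> P. square_pt x = y} \<subseteq> {pt a b, pt a (- b)}"
  proof
    fix x assume "x \<in> {x \<in> P. square_pt x = y}"
    then obtain a' b' where "x = pt a' b'" "(a', b') \<noteq> (0, 0)" "square_pt (pt a' b') = y" by (auto simp: P_def)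
    then show "x \<in> {pt a b, pt a (- b)}" using square_pt_eq_iff[of a b a' b'] ab by simp
  qed
  then show ?thesis using finite_subset by blast
next
  case False
  then have "{x \<in> P. square_pt x = y} = {}" by blast
  then show ?thesis by (simp only: finite.emptyI)
qed

lemma finite_preimage_square_pt:
  assumes "finite F" shows "finite {x \<in> P. square_pt x \<in> F}"
proof -
  have "{x \<in> P. square_pt x \<in> F} = (\<Union>y\<in>F. {x \<in> P. square_pt x = y})" by blast
  then show ?thesis using assms finite_square_pt_fibre by simp
qed

lemma openin_preimage_square_pt:
  assumes "openin (proj_topology (*s) (UNIV :: (complex^2) set)) U"
  shows "openin (proj_topology s V) {x \<in> P. square_pt x \<in> U}"
proof (cases "U = {}")
  case False
  then have "finite (line.P - U)" using assms unfolding line.openin_proj_topology by blast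
  then have "finite {x \<in> P. square_pt x \<in> line.P - U}" by (rule finite_preimage_square_pt)
  moreover have "P - {x \<in> P. square_pt x \<in> U} = {x \<in> P. square_pt x \<in> line.P - U}"
    using square_pt_in_P by blast
  ultimately show ?thesis unfolding openin_proj_topology by auto
qed simp

text \<open>Pulling back substitutes squares into forms. For the converse, a quotient of forms valid
  near both preimages of a point is averaged with its flip; numerator and denominator become even
  and hence are forms in the squares.\<close>

lemma regular_square_pt:
  assumes U: "openin (proj_topology (*s) UNIV) U" and f: "\<And>x. x \<in> P \<Longrightarrow> f x = \<phi> (square_pt x)"
  shows "\<phi> \<in> regular projective_line U \<longleftrightarrow> f \<in> regular (proj_space s V) {x \<in> P. square_pt x \<in> U}"
    (is "_ \<longleftrightarrow> f \<in> regular _ ?U")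
proof
  note U' = openin_preimage_square_pt[OF U]
  assume \<phi>: "\<phi> \<in> regular projective_line U"
  show "f \<in> regular (proj_space s V) ?U"
    unfolding regular_iff_quotient_of_forms[OF U']
  proof
    fix x assume x: "x \<in> ?U"
    then obtain d p q F where *: "line.quotient_of_forms \<phi> U (square_pt x) d p q F"
      using \<phi> unfolding line.regular_iff_quotient_of_forms[OF U] by blast
    then have forms: "is_binary_form d p" "is_binary_form d q" and F: "finite F" "square_pt x \<notin> F"
      and eq: "\<And>a b. (a, b) \<noteq> (0, 0) \<Longrightarrow> line.pt a b \<in> U - F \<Longrightarrow> q a b \<noteq> 0 \<and> \<phi> (line.pt a b) = p a b / q a b"
      unfolding line.quotient_of_forms_def by blast+
    have "q (a\<^sup>2) (b\<^sup>2) \<noteq> 0 \<and> f (pt a b) = p (a\<^sup>2) (b\<^sup>2) / q (a\<^sup>2) (b\<^sup>2)"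
      if ab: "(a, b) \<noteq> (0, 0)" "pt a b \<in> ?U - {x \<in> P. square_pt x \<in> F}" for a b
    proof -
      have "line.pt (a\<^sup>2) (b\<^sup>2) \<in> U - F" "pt a b \<in> P" using ab square_pt[OF ab(1)] by auto
      moreover have "(a\<^sup>2, b\<^sup>2) \<noteq> (0, 0)" using ab(1) by simp
      ultimately show ?thesis using eq[of "a\<^sup>2" "b\<^sup>2"] f[of "pt a b"] square_pt[OF ab(1)] by simp
    qed
    then have "quotient_of_forms f ?U x (2 * d) (\<lambda>a b. p (a\<^sup>2) (b\<^sup>2)) (\<lambda>a b. q (a\<^sup>2) (b\<^sup>2)) {x \<in> P. square_pt x \<in> F}"
      unfolding quotient_of_forms_def
      using is_binary_form_square[OF forms(1)] is_binary_form_square[OF forms(2)] finite_preimage_square_pt[OF F(1)] F(2)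
      by simp
    then show "\<exists>d p q F. quotient_of_forms f ?U x d p q F" by blast
  qed
next
  note U' = openin_preimage_square_pt[OF U]
  assume reg: "f \<in> regular (proj_space s V) ?U"
  show "\<phi> \<in> regular projective_line U"
    unfolding line.regular_iff_quotient_of_forms[OF U]
  proof
    fix y assume y: "y \<in> U"
    then have "y \<in> line.P" using openin_subset[OF U] by auto
    then obtain a0 b0 where ab0: "(a0, b0) \<noteq> (0, 0)" "y = square_pt (pt a0 b0)" "y = square_pt (pt a0 (- b0))"
      using square_pt_surj by metis
    have ab0': "(a0, - b0) \<noteq> (0, 0)" using ab0(1) by simp
    have xU: "pt a0 b0 \<in> ?U" "pt a0 (- b0) \<in> ?U"
      using ab0 y pt_in_P[OF ab0(1)] pt_in_P[OF ab0'] by auto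
    \<comment> \<open>The two preimages have the same nonzero coordinate, which is a linear form
      vanishing at neither of them.\<close>
    obtain l where l: "is_binary_form 1 l" "l a0 b0 \<noteq> 0" "l a0 (- b0) \<noteq> 0"
    proof (cases "a0 = 0")
      case True
      have "is_binary_form 1 (\<lambda>a b. b)"
        by (rule is_binary_formI[of _ _ "\<lambda>i. if i = 0 then 1 else 0"]) (simp add: binary_form_monomial)
      then show thesis using that[of "\<lambda>a b. b"] True ab0(1) by simp
    next
      case False
      have "is_binary_form 1 (\<lambda>a b. a)"
        by (rule is_binary_formI[of _ _ "\<lambda>i. if i = 1 then 1 else 0"]) (simp add: binary_form_monomial)
      then show thesis using that[of "\<lambda>a b. a"] False by simp
    qed
    obtain d p q F where *: "quotient_of_forms f ?U (pt a0 b0) d p q F" "pt a0 (- b0) \<notin> F"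
      using regular_near_two_points[OF U' reg xU(1) ab0(1) xU(2) ab0' l] by blast
    then have forms: "is_binary_form d p" "is_binary_form d q" and F: "finite F" "pt a0 b0 \<notin> F"
      and eq: "\<And>a b. (a, b) \<noteq> (0, 0) \<Longrightarrow> pt a b \<in> ?U - F \<Longrightarrow> q a b \<noteq> 0 \<and> f (pt a b) = p a b / q a b"
      unfolding quotient_of_forms_def by blast+
    \<comment> \<open>The mean of p / q and its flip, over the common denominator: both
      \<open>N\<close> and \<open>D\<close> are unchanged when \<open>b\<close> changes sign, and
      the mean is the value of \<phi>.\<close>
    define N where "N a b = p a b * q a (- b) + p a (- b) * q a b" for a b
    define D where "D a b = 2 * (q a b * q a (- b))" for a b
    have "is_binary_form (2 * d) N" "is_binary_form (2 * d) D"
    proof -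
      have flip: "is_binary_form d (\<lambda>a b. p a (- b))" "is_binary_form d (\<lambda>a b. q a (- b))"
        using forms is_binary_form_flip by blast+
      show "is_binary_form (2 * d) N"
        unfolding N_def[abs_def] mult_2
        by (rule is_binary_form_add[OF is_binary_form_mult[OF forms(1) flip(2)] is_binary_form_mult[OF flip(1) forms(2)]])
      show "is_binary_form (2 * d) D"
        unfolding D_def[abs_def] mult_2[of d]
        by (rule is_binary_form_scale[OF is_binary_form_mult[OF forms(2) flip(2)]])
    qed
    moreover have "N a (- b) = N a b" "D a (- b) = D a b" for a b by (simp_all add: N_def D_def)
    ultimately obtain N' D' where N': "is_binary_form d N'" "\<And>a b. N a b = N' (a\<^sup>2) (b\<^sup>2)"
      and D': "is_binary_form d D'" "\<And>a b. D a b = D' (a\<^sup>2) (b\<^sup>2)"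
      using is_binary_form_even by metis
    have val: "D' (a\<^sup>2) (b\<^sup>2) \<noteq> 0 \<and> \<phi> (line.pt (a\<^sup>2) (b\<^sup>2)) = N' (a\<^sup>2) (b\<^sup>2) / D' (a\<^sup>2) (b\<^sup>2)"
      if ab: "(a, b) \<noteq> (0, 0)" "line.pt (a\<^sup>2) (b\<^sup>2) \<in> U - square_pt ` (F \<inter> P)" for a b
    proof -
      have ab': "(a, - b) \<noteq> (0, 0)" using ab(1) by simp
      note sq = square_pt[OF ab(1)] square_pt[OF ab', unfolded power2_minus]
      have inP: "pt a b \<in> P" "pt a (- b) \<in> P" using pt_in_P[OF ab(1)] pt_in_P[OF ab'] .
      have "pt a b \<notin> F" "pt a (- b) \<notin> F"
        using ab(2) inP sq by (metis DiffD2 IntI imageI)+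
      then have "pt a b \<in> ?U - F" "pt a (- b) \<in> ?U - F" using ab(2) inP sq by auto
      from eq[OF ab(1) this(1)] eq[OF ab' this(2)]
      have *: "q a b \<noteq> 0" "q a (- b) \<noteq> 0" "f (pt a b) = p a b / q a b" "f (pt a (- b)) = p a (- b) / q a (- b)" by auto
      have "f (pt a b) = \<phi> (line.pt (a\<^sup>2) (b\<^sup>2))" "f (pt a (- b)) = \<phi> (line.pt (a\<^sup>2) (b\<^sup>2))"
        using f inP sq by simp_all
      then have "p a b = \<phi> (line.pt (a\<^sup>2) (b\<^sup>2)) * q a b" "p a (- b) = \<phi> (line.pt (a\<^sup>2) (b\<^sup>2)) * q a (- b)"
        using * by (simp_all add: field_simps)
      then have "N a b = \<phi> (line.pt (a\<^sup>2) (b\<^sup>2)) * D a b" unfolding N_def D_def by algebra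
      moreover have "D a b \<noteq> 0" using * by (simp add: D_def)
      ultimately show ?thesis unfolding N'(2) D'(2) by (simp add: field_simps)
    qed
    have "D' A B \<noteq> 0 \<and> \<phi> (line.pt A B) = N' A B / D' A B"
      if "(A, B) \<noteq> (0, 0)" "line.pt A B \<in> U - square_pt ` (F \<inter> P)" for A B
      using val[of "csqrt A" "csqrt B"] that by simp
    moreover have "y \<notin> square_pt ` (F \<inter> P)"
    proof
      assume "y \<in> square_pt ` (F \<inter> P)"
      then obtain a b where "pt a b \<in> F" "(a, b) \<noteq> (0, 0)" "y = square_pt (pt a b)" by (auto simp: P_def)
      then have "pt a b \<in> {pt a0 b0, pt a0 (- b0)}" using square_pt_eq_iff[OF ab0(1)] ab0(2) by metis
      then show False using \<open>pt a b \<in> F\<close> F(2) *(2) by auto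
    qed
    ultimately have "line.quotient_of_forms \<phi> U y d N' D' (square_pt ` (F \<inter> P))"
      unfolding line.quotient_of_forms_def using N'(1) D'(1) F(1) by simp
    then show "\<exists>d p q F. line.quotient_of_forms \<phi> U y d p q F" by blast
  qed
qed

lemma git_quotient_flip_action_sel:
  assumes G: "flip_action (\<lambda>k. k ^ 8 = 1) G"
  shows "zariski (git_quotient s V G) = quotient_topology (proj_topology s V) (git_class s V G)"
    and "regular (git_quotient s V G) U =
      {\<phi>. \<phi> \<circ> git_class s V G \<in> regular (proj_space s V) {x \<in> P. git_class s V G x \<in> U}}"
proof -
  have "zariski (proj_space s V) = proj_topology s V" by (simp add: proj_space_def)
  moreover have "subtopology (proj_topology s V) P = proj_topology s V"
    using subtopology_topspace[of "proj_topology s V"] by simp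
  ultimately show "zariski (git_quotient s V G) = quotient_topology (proj_topology s V) (git_class s V G)"
    and "regular (git_quotient s V G) U =
      {\<phi>. \<phi> \<circ> git_class s V G \<in> regular (proj_space s V) {x \<in> P. git_class s V G x \<in> U}}"
    by (simp_all add: git_quotient_def quotient_space_def open_subvariety_def semistable_points_flip_action[OF G])
qed

lemma git_class_eq_iff:
  assumes G: "flip_action (\<lambda>k. k ^ 8 = 1) G" and "(a, b) \<noteq> (0, 0)" "(a', b') \<noteq> (0, 0)"
  shows "git_class s V G (pt a b) = git_class s V G (pt a' b') \<longleftrightarrow> pt a' b' \<in> {pt a b, pt a (- b)}"
proof
  assume "git_class s V G (pt a b) = git_class s V G (pt a' b')"
  then show "pt a' b' \<in> {pt a b, pt a (- b)}" using git_class_flip_action[OF G] assms by auto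
next
  have "(a, - b) \<noteq> (0, 0)" using assms by simp
  note flipped = git_class_flip_action[OF G this]
  assume "pt a' b' \<in> {pt a b, pt a (- b)}"
  then show "git_class s V G (pt a b) = git_class s V G (pt a' b')"
  proof (elim insertE emptyE)
    assume "pt a' b' = pt a (- b)"
    then show ?thesis using flipped git_class_flip_action[OF G assms(2)] by auto
  qed simp
qed

text \<open>GIT classes are the fibres of \<open>square_pt\<close>, so it induces a bijection to the
  line. Both topologies are cofinite, which makes it a homeomorphism, and the regular functions
  correspond by \<open>regular_square_pt\<close>.\<close>

theorem git_quotient_flip_action:
  assumes G: "flip_action (\<lambda>k. k ^ 8 = 1) G"
  shows "isomorphic_spaces (git_quotient s V G) projective_line"
    and "cofinite_topology (zariski (git_quotient s V G))"
    and "points (git_quotient s V G) = git_class s V G ` P"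
    and "infinite (git_class s V G ` P)"
proof -
  let ?\<pi> = "git_class s V G" and ?Q = "git_quotient s V G"
  \<comment> \<open>The choice of a representative is harmless: a class consists of a point and its
    flip, and these have the same square.\<close>
  define h where "h y = square_pt (SOME x. x \<in> y)" for y
  have h_pt: "h (?\<pi> (pt a b)) = square_pt (pt a b)" if ab: "(a, b) \<noteq> (0, 0)" for a b
  proof -
    have "(SOME x. x \<in> ?\<pi> (pt a b)) \<in> ?\<pi> (pt a b)"
      by (rule someI[of _ "pt a b"]) (simp add: git_class_flip_action[OF G ab])
    moreover have "square_pt (pt a (- b)) = square_pt (pt a b)"
      using ab square_pt[of a "- b"] square_pt[of a b] by simp
    ultimately show ?thesis unfolding h_def git_class_flip_action[OF G ab] by auto
  qed
  have h: "h (?\<pi> x) = square_pt x" if "x \<in> P" for x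
    using that h_pt by (auto simp: P_def)
  have \<pi>_iff: "?\<pi> x = ?\<pi> x' \<longleftrightarrow> square_pt x = square_pt x'" if x: "x \<in> P" "x' \<in> P" for x x'
  proof -
    obtain a b a' b' where "x = pt a b" "(a, b) \<noteq> (0, 0)" "x' = pt a' b'" "(a', b') \<noteq> (0, 0)"
      using x unfolding P_def by blast
    then show ?thesis using git_class_eq_iff[OF G, of a b a' b'] square_pt_eq_iff[of a b a' b'] by simp
  qed
  show pts: "points ?Q = ?\<pi> ` P"
    unfolding git_quotient_flip_action_sel(1)[OF G] by simp
  have fibres: "finite {x \<in> topspace (proj_topology s V). ?\<pi> x = y}" for y
  proof (cases "\<exists>x\<in>P. ?\<pi> x = y")
    case True
    then obtain x0 where "x0 \<in> P" "?\<pi> x0 = y" by blast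
    then have "{x \<in> P. ?\<pi> x = y} \<subseteq> {x \<in> P. square_pt x = square_pt x0}" using \<pi>_iff by auto
    then show ?thesis
      unfolding topspace_proj_topology by (rule finite_subset) (rule finite_square_pt_fibre)
  next
    case False
    then have "{x \<in> topspace (proj_topology s V). ?\<pi> x = y} = {}" by auto
    then show ?thesis by (simp only: finite.emptyI)
  qed
  show cofin: "cofinite_topology (zariski ?Q)"
    unfolding git_quotient_flip_action_sel(1)[OF G]
    by (rule cofinite_quotient_topology[OF cofinite_proj_topology fibres])
  show "infinite (?\<pi> ` P)"
  proof
    assume "finite (?\<pi> ` P)"
    then have "finite (\<Union>y\<in>?\<pi> ` P. {x \<in> P. ?\<pi> x = y})"
      by (rule finite_UN_I) (use fibres in simp)
    moreover have "P \<subseteq> (\<Union>y\<in>?\<pi> ` P. {x \<in> P. ?\<pi> x = y})" by blast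
    ultimately show False using infinite_P finite_subset by blast
  qed
  have line_top: "zariski projective_line = proj_topology (*s) UNIV" by (simp add: proj_space_def)
  have bij: "bij_betw h (points ?Q) line.P"
    unfolding bij_betw_def pts
  proof
    show "inj_on h (?\<pi> ` P)" using h \<pi>_iff by (fastforce intro!: inj_onI)
    show "h ` ?\<pi> ` P = line.P"
    proof
      show "h ` ?\<pi> ` P \<subseteq> line.P" using h square_pt_in_P by auto
      show "line.P \<subseteq> h ` ?\<pi> ` P"
      proof
        fix y assume "y \<in> line.P"
        then obtain a b where "(a, b) \<noteq> (0, 0)" "y = square_pt (pt a b)" by (rule square_pt_surj)
        then have "pt a b \<in> P" "y = h (?\<pi> (pt a b))" using pt_in_P h_pt by auto
        then show "y \<in> h ` ?\<pi> ` P" by blast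
      qed
    qed
  qed
  have "homeomorphic_map (zariski ?Q) (zariski projective_line) h"
    unfolding line_top by (rule cofinite_topology_homeomorphic[OF cofin line.cofinite_proj_topology]) (simp add: bij)
  moreover have "\<phi> \<in> regular projective_line U \<longleftrightarrow> \<phi> \<circ> h \<in> regular ?Q {x \<in> points ?Q. h x \<in> U}"
    if U: "openin (zariski projective_line) U" for U \<phi>
  proof -
    have "{x \<in> P. ?\<pi> x \<in> {x \<in> points ?Q. h x \<in> U}} = {x \<in> P. square_pt x \<in> U}"
      unfolding pts using h by auto
    then have "\<phi> \<circ> h \<in> regular ?Q {x \<in> points ?Q. h x \<in> U} \<longleftrightarrow>
        \<phi> \<circ> h \<circ> ?\<pi> \<in> regular (proj_space s V) {x \<in> P. square_pt x \<in> U}"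
      unfolding git_quotient_flip_action_sel(2)[OF G] by simp
    also have "\<dots> \<longleftrightarrow> \<phi> \<in> regular projective_line U"
      by (rule regular_square_pt[symmetric]) (use U h in \<open>simp_all add: line_top\<close>)
    finally show ?thesis ..
  qed
  ultimately show "isomorphic_spaces ?Q projective_line" unfolding isomorphic_spaces_def by blast
qed

text \<open>The groups \<open>G\<close> and \<open>N\<close> may act by different scalars, but both
  move points through the same involution. Orbits of \<open>N\<close> are therefore literally GIT
  classes of \<open>G\<close>, and the quotient of \<open>S\<close> is a subset of the GIT quotient
  with finite complement.\<close>

theorem open_subquotient_flip_action:
  assumes G: "flip_action (\<lambda>k. k ^ 8 = 1) G" and N: "flip_action R N"
    and S: "S \<subseteq> P" "finite (P - S)" and flip: "\<And>a b. pt a b \<in> S \<Longrightarrow> pt a (- b) \<in> S"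
  defines "Y \<equiv> quotient_space (open_subvariety (proj_space s V) S) (orbit_of N)"
  shows "is_open_subvariety Y (git_quotient s V G)"
    and "zariski (git_quotient s V G) closure_of points Y = points (git_quotient s V G)"
    and "points (git_quotient s V G) - points Y = orbit_of N ` (P - S)"
proof -
  let ?\<pi> = "git_class s V G" and ?Q = "git_quotient s V G" and ?T = "proj_topology s V"
  have openS: "openin ?T S" unfolding openin_proj_topology using S by simp
  have orb: "orbit_of N x = ?\<pi> x" if "x \<in> P" for x
    using that orbit_of_flip_action[OF N] git_class_flip_action[OF G] by (auto simp: P_def)
  have zY: "zariski Y = quotient_topology (subtopology ?T S) (orbit_of N)"
    and rY: "regular Y U = {\<phi>. \<phi> \<circ> orbit_of N \<in> regular (proj_space s V) {x \<in> S. orbit_of N x \<in> U}}" for U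
    using S(1) by (simp_all add: Y_def quotient_space_def open_subvariety_def proj_space_def Int_absorb1)
  have ptsY: "points Y = ?\<pi> ` S" unfolding zY using S(1) orb by (auto simp: Int_absorb1)
  note cofin = git_quotient_flip_action(2)[OF G] and ptsQ = git_quotient_flip_action(3)[OF G]
  \<comment> \<open>Saturation of \<open>S\<close>: preimages of subsets of \<open>Y\<close> under
    the two quotient maps coincide, so both the topologies and the regular functions match.\<close>
  have satur: "x \<in> S" if x: "x \<in> P" "?\<pi> x \<in> ?\<pi> ` S" for x
  proof -
    obtain x' where x': "x' \<in> S" "?\<pi> x = ?\<pi> x'" using x(2) by blast
    obtain a b a' b' where ab: "x = pt a b" "(a, b) \<noteq> (0, 0)" "x' = pt a' b'" "(a', b') \<noteq> (0, 0)"
      using x(1) x'(1) S(1) unfolding P_def by blast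
    have "pt a b \<in> {pt a' b', pt a' (- b')}"
      using git_class_eq_iff[OF G ab(4,2)] x'(2) ab by simp
    then show ?thesis using x'(1) flip[of a' b'] ab by auto
  qed
  have diff: "points ?Q - points Y = ?\<pi> ` (P - S)"
    unfolding ptsQ ptsY using satur S(1) by blast
  then show "points ?Q - points Y = orbit_of N ` (P - S)" using orb by auto
  have fin: "finite (points ?Q - points Y)" unfolding diff using S(2) by simp
  have sub: "points Y \<subseteq> points ?Q" unfolding ptsY ptsQ using S(1) by blast
  have openY: "openin (zariski ?Q) (points Y)" using cofin sub fin unfolding cofinite_topology_def by blast
  have pre: "{x \<in> P. ?\<pi> x \<in> U} = {x \<in> S. orbit_of N x \<in> U}" if "U \<subseteq> points Y" for U
    using that satur S(1) orb unfolding ptsY by auto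
  have "zariski Y = subtopology (zariski ?Q) (points Y)"
  proof (rule topology_eq[THEN iffD2], intro allI)
    fix U
    have img: "orbit_of N ` topspace (subtopology ?T S) = points Y" unfolding zY by simp
    have tops: "topspace (subtopology ?T S) = S" using S(1) by auto
    have "openin (zariski Y) U \<longleftrightarrow> U \<subseteq> points Y \<and> openin (subtopology ?T S) {x \<in> S. orbit_of N x \<in> U}"
      using img tops unfolding zY openin_quotient_topology by simp
    also have "\<dots> \<longleftrightarrow> U \<subseteq> points Y \<and> openin ?T {x \<in> P. ?\<pi> x \<in> U}"
      using pre[of U] openin_open_subtopology[OF openS] by auto
    also have "\<dots> \<longleftrightarrow> openin (subtopology (zariski ?Q) (points Y)) U"
      unfolding openin_open_subtopology[OF openY] using sub ptsQ
      unfolding git_quotient_flip_action_sel(1)[OF G] openin_quotient_topology by auto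
    finally show "openin (zariski Y) U \<longleftrightarrow> openin (subtopology (zariski ?Q) (points Y)) U" .
  qed
  moreover have "regular Y U = regular ?Q U" if U: "openin (zariski Y) U" for U
  proof -
    have Usub: "U \<subseteq> points Y" using U openin_subset by blast
    have "openin ?T {x \<in> S. orbit_of N x \<in> U}"
    proof -
      have "topspace (subtopology ?T S) = S" using S(1) by auto
      then have "openin (subtopology ?T S) {x \<in> S. orbit_of N x \<in> U}"
        using U unfolding zY openin_quotient_topology by auto
      then show ?thesis unfolding openin_open_subtopology[OF openS] by blast
    qed
    then have "\<phi> \<circ> orbit_of N \<in> regular (proj_space s V) {x \<in> S. orbit_of N x \<in> U} \<longleftrightarrow>
        \<phi> \<circ> ?\<pi> \<in> regular (proj_space s V) {x \<in> S. orbit_of N x \<in> U}" for \<phi>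
      by (rule regular_cong) (use S(1) orb in auto)
    then show ?thesis unfolding rY git_quotient_flip_action_sel(2)[OF G] pre[OF Usub] by simp
  qed
  ultimately show "is_open_subvariety Y ?Q" unfolding is_open_subvariety_def using openY by blast
  show "zariski ?Q closure_of points Y = points ?Q"
  proof
    show "points ?Q \<subseteq> zariski ?Q closure_of points Y"
    proof
      fix x assume x: "x \<in> points ?Q"
      have "\<exists>y\<in>points Y. y \<in> U" if "x \<in> U" "openin (zariski ?Q) U" for U
      proof (rule ccontr)
        assume "\<not> ?thesis"
        then have "points ?Q \<subseteq> (points ?Q - U) \<union> (points ?Q - points Y)" by blast
        moreover have "finite (points ?Q - U)" using cofin that unfolding cofinite_topology_def by blast
        ultimately have "finite (points ?Q)" using fin by (meson finite_UnI finite_subset)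
        then show False using git_quotient_flip_action(4)[OF G] ptsQ by simp
      qed
      then show "x \<in> zariski ?Q closure_of points Y" unfolding in_closure_of using x by blast
    qed
  qed (rule closure_of_subset_topspace)
qed

end

section \<open>The invariant cubic forms\<close>

lemma sum_atLeastAtMost_7: "(\<Sum>i\<in>{1..7::nat}. f i) = f 1 + f 2 + f 3 + f 4 + f 5 + f 6 + f 7"
proof -
  have "{1..7::nat} = {1, 2, 3, 4, 5, 6, 7}" by auto
  then show ?thesis by (simp add: add.assoc)
qed

lemma ball_atLeastAtMost_7: "(\<forall>i\<in>{1..7::nat}. Q i) \<longleftrightarrow> Q 1 \<and> Q 2 \<and> Q 3 \<and> Q 4 \<and> Q 5 \<and> Q 6 \<and> Q 7"
proof -
  have "{1..7::nat} = {1, 2, 3, 4, 5, 6, 7}" by auto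
  then show ?thesis by simp
qed

lemma coord7_simps:
  "coord7 x 1 = x $ 1" "coord7 x 2 = x $ 2" "coord7 x 3 = x $ 3" "coord7 x 4 = x $ 4"
  "coord7 x 5 = x $ 5" "coord7 x 6 = x $ 6"
  "coord7 x 7 = - (x $ 1 + x $ 2 + x $ 3 + x $ 4 + x $ 5 + x $ 6)"
  by (simp_all add: coord7_def sum_6)

lemma coord7_add: "coord7 (x + y) i = coord7 x i + coord7 y i"
  by (simp add: coord7_def sum.distrib)

lemma coord7_scale: "coord7 (c *s x) i = c * coord7 x i"
  by (simp add: coord7_def sum_distrib_left)

lemma sum_coord7: "(\<Sum>i\<in>{1..7}. coord7 x i) = 0"
  by (simp only: sum_atLeastAtMost_7 coord7_simps) simp

lemma coord7_eqI: "(\<And>i. i \<in> {1..7} \<Longrightarrow> coord7 x i = coord7 y i) \<Longrightarrow> x = y"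
proof -
  assume *: "\<And>i. i \<in> {1..7} \<Longrightarrow> coord7 x i = coord7 y i"
  have "coord7 x 1 = coord7 y 1" "coord7 x 2 = coord7 y 2" "coord7 x 3 = coord7 y 3"
    "coord7 x 4 = coord7 y 4" "coord7 x 5 = coord7 y 5" "coord7 x 6 = coord7 y 6" by (rule *; simp)+
  then show "x = y" unfolding vec_eq_iff forall_6 coord7_simps by blast
qed

text \<open>The projections of the seven unit vectors to the hyperplane of sum zero. The guard on 7
  is needed because \<open>of_nat 7\<close> is 1 in the index type.\<close>

definition basis7 :: "nat \<Rightarrow> complex^6"
  where "basis7 i = (\<chi> k. (if i \<noteq> 7 \<and> of_nat i = k then 1 else 0) - 1 / 7)"

lemma coord7_basis7:
  assumes "i \<in> {1..7}" "j \<in> {1..7}"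
  shows "coord7 (basis7 i) j = (if i = j then 1 else 0) - 1 / 7"
proof -
  have "\<forall>i\<in>{1..7}. \<forall>j\<in>{1..7}. coord7 (basis7 i) j = (if i = j then 1 else 0) - 1 / 7"
    unfolding ball_atLeastAtMost_7 coord7_simps by (simp add: basis7_def)
  with assms show ?thesis by blast
qed

lemma coord7_sum: "coord7 (\<Sum>i\<in>A. f i) j = (\<Sum>i\<in>A. coord7 (f i) j)"
proof (induction A rule: infinite_finite_induct)
  case (insert x F)
  then show ?case by (simp add: coord7_add)
qed (simp_all add: coord7_def)

text \<open>Coordinates of sum zero are determined by their coefficients with respect to the seven vectors
  \<open>basis7\<close>, whose sum is zero.\<close>

lemma coord7_combination:
  assumes sum0: "(\<Sum>i\<in>{1..7}. c i) = 0" and j: "j \<in> {1..7}"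
  shows "coord7 (\<Sum>i\<in>{1..7}. c i *s basis7 i) j = c j"
proof -
  have "coord7 (\<Sum>i\<in>{1..7}. c i *s basis7 i) j = (\<Sum>i\<in>{1..7}. c i * ((if i = j then 1 else 0) - 1 / 7))"
    unfolding coord7_sum coord7_scale using j by (intro sum.cong refl) (simp add: coord7_basis7)
  also have "\<dots> = (\<Sum>i\<in>{1..7}. if i = j then c i else 0) - (\<Sum>i\<in>{1..7}. c i) / 7"
    unfolding sum_divide_distrib sum_subtractf[symmetric] by (intro sum.cong refl) (simp add: algebra_simps)
  also have "\<dots> = c j" using j sum0 by simp
  finally show ?thesis .
qed

lemma basis7_expansion: "x = (\<Sum>i\<in>{1..7}. coord7 x i *s basis7 i)"
  by (rule coord7_eqI) (simp only: coord7_combination[OF sum_coord7])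

definition swap_gen :: "nat \<Rightarrow> nat" where "swap_gen = cycle_of_list [1,2] \<circ> cycle_of_list [3,6]"
definition cycle_gen :: "nat \<Rightarrow> nat" where "cycle_gen = cycle_of_list [1,2,3,4,5,6,7]"

lemma gen_simps [simp]:
  "swap_gen 1 = 2" "swap_gen 2 = 1" "swap_gen 3 = 6" "swap_gen 4 = 4" "swap_gen 5 = 5" "swap_gen 6 = 3" "swap_gen 7 = 7"
  "cycle_gen 1 = 2" "cycle_gen 2 = 3" "cycle_gen 3 = 4" "cycle_gen 4 = 5" "cycle_gen 5 = 6" "cycle_gen 6 = 7" "cycle_gen 7 = 1"
  by (simp_all add: swap_gen_def cycle_gen_def Transposition.transpose_def)

lemmas gen_Suc_simps [simp] = gen_simps[unfolded One_nat_def]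

lemma gen_permutes: "swap_gen permutes {1..7}" "cycle_gen permutes {1..7}"
proof -
  have "cycle_of_list [1,2::nat] permutes {1..7}" "cycle_of_list [3,6::nat] permutes {1..7}"
    "cycle_of_list [1,2,3,4,5,6,7::nat] permutes {1..7}"
    by (rule permutes_subset[OF cycle_permutes]; simp)+
  then show "swap_gen permutes {1..7}" "cycle_gen permutes {1..7}"
    unfolding swap_gen_def cycle_gen_def by (auto intro: permutes_compose)
qed

lemma L27_perms_gen: "L27_perms = generate (sym_group 7) {swap_gen, cycle_gen}"
  by (simp add: L27_perms_def swap_gen_def cycle_gen_def)

lemma gen_in_L27_perms: "swap_gen \<in> L27_perms" "cycle_gen \<in> L27_perms"
  unfolding L27_perms_gen by (auto intro: generate.incl)

lemma L27_perms_permutes: "\<sigma> \<in> L27_perms \<Longrightarrow> \<sigma> permutes {1..7}"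
proof -
  assume "\<sigma> \<in> L27_perms"
  moreover have "{swap_gen, cycle_gen} \<subseteq> carrier (sym_group 7)" using gen_permutes by (simp add: sym_group_carrier)
  ultimately have "\<sigma> \<in> carrier (sym_group 7)"
    unfolding L27_perms_gen using group.generate_in_carrier[OF sym_group_is_group] by blast
  then show ?thesis by (simp add: sym_group_carrier)
qed

lemma L27_perms_induct:
  assumes "\<sigma> \<in> L27_perms" and one: "Q id" and gen: "Q swap_gen" "Q cycle_gen"
    and inv: "\<And>\<sigma>. \<sigma> permutes {1..7} \<Longrightarrow> Q \<sigma> \<Longrightarrow> Q (inv_into UNIV \<sigma>)"
    and comp: "\<And>\<sigma> \<tau>. Q \<sigma> \<Longrightarrow> Q \<tau> \<Longrightarrow> Q (\<sigma> \<circ> \<tau>)"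
  shows "Q \<sigma>"
  using assms(1) unfolding L27_perms_gen
proof induction
  case one
  then show ?case using assms(2) by (simp add: sym_group_one id_def)
next
  case (incl h)
  then show ?case using gen by blast
next
  case (inv h)
  then have "h \<in> carrier (sym_group 7)" using gen_permutes by (auto simp: sym_group_carrier)
  then show ?case using inv gen assms(5)[of h] by (auto simp: sym_group_inv_equality sym_group_carrier)
next
  case (eng h1 h2)
  then show ?case using comp[of h1 h2] by (simp add: sym_group_mult comp_def)
qed

definition perm_matrix :: "(nat \<Rightarrow> nat) \<Rightarrow> complex^6^6"
  where "perm_matrix \<sigma> = matrix (\<lambda>x. \<Sum>i\<in>{1..7}. coord7 x i *s basis7 (\<sigma> i))"

lemma matrix_works_complex:
  fixes f :: "complex^'n \<Rightarrow> complex^'m"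
  assumes "\<And>x y. f (x + y) = f x + f y" "\<And>c x. f (c *s x) = c *s f x"
  shows "matrix f *v x = f x"
proof -
  have "Vector_Spaces.linear (*s) (*s) f" by unfold_locales (simp_all add: assms)
  then show ?thesis by (rule matrix_works)
qed

lemma perm_matrix: "perm_matrix \<sigma> *v x = (\<Sum>i\<in>{1..7}. coord7 x i *s basis7 (\<sigma> i))"
  unfolding perm_matrix_def
  by (rule matrix_works_complex)
    (simp_all add: coord7_add coord7_scale vec.scale_left_distrib sum.distrib vec.scale_sum_right)

lemma coord7_perm_matrix:
  assumes \<sigma>: "\<sigma> permutes {1..7}" and i: "i \<in> {1..7}"
  shows "coord7 (perm_matrix \<sigma> *v x) (\<sigma> i) = coord7 x i"
proof -
  have bij: "bij_betw \<sigma> {1..7} {1..7}" using \<sigma> by (rule permutes_imp_bij)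
  have inv: "inv_into UNIV \<sigma> (\<sigma> j) = j" for j using permutes_inverses(2)[OF \<sigma>] .
  define c where "c j = coord7 x (inv_into UNIV \<sigma> j)" for j
  have c: "c (\<sigma> j) = coord7 x j" for j by (simp add: c_def inv)
  have "(\<Sum>j\<in>{1..7}. c j *s basis7 j) = (\<Sum>j\<in>{1..7}. c (\<sigma> j) *s basis7 (\<sigma> j))"
    by (rule sum.reindex_bij_betw[OF bij, symmetric])
  then have eq: "perm_matrix \<sigma> *v x = (\<Sum>j\<in>{1..7}. c j *s basis7 j)" unfolding perm_matrix c by simp
  have "(\<Sum>j\<in>{1..7}. c j) = (\<Sum>j\<in>{1..7}. c (\<sigma> j))" by (rule sum.reindex_bij_betw[OF bij, symmetric])
  then have "(\<Sum>j\<in>{1..7}. c j) = 0" unfolding c by (simp only: sum_coord7)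
  moreover have "\<sigma> i \<in> {1..7}" using permutes_in_image[OF \<sigma>] i by blast
  ultimately show ?thesis unfolding eq by (simp only: coord7_combination c)
qed

lemma perm_matrix_in_L27: "\<sigma> \<in> L27_perms \<Longrightarrow> perm_matrix \<sigma> \<in> L27"
  unfolding L27_def using coord7_perm_matrix[OF L27_perms_permutes] by blast

lemma L27_iff_perm_matrix: "A \<in> L27 \<longleftrightarrow> (\<exists>\<sigma>\<in>L27_perms. A = perm_matrix \<sigma>)"
proof
  assume "A \<in> L27"
  then obtain \<sigma> where \<sigma>: "\<sigma> \<in> L27_perms" "\<And>x i. i \<in> {1..7} \<Longrightarrow> coord7 (A *v x) (\<sigma> i) = coord7 x i"
    unfolding L27_def by blast
  have p: "\<sigma> permutes {1..7}" using \<sigma>(1) by (rule L27_perms_permutes)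
  have "A *v x = perm_matrix \<sigma> *v x" for x
  proof (rule coord7_eqI)
    fix j :: nat assume "j \<in> {1..7}"
    then obtain i where "j = \<sigma> i" "i \<in> {1..7}" using permutes_image[OF p] by blast
    then show "coord7 (A *v x) j = coord7 (perm_matrix \<sigma> *v x) j" using \<sigma>(2) coord7_perm_matrix[OF p] by simp
  qed
  then have "A = perm_matrix \<sigma>" by (simp add: matrix_eq)
  then show "\<exists>\<sigma>\<in>L27_perms. A = perm_matrix \<sigma>" using \<sigma>(1) by blast
qed (auto intro: perm_matrix_in_L27)

lemma perm_matrix_basis7:
  assumes \<sigma>: "\<sigma> permutes {1..7}" and i: "i \<in> {1..7}"
  shows "perm_matrix \<sigma> *v basis7 i = basis7 (\<sigma> i)"
proof (rule coord7_eqI)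
  fix j :: nat assume "j \<in> {1..7}"
  then obtain k where k: "j = \<sigma> k" "k \<in> {1..7}" using permutes_image[OF \<sigma>] by blast
  have "\<sigma> i \<in> {1..7}" "\<sigma> k \<in> {1..7}" using permutes_in_image[OF \<sigma>] i k by blast+
  then show "coord7 (perm_matrix \<sigma> *v basis7 i) j = coord7 (basis7 (\<sigma> i)) j"
    unfolding k(1) coord7_perm_matrix[OF \<sigma> k(2)] using i k(2) permutes_inj[OF \<sigma>]
    by (simp add: coord7_basis7 inj_eq)
qed

definition invariant_symmetric :: "(nat \<Rightarrow> nat \<Rightarrow> nat \<Rightarrow> complex) \<Rightarrow> bool"
  where "invariant_symmetric T \<longleftrightarrow>
    (\<forall>i j k. T i j k = T j i k) \<and> (\<forall>i j k. T i j k = T i k j) \<and>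
    (\<forall>i\<in>{1..7}. \<forall>j\<in>{1..7}. \<forall>k\<in>{1..7}. T (swap_gen i) (swap_gen j) (swap_gen k) = T i j k) \<and>
    (\<forall>i\<in>{1..7}. \<forall>j\<in>{1..7}. \<forall>k\<in>{1..7}. T (cycle_gen i) (cycle_gen j) (cycle_gen k) = T i j k)"

text \<open>The group has four orbits on unordered triples of Fano points with repetition: three
  equal points, exactly two equal points, three points on a line, three points not on a line. They
  are represented by 111, 112, 124 and 123.\<close>

lemma invariant_tensor:
  fixes T :: "nat \<Rightarrow> nat \<Rightarrow> nat \<Rightarrow> complex"
  assumes T: "invariant_symmetric T"
  shows "T 1 1 3 = T 1 1 2 \<and> T 1 1 4 = T 1 1 2 \<and> T 1 1 5 = T 1 1 2 \<and> T 1 1 6 = T 1 1 2 \<and> T 1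
    1 7 = T 1 1 2 \<and> T 1 2 2 = T 1 1 2 \<and> T 1 2 5 = T 1 2 3 \<and> T 1 2 6 = T 1 2 3 \<and> T 1 2 7 = T 1
    2 3 \<and> T 1 3 3 = T 1 1 2 \<and> T 1 3 4 = T 1 2 3 \<and> T 1 3 5 = T 1 2 3 \<and> T 1 3 6 = T 1 2 3 \<and>
    T 1 3 7 = T 1 2 4 \<and> T 1 4 4 = T 1 1 2 \<and> T 1 4 5 = T 1 2 3 \<and> T 1 4 6 = T 1 2 3 \<and> T 1 4 7 =
    T 1 2 3 \<and> T 1 5 5 = T 1 1 2 \<and> T 1 5 6 = T 1 2 4 \<and> T 1 5 7 = T 1 2 3 \<and> T 1 6 6 = T 1 1 2
    \<and> T 1 6 7 = T 1 2 3 \<and> T 1 7 7 = T 1 1 2 \<and> T 2 2 2 = T 1 1 1 \<and> T 2 2 3 = T 1 1 2 \<and> T 2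
    2 4 = T 1 1 2 \<and> T 2 2 5 = T 1 1 2 \<and> T 2 2 6 = T 1 1 2 \<and> T 2 2 7 = T 1 1 2 \<and> T 2 3 3 = T 1
    1 2 \<and> T 2 3 4 = T 1 2 3 \<and> T 2 3 5 = T 1 2 4 \<and> T 2 3 6 = T 1 2 3 \<and> T 2 3 7 = T 1 2 3 \<and>
    T 2 4 4 = T 1 1 2 \<and> T 2 4 5 = T 1 2 3 \<and> T 2 4 6 = T 1 2 3 \<and> T 2 4 7 = T 1 2 3 \<and> T 2 5 5 =
    T 1 1 2 \<and> T 2 5 6 = T 1 2 3 \<and> T 2 5 7 = T 1 2 3 \<and> T 2 6 6 = T 1 1 2 \<and> T 2 6 7 = T 1 2 4
    \<and> T 2 7 7 = T 1 1 2 \<and> T 3 3 3 = T 1 1 1 \<and> T 3 3 4 = T 1 1 2 \<and> T 3 3 5 = T 1 1 2 \<and> T 3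
    3 6 = T 1 1 2 \<and> T 3 3 7 = T 1 1 2 \<and> T 3 4 4 = T 1 1 2 \<and> T 3 4 5 = T 1 2 3 \<and> T 3 4 6 = T 1
    2 4 \<and> T 3 4 7 = T 1 2 3 \<and> T 3 5 5 = T 1 1 2 \<and> T 3 5 6 = T 1 2 3 \<and> T 3 5 7 = T 1 2 3 \<and>
    T 3 6 6 = T 1 1 2 \<and> T 3 6 7 = T 1 2 3 \<and> T 3 7 7 = T 1 1 2 \<and> T 4 4 4 = T 1 1 1 \<and> T 4 4 5 =
    T 1 1 2 \<and> T 4 4 6 = T 1 1 2 \<and> T 4 4 7 = T 1 1 2 \<and> T 4 5 5 = T 1 1 2 \<and> T 4 5 6 = T 1 2 3
    \<and> T 4 5 7 = T 1 2 4 \<and> T 4 6 6 = T 1 1 2 \<and> T 4 6 7 = T 1 2 3 \<and> T 4 7 7 = T 1 1 2 \<and> T 5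
    5 5 = T 1 1 1 \<and> T 5 5 6 = T 1 1 2 \<and> T 5 5 7 = T 1 1 2 \<and> T 5 6 6 = T 1 1 2 \<and> T 5 6 7 = T 1
    2 3 \<and> T 5 7 7 = T 1 1 2 \<and> T 6 6 6 = T 1 1 1 \<and> T 6 6 7 = T 1 1 2 \<and> T 6 7 7 = T 1 1 2 \<and>
    T 7 7 7 = T 1 1 1"
proof -
  have sym: "T i j k = T j i k" "T i j k = T i k j" for i j k
    using T unfolding invariant_symmetric_def by blast+
  have a: "T (swap_gen i) (swap_gen j) (swap_gen k) = T i j k"
    and b: "T (cycle_gen i) (cycle_gen j) (cycle_gen k) = T i j k"
    if "i \<in> {1..7}" "j \<in> {1..7}" "k \<in> {1..7}" for i j k
    using T that unfolding invariant_symmetric_def by blast+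
  \<comment> \<open>A copy under another name, so that the rewriting to sorted indices
    terminates.\<close>
  define T0 where "T0 = T"
  have sort: "T i j k = T0 (min (min i j) k) (max (min i j) (min (max i j) k)) (max (max i j) k)" for i j k
  proof -
    have 1: "T i k j = T i j k" by (rule sym(2))
    have 2: "T j i k = T i j k" by (rule sym(1))
    have 3: "T j k i = T i j k" by (rule trans[OF sym(2) 2])
    have 4: "T k i j = T i j k" by (rule trans[OF sym(1) 1])
    have 5: "T k j i = T i j k" by (rule trans[OF sym(2) 4])
    note 1 2 3 4 5
    then show ?thesis unfolding T0_def min_def max_def by simp
  qed
  \<comment> \<open>There are 84 sorted triples in four orbits. These 80 instances of generator
    invariance link each orbit together, as a spanning forest.\<close>
  note eqs = b[of 1 1 1] b[of 2 2 2] b[of 3 3 3] a[of 3 3 3] b[of 4 4 4] b[of 6 6 6] b[of 1 1 2] a[of 1 1 2]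
      b[of 2 2 3] a[of 2 2 3] b[of 1 2 2] b[of 3 3 4] a[of 3 3 4] b[of 1 1 6] b[of 2 3 3] a[of 2 3 3]
      b[of 4 4 5] b[of 4 6 6] b[of 2 2 7] a[of 2 2 7] b[of 3 4 4] a[of 3 4 4] b[of 1 6 6] b[of 5 5 6]
      a[of 5 5 6] b[of 1 3 3] a[of 1 3 3] b[of 4 5 5] b[of 4 4 6] b[of 2 7 7] a[of 2 7 7] a[of 6 6 7]
      a[of 2 4 4] b[of 2 6 6] b[of 5 6 6] a[of 5 6 6] b[of 1 1 3] a[of 1 1 3] b[of 1 4 4] b[of 3 7 7]
      b[of 2 5 5] a[of 2 5 5] b[of 1 1 4] b[of 3 6 6] a[of 3 6 6] a[of 2 2 5] b[of 3 3 6] b[of 1 2 4]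
      b[of 2 3 5] a[of 2 3 5] b[of 3 4 6] b[of 1 5 6] b[of 2 6 7] b[of 1 2 3] a[of 1 2 3] b[of 2 3 4]
      a[of 2 3 4] b[of 1 2 6] b[of 3 4 5] b[of 1 4 6] b[of 2 3 7] a[of 2 3 7] b[of 4 5 6] b[of 2 5 7]
      a[of 2 5 7] b[of 1 3 4] a[of 1 3 4] b[of 1 6 7] a[of 5 6 7] b[of 1 3 6] a[of 1 3 6] b[of 2 4 5]
      a[of 2 4 5] b[of 2 4 7] a[of 2 4 7] b[of 2 3 6] b[of 3 5 6] b[of 1 4 5] b[of 1 4 7] b[of 2 5 6]
  note eqs = eqs[simplified sort, simplified]
  show ?thesis by (simp add: sort eqs)
qed

definition power_sum :: form
  where "power_sum x = (\<Sum>i\<in>{1..7}. coord7 x i ^ 3)"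

text \<open>The seven lines of the Fano plane are the translates of \<open>{1, 2, 4}\<close> modulo 7.\<close>

definition line_sum :: form
  where "line_sum x = coord7 x 1 * coord7 x 2 * coord7 x 4 + coord7 x 2 * coord7 x 3 * coord7 x 5
    + coord7 x 3 * coord7 x 4 * coord7 x 6 + coord7 x 4 * coord7 x 5 * coord7 x 7
    + coord7 x 5 * coord7 x 6 * coord7 x 1 + coord7 x 6 * coord7 x 7 * coord7 x 2
    + coord7 x 7 * coord7 x 1 * coord7 x 3"

text \<open>In power sums, the sum of X_i^2 X_j over i \<noteq> j is p2 p1 - p3, and 6 e3 = p1^3 - 3
  p1 p2 + 2 p3. Distinct triples all enter with \<open>T 1 2 3\<close> first, and the lines are then
  corrected by the difference. When the coordinates sum to zero, only the sum of cubes and the sum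
  over lines survive.\<close>

lemma symmetric_cubic_expansion:
  fixes T :: "nat \<Rightarrow> nat \<Rightarrow> nat \<Rightarrow> complex" and X :: "nat \<Rightarrow> complex"
  assumes T: "invariant_symmetric T"
  shows "(\<Sum>i\<in>{1..7}. \<Sum>j\<in>{1..7}. \<Sum>k\<in>{1..7}. X i * (X j * (X k * T i j k))) =
    T 1 1 1 * (X 1 ^ 3 + X 2 ^ 3 + X 3 ^ 3 + X 4 ^ 3 + X 5 ^ 3 + X 6 ^ 3 + X 7 ^ 3)
    + 3 * T 1 1 2 * ((X 1 ^ 2 + X 2 ^ 2 + X 3 ^ 2 + X 4 ^ 2 + X 5 ^ 2 + X 6 ^ 2 + X 7 ^ 2) * (X 1 + X 2 + X 3 + X 4 + X 5 + X 6 + X 7)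
      - (X 1 ^ 3 + X 2 ^ 3 + X 3 ^ 3 + X 4 ^ 3 + X 5 ^ 3 + X 6 ^ 3 + X 7 ^ 3))
    + T 1 2 3 * ((X 1 + X 2 + X 3 + X 4 + X 5 + X 6 + X 7) ^ 3
      - 3 * (X 1 ^ 2 + X 2 ^ 2 + X 3 ^ 2 + X 4 ^ 2 + X 5 ^ 2 + X 6 ^ 2 + X 7 ^ 2) * (X 1 + X 2 + X 3 + X 4 + X 5 + X 6 + X 7)
      + 2 * (X 1 ^ 3 + X 2 ^ 3 + X 3 ^ 3 + X 4 ^ 3 + X 5 ^ 3 + X 6 ^ 3 + X 7 ^ 3))
    + 6 * (T 1 2 4 - T 1 2 3) * (X 1 * X 2 * X 4 + X 2 * X 3 * X 5 + X 3 * X 4 * X 6 + X 4 * X 5 * X 7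
      + X 5 * X 6 * X 1 + X 6 * X 7 * X 2 + X 7 * X 1 * X 3)"
proof -
  have sym: "T i j k = T j i k" "T i j k = T i k j" for i j k
    using T unfolding invariant_symmetric_def by blast+
  note tensor = invariant_tensor[OF T]
  define \<alpha> \<beta> \<gamma> \<delta> where vals: "\<alpha> = T 1 1 1" "\<beta> = T 1 1 2" "\<gamma> = T 1 2 4" "\<delta> = T 1 2 3"
  define s where "s = X 1 + X 2 + X 3 + X 4 + X 5 + X 6 + X 7"
  define T0 where "T0 = T"
  have sort: "T i j k = T0 (min (min i j) k) (max (min i j) (min (max i j) k)) (max (max i j) k)" for i j k
  proof -
    have 1: "T i k j = T i j k" by (rule sym(2))
    have 2: "T j i k = T i j k" by (rule sym(1))
    have 3: "T j k i = T i j k" by (rule trans[OF sym(2) 2])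
    have 4: "T k i j = T i j k" by (rule trans[OF sym(1) 1])
    have 5: "T k j i = T i j k" by (rule trans[OF sym(2) 4])
    note 1 2 3 4 5
    then show ?thesis unfolding T0_def min_def max_def by simp
  qed
  note tensor = tensor[folded T0_def] vals[folded T0_def, symmetric]
  \<comment> \<open>Contracting one index first keeps the polynomials small. In \<open>S i j\<close>
    with distinct indices, \<gamma> multiplies the third point of the line through them.\<close>
  define S where "S i j = (\<Sum>k\<in>{1..7}. X k * T i j k)" for i j
  have S_sym: "S i j = S j i" for i j unfolding S_def sym(1)[of i j] ..
  have S: "S 1 1 = \<alpha> * X 1 + \<beta> * (s - X 1)"
    "S 1 2 = \<beta> * (X 1 + X 2) + \<gamma> * X 4 + \<delta> * (s - X 1 - X 2 - X 4)"
    "S 1 3 = \<beta> * (X 1 + X 3) + \<gamma> * X 7 + \<delta> * (s - X 1 - X 3 - X 7)"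
    "S 1 4 = \<beta> * (X 1 + X 4) + \<gamma> * X 2 + \<delta> * (s - X 1 - X 4 - X 2)"
    "S 1 5 = \<beta> * (X 1 + X 5) + \<gamma> * X 6 + \<delta> * (s - X 1 - X 5 - X 6)"
    "S 1 6 = \<beta> * (X 1 + X 6) + \<gamma> * X 5 + \<delta> * (s - X 1 - X 6 - X 5)"
    "S 1 7 = \<beta> * (X 1 + X 7) + \<gamma> * X 3 + \<delta> * (s - X 1 - X 7 - X 3)"
    "S 2 2 = \<alpha> * X 2 + \<beta> * (s - X 2)"
    "S 2 3 = \<beta> * (X 2 + X 3) + \<gamma> * X 5 + \<delta> * (s - X 2 - X 3 - X 5)"
    "S 2 4 = \<beta> * (X 2 + X 4) + \<gamma> * X 1 + \<delta> * (s - X 2 - X 4 - X 1)"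
    "S 2 5 = \<beta> * (X 2 + X 5) + \<gamma> * X 3 + \<delta> * (s - X 2 - X 5 - X 3)"
    "S 2 6 = \<beta> * (X 2 + X 6) + \<gamma> * X 7 + \<delta> * (s - X 2 - X 6 - X 7)"
    "S 2 7 = \<beta> * (X 2 + X 7) + \<gamma> * X 6 + \<delta> * (s - X 2 - X 7 - X 6)"
    "S 3 3 = \<alpha> * X 3 + \<beta> * (s - X 3)"
    "S 3 4 = \<beta> * (X 3 + X 4) + \<gamma> * X 6 + \<delta> * (s - X 3 - X 4 - X 6)"
    "S 3 5 = \<beta> * (X 3 + X 5) + \<gamma> * X 2 + \<delta> * (s - X 3 - X 5 - X 2)"
    "S 3 6 = \<beta> * (X 3 + X 6) + \<gamma> * X 4 + \<delta> * (s - X 3 - X 6 - X 4)"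
    "S 3 7 = \<beta> * (X 3 + X 7) + \<gamma> * X 1 + \<delta> * (s - X 3 - X 7 - X 1)"
    "S 4 4 = \<alpha> * X 4 + \<beta> * (s - X 4)"
    "S 4 5 = \<beta> * (X 4 + X 5) + \<gamma> * X 7 + \<delta> * (s - X 4 - X 5 - X 7)"
    "S 4 6 = \<beta> * (X 4 + X 6) + \<gamma> * X 3 + \<delta> * (s - X 4 - X 6 - X 3)"
    "S 4 7 = \<beta> * (X 4 + X 7) + \<gamma> * X 5 + \<delta> * (s - X 4 - X 7 - X 5)"
    "S 5 5 = \<alpha> * X 5 + \<beta> * (s - X 5)"
    "S 5 6 = \<beta> * (X 5 + X 6) + \<gamma> * X 1 + \<delta> * (s - X 5 - X 6 - X 1)"
    "S 5 7 = \<beta> * (X 5 + X 7) + \<gamma> * X 4 + \<delta> * (s - X 5 - X 7 - X 4)"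
    "S 6 6 = \<alpha> * X 6 + \<beta> * (s - X 6)"
    "S 6 7 = \<beta> * (X 6 + X 7) + \<gamma> * X 2 + \<delta> * (s - X 6 - X 7 - X 2)"
    "S 7 7 = \<alpha> * X 7 + \<beta> * (s - X 7)"
    unfolding S_def sum_atLeastAtMost_7 s_def
    by (simp_all only: sort) (simp_all add: tensor algebra_simps del: One_nat_def)
  have "(\<Sum>i\<in>{1..7}. \<Sum>j\<in>{1..7}. \<Sum>k\<in>{1..7}. X i * (X j * (X k * T i j k))) = (\<Sum>i\<in>{1..7}. \<Sum>j\<in>{1..7}. X i * X j * S i j)"
    unfolding S_def sum_distrib_left by (simp only: mult.assoc)
  also have "\<dots> = X 1 ^ 2 * S 1 1 + X 2 ^ 2 * S 2 2 + X 3 ^ 2 * S 3 3 + X 4 ^ 2 * S 4 4 + X 5 ^ 2 * S 5 5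
      + X 6 ^ 2 * S 6 6 + X 7 ^ 2 * S 7 7 + 2 * (X 1 * X 2 * S 1 2 + X 1 * X 3 * S 1 3 + X 1 * X 4 * S 1 4 + X 1 * X 5 * S 1 5 + X 1 * X 6 * S 1 6 + X 1 * X 7 * S 1 7 + X 2 * X 3 * S 2 3 + X 2 * X 4 * S 2 4 + X 2 * X 5 * S 2 5 + X 2 * X 6 * S 2 6 + X 2 * X 7 * S 2 7 + X 3 * X 4 * S 3 4 + X 3 * X 5 * S 3 5 + X 3 * X 6 * S 3 6 + X 3 * X 7 * S 3 7 + X 4 * X 5 * S 4 5 + X 4 * X 6 * S 4 6 + X 4 * X 7 * S 4 7 + X 5 * X 6 * S 5 6 + X 5 * X 7 * S 5 7 + X 6 * X 7 * S 6 7)"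
    unfolding sum_atLeastAtMost_7
    unfolding S_sym[of 2 1] S_sym[of 3 1] S_sym[of 4 1] S_sym[of 5 1] S_sym[of 6 1] S_sym[of 7 1] S_sym[of 3 2] S_sym[of 4 2] S_sym[of 5 2] S_sym[of 6 2] S_sym[of 7 2] S_sym[of 4 3] S_sym[of 5 3] S_sym[of 6 3] S_sym[of 7 3] S_sym[of 5 4] S_sym[of 6 4] S_sym[of 7 4] S_sym[of 6 5] S_sym[of 7 5] S_sym[of 7 6]
    by algebra
  finally show ?thesis unfolding S s_def vals by algebra
qed

text \<open>Expanding in the seven dependent vectors \<open>basis7\<close>, rather than in a basis,
  keeps the permutation action on the coefficients visible.\<close>

lemma invariant_cubic_is_combination:
  assumes F: "F \<in> V_L27"
  shows "\<exists>u v. \<forall>x. F x = u * power_sum x + v * line_sum x"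
proof -
  have cubic: "F \<in> cubic_forms" and inv: "\<And>A x. A \<in> L27 \<Longrightarrow> F (A *v x) = F x"
    using F unfolding V_L27_def by blast+
  define T where "T i j k = polar F (basis7 i) (basis7 j) (basis7 k)" for i j k
  have polar_inv: "polar F (A *v x) (A *v y) (A *v z) = polar F x y z" if "A \<in> L27" for A x y z
    unfolding polar_def matrix_vector_right_distrib[symmetric] inv[OF that] ..
  have perm: "T (\<sigma> i) (\<sigma> j) (\<sigma> k) = T i j k"
    if "\<sigma> \<in> L27_perms" "i \<in> {1..7}" "j \<in> {1..7}" "k \<in> {1..7}" for \<sigma> i j k
    using polar_inv[OF perm_matrix_in_L27[OF that(1)]] that(2-) perm_matrix_basis7[OF L27_perms_permutes[OF that(1)]]
    unfolding T_def by metis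
  have T: "invariant_symmetric T"
    unfolding invariant_symmetric_def
  proof (intro conjI allI ballI)
    show "T i j k = T j i k" "T i j k = T i k j" for i j k unfolding T_def by (rule polar_commute)+
    show "T (swap_gen i) (swap_gen j) (swap_gen k) = T i j k" "T (cycle_gen i) (cycle_gen j) (cycle_gen k) = T i j k"
      if "i \<in> {1..7}" "j \<in> {1..7}" "k \<in> {1..7}" for i j k
      by (rule perm[OF gen_in_L27_perms(1) that], rule perm[OF gen_in_L27_perms(2) that])
  qed
  have "F x = (\<Sum>i\<in>{1..7}. \<Sum>j\<in>{1..7}. \<Sum>k\<in>{1..7}. coord7 x i * (coord7 x j * (coord7 x k * T i j k)))" for x
  proof -
    have "F x = polar F x x x" by (simp add: polar_linear(3)[OF cubic])
    also have "\<dots> = polar F (\<Sum>i\<in>{1..7}. coord7 x i *s basis7 i) (\<Sum>i\<in>{1..7}. coord7 x i *s basis7 i) (\<Sum>i\<in>{1..7}. coord7 x i *s basis7 i)"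
      by (simp only: basis7_expansion[symmetric])
    also have "\<dots> = (\<Sum>i\<in>{1..7}. \<Sum>j\<in>{1..7}. \<Sum>k\<in>{1..7}. coord7 x i * (coord7 x j * (coord7 x k * T i j k)))"
      unfolding polar_sum(1)[OF cubic] polar_scale(1)[OF cubic]
      unfolding polar_sum(2)[OF cubic] polar_scale(2)[OF cubic] sum_distrib_left
      unfolding polar_sum(3)[OF cubic] polar_scale(3)[OF cubic] sum_distrib_left T_def ..
    finally show ?thesis .
  qed
  note F_eq = this[unfolded symmetric_cubic_expansion[OF T]]
  have sum0: "coord7 x 1 + coord7 x 2 + coord7 x 3 + coord7 x 4 + coord7 x 5 + coord7 x 6 + coord7 x 7 = 0" for x
    using sum_coord7[of x] by (simp only: sum_atLeastAtMost_7)
  have "F x = (T 1 1 1 - 3 * T 1 1 2 + 2 * T 1 2 3) * power_sum x + 6 * (T 1 2 4 - T 1 2 3) * line_sum x" for x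
    using F_eq[of x] unfolding sum0 power_sum_def line_sum_def sum_atLeastAtMost_7
    by (simp add: algebra_simps del: One_nat_def)
  then show ?thesis by blast
qed

lemma coord7_permuted:
  assumes "\<sigma> \<in> L27_perms" and Q: "\<And>X Y. (\<And>i. i \<in> {1..7} \<Longrightarrow> X i = Y i) \<Longrightarrow> Q X = Q Y"
    and gen: "\<And>X. Q (X \<circ> swap_gen) = Q X" "\<And>X. Q (X \<circ> cycle_gen) = Q X"
  shows "Q (coord7 (perm_matrix \<sigma> *v x)) = Q (coord7 x)"
proof -
  have "\<forall>X. Q (X \<circ> \<sigma>) = Q X"
  proof (rule L27_perms_induct[OF assms(1)])
    show "\<forall>X. Q (X \<circ> inv_into UNIV \<tau>) = Q X" if \<tau>: "\<tau> permutes {1..7}" "\<forall>X. Q (X \<circ> \<tau>) = Q X" for \<tau>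
    proof
      fix X :: "nat \<Rightarrow> complex"
      have "X \<circ> inv_into UNIV \<tau> \<circ> \<tau> = X" using permutes_inverses(2)[OF \<tau>(1)] by (auto simp: o_def)
      then show "Q (X \<circ> inv_into UNIV \<tau>) = Q X" using \<tau>(2) by metis
    qed
    show "\<forall>X. Q (X \<circ> (\<sigma> \<circ> \<tau>)) = Q X" if "\<forall>X. Q (X \<circ> \<sigma>) = Q X" "\<forall>X. Q (X \<circ> \<tau>) = Q X" for \<sigma> \<tau>
      using that by (simp flip: comp_assoc)
    show "\<forall>X. Q (X \<circ> swap_gen) = Q X" "\<forall>X. Q (X \<circ> cycle_gen) = Q X" using gen by blast+
  qed simp
  then have "Q (coord7 (perm_matrix \<sigma> *v x)) = Q (coord7 (perm_matrix \<sigma> *v x) \<circ> \<sigma>)" by simp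
  also have "\<dots> = Q (coord7 x)"
    by (rule Q) (simp add: coord7_perm_matrix[OF L27_perms_permutes[OF assms(1)]])
  finally show ?thesis .
qed

lemma power_sum_invariant: "\<sigma> \<in> L27_perms \<Longrightarrow> power_sum (perm_matrix \<sigma> *v x) = power_sum x"
  unfolding power_sum_def
  by (rule coord7_permuted[of _ "\<lambda>X. \<Sum>i\<in>{1..7}. X i ^ 3"])
    (simp_all add: sum_atLeastAtMost_7 algebra_simps del: One_nat_def cong: sum.cong)

lemma line_sum_invariant: "\<sigma> \<in> L27_perms \<Longrightarrow> line_sum (perm_matrix \<sigma> *v x) = line_sum x"
  unfolding line_sum_def
  by (rule coord7_permuted[of _ "\<lambda>X. X 1 * X 2 * X 4 + X 2 * X 3 * X 5 + X 3 * X 4 * X 6 + X 4 * X 5 * X 7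
      + X 5 * X 6 * X 1 + X 6 * X 7 * X 2 + X 7 * X 1 * X 3"])
    (simp_all add: algebra_simps del: One_nat_def)

section \<open>Fourier coordinates\<close>

definition zeta :: complex where "zeta = cis (2 * pi / 7)"

lemma zeta_power_7: "zeta ^ 7 = 1"
  unfolding zeta_def by (simp only: Complex.DeMoivre) simp

lemma zeta_neq_1: "zeta \<noteq> 1"
proof
  assume "zeta = 1"
  then have "sin (2 * pi / 7) = 0" unfolding zeta_def by (simp add: complex_eq_iff)
  moreover have "sin (2 * pi / 7) > 0" by (rule sin_gt_zero) auto
  ultimately show False by simp
qed

lemma zeta_sum: "1 + zeta + zeta ^ 2 + zeta ^ 3 + zeta ^ 4 + zeta ^ 5 + zeta ^ 6 = 0"
proof -
  have "(zeta - 1) * (1 + zeta + zeta ^ 2 + zeta ^ 3 + zeta ^ 4 + zeta ^ 5 + zeta ^ 6) = 0"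
    using zeta_power_7 by algebra
  then show ?thesis using zeta_neq_1 by simp
qed

lemma zeta_power_mod: "zeta ^ (m mod 7) = zeta ^ m"
proof -
  have "zeta ^ m = (zeta ^ 7) ^ (m div 7) * zeta ^ (m mod 7)" by (simp flip: power_mult power_add)
  then show ?thesis by (simp add: zeta_power_7)
qed

lemma zeta_power_reduce: "7 \<le> m \<Longrightarrow> zeta ^ m = zeta ^ (m - 7)"
  using zeta_power_mod[of m] zeta_power_mod[of "m - 7"] by (simp add: le_mod_geq)

lemma zeta_power_eq_1: "zeta ^ m = 1 \<longleftrightarrow> 7 dvd m"
proof
  assume 1: "zeta ^ m = 1"
  define r where "r = m mod 7"
  have r: "zeta ^ r = 1" "r < 7" using 1 zeta_power_mod[of m] by (simp_all add: r_def)
  have "zeta = 1" if "r \<noteq> 0"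
  proof -
    have "r = 1 \<or> r = 2 \<or> r = 3 \<or> r = 4 \<or> r = 5 \<or> r = 6" using r(2) that by presburger
    \<comment> \<open>\<open>k\<close> is the inverse of \<open>r\<close> modulo 7; raising to this
      power turns \<open>zeta ^ r = 1\<close> into \<open>zeta = 1\<close>.\<close>
    then obtain k l where "r * k = 7 * l + 1"
    proof (elim disjE)
      show thesis if "r = 1" using \<open>r = 1\<close> by (intro \<open>\<And>k l. r * k = 7 * l + 1 \<Longrightarrow> thesis\<close>[of 1 0]) simp
      show thesis if "r = 2" using \<open>r = 2\<close> by (intro \<open>\<And>k l. r * k = 7 * l + 1 \<Longrightarrow> thesis\<close>[of 4 1]) simp
      show thesis if "r = 3" using \<open>r = 3\<close> by (intro \<open>\<And>k l. r * k = 7 * l + 1 \<Longrightarrow> thesis\<close>[of 5 2]) simp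
      show thesis if "r = 4" using \<open>r = 4\<close> by (intro \<open>\<And>k l. r * k = 7 * l + 1 \<Longrightarrow> thesis\<close>[of 2 1]) simp
      show thesis if "r = 5" using \<open>r = 5\<close> by (intro \<open>\<And>k l. r * k = 7 * l + 1 \<Longrightarrow> thesis\<close>[of 3 2]) simp
      show thesis if "r = 6" using \<open>r = 6\<close> by (intro \<open>\<And>k l. r * k = 7 * l + 1 \<Longrightarrow> thesis\<close>[of 6 5]) simp
    qed
    have "zeta ^ (r * k) = 1" using r(1) by (simp add: power_mult)
    then have "zeta ^ (7 * l + 1) = 1" using \<open>r * k = 7 * l + 1\<close> by simp
    then show "zeta = 1" by (simp add: power_add power_mult zeta_power_7)
  qed
  then have "r = 0" using zeta_neq_1 by blast
  then show "7 dvd m" by (simp add: r_def dvd_eq_mod_eq_0)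
next
  assume "7 dvd m"
  then show "zeta ^ m = 1" using zeta_power_mod[of m] by (simp add: dvd_eq_mod_eq_0)
qed

lemma zeta_orthogonality: "(\<Sum>n\<in>{1..7}. zeta ^ (m * n)) = (if 7 dvd m then 7 else 0)"
proof -
  define w where "w = zeta ^ m"
  have w7: "w ^ 7 = 1"
  proof -
    have "w ^ 7 = (zeta ^ 7) ^ m" unfolding w_def by (simp only: power_mult[symmetric] mult.commute)
    then show ?thesis by (simp add: zeta_power_7)
  qed
  have eq: "(\<Sum>n\<in>{1..7}. zeta ^ (m * n)) = w + w ^ 2 + w ^ 3 + w ^ 4 + w ^ 5 + w ^ 6 + w ^ 7"
    unfolding power_mult w_def[symmetric] sum_atLeastAtMost_7 by simp
  show ?thesis
  proof (cases "w = 1")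
    case True
    then show ?thesis unfolding eq using zeta_power_eq_1[of m] by (simp add: w_def)
  next
    case False
    have "(w - 1) * (w + w ^ 2 + w ^ 3 + w ^ 4 + w ^ 5 + w ^ 6 + w ^ 7) = 0" using w7 by algebra
    then have "w + w ^ 2 + w ^ 3 + w ^ 4 + w ^ 5 + w ^ 6 + w ^ 7 = 0" using False by simp
    then show ?thesis unfolding eq using False zeta_power_eq_1[of m] by (simp add: w_def)
  qed
qed

text \<open>The Gaussian period of the quadratic residues modulo 7, a root of x^2 + x + 2. Its
  conjugate, the period of the non-residues, is \<open>- 1 - theta\<close>.\<close>

definition theta :: complex where "theta = zeta + zeta ^ 2 + zeta ^ 4"

lemma theta_root: "theta\<^sup>2 + theta + 2 = 0"
  using zeta_sum zeta_power_7 unfolding theta_def by algebra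

lemma theta_nonzero: "theta \<noteq> 0" using theta_root by auto

text \<open>With the non-residue coordinates rescaled by \<open>theta\<close>, both
  \<open>power_sum\<close> and \<open>line_sum\<close> land in the family
  \<open>fourier_form\<close>, whose axes are symmetric determinants.\<close>

definition fourier_weight :: "complex^6 \<Rightarrow> nat \<Rightarrow> complex"
  where "fourier_weight y j = (if j \<in> {3, 5, 6} then theta else 1) * y $ of_nat j"

definition fourier_transform :: "complex^6 \<Rightarrow> nat \<Rightarrow> complex"
  where "fourier_transform y n = (\<Sum>j\<in>{1..6}. fourier_weight y j * zeta ^ (j * n))"

lemma sum_atLeastAtMost_6: "(\<Sum>i\<in>{1..6::nat}. f i) = f 1 + f 2 + f 3 + f 4 + f 5 + f 6"
proof -
  have "{1..6::nat} = {1, 2, 3, 4, 5, 6}" by auto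
  then show ?thesis by (simp add: add.assoc)
qed

lemma fourier_weight_simps:
  "fourier_weight y 1 = y $ 1" "fourier_weight y 2 = y $ 2" "fourier_weight y 3 = theta * y $ 3"
  "fourier_weight y 4 = y $ 4" "fourier_weight y 5 = theta * y $ 5" "fourier_weight y 6 = theta * y $ 6"
  by (simp_all add: fourier_weight_def)

lemma fourier_transform_coefficient:
  assumes "i \<in> {1..6}"
  shows "(\<Sum>n\<in>{1..7}. zeta ^ ((7 - i) * n) * fourier_transform y n) = 7 * fourier_weight y i"
proof -
  have "(\<Sum>n\<in>{1..7}. zeta ^ ((7 - i) * n) * fourier_transform y n)
      = (\<Sum>n\<in>{1..7}. \<Sum>j\<in>{1..6}. fourier_weight y j * zeta ^ ((j + (7 - i)) * n))"
    unfolding fourier_transform_def sum_distrib_left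
    by (intro sum.cong refl) (simp add: distrib_right power_add)
  also have "\<dots> = (\<Sum>j\<in>{1..6}. \<Sum>n\<in>{1..7}. fourier_weight y j * zeta ^ ((j + (7 - i)) * n))"
    by (rule sum.swap)
  also have "\<dots> = (\<Sum>j\<in>{1..6}. if j = i then 7 * fourier_weight y j else 0)"
  proof (intro sum.cong refl)
    fix j :: nat assume j: "j \<in> {1..6}"
    have "7 dvd j + (7 - i) \<longleftrightarrow> j = i"
    proof
      assume "7 dvd j + (7 - i)"
      then obtain k where k: "j + (7 - i) = 7 * k" by blast
      then have "k = 1" using j assms by auto
      then show "j = i" using k assms by simp
    qed (use assms in simp)
    then show "(\<Sum>n\<in>{1..7}. fourier_weight y j * zeta ^ ((j + (7 - i)) * n)) = (if j = i then 7 * fourier_weight y j else 0)"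
      unfolding sum_distrib_left[symmetric] zeta_orthogonality by simp
  qed
  also have "\<dots> = 7 * fourier_weight y i" using assms by simp
  finally show ?thesis .
qed

lemma sum_fourier_transform: "(\<Sum>n\<in>{1..7}. fourier_transform y n) = 0"
proof -
  have "(\<Sum>n\<in>{1..7}. fourier_transform y n) = (\<Sum>j\<in>{1..6}. \<Sum>n\<in>{1..7}. fourier_weight y j * zeta ^ (j * n))"
    unfolding fourier_transform_def by (rule sum.swap)
  also have "\<dots> = 0"
  proof (rule sum.neutral, rule ballI)
    fix j :: nat assume "j \<in> {1..6}"
    then have "\<not> 7 dvd j" by (auto dest: dvd_imp_le)
    then show "(\<Sum>n\<in>{1..7}. fourier_weight y j * zeta ^ (j * n)) = 0"
      unfolding sum_distrib_left[symmetric] zeta_orthogonality by simp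
  qed
  finally show ?thesis .
qed

lemma fourier_transform_periodic: "fourier_transform y (n + 7) = fourier_transform y n"
proof -
  have "zeta ^ (j * (n + 7)) = zeta ^ (j * n)" for j
  proof -
    have "zeta ^ (j * (n + 7)) = zeta ^ (j * n) * (zeta ^ 7) ^ j"
      by (simp add: distrib_left power_add power_mult[symmetric] mult.commute)
    then show ?thesis by (simp add: zeta_power_7)
  qed
  then show ?thesis unfolding fourier_transform_def by simp
qed

definition fourier_matrix :: "complex^6^6"
  where "fourier_matrix = matrix (\<lambda>y. \<Sum>n\<in>{1..7}. fourier_transform y n *s basis7 n)"

lemma coord7_fourier_matrix:
  assumes "n \<in> {1..7}" shows "coord7 (fourier_matrix *v y) n = fourier_transform y n"
proof -
  have add: "fourier_transform (x + y) n = fourier_transform x n + fourier_transform y n" for x y n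
    unfolding fourier_transform_def fourier_weight_def sum.distrib[symmetric]
    by (intro sum.cong refl) (simp add: algebra_simps)
  have scale: "fourier_transform (c *s x) n = c * fourier_transform x n" for c x n
    unfolding fourier_transform_def fourier_weight_def sum_distrib_left
    by (intro sum.cong refl) (simp add: algebra_simps)
  have "fourier_matrix *v y = (\<Sum>n\<in>{1..7}. fourier_transform y n *s basis7 n)"
    unfolding fourier_matrix_def
    by (rule matrix_works_complex) (simp_all add: add scale vec.scale_left_distrib sum.distrib vec.scale_sum_right)
  then show ?thesis using coord7_combination[OF sum_fourier_transform assms] by simp
qed

lemma invertible_fourier_matrix: "invertible fourier_matrix"
proof -
  have "y = 0" if "fourier_matrix *v y = 0" for y
  proof -
    have "fourier_transform y n = 0" if "n \<in> {1..7}" for n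
      using coord7_fourier_matrix[OF that, of y] \<open>fourier_matrix *v y = 0\<close>
      by (auto simp: coord7_def split: if_splits)
    then have w: "fourier_weight y i = 0" if "i \<in> {1..6}" for i
      using fourier_transform_coefficient[OF that, of y] by simp
    have "fourier_weight y 1 = 0" "fourier_weight y 2 = 0" "fourier_weight y 3 = 0"
      "fourier_weight y 4 = 0" "fourier_weight y 5 = 0" "fourier_weight y 6 = 0" by (rule w; simp)+
    then show "y = 0" unfolding fourier_weight_simps using theta_nonzero by (simp add: vec_eq_iff forall_6)
  qed
  then have "\<exists>B. B ** fourier_matrix = mat 1" by (simp add: matrix_left_invertible_ker)
  then show ?thesis by (simp add: invertible_left_inverse)
qed

text \<open>Orthogonality leaves the index triples with sum divisible by 7. The shifts cover both
  invariants: 0 and 0 give the sum of cubes, 1 and 3 give the sum over the lines {n, n + 1, n +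
  3}.\<close>

lemma fourier_transform_triple_sum:
  "(\<Sum>n\<in>{1..7}. fourier_transform y n * fourier_transform y (n + p) * fourier_transform y (n + q)) =
    (\<Sum>i\<in>{1..6}. \<Sum>j\<in>{1..6}. \<Sum>k\<in>{1..6}. if 7 dvd i + j + k
      then 7 * (fourier_weight y i * fourier_weight y j * fourier_weight y k * zeta ^ (j * p + k * q)) else 0)"
proof -
  let ?w = "fourier_weight y"
  have "fourier_transform y n * fourier_transform y (n + p) * fourier_transform y (n + q) =
      (\<Sum>i\<in>{1..6}. \<Sum>j\<in>{1..6}. \<Sum>k\<in>{1..6}. ?w i * ?w j * ?w k * zeta ^ (j * p + k * q) * zeta ^ ((i + j + k) * n))" for n
  proof -
    have "fourier_transform y n * fourier_transform y (n + p) * fourier_transform y (n + q) =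
      fourier_transform y (n + q) * fourier_transform y (n + p) * fourier_transform y n" by (simp only: mult_ac)
    also have "\<dots> = (\<Sum>i\<in>{1..6}. \<Sum>j\<in>{1..6}. \<Sum>k\<in>{1..6}. (?w k * zeta ^ (k * (n + q))) * (?w j * zeta ^ (j * (n + p))) * (?w i * zeta ^ (i * n)))"
      unfolding fourier_transform_def sum_distrib_right sum_distrib_left ..
    also have "\<dots> = (\<Sum>i\<in>{1..6}. \<Sum>j\<in>{1..6}. \<Sum>k\<in>{1..6}. ?w i * ?w j * ?w k * zeta ^ (j * p + k * q) * zeta ^ ((i + j + k) * n))"
      by (intro sum.cong refl) (simp add: distrib_left distrib_right power_add mult_ac)
    finally show ?thesis .
  qed
  then have "(\<Sum>n\<in>{1..7}. fourier_transform y n * fourier_transform y (n + p) * fourier_transform y (n + q)) =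
      (\<Sum>n\<in>{1..7}. \<Sum>i\<in>{1..6}. \<Sum>j\<in>{1..6}. \<Sum>k\<in>{1..6}. ?w i * ?w j * ?w k * zeta ^ (j * p + k * q) * zeta ^ ((i + j + k) * n))"
    by (simp only:)
  also have "\<dots> = (\<Sum>i\<in>{1..6}. \<Sum>n\<in>{1..7}. \<Sum>j\<in>{1..6}. \<Sum>k\<in>{1..6}. ?w i * ?w j * ?w k * zeta ^ (j * p + k * q) * zeta ^ ((i + j + k) * n))"
    by (rule sum.swap)
  also have "\<dots> = (\<Sum>i\<in>{1..6}. \<Sum>j\<in>{1..6}. \<Sum>n\<in>{1..7}. \<Sum>k\<in>{1..6}. ?w i * ?w j * ?w k * zeta ^ (j * p + k * q) * zeta ^ ((i + j + k) * n))"
    by (rule sum.cong[OF refl]) (rule sum.swap)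
  also have "\<dots> = (\<Sum>i\<in>{1..6}. \<Sum>j\<in>{1..6}. \<Sum>k\<in>{1..6}. \<Sum>n\<in>{1..7}. ?w i * ?w j * ?w k * zeta ^ (j * p + k * q) * zeta ^ ((i + j + k) * n))"
    by (rule sum.cong[OF refl], rule sum.cong[OF refl]) (rule sum.swap)
  also have "\<dots> = (\<Sum>i\<in>{1..6}. \<Sum>j\<in>{1..6}. \<Sum>k\<in>{1..6}. if 7 dvd i + j + k
      then 7 * (?w i * ?w j * ?w k * zeta ^ (j * p + k * q)) else 0)"
    unfolding sum_distrib_left[symmetric] zeta_orthogonality by (intro sum.cong refl) simp
  finally show ?thesis .
qed

lemma power_sum_fourier:
  "power_sum (fourier_matrix *v y) = - 7 * theta * fourier_form (3 * theta) 3 y"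
proof -
  let ?w = "fourier_weight y"
  have "power_sum (fourier_matrix *v y) = (\<Sum>n\<in>{1..7}. fourier_transform y n * fourier_transform y (n + 0) * fourier_transform y (n + 0))"
    unfolding power_sum_def by (intro sum.cong refl) (simp add: coord7_fourier_matrix power3_eq_cube)
  also have "\<dots> = 7 * (3 * (?w 1 ^ 2 * ?w 5 + ?w 2 ^ 2 * ?w 3 + ?w 4 ^ 2 * ?w 6
      + ?w 3 ^ 2 * ?w 1 + ?w 6 ^ 2 * ?w 2 + ?w 5 ^ 2 * ?w 4) + 6 * (?w 1 * ?w 2 * ?w 4 + ?w 3 * ?w 5 * ?w 6))"
    unfolding fourier_transform_triple_sum sum_atLeastAtMost_6 by (simp del: One_nat_def add: power2_eq_square; algebra)
  finally show ?thesis
    unfolding fourier_weight_simps fourier_form_def torus_form_def using theta_root by algebra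
qed

text \<open>The shifts 1 and 3 weight each surviving monomial by powers of \<open>zeta\<close>,
  which add up to \<open>theta\<close> or its conjugate, plus 3 for products of three different
  variables.\<close>

lemma line_sum_fourier:
  "line_sum (fourier_matrix *v y) = - 7 * theta * fourier_form 2 theta y"
proof -
  let ?w = "fourier_weight y" and ?t = "zeta ^ 3 + zeta ^ 5 + zeta ^ 6"
  have t: "?t = - 1 - theta" using zeta_sum unfolding theta_def by algebra
  note per = fourier_transform_periodic[of y 1] fourier_transform_periodic[of y 2] fourier_transform_periodic[of y 3]
  have "line_sum (fourier_matrix *v y) = (\<Sum>n\<in>{1..7}. fourier_transform y n * fourier_transform y (n + 1) * fourier_transform y (n + 3))"
    unfolding line_sum_def sum_atLeastAtMost_7 using per by (simp add: coord7_fourier_matrix del: One_nat_def)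
  also have "\<dots> = 7 * (theta * (?w 1 ^ 2 * ?w 5 + ?w 2 ^ 2 * ?w 3 + ?w 4 ^ 2 * ?w 6)
      + ?t * (?w 3 ^ 2 * ?w 1 + ?w 6 ^ 2 * ?w 2 + ?w 5 ^ 2 * ?w 4)
      + (3 + ?t) * (?w 1 * ?w 2 * ?w 4) + (3 + theta) * (?w 3 * ?w 5 * ?w 6))"
    unfolding fourier_transform_triple_sum sum_atLeastAtMost_6 theta_def
    by (simp del: One_nat_def add: power2_eq_square zeta_power_reduce; algebra)
  finally show ?thesis
    unfolding t fourier_weight_simps fourier_form_def torus_form_def using theta_root by algebra
qed

section \<open>Linear changes of coordinates\<close>

lemma homogeneous_on_compose:
  fixes B :: "complex^'n^'m"
  assumes "homogeneous_on (*s) UNIV d F"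
  shows "homogeneous_on (*s) UNIV d (\<lambda>x. F (B *v x))"
  using assms
proof induction
  case (linear l)
  then have "linear_functional_on (*s) UNIV (\<lambda>x. l (B *v x))"
    unfolding linear_functional_on_def by (simp add: matrix_vector_right_distrib vector_scalar_commute)
  then show ?case by (rule homogeneous_on.linear)
next
  case (const c)
  show ?case by (rule homogeneous_on.const)
next
  case (add d p q)
  show ?case by (rule homogeneous_on.add[OF add.IH])
next
  case (mult d p e q)
  show ?case by (rule homogeneous_on.mult[OF mult.IH])
qed

lemma cubic_compose: "F \<in> cubic_forms \<Longrightarrow> (\<lambda>x. F (B *v x)) \<in> cubic_forms"
  unfolding cubic_forms_def mem_Collect_eq by (rule homogeneous_on_compose)

lemma polar_compose: "polar (\<lambda>x. F (B *v x)) x y z = polar F (B *v x) (B *v y) (B *v z)"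
  unfolding polar_def matrix_vector_right_distrib ..

lemma invertible_matrix_inv:
  fixes A :: "complex^'n^'n"
  assumes "invertible A"
  shows "A *v (matrix_inv A *v x) = x" "matrix_inv A *v (A *v x) = x"
    "invertible (matrix_inv A)" "A ** matrix_inv A = mat 1" "matrix_inv A ** A = mat 1"
proof -
  show 1: "A ** matrix_inv A = mat 1" and 2: "matrix_inv A ** A = mat 1"
    using someI_ex[OF assms[unfolded invertible_def]] unfolding matrix_inv_def by blast+
  show "invertible (matrix_inv A)" unfolding invertible_def using 1 2 by blast
  show "A *v (matrix_inv A *v x) = x" "matrix_inv A *v (A *v x) = x"
    unfolding matrix_vector_mul_assoc 1 2 by simp_all
qed

lemma image_ray: "(\<lambda>v. B *v v) ` ray (*s) v = ray (*s) (B *v v)" for B :: "complex^'n^'m"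
  unfolding ray_def image_image by (simp add: vector_scalar_commute)

lemma singular_points_compose:
  assumes F: "F \<in> cubic_forms" and B: "invertible B"
  shows "singular_points (\<lambda>x. F (B *v x)) = (\<lambda>x. (\<lambda>v. matrix_inv B *v v) ` x) ` singular_points F"
proof -
  note inv = invertible_matrix_inv[OF B]
  have crit: "(\<forall>h. polar (\<lambda>x. F (B *v x)) v v h = 0) \<longleftrightarrow> (\<forall>h. polar F (B *v v) (B *v v) h = 0)" for v
    unfolding polar_compose using inv(1) by metis
  have nz: "B *v v = 0 \<longleftrightarrow> v = 0" for v using inv(2)[of v] by auto
  have nz': "matrix_inv B *v v = 0 \<longleftrightarrow> v = 0" for v using inv(1)[of v] by auto
  show ?thesis
    unfolding singular_points_polar[OF F] singular_points_polar[OF cubic_compose[OF F]] crit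
  proof (intro equalityI subsetI)
    fix x assume "x \<in> {ray (*s) v |v. v \<noteq> 0 \<and> (\<forall>h. polar F (B *v v) (B *v v) h = 0)}"
    then obtain v where v: "x = ray (*s) v" "v \<noteq> 0" "\<forall>h. polar F (B *v v) (B *v v) h = 0" by blast
    then have "ray (*s) (B *v v) \<in> {ray (*s) v |v. v \<noteq> 0 \<and> (\<forall>h. polar F v v h = 0)}"
      using nz by blast
    moreover have "x = (\<lambda>v. matrix_inv B *v v) ` ray (*s) (B *v v)"
      unfolding image_ray inv(2) v(1) ..
    ultimately show "x \<in> (\<lambda>x. (\<lambda>v. matrix_inv B *v v) ` x) ` {ray (*s) v |v. v \<noteq> 0 \<and> (\<forall>h. polar F v v h = 0)}"
      by blast
  next
    fix x assume "x \<in> (\<lambda>x. (\<lambda>v. matrix_inv B *v v) ` x) ` {ray (*s) v |v. v \<noteq> 0 \<and> (\<forall>h. polar F v v h = 0)}"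
    then obtain v where v: "x = (\<lambda>v. matrix_inv B *v v) ` ray (*s) v" "v \<noteq> 0" "\<forall>h. polar F v v h = 0" by blast
    have "x = ray (*s) (matrix_inv B *v v)" unfolding v(1) image_ray ..
    moreover have "matrix_inv B *v v \<noteq> 0" using nz' v(2) by simp
    moreover have "\<forall>h. polar F (B *v (matrix_inv B *v v)) (B *v (matrix_inv B *v v)) h = 0"
      unfolding inv(1) by (rule v(3))
    ultimately show "x \<in> {ray (*s) v |v. v \<noteq> 0 \<and> (\<forall>h. polar F (B *v v) (B *v v) h = 0)}" by blast
  qed
qed

lemma inj_image_matrix:
  fixes A :: "complex^'n^'n"
  assumes "invertible A" shows "inj (\<lambda>x. (\<lambda>v. A *v v) ` x)"
proof (rule injI)
  fix x y assume "(\<lambda>v. A *v v) ` x = (\<lambda>v. A *v v) ` y"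
  then have "(\<lambda>v. matrix_inv A *v v) ` (\<lambda>v. A *v v) ` x = (\<lambda>v. matrix_inv A *v v) ` (\<lambda>v. A *v v) ` y" by simp
  then show "x = y" unfolding image_image invertible_matrix_inv(2)[OF assms] by simp
qed

lemma is_A1_singularity_compose:
  assumes B: "invertible B" and A1: "is_A1_singularity F x"
  shows "is_A1_singularity (\<lambda>x. F (B *v x)) ((\<lambda>v. matrix_inv B *v v) ` x)"
proof -
  note inv = invertible_matrix_inv[OF B]
  define C where "C = matrix_inv B"
  obtain S \<psi> u \<psi>' where "open S" "0 \<in> S" "\<forall>i. holomorphic_fun S (\<lambda>z. \<psi> z $ i)"
    "holomorphic_fun S u" "\<forall>z\<in>S. u z \<noteq> 0" "\<psi> 0 \<noteq> 0" "ray (*s) (\<psi> 0) = x"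
    "(\<psi> has_derivative \<psi>') (at 0)" "\<forall>w. \<psi>' w \<in> x \<longrightarrow> w = 0"
    "\<forall>z\<in>S. F (\<psi> z) = u z * (\<Sum>i\<in>UNIV. (z $ i)\<^sup>2)"
    using A1 unfolding is_A1_singularity_def by (elim exE conjE) (rule that)
  note * = this[rule_format]
  have comp: "(C *v v) $ i = (\<Sum>j\<in>UNIV. C $ i $ j * v $ j)" for v i by (simp add: matrix_vector_mult_def)
  show ?thesis
    unfolding is_A1_singularity_def C_def[symmetric]
  proof (intro exI conjI allI ballI impI)
    show "holomorphic_fun S (\<lambda>z. (C *v \<psi> z) $ i)" for i
      unfolding holomorphic_fun_def
    proof
      fix z assume z: "z \<in> S"
      have "\<forall>j. \<exists>f'. ((\<lambda>z. \<psi> z $ j) has_derivative f') (at z) \<and> (\<forall>c w. f' (c *s w) = c * f' w)"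
        using *(3) z unfolding holomorphic_fun_def by blast
      from choice[OF this] obtain f' where f': "\<And>j. ((\<lambda>z. \<psi> z $ j) has_derivative f' j) (at z)"
        "\<And>j c w. f' j (c *s w) = c * f' j w" by blast
      have "((\<lambda>z. (C *v \<psi> z) $ i) has_derivative (\<lambda>h. \<Sum>j\<in>UNIV. C $ i $ j * f' j h)) (at z)"
        unfolding comp by (intro has_derivative_sum has_derivative_mult_right f')
      then show "\<exists>f'. ((\<lambda>z. (C *v \<psi> z) $ i) has_derivative f') (at z) \<and> (\<forall>c w. f' (c *s w) = c * f' w)"
        by (intro exI conjI) (auto simp: f'(2) sum_distrib_left mult_ac)
    qed
    have "((\<lambda>z. \<chi> i. \<Sum>j\<in>UNIV. C $ i $ j * \<psi> z $ j) has_derivative (\<lambda>h. \<chi> i. \<Sum>j\<in>UNIV. C $ i $ j * \<psi>' h $ j)) (at 0)"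
      by (intro has_derivative_vec_lambda has_derivative_sum has_derivative_mult_right has_derivative_nth *(8))
    then show "((\<lambda>z. C *v \<psi> z) has_derivative (\<lambda>h. C *v \<psi>' h)) (at 0)"
      by (simp add: matrix_vector_mult_def)
    show "C *v \<psi> 0 \<noteq> 0"
    proof
      assume "C *v \<psi> 0 = 0"
      then have "B *v (C *v \<psi> 0) = 0" by simp
      then show False using inv(1) *(6) by (simp add: C_def)
    qed
    show "ray (*s) (C *v \<psi> 0) = (\<lambda>v. C *v v) ` x" unfolding *(7)[symmetric] image_ray ..
    show "w = 0" if w: "C *v \<psi>' w \<in> (\<lambda>v. C *v v) ` x" for w
    proof -
      obtain v where "v \<in> x" "C *v \<psi>' w = C *v v" using w by blast
      then have "B *v (C *v \<psi>' w) = B *v (C *v v)" by simp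
      then have "\<psi>' w = v" using inv(1) by (simp add: C_def)
      then show ?thesis using *(9) \<open>v \<in> x\<close> by blast
    qed
    show "F (B *v (C *v \<psi> z)) = u z * (\<Sum>i\<in>UNIV. (z $ i)\<^sup>2)" if "z \<in> S" for z
      using *(10)[OF that] inv(1) by (simp add: C_def)
    show "open S" "0 \<in> S" "holomorphic_fun S u" by (fact *)+
    show "u z \<noteq> 0" if "z \<in> S" for z by (rule *(5)[OF that])
  qed
qed

lemma nodal_with_compose:
  assumes F: "F \<in> cubic_forms" and B: "invertible B" and nodal: "nodal_with k F"
  shows "nodal_with k (\<lambda>x. F (B *v x))"
proof -
  have "inj_on (\<lambda>x. (\<lambda>v. matrix_inv B *v v) ` x) (singular_points F)"
    using inj_image_matrix[OF invertible_matrix_inv(3)[OF B]] inj_on_subset by blast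
  then have "card ((\<lambda>x. (\<lambda>v. matrix_inv B *v v) ` x) ` singular_points F) = card (singular_points F)"
    by (rule card_image)
  then show ?thesis
    using nodal is_A1_singularity_compose[OF B]
    unfolding nodal_with_def singular_points_compose[OF F B] by auto
qed

lemma card_singular_points_compose:
  assumes F: "F \<in> cubic_forms" and B: "invertible B"
  shows "card (singular_points (\<lambda>x. F (B *v x))) = card (singular_points F)"
  unfolding singular_points_compose[OF F B]
  by (rule card_image) (use inj_image_matrix[OF invertible_matrix_inv(3)[OF B]] inj_on_subset in blast)

lemma singular_points_scale:
  assumes F: "F \<in> cubic_forms" and c: "c \<noteq> 0"
  shows "singular_points (form_scale c F) = singular_points F"
proof -
  have "homogeneous_on (*s) UNIV 3 F" using F unfolding cubic_forms_def by simp
  then have "homogeneous_on (*s) UNIV (0 + 3) (\<lambda>x. c * F x)"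
    by (rule homogeneous_on.mult[OF homogeneous_on.const])
  then have "form_scale c F \<in> cubic_forms" by (simp add: cubic_forms_def form_scale_def)
  moreover have "polar (form_scale c F) x y z = c * polar F x y z" for x y z
    by (simp add: polar_def form_scale_def algebra_simps diff_divide_distrib add_divide_distrib)
  ultimately show ?thesis using c by (simp add: singular_points_polar F)
qed

lemma act_apply: "invertible A \<Longrightarrow> act A F (A *v x) = F x"
  by (simp add: act_def invertible_matrix_inv)

lemma act_mult:
  assumes "invertible A" "invertible B"
  shows "act (A ** B) F = act A (act B F)"
proof
  fix x
  have AB: "invertible (A ** B)" using assms by (rule invertible_mult)
  define y where "y = matrix_inv B *v (matrix_inv A *v x)"
  have "x = (A ** B) *v y" unfolding y_def by (simp add: invertible_matrix_inv assms flip: matrix_vector_mul_assoc)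
  moreover have "act A (act B F) ((A ** B) *v y) = F y"
    by (simp add: act_apply assms flip: matrix_vector_mul_assoc)
  ultimately show "act (A ** B) F x = act A (act B F) x" using act_apply[OF AB] by metis
qed

lemma act_one [simp]: "act (mat 1) F = F"
proof -
  have "invertible (mat 1 :: complex^6^6)" unfolding invertible_def by (rule exI[of _ "mat 1"]) simp
  from act_apply[OF this, of F] show ?thesis by (auto simp: fun_eq_iff)
qed

lemma act_scale: "act A (form_scale c F) = form_scale c (act A F)"
  by (simp add: act_def form_scale_def)

section \<open>The pencil of invariant cubics\<close>

definition klein :: "complex \<Rightarrow> complex \<Rightarrow> form"
  where "klein u v x = fourier_form u v (matrix_inv fourier_matrix *v x)"

lemma klein_fourier_matrix: "klein u v (fourier_matrix *v y) = fourier_form u v y"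
  by (simp add: klein_def invertible_matrix_inv[OF invertible_fourier_matrix])

lemma klein_cubic: "klein u v \<in> cubic_forms"
  unfolding klein_def[abs_def] by (rule cubic_compose[OF fourier_form_cubic])

lemma klein_add: "klein u v + klein u' v' = klein (u + u') (v + v')"
  by (rule ext) (simp add: klein_def fourier_form_def torus_form_def algebra_simps)

lemma klein_scale: "form_scale c (klein u v) = klein (c * u) (c * v)"
  by (rule ext) (simp add: klein_def form_scale_def fourier_form_def torus_form_def algebra_simps)

lemma klein_inj: "klein u v = klein u' v' \<longleftrightarrow> u = u' \<and> v = v'"
proof
  assume eq: "klein u v = klein u' v'"
  have "fourier_form u v y = fourier_form u' v' y" for y
    using fun_cong[OF eq, of "fourier_matrix *v y"] by (simp add: klein_fourier_matrix)
  from this[of "axis 1 1 + axis 3 1"] this[of "axis 1 1 + axis 5 1"] show "u = u' \<and> v = v'"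
    by (simp add: fourier_form_def torus_form_def axis_def)
qed simp

lemma power_sum_klein: "power_sum = klein (- 7 * theta * (3 * theta)) (- 7 * theta * 3)"
  and line_sum_klein: "line_sum = klein (- 7 * theta * 2) (- 7 * theta * theta)"
proof -
  have inv: "fourier_matrix *v (matrix_inv fourier_matrix *v x) = x" for x
    by (rule invertible_matrix_inv[OF invertible_fourier_matrix])
  have scale: "k * fourier_form u v y = fourier_form (k * u) (k * v) y" for k u v y
    by (simp add: fourier_form_def torus_form_def algebra_simps)
  show "power_sum = klein (- 7 * theta * (3 * theta)) (- 7 * theta * 3)"
    using power_sum_fourier[unfolded scale, of "matrix_inv fourier_matrix *v _"] unfolding inv klein_def[abs_def] by blast
  show "line_sum = klein (- 7 * theta * 2) (- 7 * theta * theta)"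
    using line_sum_fourier[unfolded scale, of "matrix_inv fourier_matrix *v _"] unfolding inv klein_def[abs_def] by blast
qed

lemma klein_combination:
  obtains u' v' where "klein u v = form_scale u' power_sum + form_scale v' line_sum"
proof -
  \<comment> \<open>Up to the factor \<open>- 7 * theta\<close>, this is the determinant of the
    passage from \<open>power_sum\<close> and \<open>line_sum\<close> to the parameters; the
    formulas for u' and v' below are Cramer's rule.\<close>
  define \<Delta> where "\<Delta> = 21 * theta * (theta + 4)"
  have "\<Delta> * (theta + 4 - 1 + (- theta)) \<noteq> 0 \<or> theta + 4 = 0" using theta_nonzero by (auto simp: \<Delta>_def)
  moreover have "theta + 4 \<noteq> 0"
  proof
    assume "theta + 4 = 0"
    then have *: "theta = - 4" by (simp add: eq_neg_iff_add_eq_0)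
    have "(- 4)\<^sup>2 + (- 4) + 2 = (0 :: complex)" using theta_root unfolding * .
    then show False by simp
  qed
  ultimately have \<Delta>: "\<Delta> \<noteq> 0" by auto
  define u' v' where "u' = (theta * u - 2 * v) / \<Delta>" and "v' = (3 * theta * v - 3 * u) / \<Delta>"
  have "u' * \<Delta> = theta * u - 2 * v" "v' * \<Delta> = 3 * theta * v - 3 * u"
    using \<Delta> by (simp_all add: u'_def v'_def)
  then have "\<Delta> * (u' * (- 7 * theta * (3 * theta)) + v' * (- 7 * theta * 2)) = \<Delta> * u"
    "\<Delta> * (u' * (- 7 * theta * 3) + v' * (- 7 * theta * theta)) = \<Delta> * v"
    using theta_root unfolding \<Delta>_def by algebra+
  then have "u = u' * (- 7 * theta * (3 * theta)) + v' * (- 7 * theta * 2)"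
    "v = u' * (- 7 * theta * 3) + v' * (- 7 * theta * theta)" using \<Delta> by simp_all
  then show thesis
    by (intro that[of u' v']) (simp add: power_sum_klein line_sum_klein klein_scale klein_add)
qed

lemma V_L27_klein: "V_L27 = {klein u v | u v. True}"
proof (intro equalityI subsetI)
  fix F assume "F \<in> V_L27"
  then obtain u v where "\<forall>x. F x = u * power_sum x + v * line_sum x"
    using invariant_cubic_is_combination by blast
  then have "F = form_scale u power_sum + form_scale v line_sum" by (auto simp: form_scale_def fun_eq_iff)
  then show "F \<in> {klein u v | u v. True}"
    unfolding power_sum_klein line_sum_klein klein_scale klein_add by blast
next
  fix F assume "F \<in> {klein u v | u v. True}"
  then obtain u v where F: "F = klein u v" by blast
  obtain u' v' where *: "klein u v = form_scale u' power_sum + form_scale v' line_sum" by (rule klein_combination)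
  have "klein u v (A *v x) = klein u v x" if "A \<in> L27" for A x
    using that power_sum_invariant line_sum_invariant unfolding L27_iff_perm_matrix *
    by (auto simp: form_scale_def)
  then show "F \<in> V_L27" unfolding V_L27_def F using klein_cubic by blast
qed

lemma singular_points_klein:
  "singular_points (klein u v) = (\<lambda>x. (\<lambda>v. fourier_matrix *v v) ` x) ` singular_points (fourier_form u v)"
  "card (singular_points (klein u v)) = card (singular_points (fourier_form u v))"
  "nodal_with k (fourier_form u v) \<Longrightarrow> nodal_with k (klein u v)"
proof -
  note inv = invertible_matrix_inv(3)[OF invertible_fourier_matrix]
  have "matrix_inv (matrix_inv fourier_matrix) *v x = fourier_matrix *v x" for x
    using invertible_matrix_inv(2)[OF inv] invertible_matrix_inv(2)[OF invertible_fourier_matrix] by metis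
  then show "singular_points (klein u v) = (\<lambda>x. (\<lambda>v. fourier_matrix *v v) ` x) ` singular_points (fourier_form u v)"
    unfolding klein_def[abs_def] singular_points_compose[OF fourier_form_cubic inv] by simp
  show "card (singular_points (klein u v)) = card (singular_points (fourier_form u v))"
    unfolding klein_def[abs_def] by (rule card_singular_points_compose[OF fourier_form_cubic inv])
  show "nodal_with k (fourier_form u v) \<Longrightarrow> nodal_with k (klein u v)"
    unfolding klein_def[abs_def] by (rule nodal_with_compose[OF fourier_form_cubic inv])
qed

text \<open>The two conjugate values (-1 \<plusminus> sqrt (-7)) / 2, which parametrize both kinds
  of nodal members.\<close>

definition root_pm :: "complex \<Rightarrow> bool"
  where "root_pm \<eta> \<longleftrightarrow> \<eta>\<^sup>2 + \<eta> + 2 = 0"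

lemma klein_nodal_7:
  assumes "root_pm \<eta>" "v \<noteq> 0" "8 * u = (7 * \<eta> - 3) * v" shows "nodal_with 7 (klein u v)"
  using fourier_form_singular_points_7(2) assms singular_points_klein(3) unfolding root_pm_def by blast

lemma klein_nodal_14:
  assumes "root_pm \<eta>" "v \<noteq> 0" "4 * u = - (\<eta> + 6) * v" shows "nodal_with 14 (klein u v)"
  using fourier_form_singular_points_14(1) assms singular_points_klein(3) unfolding root_pm_def by blast

lemma klein_smooth:
  assumes "u \<noteq> 0" "v \<noteq> 0" "\<And>\<eta>. root_pm \<eta> \<Longrightarrow> 8 * u \<noteq> (7 * \<eta> - 3) * v" "\<And>\<eta>. root_pm \<eta> \<Longrightarrow> 4 * u \<noteq> - (\<eta> + 6) * v"
  shows "singular_points (klein u v) = {}"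
  using fourier_form_smooth[of u v] assms unfolding singular_points_klein root_pm_def by blast

text \<open>On the singular cubics \<open>u = 0\<close> and \<open>v = 0\<close>, the points below come from the rank one symmetric
  matrices \<open>(t, 1, 1)\<^sup>T (t, 1, 1)\<close>.\<close>

lemma fourier_form_infinite_singular:
  assumes "u = 0 \<or> v = 0" shows "infinite (singular_points (fourier_form u v))"
proof -
  define k where "k = (if u = 0 then 1 / 2 else 1 :: complex)"
  define pt where "pt t = (\<chi> i. if u = 0 then (if i = 1 then t else if i = 2 then 1 else if i = 4 then t
      else if i = 3 then t\<^sup>2 / 2 else 1 / 2)
    else (if i = 1 then t\<^sup>2 else if i = 2 then 1 else if i = 4 then 1 else if i = 3 then 1 else t) :: complex^6)" for t :: complex
  have crit: "\<forall>h. polar (fourier_form u v) (pt t) (pt t) h = 0" for t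
    unfolding fourier_form_critical using assms by (auto simp: torus_critical_def pt_def power2_eq_square)
  have pt2: "pt t $ 2 = 1" for t by (simp add: pt_def)
  then have "pt t \<noteq> 0" for t by (metis zero_index zero_neq_one)
  then have sub: "range (\<lambda>t. ray (*s) (pt t)) \<subseteq> singular_points (fourier_form u v)"
    unfolding singular_points_polar[OF fourier_form_cubic] using crit by blast
  have "inj (\<lambda>t. ray (*s) (pt t))"
  proof (rule injI)
    fix t t' assume "ray (*s) (pt t) = ray (*s) (pt t')"
    then obtain c where c: "pt t = c *s pt t'" using ray_self[of "pt t"] by (auto simp: ray_def)
    have "c = 1" using arg_cong[OF c, of "\<lambda>y. y $ 2"] pt2 by simp
    then have "pt t = pt t'" using c by simp
    then have "pt t $ 1 = pt t' $ 1" "pt t $ 5 = pt t' $ 5" by simp_all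
    then show "t = t'" by (auto simp: pt_def split: if_splits)
  qed
  then have "infinite (range (\<lambda>t. ray (*s) (pt t)))"
    using finite_imageD infinite_UNIV_char_0 by blast
  then show ?thesis using sub infinite_super by blast
qed

text \<open>The number 7 separates this kind from all others: smooth members have no singular point,
  the other nodal ones have 14, and the infinite singular loci of the axes have \<open>card\<close>
  0.\<close>

lemma klein_card_singular_7:
  assumes card: "card (singular_points (klein u v)) = 7"
  shows "v \<noteq> 0 \<and> (\<exists>\<eta>. root_pm \<eta> \<and> 8 * u = (7 * \<eta> - 3) * v)"
proof -
  have card: "card (singular_points (fourier_form u v)) = 7" using card unfolding singular_points_klein(2) .
  have uv: "u \<noteq> 0" "v \<noteq> 0" using fourier_form_infinite_singular[of u v] card by auto
  have "False" if "root_pm \<eta>" "4 * u = - (\<eta> + 6) * v" for \<eta>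
    using fourier_form_singular_points_14(1)[of \<eta> v u] that uv card by (simp add: nodal_with_def root_pm_def)
  moreover have "singular_points (fourier_form u v) \<noteq> {}" using card by auto
  ultimately show ?thesis using fourier_form_smooth[OF uv] uv unfolding root_pm_def by blast
qed

lemma root_pm_theta: "root_pm \<eta> \<longleftrightarrow> \<eta> = theta \<or> \<eta> = - 1 - theta"
proof
  show "root_pm \<eta> \<Longrightarrow> \<eta> = theta \<or> \<eta> = - 1 - theta" using roots_equal[OF theta_root] unfolding root_pm_def by blast
  assume "\<eta> = theta \<or> \<eta> = - 1 - theta"
  then show "root_pm \<eta>" unfolding root_pm_def
  proof
    assume "\<eta> = - 1 - theta"
    then show "\<eta>\<^sup>2 + \<eta> + 2 = 0" using theta_root by algebra
  qed (use theta_root in simp)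
qed

text \<open>The coefficient -15 makes \<open>basis7 i\<close> critical. Modulo the normal direction
  (1, ..., 1), the gradients of \<open>power_sum\<close> and \<open>line_sum\<close> there are
  multiples of the i-th unit vector by 105/49 and 7/49.\<close>

lemma seven_nodal_form: "form_scale 1 power_sum + form_scale (- 15) line_sum = klein (- 7 * theta * (3 * theta - 30)) (- 7 * theta * (3 - 15 * theta))"
  unfolding power_sum_klein line_sum_klein klein_scale klein_add klein_inj by (simp add: algebra_simps)

lemma polar_seven_nodal_form:
  assumes "i \<in> {1..7}"
  shows "polar (\<lambda>x. power_sum x - 15 * line_sum x) (basis7 i) (basis7 i) h = 0"
proof -
  have *: "6 * polar F x x h = F (x + x + h) - F (x + x) - F (x + h) - F (x + h) + F x + F x + F h" for F x
    by (simp add: polar_def)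
  have "\<forall>i\<in>{1..7}. 6 * polar (\<lambda>x. power_sum x - 15 * line_sum x) (basis7 i) (basis7 i) h = 0"
    unfolding * power_sum_def line_sum_def sum_atLeastAtMost_7 coord7_add coord7_simps(7)[of h]
    unfolding ball_atLeastAtMost_7
    by (intro conjI; simp add: coord7_basis7 coord7_simps(1-6)[of h] del: One_nat_def; algebra)
  then show ?thesis using assms by simp
qed

lemma ray_basis7_inj: "i \<in> {1..7} \<Longrightarrow> j \<in> {1..7} \<Longrightarrow> ray (*s) (basis7 i) = ray (*s) (basis7 j) \<Longrightarrow> i = j"
proof (rule ccontr)
  assume i: "i \<in> {1..7}" and j: "j \<in> {1..7}" and eq: "ray (*s) (basis7 i) = ray (*s) (basis7 j)" and ne: "i \<noteq> j"
  obtain c where c: "basis7 i = c *s basis7 j" using eq ray_self[of "basis7 i"] by (auto simp: ray_def)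
  obtain k :: nat where k: "k \<in> {1..7}" "k \<noteq> i" "k \<noteq> j"
  proof -
    have "card ({1..7::nat} - {i, j}) > 0" using i j ne by (simp add: card_Diff_subset)
    then have "{1..7::nat} - {i, j} \<noteq> {}" by (metis card.empty less_irrefl)
    then show thesis using that by blast
  qed
  have "- 1 / 7 = c * (- 1 / 7)"
    using arg_cong[OF c, of "\<lambda>x. coord7 x k"] i j k by (simp add: coord7_scale coord7_basis7)
  then have "c = 1" by simp
  then have "coord7 (basis7 i) i = coord7 (basis7 j) i" using c by simp
  then show False using i j ne by (simp add: coord7_basis7)
qed

text \<open>The seven points are critical, and the parameters are those of a 7-nodal member for the
  root \<open>- 1 - theta\<close>, so no further singular point exists. This identifies the nodes of
  that member with the coordinate vectors.\<close>

lemma seven_nodal_singular_points: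
  "singular_points (\<lambda>x. power_sum x - 15 * line_sum x) = (\<lambda>i. ray (*s) (basis7 i)) ` {1..7}"
proof -
  let ?F = "\<lambda>x. power_sum x - 15 * line_sum x"
  have F: "?F = klein (- 7 * theta * (3 * theta - 30)) (- 7 * theta * (3 - 15 * theta))"
    unfolding seven_nodal_form[symmetric] by (auto simp: form_scale_def)
  have cubic: "?F \<in> cubic_forms" unfolding F by (rule klein_cubic)
  have "- 7 * theta * (3 - 15 * theta) \<noteq> 0"
  proof
    assume "- 7 * theta * (3 - 15 * theta) = 0"
    then have "theta * 5 = 1" using theta_nonzero by (simp add: mult.commute)
    then have *: "theta = 1 / 5" by (simp add: eq_divide_eq)
    have "(1 / 5)\<^sup>2 + (1 / 5) + 2 = (0 :: complex)" using theta_root unfolding * .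
    then show False by (simp add: power2_eq_square)
  qed
  moreover have "8 * (- 7 * theta * (3 * theta - 30)) = (7 * (- 1 - theta) - 3) * (- 7 * theta * (3 - 15 * theta))"
    using theta_root by algebra
  ultimately have "nodal_with 7 ?F" unfolding F using klein_nodal_7 root_pm_theta by blast
  then have fin: "finite (singular_points ?F)" "card (singular_points ?F) = 7" by (auto simp: nodal_with_def)
  have sub: "(\<lambda>i. ray (*s) (basis7 i)) ` {1..7} \<subseteq> singular_points ?F"
  proof
    fix x assume "x \<in> (\<lambda>i. ray (*s) (basis7 i)) ` {1..7}"
    then obtain i where i: "i \<in> {1..7}" "x = ray (*s) (basis7 i)" by blast
    have "coord7 (basis7 i) i \<noteq> 0" using i(1) by (simp add: coord7_basis7)
    then have "basis7 i \<noteq> 0" by (auto simp: coord7_def split: if_splits)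
    then show "x \<in> singular_points ?F"
      unfolding singular_points_polar[OF cubic] using i polar_seven_nodal_form[OF i(1)] by blast
  qed
  have "card ((\<lambda>i. ray (*s) (basis7 i)) ` {1..7}) = card {1..7::nat}"
    by (rule card_image, rule inj_onI) (rule ray_basis7_inj)
  then show ?thesis using card_subset_eq[OF fin(1) sub] fin(2) by simp
qed

text \<open>The involution of the pencil is induced by an exchange of the two halves of the Fourier
  coordinates.\<close>

definition exchange_matrix :: "complex^6^6"
  where "exchange_matrix = matrix (\<lambda>y. \<chi> i. if i = 1 then 2 * y $ 6 else if i = 2 then 2 * y $ 5
    else if i = 4 then 2 * y $ 3 else if i = 3 then y $ 4 else if i = 6 then y $ 1 else y $ 2)"

lemma exchange_matrix_nth:
  "(exchange_matrix *v y) $ 1 = 2 * y $ 6" "(exchange_matrix *v y) $ 2 = 2 * y $ 5" "(exchange_matrix *v y) $ 4 = 2 * y $ 3"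
  "(exchange_matrix *v y) $ 3 = y $ 4" "(exchange_matrix *v y) $ 6 = y $ 1" "(exchange_matrix *v y) $ 5 = y $ 2"
proof -
  have "exchange_matrix *v y = (\<chi> i. if i = 1 then 2 * y $ 6 else if i = 2 then 2 * y $ 5
    else if i = 4 then 2 * y $ 3 else if i = 3 then y $ 4 else if i = 6 then y $ 1 else y $ 2)"
    unfolding exchange_matrix_def by (rule matrix_works_complex) (simp_all add: vec_eq_iff algebra_simps)
  then show "(exchange_matrix *v y) $ 1 = 2 * y $ 6" "(exchange_matrix *v y) $ 2 = 2 * y $ 5" "(exchange_matrix *v y) $ 4 = 2 * y $ 3"
    "(exchange_matrix *v y) $ 3 = y $ 4" "(exchange_matrix *v y) $ 6 = y $ 1" "(exchange_matrix *v y) $ 5 = y $ 2"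
    by simp_all
qed

lemma fourier_form_exchange: "fourier_form u v (exchange_matrix *v y) = fourier_form (4 * v) (2 * u) y"
  unfolding fourier_form_def torus_form_def exchange_matrix_nth by algebra

definition exchange7 :: "complex^6^6"
  where "exchange7 = fourier_matrix ** exchange_matrix ** matrix_inv fourier_matrix"

lemma exchange7_fourier: "exchange7 *v (fourier_matrix *v y) = fourier_matrix *v (exchange_matrix *v y)"
  unfolding exchange7_def matrix_vector_mul_assoc[symmetric]
  by (simp add: invertible_matrix_inv[OF invertible_fourier_matrix])

lemma klein_exchange7: "klein u v (exchange7 *v x) = klein (4 * v) (2 * u) x"
proof -
  define y where "y = matrix_inv fourier_matrix *v x"
  have x: "x = fourier_matrix *v y" by (simp add: y_def invertible_matrix_inv[OF invertible_fourier_matrix])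
  show ?thesis unfolding x exchange7_fourier klein_fourier_matrix by (rule fourier_form_exchange)
qed

lemma exchange7_square: "exchange7 *v (exchange7 *v x) = 2 *s x"
proof -
  define y where "y = matrix_inv fourier_matrix *v x"
  have x: "x = fourier_matrix *v y" by (simp add: y_def invertible_matrix_inv[OF invertible_fourier_matrix])
  have "exchange_matrix *v (exchange_matrix *v y) = 2 *s y"
    by (simp add: vec_eq_iff forall_6 exchange_matrix_nth)
  then show ?thesis unfolding x exchange7_fourier by (simp add: vector_scalar_commute)
qed

lemma invertible_exchange7: "invertible exchange7"
proof -
  have "x = 0" if "exchange7 *v x = 0" for x using exchange7_square[of x] that by simp
  then have "\<exists>B. B ** exchange7 = mat 1" by (simp add: matrix_left_invertible_ker)
  then show ?thesis by (simp add: invertible_left_inverse)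
qed

lemma act_exchange7: "act exchange7 (klein u v) = klein (v / 2) (u / 4)"
proof
  fix x
  define y where "y = matrix_inv exchange7 *v x"
  have x: "x = exchange7 *v y" by (simp add: y_def invertible_matrix_inv[OF invertible_exchange7])
  show "act exchange7 (klein u v) x = klein (v / 2) (u / 4) x"
    unfolding x act_apply[OF invertible_exchange7] klein_exchange7 by simp
qed

section \<open>The normalizer\<close>

lemma mat_mult_vec: "mat c *v x = c *s x" for x :: "complex^'n"
proof -
  have "(mat c *v x) $ i = (\<Sum>j\<in>UNIV. if i = j then c * x $ j else 0)" for i
    unfolding matrix_vector_mult_def mat_def vec_lambda_beta by (intro sum.cong refl) auto
  then show ?thesis by (simp add: vec_eq_iff)
qed

lemma mat_mult_mat: "mat c ** mat d = (mat (c * d) :: complex^'n^'n)"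
  unfolding matrix_eq matrix_vector_mul_assoc[symmetric] mat_mult_vec vector_smult_assoc by simp

lemma mat_mult_commute: "A ** mat c = mat c ** A" for A :: "complex^'n^'n"
  unfolding matrix_eq matrix_vector_mul_assoc[symmetric] mat_mult_vec vector_scalar_commute by simp

lemma invertible_mat: "c \<noteq> 0 \<Longrightarrow> invertible (mat c :: complex^'n^'n)"
  unfolding invertible_def by (intro exI[of _ "mat (1 / c)"]) (simp add: mat_mult_mat)

lemma group_GL6: "group GL6"
proof (rule groupI)
  fix x assume "x \<in> carrier GL6"
  then have "invertible x" by (simp add: GL6_def)
  then show "\<exists>y\<in>carrier GL6. y \<otimes>\<^bsub>GL6\<^esub> x = \<one>\<^bsub>GL6\<^esub>"
    using invertible_matrix_inv(3,5) by (auto simp: GL6_def)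
qed (auto simp: GL6_def invertible_mult matrix_mul_assoc invertible_mat)

lemma normal_scalars6: "scalars6 \<lhd> GL6"
proof (rule group.normal_invI[OF group_GL6])
  show "subgroup scalars6 GL6"
  proof (rule group.subgroupI[OF group_GL6])
    show "scalars6 \<subseteq> carrier GL6" by (auto simp: scalars6_def GL6_def invertible_mat)
    show "scalars6 \<noteq> {}" unfolding scalars6_def by blast
    fix a assume "a \<in> scalars6"
    then obtain c where c: "a = mat c" "c \<noteq> 0" by (auto simp: scalars6_def)
    have "inv\<^bsub>GL6\<^esub> a = mat (1 / c)"
      by (rule group.inv_equality[OF group_GL6]) (use c in \<open>auto simp: GL6_def mat_mult_mat invertible_mat\<close>)
    then show "inv\<^bsub>GL6\<^esub> a \<in> scalars6" using c unfolding scalars6_def by auto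
    fix b assume "b \<in> scalars6"
    then obtain d where "b = mat d" "d \<noteq> 0" by (auto simp: scalars6_def)
    then show "a \<otimes>\<^bsub>GL6\<^esub> b \<in> scalars6" using c by (auto simp: GL6_def mat_mult_mat scalars6_def)
  qed
  fix x h assume x: "x \<in> carrier GL6" and h: "h \<in> scalars6"
  have "x \<otimes>\<^bsub>GL6\<^esub> h = h \<otimes>\<^bsub>GL6\<^esub> x" using h by (auto simp: scalars6_def GL6_def mat_mult_commute)
  moreover have "h \<in> carrier GL6" using h by (auto simp: scalars6_def GL6_def invertible_mat)
  ultimately have "x \<otimes>\<^bsub>GL6\<^esub> h \<otimes>\<^bsub>GL6\<^esub> inv\<^bsub>GL6\<^esub> x = h"
    using x group.inv_solve_right'[OF group_GL6] group.inv_closed[OF group_GL6] group.r_inv[OF group_GL6]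
    by (metis group.is_monoid[OF group_GL6] monoid.m_assoc monoid.r_one)
  then show "x \<otimes>\<^bsub>GL6\<^esub> h \<otimes>\<^bsub>GL6\<^esub> inv\<^bsub>GL6\<^esub> x \<in> scalars6" using h by simp
qed

definition proj_class :: "complex^6^6 \<Rightarrow> (complex^6^6) set"
  where "proj_class A = scalars6 #>\<^bsub>GL6\<^esub> A"

lemma proj_class_eq: "proj_class A = {mat c ** A | c. c \<noteq> 0}"
  unfolding proj_class_def r_coset_def scalars6_def GL6_def by auto

lemma proj_class_self: "A \<in> proj_class A"
  unfolding proj_class_eq mem_Collect_eq by (intro exI[of _ 1]) simp

lemma proj_class_eqD: "proj_class A = proj_class B \<Longrightarrow> \<exists>c. c \<noteq> 0 \<and> A = mat c ** B"
  using proj_class_self[of A] unfolding proj_class_eq by blast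

lemma group_PGL6: "group PGL6"
  unfolding PGL6_def by (rule normal.factorgroup_is_group[OF normal_scalars6])

lemma carrier_PGL6: "carrier PGL6 = proj_class ` {A. invertible A}"
  unfolding PGL6_def FactGroup_def RCOSETS_def proj_class_def by (auto simp: GL6_def)

lemma mult_PGL6: "invertible A \<Longrightarrow> invertible B \<Longrightarrow> proj_class A \<otimes>\<^bsub>PGL6\<^esub> proj_class B = proj_class (A ** B)"
  unfolding PGL6_def FactGroup_def proj_class_def
  using normal.rcos_sum[OF normal_scalars6, of A B] by (simp add: GL6_def)

lemma L27_invertible: "A \<in> L27 \<Longrightarrow> invertible A"
proof -
  assume "A \<in> L27"
  then obtain \<sigma> where s: "\<sigma> \<in> L27_perms" "A = perm_matrix \<sigma>" unfolding L27_iff_perm_matrix by blast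
  note p = L27_perms_permutes[OF s(1)]
  have "x = 0" if "A *v x = 0" for x
  proof (rule coord7_eqI)
    fix i :: nat assume "i \<in> {1..7}"
    then have "coord7 x i = coord7 (A *v x) (\<sigma> i)" using coord7_perm_matrix[OF p] s(2) by simp
    then show "coord7 x i = coord7 0 i" unfolding that by (simp add: coord7_def)
  qed
  then have "\<exists>B. B ** A = mat 1" by (simp add: matrix_left_invertible_ker)
  then show ?thesis by (simp add: invertible_left_inverse)
qed

abbreviation L27_classes :: "(complex^6^6) set set"
  where "L27_classes \<equiv> proj_class ` L27"

lemma normalizer_L27_iff: "C \<in> normalizer_L27 \<longleftrightarrow> C \<in> carrier PGL6 \<and>
    (\<lambda>X. C \<otimes>\<^bsub>PGL6\<^esub> X \<otimes>\<^bsub>PGL6\<^esub> inv\<^bsub>PGL6\<^esub> C) ` L27_classes = L27_classes"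
proof -
  have "L27_classes \<subseteq> carrier PGL6" unfolding carrier_PGL6 using L27_invertible by blast
  moreover have "C <#\<^bsub>PGL6\<^esub> H #>\<^bsub>PGL6\<^esub> inv\<^bsub>PGL6\<^esub> C = (\<lambda>X. C \<otimes>\<^bsub>PGL6\<^esub> X \<otimes>\<^bsub>PGL6\<^esub> inv\<^bsub>PGL6\<^esub> C) ` H" for H
    by (auto simp: l_coset_def r_coset_def)
  ultimately show ?thesis
    unfolding normalizer_L27_def normalizer_def stabilizer_def proj_class_def[symmetric] by simp
qed

text \<open>Equality of classes in the projective group lifts to matrices only up to a scalar
  \<open>k\<close>, so the conjugation relation is available only in this weaker form.\<close>

lemma normalizer_L27_D:
  assumes "A \<in> \<Union>normalizer_L27"
  shows "invertible A" "g \<in> L27 \<Longrightarrow> \<exists>g'\<in>L27. \<exists>k. k \<noteq> 0 \<and> g ** A = mat k ** (A ** g')"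
proof -
  obtain C where C: "C \<in> normalizer_L27" "A \<in> C" using assms by blast
  then obtain A0 where A0: "C = proj_class A0" "invertible A0" unfolding normalizer_L27_iff carrier_PGL6 by blast
  then obtain c where c: "c \<noteq> 0" "A = mat c ** A0" using C(2) unfolding proj_class_eq by blast
  show inv: "invertible A" unfolding c(2) by (rule invertible_mult[OF invertible_mat[OF c(1)] A0(2)])
  have CA: "C = proj_class A"
  proof -
    have "mat d ** A0 = mat (d / c) ** A" for d unfolding c(2) matrix_mul_assoc mat_mult_mat using c(1) by simp
    moreover have "mat d ** A = mat (d * c) ** A0" for d unfolding c(2) matrix_mul_assoc mat_mult_mat ..
    ultimately show ?thesis unfolding A0(1) proj_class_eq using c(1) by (auto; metis divide_eq_0_iff mult_eq_0_iff)
  qed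
  assume g: "g \<in> L27"
  then have "proj_class g \<in> (\<lambda>X. C \<otimes>\<^bsub>PGL6\<^esub> X \<otimes>\<^bsub>PGL6\<^esub> inv\<^bsub>PGL6\<^esub> C) ` L27_classes"
    using C(1) unfolding normalizer_L27_iff by blast
  then obtain g' where g': "g' \<in> L27" "proj_class g = C \<otimes>\<^bsub>PGL6\<^esub> proj_class g' \<otimes>\<^bsub>PGL6\<^esub> inv\<^bsub>PGL6\<^esub> C" by blast
  interpret PGL: group PGL6 by (rule group_PGL6)
  have Cc: "C \<in> carrier PGL6" and gc: "proj_class g' \<in> carrier PGL6"
    using C(1) g'(1) L27_invertible unfolding normalizer_L27_iff carrier_PGL6 by blast+
  have "proj_class g \<otimes>\<^bsub>PGL6\<^esub> C = C \<otimes>\<^bsub>PGL6\<^esub> proj_class g'"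
    unfolding g'(2) using Cc gc by (simp add: PGL.m_assoc)
  then have "proj_class (g ** A) = proj_class (A ** g')"
    unfolding CA using mult_PGL6 L27_invertible g g'(1) inv by simp
  then show "\<exists>g'\<in>L27. \<exists>k. k \<noteq> 0 \<and> g ** A = mat k ** (A ** g')" using proj_class_eqD g'(1) by blast
qed

lemma normalizer_L27_I:
  assumes A: "invertible A" and 1: "\<And>g. g \<in> L27 \<Longrightarrow> \<exists>g'\<in>L27. A ** g = g' ** A"
    and 2: "\<And>g. g \<in> L27 \<Longrightarrow> \<exists>g'\<in>L27. g ** A = A ** g'"
  shows "A \<in> \<Union>normalizer_L27"
proof -
  interpret PGL: group PGL6 by (rule group_PGL6)
  let ?C = "proj_class A"
  have Cc: "?C \<in> carrier PGL6" using A unfolding carrier_PGL6 by blast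
  have Lc: "proj_class g \<in> carrier PGL6" if "g \<in> L27" for g using that L27_invertible unfolding carrier_PGL6 by blast
  have conj: "?C \<otimes>\<^bsub>PGL6\<^esub> proj_class g \<otimes>\<^bsub>PGL6\<^esub> inv\<^bsub>PGL6\<^esub> ?C = proj_class g'"
    if "g \<in> L27" "g' \<in> L27" "A ** g = g' ** A" for g g'
  proof -
    have "?C \<otimes>\<^bsub>PGL6\<^esub> proj_class g = proj_class g' \<otimes>\<^bsub>PGL6\<^esub> ?C"
      using mult_PGL6 A that L27_invertible by simp
    then show ?thesis using Cc Lc that by (simp add: PGL.m_assoc)
  qed
  have "(\<lambda>X. ?C \<otimes>\<^bsub>PGL6\<^esub> X \<otimes>\<^bsub>PGL6\<^esub> inv\<^bsub>PGL6\<^esub> ?C) ` L27_classes = L27_classes"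
  proof (intro equalityI subsetI)
    fix X assume "X \<in> (\<lambda>X. ?C \<otimes>\<^bsub>PGL6\<^esub> X \<otimes>\<^bsub>PGL6\<^esub> inv\<^bsub>PGL6\<^esub> ?C) ` L27_classes"
    then obtain g where "g \<in> L27" "X = ?C \<otimes>\<^bsub>PGL6\<^esub> proj_class g \<otimes>\<^bsub>PGL6\<^esub> inv\<^bsub>PGL6\<^esub> ?C" by blast
    then show "X \<in> L27_classes" using 1[of g] conj[of g] by auto
  next
    fix X assume "X \<in> L27_classes"
    then obtain g where g: "g \<in> L27" "X = proj_class g" by blast
    then obtain g' where g': "g' \<in> L27" "g ** A = A ** g'" using 2 by blast
    have "X = ?C \<otimes>\<^bsub>PGL6\<^esub> proj_class g' \<otimes>\<^bsub>PGL6\<^esub> inv\<^bsub>PGL6\<^esub> ?C"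
      using conj[OF g'(1) g(1) g'(2)[symmetric]] g(2) by simp
    then show "X \<in> (\<lambda>X. ?C \<otimes>\<^bsub>PGL6\<^esub> X \<otimes>\<^bsub>PGL6\<^esub> inv\<^bsub>PGL6\<^esub> ?C) ` L27_classes" using g'(1) by blast
  qed
  then show ?thesis using Cc proj_class_self unfolding normalizer_L27_iff[symmetric] Union_iff by (metis normalizer_L27_iff)
qed

lemma perm_matrix_comp:
  assumes "\<sigma> permutes {1..7}" "\<tau> permutes {1..7}"
  shows "perm_matrix (\<sigma> \<circ> \<tau>) *v x = perm_matrix \<sigma> *v (perm_matrix \<tau> *v x)"
proof (rule coord7_eqI)
  fix j :: nat assume "j \<in> {1..7}"
  then obtain i where i: "j = (\<sigma> \<circ> \<tau>) i" "i \<in> {1..7}"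
    using permutes_image[OF permutes_compose[OF assms(2,1)]] by blast
  have "\<tau> i \<in> {1..7}" using permutes_in_image[OF assms(2)] i(2) by blast
  then show "coord7 (perm_matrix (\<sigma> \<circ> \<tau>) *v x) j = coord7 (perm_matrix \<sigma> *v (perm_matrix \<tau> *v x)) j"
    unfolding i(1) coord7_perm_matrix[OF permutes_compose[OF assms(2,1)] i(2)]
    by (simp add: coord7_perm_matrix[OF assms(1)] coord7_perm_matrix[OF assms(2) i(2)])
qed

lemma perm_matrix_id: "perm_matrix id *v x = x"
  by (rule coord7_eqI) (use coord7_perm_matrix[OF permutes_id] in simp)

lemma perm_matrix_inv:
  assumes "\<sigma> permutes {1..7}"
  shows "perm_matrix (inv_into UNIV \<sigma>) *v (perm_matrix \<sigma> *v x) = x" "perm_matrix \<sigma> *v (perm_matrix (inv_into UNIV \<sigma>) *v x) = x"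
  using perm_matrix_comp[OF permutes_inv[OF assms] assms] perm_matrix_comp[OF assms permutes_inv[OF assms]] perm_matrix_id
    permutes_inv_o[OF assms] by metis+

lemma L27_perms_comp: "\<sigma> \<in> L27_perms \<Longrightarrow> \<tau> \<in> L27_perms \<Longrightarrow> \<sigma> \<circ> \<tau> \<in> L27_perms"
  unfolding L27_perms_gen using generate.eng[of \<sigma> "sym_group 7" _ \<tau>] by (simp add: sym_group_mult)

lemma L27_perms_inv: "\<sigma> \<in> L27_perms \<Longrightarrow> inv_into UNIV \<sigma> \<in> L27_perms"
proof -
  assume s: "\<sigma> \<in> L27_perms"
  have sub: "{swap_gen, cycle_gen} \<subseteq> carrier (sym_group 7)" using gen_permutes by (simp add: sym_group_carrier)
  have c: "\<sigma> \<in> carrier (sym_group 7)" using L27_perms_permutes[OF s] by (simp add: sym_group_carrier)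
  show ?thesis
    using group.generate_m_inv_closed[OF sym_group_is_group sub s[unfolded L27_perms_gen]]
    unfolding sym_group_inv_equality[OF c] L27_perms_gen .
qed

text \<open>The incidence matrix of a polarity of the Fano plane: coordinate n of the image is the
  sum over the line {1, 2, 4} - n. This description exhibits how the exchange interacts with the
  permutations.\<close>

lemma coord7_exchange7:
  "coord7 (exchange7 *v x) 1 = coord7 x 7 + coord7 x 1 + coord7 x 3"
  "coord7 (exchange7 *v x) 2 = coord7 x 6 + coord7 x 7 + coord7 x 2"
  "coord7 (exchange7 *v x) 3 = coord7 x 5 + coord7 x 6 + coord7 x 1"
  "coord7 (exchange7 *v x) 4 = coord7 x 4 + coord7 x 5 + coord7 x 7"
  "coord7 (exchange7 *v x) 5 = coord7 x 3 + coord7 x 4 + coord7 x 6"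
  "coord7 (exchange7 *v x) 6 = coord7 x 2 + coord7 x 3 + coord7 x 5"
  "coord7 (exchange7 *v x) 7 = coord7 x 1 + coord7 x 2 + coord7 x 4"
proof -
  define y where "y = matrix_inv fourier_matrix *v x"
  have x: "x = fourier_matrix *v y" by (simp add: y_def invertible_matrix_inv[OF invertible_fourier_matrix])
  note [simp] = coord7_fourier_matrix
  note expand = fourier_transform_def sum_atLeastAtMost_6 fourier_weight_simps exchange_matrix_nth theta_def
  show "coord7 (exchange7 *v x) 1 = coord7 x 7 + coord7 x 1 + coord7 x 3"
    unfolding x exchange7_fourier by (simp add: expand zeta_power_reduce zeta_power_7 del: One_nat_def) (use zeta_sum zeta_power_7 in algebra)
  show "coord7 (exchange7 *v x) 2 = coord7 x 6 + coord7 x 7 + coord7 x 2"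
    unfolding x exchange7_fourier by (simp add: expand zeta_power_reduce zeta_power_7 del: One_nat_def) (use zeta_sum zeta_power_7 in algebra)
  show "coord7 (exchange7 *v x) 3 = coord7 x 5 + coord7 x 6 + coord7 x 1"
    unfolding x exchange7_fourier by (simp add: expand zeta_power_reduce zeta_power_7 del: One_nat_def) (use zeta_sum zeta_power_7 in algebra)
  show "coord7 (exchange7 *v x) 4 = coord7 x 4 + coord7 x 5 + coord7 x 7"
    unfolding x exchange7_fourier by (simp add: expand zeta_power_reduce zeta_power_7 del: One_nat_def) (use zeta_sum zeta_power_7 in algebra)
  show "coord7 (exchange7 *v x) 5 = coord7 x 3 + coord7 x 4 + coord7 x 6"
    unfolding x exchange7_fourier by (simp add: expand zeta_power_reduce zeta_power_7 del: One_nat_def) (use zeta_sum zeta_power_7 in algebra)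
  show "coord7 (exchange7 *v x) 6 = coord7 x 2 + coord7 x 3 + coord7 x 5"
    unfolding x exchange7_fourier by (simp add: expand zeta_power_reduce zeta_power_7 del: One_nat_def) (use zeta_sum zeta_power_7 in algebra)
  show "coord7 (exchange7 *v x) 7 = coord7 x 1 + coord7 x 2 + coord7 x 4"
    unfolding x exchange7_fourier by (simp add: expand zeta_power_reduce zeta_power_7 del: One_nat_def) (use zeta_sum zeta_power_7 in algebra)
qed

lemma coord7_generators:
  "coord7 (perm_matrix swap_gen *v x) 1 = coord7 x 2" "coord7 (perm_matrix swap_gen *v x) 2 = coord7 x 1"
  "coord7 (perm_matrix swap_gen *v x) 3 = coord7 x 6" "coord7 (perm_matrix swap_gen *v x) 4 = coord7 x 4"
  "coord7 (perm_matrix swap_gen *v x) 5 = coord7 x 5" "coord7 (perm_matrix swap_gen *v x) 6 = coord7 x 3"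
  "coord7 (perm_matrix swap_gen *v x) 7 = coord7 x 7"
  "coord7 (perm_matrix cycle_gen *v x) 1 = coord7 x 7" "coord7 (perm_matrix cycle_gen *v x) 2 = coord7 x 1"
  "coord7 (perm_matrix cycle_gen *v x) 3 = coord7 x 2" "coord7 (perm_matrix cycle_gen *v x) 4 = coord7 x 3"
  "coord7 (perm_matrix cycle_gen *v x) 5 = coord7 x 4" "coord7 (perm_matrix cycle_gen *v x) 6 = coord7 x 5"
  "coord7 (perm_matrix cycle_gen *v x) 7 = coord7 x 6"
  using coord7_perm_matrix[OF gen_permutes(1), of 2 x] coord7_perm_matrix[OF gen_permutes(1), of 1 x]
    coord7_perm_matrix[OF gen_permutes(1), of 6 x] coord7_perm_matrix[OF gen_permutes(1), of 4 x]
    coord7_perm_matrix[OF gen_permutes(1), of 5 x] coord7_perm_matrix[OF gen_permutes(1), of 3 x]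
    coord7_perm_matrix[OF gen_permutes(1), of 7 x]
    coord7_perm_matrix[OF gen_permutes(2), of 7 x] coord7_perm_matrix[OF gen_permutes(2), of 1 x]
    coord7_perm_matrix[OF gen_permutes(2), of 2 x] coord7_perm_matrix[OF gen_permutes(2), of 3 x]
    coord7_perm_matrix[OF gen_permutes(2), of 4 x] coord7_perm_matrix[OF gen_permutes(2), of 5 x]
    coord7_perm_matrix[OF gen_permutes(2), of 6 x]
  by (simp_all del: One_nat_def)

lemma coord7_eqI7:
  assumes "coord7 x 1 = coord7 y 1" "coord7 x 2 = coord7 y 2" "coord7 x 3 = coord7 y 3" "coord7 x 4 = coord7 y 4"
    "coord7 x 5 = coord7 y 5" "coord7 x 6 = coord7 y 6"
  shows "x = y"
  using assms unfolding vec_eq_iff forall_6 coord7_simps by blast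

lemma exchange7_swap: "exchange7 *v (perm_matrix swap_gen *v x) = perm_matrix swap_gen *v (exchange7 *v x)"
  by (rule coord7_eqI7; simp only: coord7_exchange7 coord7_generators; simp only: add_ac)

text \<open>The polarity n \<mapsto> {1, 2, 4} - n reverses translations, so conjugation by it
  inverts the 7-cycle.\<close>

lemma exchange7_cycle: "perm_matrix cycle_gen *v (exchange7 *v (perm_matrix cycle_gen *v x)) = exchange7 *v x"
  by (rule coord7_eqI7; simp only: coord7_exchange7 coord7_generators; simp only: add_ac)

lemma exchange7_perm:
  assumes "\<sigma> \<in> L27_perms"
  shows "\<exists>\<tau>\<in>L27_perms. \<forall>x. exchange7 *v (perm_matrix \<sigma> *v x) = perm_matrix \<tau> *v (exchange7 *v x)"
proof -
  have "\<sigma> permutes {1..7} \<and> (\<exists>\<tau>\<in>L27_perms. \<forall>x. exchange7 *v (perm_matrix \<sigma> *v x) = perm_matrix \<tau> *v (exchange7 *v x))"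
  proof (rule L27_perms_induct[OF assms])
    have "id \<in> L27_perms" using L27_perms_comp[OF gen_in_L27_perms(1) L27_perms_inv[OF gen_in_L27_perms(1)]]
      permutes_inv_o[OF gen_permutes(1)] by simp
    then show "id permutes {1..7} \<and> (\<exists>\<tau>\<in>L27_perms. \<forall>x. exchange7 *v (perm_matrix id *v x) = perm_matrix \<tau> *v (exchange7 *v x))"
      using permutes_id by (intro conjI bexI[of _ id]) (simp_all add: perm_matrix_id)
    show "swap_gen permutes {1..7} \<and> (\<exists>\<tau>\<in>L27_perms. \<forall>x. exchange7 *v (perm_matrix swap_gen *v x) = perm_matrix \<tau> *v (exchange7 *v x))"
      using gen_permutes gen_in_L27_perms exchange7_swap by blast
    have "exchange7 *v (perm_matrix cycle_gen *v x) = perm_matrix (inv_into UNIV cycle_gen) *v (exchange7 *v x)" for x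
      using perm_matrix_inv(1)[OF gen_permutes(2)] exchange7_cycle by metis
    then show "cycle_gen permutes {1..7} \<and> (\<exists>\<tau>\<in>L27_perms. \<forall>x. exchange7 *v (perm_matrix cycle_gen *v x) = perm_matrix \<tau> *v (exchange7 *v x))"
      using gen_permutes L27_perms_inv[OF gen_in_L27_perms(2)] by blast
  next
    fix \<sigma> assume p: "\<sigma> permutes {1..7}"
      and "\<sigma> permutes {1..7} \<and> (\<exists>\<tau>\<in>L27_perms. \<forall>x. exchange7 *v (perm_matrix \<sigma> *v x) = perm_matrix \<tau> *v (exchange7 *v x))"
    then obtain \<tau> where t: "\<tau> \<in> L27_perms" "\<And>x. exchange7 *v (perm_matrix \<sigma> *v x) = perm_matrix \<tau> *v (exchange7 *v x)" by blast
    have "exchange7 *v (perm_matrix (inv_into UNIV \<sigma>) *v x) = perm_matrix (inv_into UNIV \<tau>) *v (exchange7 *v x)" for x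
      using t(2)[of "perm_matrix (inv_into UNIV \<sigma>) *v x"] perm_matrix_inv(2)[OF p] perm_matrix_inv(1)[OF L27_perms_permutes[OF t(1)]] by metis
    then show "inv_into UNIV \<sigma> permutes {1..7} \<and> (\<exists>\<tau>\<in>L27_perms. \<forall>x. exchange7 *v (perm_matrix (inv_into UNIV \<sigma>) *v x) = perm_matrix \<tau> *v (exchange7 *v x))"
      using permutes_inv[OF p] L27_perms_inv[OF t(1)] by blast
  next
    fix \<sigma> \<sigma>'
    assume "\<sigma> permutes {1..7} \<and> (\<exists>\<tau>\<in>L27_perms. \<forall>x. exchange7 *v (perm_matrix \<sigma> *v x) = perm_matrix \<tau> *v (exchange7 *v x))"
      and "\<sigma>' permutes {1..7} \<and> (\<exists>\<tau>\<in>L27_perms. \<forall>x. exchange7 *v (perm_matrix \<sigma>' *v x) = perm_matrix \<tau> *v (exchange7 *v x))"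
    then obtain \<tau> \<tau>' where p: "\<sigma> permutes {1..7}" "\<sigma>' permutes {1..7}" and t: "\<tau> \<in> L27_perms" "\<tau>' \<in> L27_perms"
      "\<And>x. exchange7 *v (perm_matrix \<sigma> *v x) = perm_matrix \<tau> *v (exchange7 *v x)"
      "\<And>x. exchange7 *v (perm_matrix \<sigma>' *v x) = perm_matrix \<tau>' *v (exchange7 *v x)" by blast
    have "exchange7 *v (perm_matrix (\<sigma> \<circ> \<sigma>') *v x) = perm_matrix (\<tau> \<circ> \<tau>') *v (exchange7 *v x)" for x
      unfolding perm_matrix_comp[OF p] perm_matrix_comp[OF L27_perms_permutes[OF t(1)] L27_perms_permutes[OF t(2)]] t(3,4) ..
    then show "\<sigma> \<circ> \<sigma>' permutes {1..7} \<and> (\<exists>\<tau>\<in>L27_perms. \<forall>x. exchange7 *v (perm_matrix (\<sigma> \<circ> \<sigma>') *v x) = perm_matrix \<tau> *v (exchange7 *v x))"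
      using permutes_compose[OF p(2,1)] L27_perms_comp[OF t(1,2)] by blast
  qed
  then show ?thesis by blast
qed

lemma scaled_exchange7_in_normalizer:
  assumes c: "c \<noteq> 0" shows "mat c ** exchange7 \<in> \<Union>normalizer_L27"
proof (rule normalizer_L27_I)
  show "invertible (mat c ** exchange7)" by (rule invertible_mult[OF invertible_mat[OF c] invertible_exchange7])
  fix g assume "g \<in> L27"
  then obtain \<sigma> where g: "\<sigma> \<in> L27_perms" "g = perm_matrix \<sigma>" unfolding L27_iff_perm_matrix by blast
  obtain \<tau> where t: "\<tau> \<in> L27_perms" "\<And>x. exchange7 *v (perm_matrix \<sigma> *v x) = perm_matrix \<tau> *v (exchange7 *v x)"
    using exchange7_perm[OF g(1)] by blast
  have "mat c ** exchange7 ** g = perm_matrix \<tau> ** (mat c ** exchange7)"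
    unfolding matrix_eq matrix_vector_mul_assoc[symmetric] g(2) t(2) mat_mult_vec vector_scalar_commute by simp
  then show "\<exists>g'\<in>L27. mat c ** exchange7 ** g = g' ** (mat c ** exchange7)" using perm_matrix_in_L27[OF t(1)] by blast
  \<comment> \<open>As the square of the exchange is the scalar 2, conjugating twice is trivial and
    the relation for \<sigma> and \<tau> can be read backwards.\<close>
  have "2 *s (perm_matrix \<sigma> *v (exchange7 *v x)) = 2 *s (exchange7 *v (perm_matrix \<tau> *v x))" for x
  proof -
    have "2 *s (exchange7 *v (perm_matrix \<tau> *v x)) = exchange7 *v (perm_matrix \<tau> *v (exchange7 *v (exchange7 *v x)))"
      by (simp add: exchange7_square vector_scalar_commute)
    also have "\<dots> = 2 *s (perm_matrix \<sigma> *v (exchange7 *v x))"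
      unfolding t(2)[symmetric] by (rule exchange7_square)
    finally show ?thesis ..
  qed
  then have "perm_matrix \<sigma> *v (exchange7 *v x) = exchange7 *v (perm_matrix \<tau> *v x)" for x by simp
  then have "g ** (mat c ** exchange7) = mat c ** exchange7 ** perm_matrix \<tau>"
    unfolding matrix_eq matrix_vector_mul_assoc[symmetric] g(2) mat_mult_vec vector_scalar_commute by simp
  then show "\<exists>g'\<in>L27. g ** (mat c ** exchange7) = mat c ** exchange7 ** g'" using perm_matrix_in_L27[OF t(1)] by blast
qed

lemma one_in_normalizer: "mat 1 \<in> \<Union>normalizer_L27"
  by (rule normalizer_L27_I) (auto simp: invertible_mat)

text \<open>Because of the scalars in the conjugation relation, the transformed form is at first
  only multiplied by a constant under each group element. The constants of the two generators are
  then forced to be 1 by their relations.\<close>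

lemma normalizer_preserves_V_L27:
  assumes A: "A \<in> \<Union>normalizer_L27" and F: "F \<in> V_L27"
  shows "act A F \<in> V_L27"
proof -
  note inv = normalizer_L27_D(1)[OF A]
  define G where "G = act A F"
  have cubic: "F \<in> cubic_forms" and Finv: "\<And>g x. g \<in> L27 \<Longrightarrow> F (g *v x) = F x"
    using F unfolding V_L27_def by blast+
  have Gcubic: "G \<in> cubic_forms" unfolding G_def act_def by (rule cubic_compose[OF cubic])
  have "\<exists>k. \<forall>x. G (g *v x) = k * G x" if g: "g \<in> L27" for g
  proof -
    obtain g' k where g': "g' \<in> L27" "g ** A = mat k ** (A ** g')" using normalizer_L27_D(2)[OF A g] by blast
    have "G (g *v x) = k ^ 3 * G x" for x
    proof -
      define y where "y = matrix_inv A *v x"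
      have x: "x = A *v y" by (simp add: y_def invertible_matrix_inv[OF inv])
      have "g *v x = (g ** A) *v y" by (simp add: x matrix_vector_mul_assoc)
      also have "\<dots> = A *v (k *s (g' *v y))"
        unfolding g'(2) by (simp add: mat_mult_vec vector_scalar_commute flip: matrix_vector_mul_assoc)
      finally have "G (g *v x) = F (k *s (g' *v y))" by (simp add: G_def act_apply[OF inv])
      also have "\<dots> = k ^ 3 * G x" by (simp add: cubic_form_scale[OF cubic] Finv[OF g'(1)] x G_def act_apply[OF inv])
      finally show ?thesis .
    qed
    then show ?thesis by blast
  qed
  note char = this
  let ?a = "perm_matrix swap_gen" and ?b = "perm_matrix cycle_gen"
  obtain \<alpha> \<beta> where ab: "\<And>x. G (?a *v x) = \<alpha> * G x" "\<And>x. G (?b *v x) = \<beta> * G x"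
    using char[OF perm_matrix_in_L27[OF gen_in_L27_perms(1)]] char[OF perm_matrix_in_L27[OF gen_in_L27_perms(2)]] by blast
  have gens: "G (?a *v x) = G x \<and> G (?b *v x) = G x" for x
  proof (cases "\<exists>x0. G x0 \<noteq> 0")
    case True
    then obtain x0 where x0: "G x0 \<noteq> 0" by blast
    \<comment> \<open>The generators satisfy a^2 = b^7 = (a b)^3 = 1. Commuting numbers subject to
      these relations are trivial: the sixth power of the last one gives \<beta>^6 = 1, which
      together with \<beta>^7 = 1 yields \<beta> = 1, and then \<alpha>^2 = \<alpha>^3 = 1.\<close>
    have "?a *v (?a *v x0) = x0" by (rule coord7_eqI7; simp only: coord7_generators)
    then have "\<alpha> * \<alpha> * G x0 = G x0" using ab(1)[of "?a *v x0"] ab(1)[of x0] by simp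
    then have a: "\<alpha> ^ 2 = 1" using x0 by (simp add: power2_eq_square)
    have "?b *v (?b *v (?b *v (?b *v (?b *v (?b *v (?b *v x0)))))) = x0" by (rule coord7_eqI7; simp only: coord7_generators)
    then have "\<beta> * (\<beta> * (\<beta> * (\<beta> * (\<beta> * (\<beta> * (\<beta> * G x0)))))) = G x0" using ab(2) by metis
    then have "\<beta> ^ 7 * G x0 = G x0" by (simp add: eval_nat_numeral mult.assoc)
    then have b: "\<beta> ^ 7 = 1" using x0 by simp
    have "?a *v (?b *v (?a *v (?b *v (?a *v (?b *v x0))))) = x0" by (rule coord7_eqI7; simp only: coord7_generators)
    then have "\<alpha> * (\<beta> * (\<alpha> * (\<beta> * (\<alpha> * (\<beta> * G x0))))) = G x0" using ab by metis
    then have "(\<alpha> * \<beta>) ^ 3 * G x0 = G x0" by (simp add: power3_eq_cube mult_ac)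
    then have c: "(\<alpha> * \<beta>) ^ 3 = 1" using x0 by simp
    have "((\<alpha> * \<beta>) ^ 3) ^ 2 = (\<alpha> ^ 2) ^ 3 * \<beta> ^ 6" by (simp add: power_mult_distrib flip: power_mult)
    then have "\<beta> ^ 6 = 1" using a c by simp
    moreover have "\<beta> ^ 7 = \<beta> * \<beta> ^ 6" by (simp flip: power_Suc)
    ultimately have "\<beta> = 1" using b by simp
    moreover have "\<alpha> = 1" using a c \<open>\<beta> = 1\<close> by (simp add: power3_eq_cube power2_eq_square)
    ultimately show ?thesis using ab by simp
  qed auto
  have "\<sigma> permutes {1..7} \<and> (\<forall>x. G (perm_matrix \<sigma> *v x) = G x)" if "\<sigma> \<in> L27_perms" for \<sigma>
  proof (rule L27_perms_induct[OF that])
    show "id permutes {1..7} \<and> (\<forall>x. G (perm_matrix id *v x) = G x)" using permutes_id by (simp add: perm_matrix_id)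
    show "swap_gen permutes {1..7} \<and> (\<forall>x. G (?a *v x) = G x)" "cycle_gen permutes {1..7} \<and> (\<forall>x. G (?b *v x) = G x)"
      using gen_permutes gens by blast+
    show "inv_into UNIV \<sigma> permutes {1..7} \<and> (\<forall>x. G (perm_matrix (inv_into UNIV \<sigma>) *v x) = G x)"
      if "\<sigma> permutes {1..7}" "\<sigma> permutes {1..7} \<and> (\<forall>x. G (perm_matrix \<sigma> *v x) = G x)" for \<sigma>
      using permutes_inv[OF that(1)] that(2) perm_matrix_inv(2)[OF that(1)] by metis
    show "\<sigma> \<circ> \<tau> permutes {1..7} \<and> (\<forall>x. G (perm_matrix (\<sigma> \<circ> \<tau>) *v x) = G x)"
      if "\<sigma> permutes {1..7} \<and> (\<forall>x. G (perm_matrix \<sigma> *v x) = G x)" "\<tau> permutes {1..7} \<and> (\<forall>x. G (perm_matrix \<tau> *v x) = G x)" for \<sigma> \<tau>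
      using that permutes_compose perm_matrix_comp by metis
  qed
  note perm = this
  have "G (A *v x) = G x" if A: "A \<in> L27" for A x
  proof -
    obtain \<sigma> where "\<sigma> \<in> L27_perms" "A = perm_matrix \<sigma>" using A unfolding L27_iff_perm_matrix by blast
    then show ?thesis using perm by simp
  qed
  then show ?thesis unfolding G_def[symmetric] V_L27_def using Gcubic by blast
qed

section \<open>The action of the normalizer on the pencil\<close>

lemma act_add: "act A (F + F') = act A F + act A F'"
  by (simp add: act_def fun_eq_iff)

lemma act_inj: "invertible A \<Longrightarrow> act A F = act A F' \<Longrightarrow> F = F'"
  using act_apply[of A F] act_apply[of A F'] by (metis ext)

lemma two_theta_nonzero: "2 * theta + 1 \<noteq> 0"
proof
  assume "2 * theta + 1 = 0"
  then have "(7 :: complex) = 0" using theta_root by algebra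
  then show False by simp
qed

text \<open>A representative of each 7-nodal member, scaled to have second parameter 8; the two of
  them form a basis of the pencil.\<close>

definition klein7 :: "complex \<Rightarrow> form"
  where "klein7 \<eta> = klein (7 * \<eta> - 3) 8"

lemma klein7_card: "root_pm \<eta> \<Longrightarrow> card (singular_points (klein7 \<eta>)) = 7"
proof -
  assume \<eta>: "root_pm \<eta>"
  have "nodal_with 7 (klein (7 * \<eta> - 3) 8)" by (rule klein_nodal_7[OF \<eta>]) simp_all
  then show ?thesis unfolding klein7_def nodal_with_def by blast
qed

lemma klein7_span: obtains p q where "klein u v = form_scale p (klein7 theta) + form_scale q (klein7 (- 1 - theta))"
proof -
  define w where "w = v / 8"
  define p where "p = (u + w * (10 + 7 * theta)) / (7 * (2 * theta + 1))"
  have v: "v = 8 * w" by (simp add: w_def)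
  have nz: "7 * (2 * theta + 1) \<noteq> 0" using two_theta_nonzero by (metis mult_eq_0_iff zero_neq_numeral)
  have "p * (7 * (2 * theta + 1)) = u + w * (10 + 7 * theta)"
    unfolding p_def times_divide_eq_left by (rule nonzero_mult_div_cancel_right[OF nz])
  then have "u = p * (7 * theta - 3) + (w - p) * (7 * (- 1 - theta) - 3)" by algebra
  moreover have "v = p * 8 + (w - p) * 8" by (simp add: v algebra_simps)
  ultimately show ?thesis by (intro that[of p "w - p"]) (simp only: klein7_def klein_scale klein_add)
qed

text \<open>That both components are nonzero is the point: a transformation fixing both 7-nodal
  members and scaling \<open>power_sum\<close> must scale the whole pencil.\<close>

lemma power_sum_klein7:
  obtains a b where "a \<noteq> 0" "b \<noteq> 0" "power_sum = form_scale a (klein7 theta) + form_scale b (klein7 (- 1 - theta))"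
proof -
  define w where "w = theta / 56"
  have w: "theta = 56 * w" "w \<noteq> 0" using theta_nonzero by (simp_all add: w_def)
  have "- 7 * theta * (3 * theta) = 15 * w * (theta - 10) * (7 * theta - 3) + w * (3 - 15 * theta) * (7 * (- 1 - theta) - 3)"
    using w(1) theta_root by algebra
  moreover have "- 7 * theta * 3 = 15 * w * (theta - 10) * 8 + w * (3 - 15 * theta) * 8" using w(1) by algebra
  moreover have "theta - 10 \<noteq> 0"
  proof
    assume "theta - 10 = 0"
    \<comment> \<open>112 is the norm of \<open>theta - 10\<close>; likewise 504 below is the norm
      of \<open>3 - 15 * theta\<close>.\<close>
    then have "(112 :: complex) = 0" using theta_root by algebra
    then show False by simp
  qed
  moreover have "3 - 15 * theta \<noteq> 0"
  proof
    assume "3 - 15 * theta = 0"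
    then have "(504 :: complex) = 0" using theta_root by algebra
    then show False by simp
  qed
  ultimately show ?thesis
    using w(2) by (intro that[of "15 * w * (theta - 10)" "w * (3 - 15 * theta)"]) (simp_all only: power_sum_klein klein7_def klein_scale klein_add mult_eq_0_iff zero_neq_numeral numeral_neq_zero not_False_eq_True simp_thms)
qed

lemma singular_points_klein7: "singular_points (klein7 (- 1 - theta)) = (\<lambda>i. ray (*s) (basis7 i)) ` {1..7}"
proof -
  define d where "d = - 7 * theta * (3 - 15 * theta) / 8"
  have d8: "8 * d = - 7 * theta * (3 - 15 * theta)" by (simp add: d_def)
  have "d \<noteq> 0"
  proof
    assume "d = 0"
    then have "theta * (504 :: complex) = 0" using d8 theta_root by algebra
    then show False using theta_nonzero by simp
  qed
  have "(\<lambda>x. power_sum x - 15 * line_sum x) = form_scale 1 power_sum + form_scale (- 15) line_sum"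
    by (simp add: fun_eq_iff form_scale_def)
  also have "\<dots> = form_scale d (klein7 (- 1 - theta))"
  proof -
    have "8 * (- 7 * theta * (3 * theta - 30)) = 8 * (d * (7 * (- 1 - theta) - 3))" using d8 theta_root by algebra
    then have 1: "- 7 * theta * (3 * theta - 30) = d * (7 * (- 1 - theta) - 3)" by (simp only: mult_cancel_left zero_neq_numeral[symmetric] simp_thms)
    have 2: "- 7 * theta * (3 - 15 * theta) = d * 8" using d8 by algebra
    show ?thesis unfolding seven_nodal_form klein7_def klein_scale 1 2 ..
  qed
  finally have "singular_points (\<lambda>x. power_sum x - 15 * line_sum x) = singular_points (form_scale d (klein7 (- 1 - theta)))" by simp
  also have "\<dots> = singular_points (klein7 (- 1 - theta))"
    unfolding klein7_def by (rule singular_points_scale[OF klein_cubic \<open>d \<noteq> 0\<close>])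
  finally show ?thesis using seven_nodal_singular_points by simp
qed

text \<open>A linear change of coordinates keeps the number of singular points, and within the
  pencil the number 7 characterizes the 7-nodal members.\<close>

lemma act_klein7:
  assumes A: "invertible A" "act A ` V_L27 \<subseteq> V_L27" and \<eta>: "root_pm \<eta>"
  obtains s \<eta>' where "root_pm \<eta>'" "s \<noteq> 0" "act A (klein7 \<eta>) = form_scale s (klein7 \<eta>')"
proof -
  have "klein7 \<eta> \<in> V_L27" unfolding V_L27_klein klein7_def by blast
  then have "act A (klein7 \<eta>) \<in> V_L27" using A(2) by blast
  then obtain u v where uv: "act A (klein7 \<eta>) = klein u v" unfolding V_L27_klein by blast
  have "card (singular_points (act A (klein7 \<eta>))) = card (singular_points (klein7 \<eta>))"
    unfolding act_def klein7_def by (rule card_singular_points_compose[OF klein_cubic invertible_matrix_inv(3)[OF A(1)]])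
  then have "card (singular_points (klein u v)) = 7" unfolding uv klein7_card[OF \<eta>] .
  then obtain \<eta>' where h: "v \<noteq> 0" "root_pm \<eta>'" "8 * u = (7 * \<eta>' - 3) * v" using klein_card_singular_7 by blast
  have "klein u v = form_scale (v / 8) (klein7 \<eta>')"
    unfolding klein7_def klein_scale klein_inj using h(3) by (simp add: field_simps)
  then show ?thesis using that[OF h(2), of "v / 8"] h(1) uv by simp
qed

lemma sum_basis7: "(\<Sum>i\<in>{1..7}. basis7 i) = 0"
proof (rule coord7_eqI)
  fix j :: nat assume j: "j \<in> {1..7}"
  have "coord7 (\<Sum>i\<in>{1..7}. basis7 i) j = (\<Sum>i\<in>{1..7}. (if i = j then 1 else 0) - 1 / 7)"
    unfolding coord7_sum by (intro sum.cong refl coord7_basis7 j)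
  also have "\<dots> = 0" using j by (simp add: sum_subtractf sum.delta del: One_nat_def)
  finally show "coord7 (\<Sum>i\<in>{1..7}. basis7 i) j = coord7 0 j" by (simp add: coord7_def)
qed

lemma coord7_zero: "coord7 0 i = 0"
  using coord7_scale[of 0 0 i] by simp

text \<open>\<open>A\<close> permutes the seven nodes, so it maps each \<open>basis7 i\<close> to a
  multiple of some \<open>basis7 j\<close>. Up to a factor, the only linear relation among these
  vectors is that their sum is zero; \<open>A\<close> respects it, so the multiples are all
  equal.\<close>

lemma preserved_klein7_monomial:
  assumes A: "invertible A" and s: "s \<noteq> 0" "act A (klein7 (- 1 - theta)) = form_scale s (klein7 (- 1 - theta))"
  obtains \<mu> \<sigma> where "\<mu> \<noteq> 0" "bij_betw \<sigma> {1..7} {1..7}"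
    "\<And>x k. k \<in> {1..7} \<Longrightarrow> coord7 (A *v x) (\<sigma> k) = \<mu> * coord7 x k"
proof -
  note inv = invertible_matrix_inv[OF A]
  let ?F = "klein7 (- 1 - theta)" and ?r = "\<lambda>i. ray (*s) (basis7 i)"
  have cubic: "?F \<in> cubic_forms" unfolding klein7_def by (rule klein_cubic)
  have cubic': "act A ?F \<in> cubic_forms" unfolding act_def by (rule cubic_compose[OF cubic])
  have "?F = (\<lambda>x. act A ?F (A *v x))" by (rule ext) (simp only: act_apply[OF A])
  then have "singular_points ?F = (\<lambda>x. (\<lambda>v. matrix_inv A *v v) ` x) ` singular_points (act A ?F)"
    using singular_points_compose[OF cubic' A] by simp
  then have sing: "?r ` {1..7} = (\<lambda>x. (\<lambda>v. matrix_inv A *v v) ` x) ` (?r ` {1..7})"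
    unfolding s(2) singular_points_scale[OF cubic s(1)] singular_points_klein7 .
  have "\<exists>j\<in>{1..7}. ray (*s) (A *v basis7 i) = ?r j" if "i \<in> {1..7}" for i
  proof -
    have "?r i \<in> (\<lambda>x. (\<lambda>v. matrix_inv A *v v) ` x) ` (?r ` {1..7})" unfolding sing[symmetric] using that by (rule imageI)
    then obtain j where j: "?r i = (\<lambda>v. matrix_inv A *v v) ` ?r j" "j \<in> {1..7}" unfolding image_image by (rule imageE)
    have "ray (*s) (A *v basis7 i) = (\<lambda>v. A *v v) ` ?r i" unfolding image_ray ..
    also have "\<dots> = ?r j" unfolding j(1) image_ray inv(1) ..
    finally show ?thesis using j(2) by (rule bexI)
  qed
  then have "\<forall>i\<in>{1..7}. \<exists>j. j \<in> {1..7} \<and> ray (*s) (A *v basis7 i) = ?r j" by blast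
  from bchoice[OF this] obtain \<sigma> where \<sigma>: "\<And>i. i \<in> {1..7} \<Longrightarrow> \<sigma> i \<in> {1..7}"
    "\<And>i. i \<in> {1..7} \<Longrightarrow> ray (*s) (A *v basis7 i) = ?r (\<sigma> i)" by blast
  have "\<exists>m. A *v basis7 i = m *s basis7 (\<sigma> i)" if "i \<in> {1..7}" for i
    using ray_self[of "A *v basis7 i"] unfolding \<sigma>(2)[OF that] by (auto simp: ray_def)
  then have "\<forall>i\<in>{1..7}. \<exists>m. A *v basis7 i = m *s basis7 (\<sigma> i)" by blast
  from bchoice[OF this] obtain m where m: "\<And>i. i \<in> {1..7} \<Longrightarrow> A *v basis7 i = m i *s basis7 (\<sigma> i)" by blast
  have inj: "inj_on \<sigma> {1..7}"
  proof (rule inj_onI)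
    fix i j assume ij: "i \<in> {1..7}" "j \<in> {1..7}" "\<sigma> i = \<sigma> j"
    then have "(\<lambda>v. matrix_inv A *v v) ` ray (*s) (A *v basis7 i) = (\<lambda>v. matrix_inv A *v v) ` ray (*s) (A *v basis7 j)"
      using \<sigma>(2) by simp
    then have "?r i = ?r j" unfolding image_ray inv(2) .
    then show "i = j" by (rule ray_basis7_inj[OF ij(1,2)])
  qed
  have bij: "bij_betw \<sigma> {1..7} {1..7}"
    unfolding bij_betw_def
  proof
    show "\<sigma> ` {1..7} = {1..7}" by (rule endo_inj_surj[OF finite_atLeastAtMost _ inj]) (use \<sigma>(1) in blast)
  qed (rule inj)
  define \<mu> where "\<mu> = (\<Sum>i\<in>{1..7}. m i) / 7"
  have image: "coord7 (\<Sum>i\<in>{1..7}. c i *s (A *v basis7 i)) (\<sigma> k) = c k * m k - (\<Sum>i\<in>{1..7}. c i * m i) / 7"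
    if k: "k \<in> {1..7}" for c k
  proof -
    have "coord7 (\<Sum>i\<in>{1..7}. c i *s (A *v basis7 i)) (\<sigma> k) = (\<Sum>i\<in>{1..7}. (if i = k then c i * m i else 0) - c i * m i / 7)"
      unfolding coord7_sum
    proof (intro sum.cong refl)
      fix i :: nat assume i: "i \<in> {1..7}"
      have "\<sigma> i = \<sigma> k \<longleftrightarrow> i = k" using inj i k by (auto dest: inj_onD)
      then show "coord7 (c i *s (A *v basis7 i)) (\<sigma> k) = (if i = k then c i * m i else 0) - c i * m i / 7"
        unfolding m[OF i] coord7_scale coord7_basis7[OF \<sigma>(1)[OF i] \<sigma>(1)[OF k]] by (simp add: algebra_simps)
    qed
    also have "\<dots> = c k * m k - (\<Sum>i\<in>{1..7}. c i * m i) / 7"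
      using k by (simp add: sum_subtractf sum_divide_distrib sum.delta del: One_nat_def)
    finally show ?thesis .
  qed
  \<comment> \<open>Applying \<open>A\<close> to the relation gives a relation with coefficients
    \<open>m\<close>; its k-th component says that \<open>m k\<close> equals the mean \<mu>.\<close>
  have "A *v (\<Sum>i\<in>{1..7}. basis7 i) = (\<Sum>i\<in>{1..7}. 1 *s (A *v basis7 i))"
    by (simp add: vec.linear_sum[OF matrix_vector_mul_linear_gen] o_def)
  then have "(\<Sum>i\<in>{1..7}. 1 *s (A *v basis7 i)) = 0" unfolding sum_basis7 by simp
  then have m\<mu>: "m k = \<mu>" if "k \<in> {1..7}" for k
    using image[OF that, of "\<lambda>_. 1"] by (simp add: \<mu>_def coord7_zero del: One_nat_def)
  have "\<mu> \<noteq> 0"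
  proof
    assume "\<mu> = 0"
    then have "A *v basis7 1 = 0" using m[of 1] m\<mu>[of 1] by simp
    then have "basis7 1 = 0" using inv(2)[of "basis7 1"] by simp
    then have "coord7 (basis7 1) 1 = 0" by (simp add: coord7_zero)
    then show False using coord7_basis7[of 1 1] by simp
  qed
  moreover have "coord7 (A *v x) (\<sigma> k) = \<mu> * coord7 x k" if k: "k \<in> {1..7}" for x k
  proof -
    have "A *v x = A *v (\<Sum>i\<in>{1..7}. coord7 x i *s basis7 i)" using basis7_expansion[of x] by simp
    also have "\<dots> = (\<Sum>i\<in>{1..7}. coord7 x i *s (A *v basis7 i))"
      by (simp add: vec.linear_sum[OF matrix_vector_mul_linear_gen] o_def vector_scalar_commute)
    finally have "coord7 (A *v x) (\<sigma> k) = coord7 x k * m k - (\<Sum>i\<in>{1..7}. coord7 x i * m i) / 7"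
      using image[OF k] by simp
    also have "(\<Sum>i\<in>{1..7}. coord7 x i * m i) = (\<Sum>i\<in>{1..7}. coord7 x i) * \<mu>"
      unfolding sum_distrib_right by (intro sum.cong refl) (simp add: m\<mu>)
    finally show ?thesis unfolding sum_coord7 m\<mu>[OF k] by simp
  qed
  ultimately show ?thesis using that bij by blast
qed

lemma det_mat: "det (mat c :: complex^'n^'n) = c ^ CARD('n)"
  by (subst det_diagonal) (simp_all add: mat_def)

lemma vec_dot_eqI:
  fixes w w' :: "complex^'n"
  assumes "\<And>x. (\<Sum>i\<in>UNIV. x $ i * w $ i) = (\<Sum>i\<in>UNIV. x $ i * w' $ i)"
  shows "w = w'"
proof -
  have "(\<Sum>i\<in>UNIV. (axis k 1 :: complex^'n) $ i * z $ i) = z $ k" for k and z :: "complex^'n"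
  proof -
    have "(\<Sum>i\<in>UNIV. (axis k 1 :: complex^'n) $ i * z $ i) = (\<Sum>i\<in>UNIV. if i = k then z $ i else 0)"
      by (intro sum.cong refl) (simp add: axis_def)
    then show ?thesis by simp
  qed
  then show ?thesis using assms by (metis vec_eq_iff)
qed

lemma vec_dot_transpose:
  "(\<Sum>i\<in>UNIV. x $ i * (transpose A *v w) $ i) = (\<Sum>i\<in>UNIV. (A *v x) $ i * w $ i)" for A :: "complex^'n^'n"
proof -
  have "(\<Sum>i\<in>UNIV. x $ i * (transpose A *v w) $ i) = (\<Sum>i\<in>UNIV. \<Sum>j\<in>UNIV. x $ i * (A $ j $ i * w $ j))"
    by (simp add: matrix_vector_mult_def transpose_def sum_distrib_left)
  also have "\<dots> = (\<Sum>j\<in>UNIV. \<Sum>i\<in>UNIV. x $ i * (A $ j $ i * w $ j))" by (rule sum.swap)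
  also have "\<dots> = (\<Sum>i\<in>UNIV. (A *v x) $ i * w $ i)"
    unfolding matrix_vector_mult_def vec_lambda_beta sum_distrib_right by (intro sum.cong refl) (simp add: mult_ac)
  finally show ?thesis .
qed

text \<open>The Gram matrix of \<open>y\<^sub>1\<^sup>2 + \<dots> + y\<^sub>7\<^sup>2\<close> on the hyperplane.\<close>

definition gram :: "complex^6^6"
  where "gram = (\<chi> i j. if i = j then 2 else 1)"

lemma gram_nth: "(gram *v y) $ i = y $ i + (\<Sum>j\<in>UNIV. y $ j)"
proof -
  have "(gram *v y) $ i = (\<Sum>j\<in>UNIV. (if j = i then y $ j else 0) + y $ j)"
    unfolding gram_def matrix_vector_mult_def vec_lambda_beta by (intro sum.cong refl) auto
  then show ?thesis by (simp add: sum.distrib)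
qed

lemma vec_dot_gram: "(\<Sum>i\<in>UNIV. x $ i * (gram *v y) $ i) = (\<Sum>k\<in>{1..7}. coord7 x k * coord7 y k)"
  unfolding gram_nth sum_6 sum_atLeastAtMost_7 coord7_simps by algebra

lemma det_gram: "det gram \<noteq> 0"
proof -
  have "x = 0" if "gram *v x = 0" for x
  proof -
    define t where "t = - (\<Sum>j\<in>UNIV. x $ j)"
    have "x $ i + (\<Sum>j\<in>UNIV. x $ j) = 0" for i using that gram_nth[of x i] by simp
    then have x: "x $ i = t" for i unfolding t_def by (metis eq_neg_iff_add_eq_0)
    have "t = - (6 * t)" using t_def unfolding sum_6 x by simp
    then have "t = 0" by algebra
    then show ?thesis using x by (simp add: vec_eq_iff)
  qed
  then have "\<exists>B. B ** gram = mat 1" by (simp add: matrix_left_invertible_ker)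
  then show ?thesis by (simp add: invertible_left_inverse flip: invertible_det_nz)
qed

text \<open>\<open>A\<close> multiplies the seven coordinates by \<mu> up to a permutation, so it
  scales \<open>power_sum\<close>, and comparing components along the two 7-nodal members gives a
  single eigenvalue. For the root of unity, \<open>A\<close> also scales the sum of the squares of
  the coordinates.\<close>

lemma act_scalar:
  assumes A: "invertible A" and s: "s \<noteq> 0" "act A (klein7 (- 1 - theta)) = form_scale s (klein7 (- 1 - theta))"
    and t: "act A (klein7 theta) = form_scale t (klein7 theta)"
  shows "\<exists>\<kappa>. \<kappa> \<noteq> 0 \<and> (\<forall>u v. act A (klein u v) = klein (\<kappa> * u) (\<kappa> * v)) \<and> (det A = 1 \<longrightarrow> \<kappa> ^ 4 = 1)"
proof -
  obtain \<mu> \<sigma> where \<mu>: "\<mu> \<noteq> 0" and \<sigma>: "bij_betw \<sigma> {1..7} {1..7}"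
    and A\<sigma>: "\<And>x k. k \<in> {1..7} \<Longrightarrow> coord7 (A *v x) (\<sigma> k) = \<mu> * coord7 x k"
    using preserved_klein7_monomial[OF A s] by blast
  define \<kappa> where "\<kappa> = 1 / \<mu> ^ 3"
  have ps: "power_sum (A *v x) = \<mu> ^ 3 * power_sum x" for x
  proof -
    have "power_sum (A *v x) = (\<Sum>k\<in>{1..7}. coord7 (A *v x) (\<sigma> k) ^ 3)"
      unfolding power_sum_def by (rule sum.reindex_bij_betw[OF \<sigma>, symmetric])
    then show ?thesis by (simp add: A\<sigma> power_mult_distrib sum_distrib_left power_sum_def del: One_nat_def)
  qed
  have act_ps: "act A power_sum = form_scale \<kappa> power_sum"
  proof
    fix x
    define y where "y = matrix_inv A *v x"
    have x: "x = A *v y" by (simp add: y_def invertible_matrix_inv[OF A])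
    show "act A power_sum x = form_scale \<kappa> power_sum x"
      unfolding x act_apply[OF A] form_scale_def ps \<kappa>_def using \<mu> by simp
  qed
  obtain a b where ab: "a \<noteq> 0" "b \<noteq> 0" "power_sum = form_scale a (klein7 theta) + form_scale b (klein7 (- 1 - theta))"
    by (rule power_sum_klein7)
  have "form_scale a (form_scale t (klein7 theta)) + form_scale b (form_scale s (klein7 (- 1 - theta))) = form_scale \<kappa> power_sum"
    unfolding act_ps[symmetric] unfolding ab(3) act_add act_scale s(2) t ..
  also have "form_scale \<kappa> power_sum = form_scale \<kappa> (form_scale a (klein7 theta) + form_scale b (klein7 (- 1 - theta)))"
    by (simp only: ab(3)[symmetric])
  finally have eq: "a * (t * (7 * theta - 3)) + b * (s * (7 * (- 1 - theta) - 3)) = \<kappa> * (a * (7 * theta - 3) + b * (7 * (- 1 - theta) - 3))"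
      "a * (t * 8) + b * (s * 8) = \<kappa> * (a * 8 + b * 8)"
    unfolding klein7_def klein_scale klein_add klein_inj by blast+
  \<comment> \<open>The determinant of the parameter vectors of the two 7-nodal members; its
    nonvanishing allows comparing components.\<close>
  define D where "D = 7 * 8 * (2 * theta + 1)"
  have "D \<noteq> 0" unfolding D_def using two_theta_nonzero by (metis mult_eq_0_iff zero_neq_numeral)
  moreover have "(a * (t - \<kappa>)) * D = 0" "(b * (s - \<kappa>)) * D = 0" unfolding D_def using eq by algebra+
  ultimately have st: "t = \<kappa>" "s = \<kappa>" using ab(1,2) by simp_all
  have "act A (klein u v) = klein (\<kappa> * u) (\<kappa> * v)" for u v
  proof -
    obtain p q where pq: "klein u v = form_scale p (klein7 theta) + form_scale q (klein7 (- 1 - theta))" by (rule klein7_span)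
    have "act A (klein u v) = form_scale \<kappa> (klein u v)"
      unfolding pq act_add act_scale s(2) t st unfolding klein7_def klein_scale klein_add klein_inj by (simp add: algebra_simps)
    then show ?thesis unfolding klein_scale .
  qed
  moreover have "\<kappa> ^ 4 = 1" if "det A = 1"
  proof -
    \<comment> \<open>Invariance of the quadratic form up to \<mu>^2. Taking determinants with
      \<open>det A = 1\<close> gives \<mu>^12 = 1, which is the inverse of \<kappa>^4 = 1.\<close>
    have "transpose A *v (gram *v (A *v y)) = \<mu>\<^sup>2 *s (gram *v y)" for y
    proof (rule vec_dot_eqI)
      fix x
      have "(\<Sum>i\<in>UNIV. x $ i * (transpose A *v (gram *v (A *v y))) $ i) = (\<Sum>k\<in>{1..7}. coord7 (A *v x) k * coord7 (A *v y) k)"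
        unfolding vec_dot_transpose vec_dot_gram ..
      also have "\<dots> = (\<Sum>k\<in>{1..7}. coord7 (A *v x) (\<sigma> k) * coord7 (A *v y) (\<sigma> k))"
        by (rule sum.reindex_bij_betw[OF \<sigma>, symmetric])
      also have "\<dots> = (\<Sum>k\<in>{1..7}. \<mu>\<^sup>2 * (coord7 x k * coord7 y k))"
        by (intro sum.cong refl) (simp add: A\<sigma> power2_eq_square mult_ac)
      also have "\<dots> = \<mu>\<^sup>2 * (\<Sum>i\<in>UNIV. x $ i * (gram *v y) $ i)" unfolding vec_dot_gram sum_distrib_left ..
      finally show "(\<Sum>i\<in>UNIV. x $ i * (transpose A *v (gram *v (A *v y))) $ i) = (\<Sum>i\<in>UNIV. x $ i * (\<mu>\<^sup>2 *s (gram *v y)) $ i)"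
        by (simp add: sum_distrib_left mult_ac)
    qed
    then have "transpose A ** gram ** A = mat (\<mu>\<^sup>2) ** gram"
      unfolding matrix_eq by (simp add: mat_mult_vec flip: matrix_vector_mul_assoc)
    then have "det (transpose A ** gram ** A) = det (mat (\<mu>\<^sup>2) ** gram)" by simp
    then have "(\<mu>\<^sup>2) ^ 6 = 1" unfolding det_mul det_transpose det_mat that using det_gram by simp
    then have "\<mu> ^ 12 = 1" by (simp flip: power_mult)
    then show ?thesis by (simp add: \<kappa>_def power_one_over flip: power_mult)
  qed
  ultimately show ?thesis using \<mu> by (intro exI[of _ \<kappa>]) (simp add: \<kappa>_def)
qed

text \<open>The conjugate values of \<open>7 * \<eta> - 3\<close> have product 128 = 2 * 8^2, so u /
  v \<mapsto> 2 v / u interchanges the two 7-nodal ratios.\<close>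

lemma act_exchange7_klein7:
  assumes "root_pm \<eta>"
  shows "act exchange7 (klein7 \<eta>) = form_scale ((7 * \<eta> - 3) / 32) (klein7 (- 1 - \<eta>))" "7 * \<eta> - 3 \<noteq> 0"
proof -
  have p: "(7 * \<eta> - 3) * (7 * (- 1 - \<eta>) - 3) = 128" using assms unfolding root_pm_def by algebra
  then show "7 * \<eta> - 3 \<noteq> 0" by auto
  have "(7 * \<eta> - 3) / 32 * (7 * (- 1 - \<eta>) - 3) = (7 * \<eta> - 3) * (7 * (- 1 - \<eta>) - 3) / 32" by simp
  then have "(7 * \<eta> - 3) / 32 * (7 * (- 1 - \<eta>) - 3) = 8 / 2" unfolding p by simp
  then show "act exchange7 (klein7 \<eta>) = form_scale ((7 * \<eta> - 3) / 32) (klein7 (- 1 - \<eta>))"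
    unfolding klein7_def act_exchange7 klein_scale klein_inj by simp
qed

text \<open>The two 7-nodal members are either both fixed, and the action is scalar, or
  interchanged; composing with \<open>exchange7\<close> reduces the second case to the
  first.\<close>

lemma act_on_pencil:
  assumes A: "invertible A" "act A ` V_L27 \<subseteq> V_L27"
  shows "(\<exists>\<kappa>. \<kappa> \<noteq> 0 \<and> (\<forall>u v. act A (klein u v) = klein (\<kappa> * u) (\<kappa> * v)) \<and> (det A = 1 \<longrightarrow> \<kappa> ^ 4 = 1))
    \<or> (\<exists>\<kappa>. \<kappa> \<noteq> 0 \<and> (\<forall>u v. act A (klein u v) = klein (4 * \<kappa> * v) (2 * \<kappa> * u)))"
proof -
  have r: "root_pm theta" "root_pm (- 1 - theta)" unfolding root_pm_theta by simp_all
  obtain s1 \<eta>1 where 1: "root_pm \<eta>1" "s1 \<noteq> 0" "act A (klein7 theta) = form_scale s1 (klein7 \<eta>1)"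
    by (rule act_klein7[OF A r(1)])
  obtain s2 \<eta>2 where 2: "root_pm \<eta>2" "s2 \<noteq> 0" "act A (klein7 (- 1 - theta)) = form_scale s2 (klein7 \<eta>2)"
    by (rule act_klein7[OF A r(2)])
  have ne: "\<eta>1 \<noteq> \<eta>2"
  proof
    assume eq: "\<eta>1 = \<eta>2"
    have "act A (form_scale s2 (klein7 theta)) = act A (form_scale s1 (klein7 (- 1 - theta)))"
      unfolding act_scale 1(3) 2(3) eq by (simp add: form_scale_def mult_ac)
    then have "form_scale s2 (klein7 theta) = form_scale s1 (klein7 (- 1 - theta))" by (rule act_inj[OF A(1)])
    then have "s2 * (7 * theta - 3) = s1 * (7 * (- 1 - theta) - 3)" "s2 * 8 = s1 * 8"
      unfolding klein7_def klein_scale klein_inj by blast+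
    then have "s2 * (7 * 8 * (2 * theta + 1)) = 0" by algebra
    then show False using 2(2) two_theta_nonzero by (metis mult_eq_0_iff zero_neq_numeral)
  qed
  show ?thesis
  proof (cases "\<eta>1 = theta")
    case True
    then have "\<eta>2 = - 1 - theta" using ne 2(1) unfolding root_pm_theta by blast
    then show ?thesis using act_scalar[OF A(1) 2(2)] 1(3) 2(3) True by blast
  next
    case False
    then have \<eta>: "\<eta>1 = - 1 - theta" "\<eta>2 = theta" using ne 1(1) 2(1) unfolding root_pm_theta by blast+
    let ?B = "exchange7 ** A"
    have B: "act ?B F = act exchange7 (act A F)" for F by (rule act_mult[OF invertible_exchange7 A(1)])
    have "\<exists>\<kappa>. \<kappa> \<noteq> 0 \<and> (\<forall>u v. act ?B (klein u v) = klein (\<kappa> * u) (\<kappa> * v)) \<and> (det ?B = 1 \<longrightarrow> \<kappa> ^ 4 = 1)"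
    proof (rule act_scalar)
      show "invertible ?B" by (rule invertible_mult[OF invertible_exchange7 A(1)])
      show "s2 * ((7 * theta - 3) / 32) \<noteq> 0" using 2(2) act_exchange7_klein7(2)[OF r(1)] by simp
      show "act ?B (klein7 (- 1 - theta)) = form_scale (s2 * ((7 * theta - 3) / 32)) (klein7 (- 1 - theta))"
        unfolding B 2(3) \<eta> act_scale act_exchange7_klein7(1)[OF r(1)] by (simp add: form_scale_def mult.assoc)
      show "act ?B (klein7 theta) = form_scale (s1 * ((7 * (- 1 - theta) - 3) / 32)) (klein7 theta)"
        unfolding B 1(3) \<eta> act_scale act_exchange7_klein7(1)[OF r(2)] by (simp add: form_scale_def mult.assoc)
    qed
    then obtain \<kappa> where \<kappa>: "\<kappa> \<noteq> 0" "\<And>u v. act ?B (klein u v) = klein (\<kappa> * u) (\<kappa> * v)" by blast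
    have "act A (klein u v) = klein (4 * \<kappa> * v) (2 * \<kappa> * u)" for u v
      by (rule act_inj[OF invertible_exchange7]) (simp add: B[symmetric] \<kappa>(2) act_exchange7)
    then show ?thesis using \<kappa>(1) by blast
  qed
qed

text \<open>The fixed points of u / v \<mapsto> 2 v / u are the two square roots of 2, so
  diagonalizing the involution requires this number.\<close>

definition sqrt2 :: complex
  where "sqrt2 = complex_of_real (sqrt 2)"

lemma sqrt2_square: "sqrt2 * sqrt2 = 2"
  unfolding sqrt2_def of_real_mult[symmetric] by simp

lemma sqrt2_mult: "sqrt2 * (sqrt2 * x) = 2 * x"
  unfolding mult.assoc[symmetric] sqrt2_square ..

lemma sqrt2_nonzero: "sqrt2 \<noteq> 0" unfolding sqrt2_def by simp

text \<open>Coordinates in which the nontrivial involution of the pencil changes the sign of the second one.\<close>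

definition pencil :: "complex \<Rightarrow> complex \<Rightarrow> form"
  where "pencil a b = klein ((a + b) / 2) (sqrt2 * (a - b) / 4)"

lemma klein_pencil: "klein u v = pencil (u + sqrt2 * v) (u - sqrt2 * v)"
proof -
  have "sqrt2 * (u + sqrt2 * v - (u - sqrt2 * v)) = 4 * v" by ((simp add: algebra_simps sqrt2_mult sqrt2_square; fail) | (insert sqrt2_square, algebra))
  then show ?thesis unfolding pencil_def klein_inj by simp
qed

interpretation pencil: binary_space form_scale V_L27 pencil
proof
  show "V_L27 = {pencil a b | a b. True}"
    unfolding V_L27_klein using klein_pencil unfolding pencil_def by blast
  show "pencil a b + pencil a' b' = pencil (a + a') (b + b')" for a b a' b'
    unfolding pencil_def klein_add klein_inj by (simp add: field_simps)
  show "form_scale k (pencil a b) = pencil (k * a) (k * b)" for k a b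
    unfolding pencil_def klein_scale klein_inj by (simp add: field_simps)
  show "pencil a b = pencil a' b' \<longleftrightarrow> a = a' \<and> b = b'" for a b a' b'
  proof
    assume "pencil a b = pencil a' b'"
    then have h: "(a + b) / 2 = (a' + b') / 2" "sqrt2 * (a - b) / 4 = sqrt2 * (a' - b') / 4"
      unfolding pencil_def klein_inj by blast+
    have "a + b = a' + b'" using h(1) by (simp only: divide_cancel_right numeral_neq_zero simp_thms)
    moreover have "a - b = a' - b'"
      using h(2) sqrt2_nonzero by (simp only: divide_cancel_right numeral_neq_zero mult_cancel_left simp_thms)
    ultimately have "2 * a = 2 * a'" "2 * b = 2 * b'" by algebra+
    then show "a = a' \<and> b = b'" by simp
  qed simp
qed

text \<open>The eighth power is needed for the elements acting through the involution: their squares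
  act by scalars that are fourth roots of unity when the determinant is 1.\<close>

lemma act_pencil:
  assumes A: "invertible A" "act A ` V_L27 \<subseteq> V_L27"
  shows "\<exists>k. k \<noteq> 0 \<and> (det A = 1 \<longrightarrow> k ^ 8 = 1) \<and>
    ((\<forall>a b. act A (pencil a b) = pencil (k * a) (k * b)) \<or> (\<forall>a b. act A (pencil a b) = pencil (k * a) (- (k * b))))"
  using act_on_pencil[OF A]
proof (elim disjE exE conjE)
  fix \<kappa> assume \<kappa>: "\<kappa> \<noteq> 0" "\<forall>u v. act A (klein u v) = klein (\<kappa> * u) (\<kappa> * v)" "det A = 1 \<longrightarrow> \<kappa> ^ 4 = 1"
  have "act A (pencil a b) = pencil (\<kappa> * a) (\<kappa> * b)" for a b
    unfolding pencil_def \<kappa>(2)[rule_format] klein_inj by (simp add: field_simps)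
  moreover have "\<kappa> ^ 8 = 1" if "det A = 1"
  proof -
    have "\<kappa> ^ 8 = (\<kappa> ^ 4) ^ 2" by (simp flip: power_mult)
    then show ?thesis using \<kappa>(3) that by simp
  qed
  ultimately show ?thesis using \<kappa>(1) by blast
next
  fix \<kappa> assume \<kappa>: "\<kappa> \<noteq> 0" "\<forall>u v. act A (klein u v) = klein (4 * \<kappa> * v) (2 * \<kappa> * u)"
  define k where "k = 2 * sqrt2 * \<kappa>"
  have "act A (pencil a b) = pencil (k * a) (- (k * b))" for a b
  proof -
    have "sqrt2 * (k * a - - (k * b)) = 4 * (\<kappa> * (a + b))" unfolding k_def power2_eq_square by ((simp add: algebra_simps sqrt2_mult sqrt2_square; fail) | (insert sqrt2_square, algebra))
    then show ?thesis unfolding pencil_def \<kappa>(2)[rule_format] klein_inj by (simp add: k_def field_simps)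
  qed
  moreover have "k \<noteq> 0" using \<kappa>(1) sqrt2_nonzero by (simp add: k_def)
  moreover have "k ^ 8 = 1" if det: "det A = 1"
  proof -
    \<comment> \<open>Squaring reduces to the scalar case. The scalar of \<open>A ** A\<close> is
      \<open>k\<^sup>2\<close>, and its fourth power is 1.\<close>
    have AA: "act (A ** A) (klein u v) = klein (8 * \<kappa>\<^sup>2 * u) (8 * \<kappa>\<^sup>2 * v)" for u v
      unfolding act_mult[OF A(1) A(1)] \<kappa>(2)[rule_format] klein_inj by (simp add: power2_eq_square)
    have "act (A ** A) ` V_L27 \<subseteq> V_L27" unfolding act_mult[OF A(1) A(1)] using A(2) by blast
    from act_on_pencil[OF invertible_mult[OF A(1) A(1)] this] have "(8 * \<kappa>\<^sup>2) ^ 4 = 1"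
    proof (elim disjE exE conjE)
      fix \<kappa>' assume h: "\<forall>u v. act (A ** A) (klein u v) = klein (\<kappa>' * u) (\<kappa>' * v)" "det (A ** A) = 1 \<longrightarrow> \<kappa>' ^ 4 = 1"
      have "8 * \<kappa>\<^sup>2 = \<kappa>'" using h(1)[rule_format, of 1 0] unfolding AA klein_inj by simp
      then show ?thesis using h(2) det by (simp add: det_mul)
    next
      fix \<kappa>' assume h: "\<forall>u v. act (A ** A) (klein u v) = klein (4 * \<kappa>' * v) (2 * \<kappa>' * u)"
      have "8 * \<kappa>\<^sup>2 = 0" using h[rule_format, of 1 0] unfolding AA klein_inj by simp
      then show ?thesis using \<kappa>(1) by simp
    qed
    moreover have "k\<^sup>2 = 8 * \<kappa>\<^sup>2" unfolding k_def power2_eq_square by ((simp add: algebra_simps sqrt2_mult sqrt2_square; fail) | (insert sqrt2_square, algebra))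
    moreover have "k ^ 8 = (k\<^sup>2) ^ 4" by (simp flip: power_mult)
    ultimately show ?thesis by simp
  qed
  ultimately show ?thesis by blast
qed

lemma act_scaled_exchange7:
  assumes c: "c \<noteq> 0"
  shows "act (mat c ** exchange7) (pencil a b) = pencil (sqrt2 / (4 * c ^ 3) * a) (- (sqrt2 / (4 * c ^ 3) * b))"
proof -
  note inv = invertible_mult[OF invertible_mat[OF c] invertible_exchange7]
  have "act (mat c ** exchange7) (klein u v) = klein (v / (2 * c ^ 3)) (u / (4 * c ^ 3))" for u v
  proof
    fix x
    define y where "y = matrix_inv (mat c ** exchange7) *v x"
    have x: "x = (mat c ** exchange7) *v y" by (simp add: y_def invertible_matrix_inv[OF inv])
    have "klein (v / (2 * c ^ 3)) (u / (4 * c ^ 3)) x = c ^ 3 * klein (u / c ^ 3) (v / c ^ 3) y"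
      unfolding x matrix_vector_mul_assoc[symmetric] mat_mult_vec cubic_form_scale[OF klein_cubic] klein_exchange7 by simp
    also have "\<dots> = form_scale (c ^ 3) (klein (u / c ^ 3) (v / c ^ 3)) y" by (simp add: form_scale_def)
    also have "\<dots> = klein u v y" unfolding klein_scale using c by simp
    finally show "act (mat c ** exchange7) (klein u v) x = klein (v / (2 * c ^ 3)) (u / (4 * c ^ 3)) x"
      unfolding x act_apply[OF inv] by simp
  qed
  note act = this
  define d where "d = 1 / (4 * c ^ 3)"
  have "sqrt2 * (sqrt2 * d * a - - (sqrt2 * d * b)) = 2 * (d * (a + b))" by ((simp add: algebra_simps sqrt2_mult sqrt2_square; fail) | (insert sqrt2_square, algebra))
  then have "pencil (sqrt2 * d * a) (- (sqrt2 * d * b)) = klein (sqrt2 * d * (a - b) / 2) (d * (a + b) / 2)"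
    unfolding pencil_def klein_inj by (simp add: algebra_simps)
  moreover have "act (mat c ** exchange7) (pencil a b) = klein (sqrt2 * d * (a - b) / 2) (d * (a + b) / 2)"
    unfolding pencil_def act klein_inj d_def using c by (simp add: field_simps)
  ultimately show ?thesis by (simp add: d_def)
qed

text \<open>The identity and a multiple of \<open>exchange7\<close> with determinant 1 represent the
  two kinds of action, already inside the special linear group; the full preimage acts in the same
  way with unrestricted scalars.\<close>

lemma flip_action_normalizer:
  "pencil.flip_action (\<lambda>k. k ^ 8 = 1) (act ` {A \<in> \<Union>normalizer_L27. det A = 1})"
  "pencil.flip_action (\<lambda>_. True) (act ` \<Union>normalizer_L27)"
proof -
  have "det exchange7 \<noteq> 0" using invertible_exchange7 by (simp add: invertible_det_nz)
  \<comment> \<open>Scaling a 6 by 6 matrix by \<open>c\<close> multiplies its determinant by c^6,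
    so a sixth root normalizes the determinant to 1.\<close>
  moreover obtain c where c6: "1 / det exchange7 = c ^ 6" by (rule exists_complex_root[of 6 "1 / det exchange7"]) simp
  ultimately have c: "c \<noteq> 0" by auto
  let ?E = "mat c ** exchange7"
  have mat: "det (mat c :: complex^6^6) = c ^ 6" unfolding det_mat by simp
  have det: "det ?E = 1" unfolding det_mul mat c6[symmetric] using \<open>det exchange7 \<noteq> 0\<close> by simp
  have E: "\<exists>k. k \<noteq> 0 \<and> (\<forall>a b. act ?E (pencil a b) = pencil (k * a) (- (k * b)))"
    using act_scaled_exchange7[OF c] c sqrt2_nonzero by (intro exI[of _ "sqrt2 / (4 * c ^ 3)"]) simp
  have I: "\<exists>k. k \<noteq> 0 \<and> (\<forall>a b. act (mat 1) (pencil a b) = pencil (k * a) (k * b))" by (intro exI[of _ 1]) simp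
  have act: "\<exists>k. k \<noteq> 0 \<and> (det A = 1 \<longrightarrow> k ^ 8 = 1) \<and>
      ((\<forall>a b. act A (pencil a b) = pencil (k * a) (k * b)) \<or> (\<forall>a b. act A (pencil a b) = pencil (k * a) (- (k * b))))"
    if A: "A \<in> \<Union>normalizer_L27" for A
    by (rule act_pencil[OF normalizer_L27_D(1)[OF A]]) (use normalizer_preserves_V_L27[OF A] in blast)
  have mem: "act ?E \<in> act ` {A \<in> \<Union>normalizer_L27. det A = 1}" "act (mat 1) \<in> act ` {A \<in> \<Union>normalizer_L27. det A = 1}"
    by (intro imageI CollectI conjI scaled_exchange7_in_normalizer[OF c] det)
      (intro imageI CollectI conjI one_in_normalizer det_I)
  then have mem': "act ?E \<in> act ` \<Union>normalizer_L27" "act (mat 1) \<in> act ` \<Union>normalizer_L27" by blast+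
  show "pencil.flip_action (\<lambda>k. k ^ 8 = 1) (act ` {A \<in> \<Union>normalizer_L27. det A = 1})"
    unfolding pencil.flip_action_def
  proof (intro conjI ballI)
    fix g assume "g \<in> act ` {A \<in> \<Union>normalizer_L27. det A = 1}"
    then obtain A where A: "A \<in> \<Union>normalizer_L27" "det A = 1" "g = act A" by blast
    show "\<exists>k. k \<noteq> 0 \<and> k ^ 8 = 1 \<and> ((\<forall>a b. g (pencil a b) = pencil (k * a) (k * b)) \<or> (\<forall>a b. g (pencil a b) = pencil (k * a) (- (k * b))))"
      using act[OF A(1)] A(2) unfolding A(3) by blast
  qed (rule bexI[where x = "act (mat 1)"], rule I, rule mem(2), rule bexI[where x = "act ?E"], rule E, rule mem(1))
  show "pencil.flip_action (\<lambda>_. True) (act ` \<Union>normalizer_L27)"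
    unfolding pencil.flip_action_def
  proof (intro conjI ballI)
    fix g assume "g \<in> act ` \<Union>normalizer_L27"
    then obtain A where A: "A \<in> \<Union>normalizer_L27" "g = act A" by blast
    show "\<exists>k. k \<noteq> 0 \<and> True \<and> ((\<forall>a b. g (pencil a b) = pencil (k * a) (k * b)) \<or> (\<forall>a b. g (pencil a b) = pencil (k * a) (- (k * b))))"
      using act[OF A(1)] unfolding A(2) by blast
  qed (rule bexI[where x = "act (mat 1)"], rule I, rule mem'(2), rule bexI[where x = "act ?E"], rule E, rule mem'(1))
qed

section \<open>The boundary\<close>

definition member :: "complex \<Rightarrow> complex \<Rightarrow> form set"
  where "member u v = ray form_scale (klein u v)"

lemma member_pt: "member u v = pencil.pt (u + sqrt2 * v) (u - sqrt2 * v)"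
  unfolding member_def pencil.pt_def klein_pencil ..

lemma pt_member: "pencil.pt a b = member ((a + b) / 2) (sqrt2 * (a - b) / 4)"
  unfolding member_def pencil.pt_def pencil_def ..

lemma member_scale: "k \<noteq> 0 \<Longrightarrow> member (k * u) (k * v) = member u v"
  using pencil.pt_scale[of k "u + sqrt2 * v" "u - sqrt2 * v"] unfolding member_pt by (simp add: algebra_simps)

lemma coords_zero: "(u + sqrt2 * v, u - sqrt2 * v) = (0, 0) \<longleftrightarrow> (u, v) = (0, 0)"
  unfolding prod.inject using pencil.ph_eq_0[of "u + sqrt2 * v" "u - sqrt2 * v"] pencil.ph_eq_0[of 0 0]
  by (metis klein_inj klein_pencil add_0 diff_0_right mult_zero_right)

lemma member_eq_iff:
  assumes "(u, v) \<noteq> (0, 0)" "(u', v') \<noteq> (0, 0)"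
  shows "member u v = member u' v' \<longleftrightarrow> u * v' = u' * v"
proof -
  have "member u v = member u' v' \<longleftrightarrow> (u + sqrt2 * v) * (u' - sqrt2 * v') = (u' + sqrt2 * v') * (u - sqrt2 * v)"
    unfolding member_pt by (rule pencil.pt_eq_iff) (use assms coords_zero in metis)+
  also have "\<dots> \<longleftrightarrow> (2 * sqrt2) * (u * v') = (2 * sqrt2) * (u' * v)" by algebra
  also have "\<dots> \<longleftrightarrow> u * v' = u' * v" using sqrt2_nonzero by simp
  finally show ?thesis .
qed

text \<open>The sign change of \<open>b\<close> in the original parameters: multiplying both by
  \<open>sqrt2\<close> turns the flipped pair into (2 v, u).\<close>

lemma flipped_member: "pencil.pt a (- b) = member (2 * (sqrt2 * (a - b) / 4)) ((a + b) / 2)"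
proof -
  have "sqrt2 * (sqrt2 * (a - - b) / 4) = (a + b) / 2"
  proof -
    have "sqrt2 * (sqrt2 * (a - - b)) = 2 * (a + b)" by ((simp add: algebra_simps sqrt2_mult sqrt2_square; fail) | (insert sqrt2_square, algebra))
    then show ?thesis by simp
  qed
  moreover have "sqrt2 * ((a + - b) / 2) = 2 * (sqrt2 * (a - b) / 4)" by simp
  ultimately show ?thesis
    using member_scale[OF sqrt2_nonzero, of "(a + - b) / 2" "sqrt2 * (a - - b) / 4"] unfolding pt_member by metis
qed

lemma orbit_of_member: "orbit_of (act ` \<Union>normalizer_L27) (member u v) = {member u v, member (2 * v) u}"
proof -
  have "pencil.pt (u + sqrt2 * v) (- (u - sqrt2 * v)) = member (2 * v) u"
    unfolding flipped_member by (simp add: sqrt2_mult)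
  then show ?thesis unfolding member_pt[of u v] pencil.orbit_of_flip_action[OF flip_action_normalizer(2)] by simp
qed

lemma P_member: "pencil.P = {member u v | u v. (u, v) \<noteq> (0, 0)}"
proof (intro equalityI subsetI)
  fix x assume "x \<in> pencil.P"
  then obtain a b where ab: "x = pencil.pt a b" "(a, b) \<noteq> (0, 0)" unfolding pencil.P_def by blast
  then have "((a + b) / 2, sqrt2 * (a - b) / 4) \<noteq> (0, 0)" using sqrt2_nonzero by (auto simp: eq_neg_iff_add_eq_0[symmetric])
  then show "x \<in> {member u v | u v. (u, v) \<noteq> (0, 0)}" unfolding ab(1) pt_member by blast
next
  fix x assume "x \<in> {member u v | u v. (u, v) \<noteq> (0, 0)}"
  then obtain u v where "x = member u v" "(u, v) \<noteq> (0, 0)" by blast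
  then show "x \<in> pencil.P" unfolding member_pt using pencil.pt_in_P coords_zero by metis
qed

lemma klein_zero_iff: "klein u v = 0 \<longleftrightarrow> u = 0 \<and> v = 0"
  using klein_add[of 0 0 0 0] klein_inj[of u v 0 0] by simp

lemma smooth_klein_iff:
  "smooth_cubic (klein u v) \<longleftrightarrow> u \<noteq> 0 \<and> v \<noteq> 0 \<and>
    (\<forall>\<eta>. root_pm \<eta> \<longrightarrow> 8 * u \<noteq> (7 * \<eta> - 3) * v \<and> 4 * u \<noteq> - (\<eta> + 6) * v)"
proof
  assume "smooth_cubic (klein u v)"
  then have sing: "singular_points (klein u v) = {}" unfolding smooth_cubic_def by blast
  then have "singular_points (fourier_form u v) = {}" unfolding singular_points_klein(1) by blast
  then have uv: "u \<noteq> 0" "v \<noteq> 0" using fourier_form_infinite_singular[of u v] by auto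
  have "\<not> nodal_with (Suc k) (klein u v)" for k using sing by (simp add: nodal_with_def)
  from this[of 6] this[of 13] have "\<not> nodal_with 7 (klein u v)" "\<not> nodal_with 14 (klein u v)" by simp_all
  then show "u \<noteq> 0 \<and> v \<noteq> 0 \<and> (\<forall>\<eta>. root_pm \<eta> \<longrightarrow> 8 * u \<noteq> (7 * \<eta> - 3) * v \<and> 4 * u \<noteq> - (\<eta> + 6) * v)"
    using uv klein_nodal_7 klein_nodal_14 by blast
next
  assume r: "u \<noteq> 0 \<and> v \<noteq> 0 \<and> (\<forall>\<eta>. root_pm \<eta> \<longrightarrow> 8 * u \<noteq> (7 * \<eta> - 3) * v \<and> 4 * u \<noteq> - (\<eta> + 6) * v)"
  then have "singular_points (klein u v) = {}" by (intro klein_smooth) blast+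
  then show "smooth_cubic (klein u v)" unfolding smooth_cubic_def using klein_cubic klein_zero_iff r by blast
qed

lemma in_member:
  assumes "F \<noteq> 0" "ray form_scale F = member u v"
  obtains c where "c \<noteq> 0" "F = klein (c * u) (c * v)"
proof -
  have "form_scale 1 F = F" by (simp add: form_scale_def)
  then have "F \<in> ray form_scale F" unfolding ray_def by (metis rangeI)
  then obtain c where c: "F = form_scale c (klein u v)" unfolding assms(2) unfolding member_def ray_def by blast
  then have "c \<noteq> 0" using assms(1) by (auto simp: form_scale_def fun_eq_iff)
  then show ?thesis using that c unfolding klein_scale by blast
qed

lemma member_in_smooth_locus:
  "member u v \<in> smooth_locus \<longleftrightarrow> smooth_cubic (klein u v)"
proof
  assume "member u v \<in> smooth_locus"
  then obtain F where F: "F \<in> V_L27" "smooth_cubic F" "ray form_scale F = member u v" unfolding smooth_locus_def by auto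
  then have "F \<noteq> 0" unfolding smooth_cubic_def by blast
  then obtain c where c: "c \<noteq> 0" "F = klein (c * u) (c * v)" using in_member F(3) by blast
  then have "klein u v = form_scale (1 / c) F" unfolding c(2) klein_scale by simp
  then have "singular_points (klein u v) = singular_points F"
    using singular_points_scale[of F "1 / c"] F(2) c(1) unfolding smooth_cubic_def by simp
  moreover have "klein u v \<noteq> 0" using \<open>F \<noteq> 0\<close> c unfolding c(2) klein_zero_iff by simp
  ultimately show "smooth_cubic (klein u v)" using F(2) klein_cubic unfolding smooth_cubic_def by blast
next
  assume "smooth_cubic (klein u v)"
  moreover have "klein u v \<in> V_L27" unfolding V_L27_klein by blast
  ultimately show "member u v \<in> smooth_locus" unfolding smooth_locus_def member_def by blast
qed

lemma smooth_klein_exchange: "smooth_cubic (klein u v) \<Longrightarrow> smooth_cubic (klein (2 * v) u)"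
proof -
  assume s: "smooth_cubic (klein u v)"
  have "form_scale 2 (klein (2 * v) u) = (\<lambda>x. klein u v (exchange7 *v x))"
    by (simp add: klein_scale klein_exchange7 fun_eq_iff)
  then have "singular_points (form_scale 2 (klein (2 * v) u)) = {}"
    using singular_points_compose[OF klein_cubic invertible_exchange7, of u v] s unfolding smooth_cubic_def by simp
  then have "singular_points (klein (2 * v) u) = {}" using singular_points_scale[OF klein_cubic, of 2] by simp
  moreover have "klein (2 * v) u \<noteq> 0" using s unfolding smooth_cubic_def klein_zero_iff by auto
  ultimately show ?thesis using klein_cubic unfolding smooth_cubic_def by blast
qed

definition member7 :: "complex \<Rightarrow> form set" where "member7 \<eta> = member (7 * \<eta> - 3) 8"

definition member14 :: "complex \<Rightarrow> form set" where "member14 \<eta> = member (- (\<eta> + 6)) 4"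

lemma smooth_locus_subset_P: "smooth_locus \<subseteq> pencil.P"
proof
  fix x assume "x \<in> smooth_locus"
  then obtain F where F: "F \<in> V_L27" "smooth_cubic F" "x = ray form_scale F" unfolding smooth_locus_def by blast
  then obtain u v where uv: "F = klein u v" unfolding V_L27_klein by blast
  then have "(u, v) \<noteq> (0, 0)" using F(2) unfolding uv smooth_klein_iff by auto
  then show "x \<in> pencil.P" unfolding P_member F(3) uv member_def[symmetric] by blast
qed

lemma boundary:
  "pencil.P - smooth_locus = {member 1 0, member 0 1} \<union> member7 ` {\<eta>. root_pm \<eta>} \<union> member14 ` {\<eta>. root_pm \<eta>}"
proof (intro equalityI subsetI)
  fix x assume "x \<in> pencil.P - smooth_locus"
  then obtain u v where uv: "x = member u v" "(u, v) \<noteq> (0, 0)" "\<not> smooth_cubic (klein u v)"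
    unfolding P_member using member_in_smooth_locus by blast
  consider "u = 0" | "v = 0" | \<eta> where "root_pm \<eta>" "8 * u = (7 * \<eta> - 3) * v" | \<eta> where "root_pm \<eta>" "4 * u = - (\<eta> + 6) * v"
    using uv(3) unfolding smooth_klein_iff by blast
  then show "x \<in> {member 1 0, member 0 1} \<union> member7 ` {\<eta>. root_pm \<eta>} \<union> member14 ` {\<eta>. root_pm \<eta>}"
  proof cases
    case 1
    then have "x = member 0 1" unfolding uv(1) using uv(2) by (subst member_eq_iff) auto
    then show ?thesis by blast
  next
    case 2
    then have "x = member 1 0" unfolding uv(1) using uv(2) by (subst member_eq_iff) auto
    then show ?thesis by blast
  next
    case 3
    then have "x = member7 \<eta>" unfolding uv(1) member7_def using uv(2) by (subst member_eq_iff) (auto simp: mult.commute)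
    then show ?thesis using 3 by blast
  next
    case 4
    then have "x = member14 \<eta>" unfolding uv(1) member14_def using uv(2) by (subst member_eq_iff) (auto simp: mult.commute)
    then show ?thesis using 4 by blast
  qed
next
  fix x assume "x \<in> {member 1 0, member 0 1} \<union> member7 ` {\<eta>. root_pm \<eta>} \<union> member14 ` {\<eta>. root_pm \<eta>}"
  then consider "x = member 1 0" | "x = member 0 1" | \<eta> where "root_pm \<eta>" "x = member7 \<eta>" | \<eta> where "root_pm \<eta>" "x = member14 \<eta>"
    by blast
  then have "\<exists>u v. x = member u v \<and> (u, v) \<noteq> (0, 0) \<and> \<not> smooth_cubic (klein u v)"
  proof cases
    case 1 then show ?thesis unfolding smooth_klein_iff by (intro exI[of _ 1] exI[of _ 0]) simp
  next
    case 2 then show ?thesis unfolding smooth_klein_iff by (intro exI[of _ 0] exI[of _ 1]) simp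
  next
    case 3
    have "8 * (7 * \<eta> - 3) = (7 * \<eta> - 3) * 8" by (rule mult.commute)
    then show ?thesis using 3 unfolding smooth_klein_iff member7_def by (intro exI[of _ "7 * \<eta> - 3"] exI[of _ 8]) fastforce
  next
    case 4
    have "4 * (- (\<eta> + 6)) = - (\<eta> + 6) * 4" by (rule mult.commute)
    then show ?thesis using 4 unfolding smooth_klein_iff member14_def by (intro exI[of _ "- (\<eta> + 6)"] exI[of _ 4]) fastforce
  qed
  then show "x \<in> pencil.P - smooth_locus" unfolding P_member using member_in_smooth_locus by blast
qed

lemma roots_pm: "{\<eta>. root_pm \<eta>} = {theta, - 1 - theta}"
  using root_pm_theta by blast

text \<open>The involution u / v \<mapsto> 2 v / u exchanges 0 and infinity. For the nodal members,
  the norms of \<open>7 * \<eta> - 3\<close> and \<open>\<eta> + 6\<close> are 128 = 2 * 8^2 and 32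
  = 2 * 4^2, so conjugate ratios are interchanged.\<close>

lemma orbit_of_boundary:
  "orbit_of (act ` \<Union>normalizer_L27) (member 1 0) = {member 1 0, member 0 1}"
  "orbit_of (act ` \<Union>normalizer_L27) (member 0 1) = {member 1 0, member 0 1}"
  "root_pm \<eta> \<Longrightarrow> orbit_of (act ` \<Union>normalizer_L27) (member7 \<eta>) = {member7 theta, member7 (- 1 - theta)}"
  "root_pm \<eta> \<Longrightarrow> orbit_of (act ` \<Union>normalizer_L27) (member14 \<eta>) = {member14 theta, member14 (- 1 - theta)}"
proof -
  show "orbit_of (act ` \<Union>normalizer_L27) (member 1 0) = {member 1 0, member 0 1}" unfolding orbit_of_member by simp
  have "member 2 0 = member 1 0" by (subst member_eq_iff) auto
  then show "orbit_of (act ` \<Union>normalizer_L27) (member 0 1) = {member 1 0, member 0 1}" unfolding orbit_of_member by auto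
  assume \<eta>: "root_pm \<eta>"
  then have both: "{theta, - 1 - theta} = {\<eta>, - 1 - \<eta>}" unfolding root_pm_theta by auto
  have "member (2 * 8) (7 * \<eta> - 3) = member (7 * (- 1 - \<eta>) - 3) 8"
  proof (subst member_eq_iff)
    show "2 * 8 * 8 = (7 * (- 1 - \<eta>) - 3) * (7 * \<eta> - 3)" using \<eta> unfolding root_pm_def by algebra
  qed simp_all
  then have "orbit_of (act ` \<Union>normalizer_L27) (member7 \<eta>) = member7 ` {\<eta>, - 1 - \<eta>}"
    unfolding member7_def orbit_of_member by simp
  then show "orbit_of (act ` \<Union>normalizer_L27) (member7 \<eta>) = {member7 theta, member7 (- 1 - theta)}"
    unfolding both[symmetric] by simp
  have "member (2 * 4) (- (\<eta> + 6)) = member (- (- 1 - \<eta> + 6)) 4"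
  proof (subst member_eq_iff)
    show "2 * 4 * 4 = - (- 1 - \<eta> + 6) * (- (\<eta> + 6))" using \<eta> unfolding root_pm_def by algebra
  qed simp_all
  then have "orbit_of (act ` \<Union>normalizer_L27) (member14 \<eta>) = member14 ` {\<eta>, - 1 - \<eta>}"
    unfolding member14_def orbit_of_member by simp
  then show "orbit_of (act ` \<Union>normalizer_L27) (member14 \<eta>) = {member14 theta, member14 (- 1 - theta)}"
    unfolding both[symmetric] by simp
qed

lemma boundary_orbits:
  "orbit_of (act ` \<Union>normalizer_L27) ` (pencil.P - smooth_locus) =
    {{member 1 0, member 0 1}, {member7 theta, member7 (- 1 - theta)}, {member14 theta, member14 (- 1 - theta)}}"
proof -
  have r: "root_pm theta" "root_pm (- 1 - theta)" unfolding root_pm_theta by simp_all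
  show ?thesis
    unfolding boundary roots_pm image_Un image_insert image_empty orbit_of_boundary(1,2)
      orbit_of_boundary(3)[OF r(1)] orbit_of_boundary(3)[OF r(2)] orbit_of_boundary(4)[OF r(1)] orbit_of_boundary(4)[OF r(2)]
    by auto
qed

lemma determinantal_klein:
  assumes B: "\<And>y. B *v y = 0 \<Longrightarrow> y = 0" and c: "c \<noteq> 0"
    and F: "\<And>y. fourier_form u v y = c * det (generic_symmetric (B *v y))"
  shows "determinantal_cubic (klein u v)"
proof -
  have "\<exists>C. C ** B = mat 1" unfolding matrix_left_invertible_ker using B by blast
  then have "invertible B" by (simp add: invertible_left_inverse)
  then have "invertible (B ** matrix_inv fourier_matrix)"
    by (rule invertible_mult[OF _ invertible_matrix_inv(3)[OF invertible_fourier_matrix]])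
  moreover have "klein u v = (\<lambda>x. c * det (generic_symmetric ((B ** matrix_inv fourier_matrix) *v x)))"
    by (rule ext) (simp add: klein_def F flip: matrix_vector_mul_assoc)
  ultimately show ?thesis unfolding determinantal_cubic_def using c by blast
qed

lemma determinantal_klein_axes:
  assumes c: "c \<noteq> 0"
  shows "determinantal_cubic (klein c 0)" "determinantal_cubic (klein 0 c)"
proof -
  \<comment> \<open>The symmetric matrix with rows (a, r, q), (r, b, p), (q, p, c), listed by its
    upper triangle.\<close>
  define f :: "complex^6 \<Rightarrow> complex^6" where "f = (\<lambda>y. \<chi> i. if i = 1 then y $ 1 else if i = 2 then y $ 5
    else if i = 3 then y $ 6 else if i = 4 then y $ 2 else if i = 5 then y $ 3 else y $ 4)"
  have f: "matrix f *v y = f y" for y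
    by (rule matrix_works_complex) (simp_all add: f_def vec_eq_iff forall_6)
  show "determinantal_cubic (klein c 0)"
  proof (rule determinantal_klein[OF _ c])
    show "y = 0" if "matrix f *v y = 0" for y
      using that unfolding f unfolding f_def by (simp add: vec_eq_iff forall_6)
    show "fourier_form c 0 y = c * det (generic_symmetric (matrix f *v y))" for y
      unfolding f by (simp add: f_def fourier_form_def torus_form_def generic_symmetric_def det_3 power2_eq_square algebra_simps)
  qed
  \<comment> \<open>The symmetric matrix with rows (2 p, a, c), (a, 2 q, b), (c, b, 2 r). Its
    determinant is twice the required cubic, whence the factor \<open>c / 2\<close> below.\<close>
  define g :: "complex^6 \<Rightarrow> complex^6" where "g = (\<lambda>y. \<chi> i. if i = 1 then 2 * y $ 3 else if i = 2 then y $ 1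
    else if i = 3 then y $ 4 else if i = 4 then 2 * y $ 6 else if i = 5 then y $ 2 else 2 * y $ 5)"
  have g: "matrix g *v y = g y" for y
    by (rule matrix_works_complex) (simp_all add: g_def vec_eq_iff forall_6 algebra_simps)
  show "determinantal_cubic (klein 0 c)"
  proof (rule determinantal_klein)
    show "y = 0" if "matrix g *v y = 0" for y
      using that unfolding g unfolding g_def by (simp add: vec_eq_iff forall_6)
    show "c / 2 \<noteq> 0" using c by simp
    show "fourier_form 0 c y = c / 2 * det (generic_symmetric (matrix g *v y))" for y
      unfolding g by (simp add: g_def fourier_form_def torus_form_def generic_symmetric_def det_3 power2_eq_square algebra_simps)
  qed
qed

theorem proposition1p4:
  shows "isomorphic_spaces git_moduli_L27 projective_line
    \<and> is_open_subvariety moduli_L27 git_moduli_L27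
    \<and> zariski git_moduli_L27 closure_of points moduli_L27 = points git_moduli_L27
    \<and> (\<exists>b_det b_7 b_14.
        points git_moduli_L27 - points moduli_L27 = {b_det, b_7, b_14}
        \<and> b_det \<noteq> b_7 \<and> b_det \<noteq> b_14 \<and> b_7 \<noteq> b_14
        \<and> parametrizes b_det determinantal_cubic
        \<and> parametrizes b_7 (nodal_with 7)
        \<and> parametrizes b_14 (nodal_with 14))"
proof -
  have finite: "finite (pencil.P - smooth_locus)" unfolding boundary roots_pm by simp
  \<comment> \<open>Smoothness is stable under the involution because the latter comes from the
    invertible matrix \<open>exchange7\<close>; this makes the smooth locus saturated for the GIT
    quotient map.\<close>
  have flip: "pencil.pt a (- b) \<in> smooth_locus" if "pencil.pt a b \<in> smooth_locus" for a b
    using that smooth_klein_exchange unfolding flipped_member unfolding pt_member member_in_smooth_locus by blast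
  have quotient: "is_open_subvariety moduli_L27 git_moduli_L27"
    "zariski git_moduli_L27 closure_of points moduli_L27 = points git_moduli_L27"
    "points git_moduli_L27 - points moduli_L27 = orbit_of (act ` \<Union>normalizer_L27) ` (pencil.P - smooth_locus)"
    unfolding moduli_L27_def git_moduli_L27_def
    by (rule pencil.open_subquotient_flip_action[OF flip_action_normalizer smooth_locus_subset_P finite], erule flip)+
  have iso: "isomorphic_spaces git_moduli_L27 projective_line"
    unfolding git_moduli_L27_def by (rule pencil.git_quotient_flip_action(1)[OF flip_action_normalizer(1)])
  let ?det = "{member 1 0, member 0 1}" and ?b7 = "{member7 theta, member7 (- 1 - theta)}"
    and ?b14 = "{member14 theta, member14 (- 1 - theta)}"
  have r: "root_pm theta" "root_pm (- 1 - theta)" unfolding root_pm_theta by simp_all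
  have "member 1 0 \<noteq> member u v" if "v \<noteq> 0" for u v using that by (subst member_eq_iff) auto
  then have d: "?det \<noteq> ?b7" "?det \<noteq> ?b14" unfolding member7_def member14_def by (metis insertCI insertE singletonD zero_neq_numeral)+
  have ne: "member7 theta \<noteq> member14 \<eta>" if "root_pm \<eta>" for \<eta>
  proof
    assume "member7 theta = member14 \<eta>"
    then have "(7 * theta - 3) * 4 = - (\<eta> + 6) * 8" unfolding member7_def member14_def by (subst (asm) member_eq_iff) simp_all
    then have "4 * (7 * theta - 3) = - (\<eta> + 6) * 8" by (simp only: mult.commute)
    moreover have "8 * (7 * theta - 3) = (7 * theta - 3) * 8" by (rule mult.commute)
    ultimately show False using special_ratios_disjoint[of theta \<eta> 8 "7 * theta - 3"] that r(1) unfolding root_pm_def by simp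
  qed
  have d': "?b7 \<noteq> ?b14" using ne[OF r(1)] ne[OF r(2)] by auto
  have pdet: "parametrizes ?det determinantal_cubic" unfolding parametrizes_def
  proof (intro allI impI, elim conjE)
    fix F assume "F \<noteq> 0" "ray form_scale F \<in> ?det"
    then consider "ray form_scale F = member 1 0" | "ray form_scale F = member 0 1" by blast
    then show "determinantal_cubic F"
    proof cases
      case 1 then obtain c where "c \<noteq> 0" "F = klein (c * 1) (c * 0)" by (rule in_member[OF \<open>F \<noteq> 0\<close>])
      then show ?thesis using determinantal_klein_axes by simp
    next
      case 2 then obtain c where "c \<noteq> 0" "F = klein (c * 0) (c * 1)" by (rule in_member[OF \<open>F \<noteq> 0\<close>])
      then show ?thesis using determinantal_klein_axes by simp
    qed
  qed
  have p7: "parametrizes ?b7 (nodal_with 7)" unfolding parametrizes_def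
  proof (intro allI impI, elim conjE)
    fix F assume F: "F \<noteq> 0" "ray form_scale F \<in> ?b7"
    then obtain \<eta> where \<eta>: "root_pm \<eta>" "ray form_scale F = member7 \<eta>" using r by blast
    obtain c where c: "c \<noteq> 0" "F = klein (c * (7 * \<eta> - 3)) (c * 8)" by (rule in_member[OF F(1) \<eta>(2)[unfolded member7_def]])
    show "nodal_with 7 F" unfolding c(2) by (rule klein_nodal_7[OF \<eta>(1)]) (use c(1) in \<open>simp_all add: mult_ac\<close>)
  qed
  have p14: "parametrizes ?b14 (nodal_with 14)" unfolding parametrizes_def
  proof (intro allI impI, elim conjE)
    fix F assume F: "F \<noteq> 0" "ray form_scale F \<in> ?b14"
    then obtain \<eta> where \<eta>: "root_pm \<eta>" "ray form_scale F = member14 \<eta>" using r by blast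
    obtain c where c: "c \<noteq> 0" "F = klein (c * (- (\<eta> + 6))) (c * 4)" by (rule in_member[OF F(1) \<eta>(2)[unfolded member14_def]])
    show "nodal_with 14 F" unfolding c(2) by (rule klein_nodal_14[OF \<eta>(1)]) (use c(1) in \<open>simp_all add: mult_ac\<close>)
  qed
  have points: "points git_moduli_L27 - points moduli_L27 = {?det, ?b7, ?b14}"
    using quotient(3) unfolding boundary_orbits .
  show ?thesis
    by (intro conjI iso quotient(1,2), rule exI[of _ ?det], rule exI[of _ ?b7], rule exI[of _ ?b14])
      (intro conjI points d d' pdet p7 p14)
qed

end
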